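(* Let $\mathfrak g=G(3)$, let $\beta=\varepsilon_3+\delta_1$, and let $0\ne x\in\mathfrak g_\beta$, so that $\mathfrak g_x\cong\mathfrak{sl}(2)$ with root system $\Delta_x=\{\pm(\varepsilon_1-\varepsilon_2)\}$. Then the image of $ds_x:\mathcal J_{\mathfrak g}\to\mathcal J_{\mathfrak g_x}$ is the polynomial ring $\mathbb Z[w_x]$ generated by $$w_x=\frac{x_1}{x_2}+\frac{x_2}{x_1}\in\mathcal J_{\mathfrak g_x}.$$ Equivalently, using the relation $x_1x_2=1$ in $\mathcal J_{\mathfrak g_x}$, $$\operatorname{Im}ds_x=\mathbb Z[x_1^2+x_2^2]\subsetneq\mathcal J_{SL(2)}=\mathbb Z[x_1^{\pm1},x_2^{\pm1}]^{S_2}/\langle x_1x_2-1\rangle\cong\mathbb Z[x_1+x_1^{-1}].$$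
   Context: Over $\mathbb C$. $G(3)$ has $\mathfrak g_{\bar0}=G_2\oplus\mathfrak{sl}(2)$, even roots $\varepsilon_i-\varepsilon_j$ ($i\neq j$), $\pm\varepsilon_i$, $\pm2\delta_1$, and odd roots $\pm\varepsilon_i\pm\delta_1$ (isotropic), $\pm\delta_1$, where $1\le i,j\le3$ and $\varepsilon_1+\varepsilon_2+\varepsilon_3=0$. $x_i=e^{\varepsilon_i}$. $\mathcal J_{\mathfrak g}$ (supercharacter ring) is the ring spanned over $\mathbb Z$ by the supercharacters $[M]=\operatorname{sch}M=\sum_\mu(\dim M^\mu_{\bar0}-\dim M^\mu_{\bar1})e^\mu$ of finite-dimensional $\mathfrak g$-modules. For $x$ odd with $[x,x]=0$: $\mathfrak g_x=\{a\in\mathfrak g\mid[x,a]=0\}/[x,\mathfrak g]$, $M_x=\ker_Mx/xM$ is a $\mathfrak g_x$-module, and $ds_x:\mathcal J_{\mathfrak g}\to\mathcal J_{\mathfrak g_x}$ is the ring homomorphism determined by $ds_x([M])=[M_x]$. $\mathfrak g_x$ is embedded in $\mathfrak g$ with its root spaces being the root spaces $\mathfrak g_{\pm(\varepsilon_1-\varepsilon_2)}$, and $x_1,x_2$ are viewed in $\mathcal J_{\mathfrak g_x}$ by restriction to the Cartan subalgebra $\mathfrak h_x=\mathfrak h\cap\mathfrak g_x$, where $x_1x_2=1$ and $x_1/x_2=e^{\varepsilon_1-\varepsilon_2}$ is the exponential of the root of $\mathfrak{sl}(2)$. *)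

theory Defs
  imports
    "HOL-Library.Poly_Mapping"
    "HOL-Library.Function_Algebras"
    "HOL-Library.Product_Plus"
    "HOL-Algebra.AbelCoset"
    "Jordan_Normal_Form.VS_Connect"
begin

section \<open>Superspaces, Lie superalgebras and their modules\<close>

text \<open>Complex superspaces are module records over the field \<open>class_ring :: complex ring\<close>. The fields
  \<open>mult\<close> and \<open>one\<close> of the underlying ring record are irrelevant, as always for modules in HOL-Algebra.\<close>

record 'v superspace = "(complex, 'v) module" +
  even_part :: "'v set"
  odd_part :: "'v set"

record 'v lie_super = "'v superspace" +
  brk :: "'v \<Rightarrow> 'v \<Rightarrow> 'v"

record ('g, 'v) rep = "'v superspace" +
  act :: "'g \<Rightarrow> 'v \<Rightarrow> 'v"

abbreviation \<CC> :: "complex ring" where "\<CC> \<equiv> class_ring"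

definition superspace :: "('v, 'm) superspace_scheme \<Rightarrow> bool" where
  "superspace V \<longleftrightarrow> vectorspace \<CC> V \<and> subspace \<CC> (even_part V) V \<and> subspace \<CC> (odd_part V) V
     \<and> even_part V \<inter> odd_part V = {\<zero>\<^bsub>V\<^esub>}
     \<and> carrier V = {u \<oplus>\<^bsub>V\<^esub> v |u v. u \<in> even_part V \<and> v \<in> odd_part V}"

text \<open>The homogeneous component of parity \<open>p\<close> (\<open>False\<close> is even, \<open>True\<close> is odd).\<close>

definition part :: "('v, 'm) superspace_scheme \<Rightarrow> bool \<Rightarrow> 'v set" where
  "part V p = (if p then odd_part V else even_part V)"

text \<open>The parity of a sum of degrees \<open>p\<close>, \<open>q\<close> is \<open>p \<noteq> q\<close>; the sign \<open>(-1)\<close> to the power \<open>p q\<close> is:\<close>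

definition koszul :: "bool \<Rightarrow> bool \<Rightarrow> complex" where
  "koszul p q = (if p \<and> q then -1 else 1)"

definition bilinear_on ::
  "('u, 'm) superspace_scheme \<Rightarrow> ('v, 'n) superspace_scheme \<Rightarrow> ('w, 'k) superspace_scheme
     \<Rightarrow> ('u \<Rightarrow> 'v \<Rightarrow> 'w) \<Rightarrow> bool" where
  "bilinear_on U V W b \<longleftrightarrow>
     (\<forall>u\<in>carrier U. b u \<in> LinearCombinations.module_hom \<CC> V W) \<and> (\<forall>v\<in>carrier V. (\<lambda>u. b u v) \<in> LinearCombinations.module_hom \<CC> U W)"

definition lie_superalgebra :: "('g, 'm) lie_super_scheme \<Rightarrow> bool" where
  "lie_superalgebra L \<longleftrightarrow> superspace L \<and> bilinear_on L L L (brk L)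
     \<and> (\<forall>p q. \<forall>a\<in>part L p. \<forall>b\<in>part L q. brk L a b \<in> part L (p \<noteq> q))
     \<and> (\<forall>p q. \<forall>a\<in>part L p. \<forall>b\<in>part L q. brk L a b = (- koszul p q) \<odot>\<^bsub>L\<^esub> brk L b a)
     \<and> (\<forall>p q. \<forall>a\<in>part L p. \<forall>b\<in>part L q. \<forall>c\<in>carrier L.
          brk L (brk L a b) c =
            brk L a (brk L b c) \<oplus>\<^bsub>L\<^esub> (- koszul p q) \<odot>\<^bsub>L\<^esub> brk L b (brk L a c))"

definition is_rep :: "('g, 'm) lie_super_scheme \<Rightarrow> ('g, 'v) rep \<Rightarrow> bool" where
  "is_rep L M \<longleftrightarrow> superspace M \<and> bilinear_on L M M (act M)
     \<and> (\<forall>p q. \<forall>a\<in>part L p. \<forall>v\<in>part M q. act M a v \<in> part M (p \<noteq> q))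
     \<and> (\<forall>p q. \<forall>a\<in>part L p. \<forall>b\<in>part L q. \<forall>v\<in>carrier M.
          act M (brk L a b) v =
            act M a (act M b v) \<oplus>\<^bsub>M\<^esub> (- koszul p q) \<odot>\<^bsub>M\<^esub> act M b (act M a v))"

definition fd_rep :: "('g, 'm) lie_super_scheme \<Rightarrow> ('g, 'v) rep \<Rightarrow> bool" where
  "fd_rep L M \<longleftrightarrow> is_rep L M \<and> vectorspace.fin_dim \<CC> M"

definition lie_iso ::
  "('g, 'm) lie_super_scheme \<Rightarrow> ('h, 'n) lie_super_scheme \<Rightarrow> ('g \<Rightarrow> 'h) \<Rightarrow> bool" where
  "lie_iso L K f \<longleftrightarrow> lie_superalgebra L \<and> lie_superalgebra K
     \<and> f \<in> LinearCombinations.module_hom \<CC> L K \<and> bij_betw f (carrier L) (carrier K)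
     \<and> (\<forall>p. f ` part L p = part K p)
     \<and> (\<forall>a\<in>carrier L. \<forall>b\<in>carrier L. f (brk L a b) = brk K (f a) (f b))"

definition lie_subalgebra :: "('g, 'm) lie_super_scheme \<Rightarrow> 'g set \<Rightarrow> bool" where
  "lie_subalgebra L T \<longleftrightarrow> subspace \<CC> T L \<and> (\<forall>a\<in>T. \<forall>b\<in>T. brk L a b \<in> T)"

definition lie_generated :: "('g, 'm) lie_super_scheme \<Rightarrow> 'g set \<Rightarrow> 'g set" where
  "lie_generated L S = \<Inter>{T. lie_subalgebra L T \<and> S \<subseteq> T}"

definition sub_lie :: "('g, 'm) lie_super_scheme \<Rightarrow> 'g set \<Rightarrow> ('g, 'm) lie_super_scheme" where
  "sub_lie L T = L\<lparr>carrier := T, even_part := T \<inter> even_part L, odd_part := T \<inter> odd_part L\<rparr>"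


section \<open>Weights and supercharacters\<close>

text \<open>Weights are linear functionals on a Cartan subalgebra \<open>H \<subseteq> carrier L\<close>, extended by \<open>0\<close> outside
  \<open>H\<close>; with pointwise addition they are the exponents of the group ring, whose elements are
  finitely supported functions from weights to the integers.\<close>

type_synonym 'g weight = "'g \<Rightarrow> complex"
type_synonym 'g group_ring = "'g weight \<Rightarrow>\<^sub>0 int"

definition dual :: "('g, 'm) superspace_scheme \<Rightarrow> 'g set \<Rightarrow> 'g weight set" where
  "dual L H = {\<mu>. (\<forall>h. h \<notin> H \<longrightarrow> \<mu> h = 0)
     \<and> (\<forall>h\<in>H. \<forall>k\<in>H. \<mu> (h \<oplus>\<^bsub>L\<^esub> k) = \<mu> h + \<mu> k) \<and> (\<forall>c. \<forall>h\<in>H. \<mu> (c \<odot>\<^bsub>L\<^esub> h) = c * \<mu> h)}"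

definition fexp :: "'g weight \<Rightarrow> 'g group_ring" where
  "fexp \<mu> = Poly_Mapping.single \<mu> 1"

definition restrict_weight :: "'g set \<Rightarrow> 'g weight \<Rightarrow> 'g weight" where
  "restrict_weight H \<mu> = (\<lambda>h. if h \<in> H then \<mu> h else 0)"

text \<open>\<open>\<iota>\<close> embeds the Cartan subalgebra \<open>H\<close> into the algebra acting on \<open>M\<close>. It is the identity for
  \<open>G(3)\<close>-modules; for modules over \<open>\<gg>\<^sub>x\<close> it is the embedding of \<open>\<hh>\<^sub>x \<subseteq> \<hh>\<close> into the subquotient \<open>\<gg>\<^sub>x\<close>.\<close>

definition weight_space :: "'h set \<Rightarrow> ('h \<Rightarrow> 'g) \<Rightarrow> ('g, 'v) rep \<Rightarrow> 'h weight \<Rightarrow> 'v set" where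
  "weight_space H \<iota> M \<mu> = {v \<in> carrier M. \<forall>h\<in>H. act M (\<iota> h) v = \<mu> h \<odot>\<^bsub>M\<^esub> v}"

definition sdim :: "('v, 'm) superspace_scheme \<Rightarrow> 'v set \<Rightarrow> int" where
  "sdim M W = int (vectorspace.dim \<CC> (M\<lparr>carrier := W \<inter> even_part M\<rparr>))
            - int (vectorspace.dim \<CC> (M\<lparr>carrier := W \<inter> odd_part M\<rparr>))"

definition sch ::
  "('h, 'm) superspace_scheme \<Rightarrow> 'h set \<Rightarrow> ('h \<Rightarrow> 'g) \<Rightarrow> ('g, 'v) rep \<Rightarrow> 'h group_ring" where
  "sch L H \<iota> M = (\<Sum>\<mu> | \<mu> \<in> dual L H \<and> weight_space H \<iota> M \<mu> \<noteq> {\<zero>\<^bsub>M\<^esub>}.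
     of_int (sdim M (weight_space H \<iota> M \<mu>)) * fexp \<mu>)"

definition int_span :: "'r::comm_ring_1 set \<Rightarrow> 'r set" where
  "int_span S = {\<Sum>s\<in>F. of_int (c s) * s |F c. finite F \<and> F \<subseteq> S}"

text \<open>The supercharacter ring of \<open>K\<close> with respect to \<open>\<iota> : H \<rightarrow> K\<close>. The underlying spaces of the modules
  are arbitrary records with elements in \<open>complex vec\<close>; as this type contains every \<open>\<complex>\<^sup>n\<close>, every
  finite-dimensional module has an isomorphic copy among them.\<close>

definition sch_ring ::
  "('h, 'm) superspace_scheme \<Rightarrow> 'h set \<Rightarrow> ('g, 'n) lie_super_scheme \<Rightarrow> ('h \<Rightarrow> 'g) \<Rightarrow> 'h group_ring set" where
  "sch_ring L H K \<iota> = int_span {sch L H \<iota> M |M :: ('g, complex vec) rep. fd_rep K M}"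

definition ipoly :: "'r::comm_ring_1 \<Rightarrow> int poly \<Rightarrow> 'r" where
  "ipoly w p = poly (map_poly of_int p) w"

abbreviation int_adjoin :: "'r::comm_ring_1 \<Rightarrow> 'r set" where
  "int_adjoin w \<equiv> range (ipoly w)"


section \<open>The Duflo--Serganova functor\<close>

text \<open>The superspace \<open>K / W\<close> for subspaces \<open>W \<subseteq> K\<close> of \<open>V\<close>, consisting of cosets.\<close>

definition subquotient ::
  "('v, 'm) superspace_scheme \<Rightarrow> 'v set \<Rightarrow> 'v set \<Rightarrow> 'v set superspace" where
  "subquotient V K W = \<lparr>carrier = (\<lambda>v. W +>\<^bsub>V\<^esub> v) ` K, mult = undefined, one = undefined,
     zero = W, add = set_add V, smult = (\<lambda>c A. \<Union>a\<in>A. W +>\<^bsub>V\<^esub> (c \<odot>\<^bsub>V\<^esub> a)),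
     even_part = (\<lambda>v. W +>\<^bsub>V\<^esub> v) ` (K \<inter> even_part V),
     odd_part = (\<lambda>v. W +>\<^bsub>V\<^esub> v) ` (K \<inter> odd_part V)\<rparr>"

definition ds_ideal :: "('g, 'm) lie_super_scheme \<Rightarrow> 'g \<Rightarrow> 'g set" where
  "ds_ideal L x = brk L x ` carrier L"

definition DS_alg :: "('g, 'm) lie_super_scheme \<Rightarrow> 'g \<Rightarrow> 'g set lie_super" where
  "DS_alg L x = superspace.extend
     (subquotient L {a \<in> carrier L. brk L x a = \<zero>\<^bsub>L\<^esub>} (ds_ideal L x))
     (lie_super.fields (\<lambda>A B. \<Union>a\<in>A. \<Union>b\<in>B. ds_ideal L x +>\<^bsub>L\<^esub> brk L a b))"

definition DS_mod :: "('g, 'v) rep \<Rightarrow> 'g \<Rightarrow> ('g set, 'v set) rep" where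
  "DS_mod M x = superspace.extend
     (subquotient M {v \<in> carrier M. act M x v = \<zero>\<^bsub>M\<^esub>} (act M x ` carrier M))
     (rep.fields (\<lambda>A B. \<Union>a\<in>A. \<Union>v\<in>B. (act M x ` carrier M) +>\<^bsub>M\<^esub> act M a v))"

definition root_space :: "('g, 'm) lie_super_scheme \<Rightarrow> 'h set \<Rightarrow> ('h \<Rightarrow> 'g) \<Rightarrow> 'h weight \<Rightarrow> 'g set" where
  "root_space L H \<iota> \<alpha> = {a \<in> carrier L. \<forall>h\<in>H. brk L (\<iota> h) a = \<alpha> h \<odot>\<^bsub>L\<^esub> a}"


section \<open>The Lie superalgebra \<open>G(3)\<close>\<close>

text \<open>Octonions are realised as Zorn vector matrices with diagonal entries \<open>a, b\<close> and off-diagonal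
  vectors \<open>u, v\<close>. \<open>G\<^sub>2\<close> is the derivation algebra of the octonions, and
  \<open>G(3) = (Der \<OO> \<oplus> \<ss>\<ll>(2)) \<oplus> (\<OO>\<^sub>0 \<otimes> \<complex>\<^sup>2)\<close> with \<open>\<OO>\<^sub>0\<close> the trace zero octonions.\<close>

type_synonym vec3 = "complex \<times> complex \<times> complex"
type_synonym zorn = "complex \<times> vec3 \<times> vec3 \<times> complex"
type_synonym mat2 = "(complex \<times> complex) \<times> (complex \<times> complex)"

fun vscale :: "complex \<Rightarrow> vec3 \<Rightarrow> vec3" where
  "vscale c (u1, u2, u3) = (c * u1, c * u2, c * u3)"

fun vdot :: "vec3 \<Rightarrow> vec3 \<Rightarrow> complex" where
  "vdot (u1, u2, u3) (v1, v2, v3) = u1 * v1 + u2 * v2 + u3 * v3"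

fun vcross :: "vec3 \<Rightarrow> vec3 \<Rightarrow> vec3" where
  "vcross (u1, u2, u3) (v1, v2, v3) = (u2 * v3 - u3 * v2, u3 * v1 - u1 * v3, u1 * v2 - u2 * v1)"

fun zscale :: "complex \<Rightarrow> zorn \<Rightarrow> zorn" where
  "zscale c (a, u, v, b) = (c * a, vscale c u, vscale c v, c * b)"

fun zmul :: "zorn \<Rightarrow> zorn \<Rightarrow> zorn" (infixl \<open>\<cdot>\<close> 70) where
  "(a, u, v, b) \<cdot> (a', u', v', b') =
     (a * a' + vdot u v', vscale a u' + vscale b' u - vcross v v',
      vscale a' v + vscale b v' + vcross u u', b * b' + vdot v u')"

definition imaginary :: "zorn set" where
  "imaginary = {(a, u, v, b). a + b = 0}"

definition Der :: "(zorn \<Rightarrow> zorn) set" where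
  "Der = {D. (\<forall>p q. D (p + q) = D p + D q) \<and> (\<forall>c p. D (zscale c p) = zscale c (D p))
     \<and> (\<forall>p q. D (p \<cdot> q) = D p \<cdot> q + p \<cdot> D q)}"

text \<open>For \<open>p, q\<close> in \<open>\<OO>\<^sub>0\<close>, \<open>ztrace p q\<close> is the scalar \<open>p q + q p\<close>, and \<open>zder p q\<close> is the standard inner
  derivation, mapping \<open>w\<close> to \<open>[[p, q], w] - 3 (p, q, w)\<close>, where the last term is the associator.\<close>

definition ztrace :: "zorn \<Rightarrow> zorn \<Rightarrow> complex" where
  "ztrace p q = fst (p \<cdot> q + q \<cdot> p)"

definition zder :: "zorn \<Rightarrow> zorn \<Rightarrow> zorn \<Rightarrow> zorn" where
  "zder p q w = ((p \<cdot> q - q \<cdot> p) \<cdot> w - w \<cdot> (p \<cdot> q - q \<cdot> p)) - zscale 3 ((p \<cdot> q) \<cdot> w - p \<cdot> (q \<cdot> w))"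

fun mmul :: "mat2 \<Rightarrow> mat2 \<Rightarrow> mat2" where
  "mmul ((a, b), (c, d)) ((a', b'), (c', d')) =
     ((a * a' + b * c', a * b' + b * d'), (c * a' + d * c', c * b' + d * d'))"

fun mscale :: "complex \<Rightarrow> mat2 \<Rightarrow> mat2" where
  "mscale k ((a, b), (c, d)) = ((k * a, k * b), (k * c, k * d))"

definition traceless :: "mat2 set" where
  "traceless = {((a, b), (c, d)). a + d = 0}"

definition sl2 :: "mat2 lie_super" where
  "sl2 = \<lparr>carrier = traceless, mult = undefined, one = undefined, zero = 0, add = (+),
     smult = mscale, even_part = traceless, odd_part = {0},
     brk = (\<lambda>A B. mmul A B - mmul B A)\<rparr>"

text \<open>The quadruple \<open>(D, A, p, q)\<close> stands for \<open>D + A + p \<otimes> e\<^sub>1 + q \<otimes> e\<^sub>2\<close>.\<close>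

type_synonym g3 = "(zorn \<Rightarrow> zorn) \<times> mat2 \<times> zorn \<times> zorn"

fun g3_scale :: "complex \<Rightarrow> g3 \<Rightarrow> g3" where
  "g3_scale c (D, A, p, q) = ((\<lambda>w. zscale c (D w)), mscale c A, zscale c p, zscale c q)"

text \<open>With the symplectic form \<open>\<omega>(e\<^sub>1, e\<^sub>2) = 1\<close> and the map \<open>s \<bullet> t\<close> in \<open>\<ss>\<ll>(2)\<close> sending \<open>r\<close> to
  \<open>\<omega>(s, r) t + \<omega>(t, r) s\<close>, the bracket of odd elements is
  \<open>[p \<otimes> s, q \<otimes> t] = \<omega>(s, t) zder p q + 2 ztrace p q (s \<bullet> t)\<close>; the Jacobi identity of three odd elements
  fixes the relative factor \<open>2\<close>. The matrix in \<open>odd_brk_sl2\<close> is the second summand.\<close>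

definition odd_brk_sl2 :: "zorn \<Rightarrow> zorn \<Rightarrow> zorn \<Rightarrow> zorn \<Rightarrow> mat2" where
  "odd_brk_sl2 p q p' q' =
     ((- 2 * (ztrace p q' + ztrace q p'), 4 * ztrace p p'),
      (- 4 * ztrace q q', 2 * (ztrace p q' + ztrace q p')))"

fun mat_act :: "mat2 \<Rightarrow> zorn \<times> zorn \<Rightarrow> zorn \<times> zorn" where
  "mat_act ((a, b), (c, d)) (p, q) = (zscale a p + zscale b q, zscale c p + zscale d q)"

fun g3_brk :: "g3 \<Rightarrow> g3 \<Rightarrow> g3" where
  "g3_brk (D, A, p, q) (D', A', p', q') =
     ((\<lambda>w. D (D' w) - D' (D w) + zder p q' w - zder q p' w),
      mmul A A' - mmul A' A + odd_brk_sl2 p q p' q',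
      (D p', D q') + mat_act A (p', q') - (D' p, D' q) - mat_act A' (p, q))"

definition G3 :: "g3 lie_super" where
  "G3 = \<lparr>carrier = Der \<times> traceless \<times> imaginary \<times> imaginary, mult = undefined, one = undefined,
     zero = 0, add = (+), smult = g3_scale,
     even_part = Der \<times> traceless \<times> {0} \<times> {0}, odd_part = {0} \<times> {0} \<times> imaginary \<times> imaginary,
     brk = g3_brk\<rparr>"

fun torus_der :: "vec3 \<Rightarrow> zorn \<Rightarrow> zorn" where
  "torus_der (t1, t2, t3) (a, (u1, u2, u3), (v1, v2, v3), b) =
     (0, (t1 * u1, t2 * u2, t3 * u3), (- t1 * v1, - t2 * v2, - t3 * v3), 0)"

definition g3_cartan :: "g3 set" where
  "g3_cartan = {(torus_der (t1, t2, t3), ((s, 0), (0, - s)), 0, 0) |t1 t2 t3 s. t1 + t2 + t3 = 0}"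

text \<open>\<open>torus_der t\<close> maps \<open>(0, (1, 1, 1), 0, 0)\<close> to \<open>(0, t, 0, 0)\<close>, so \<open>eps i\<close> and \<open>delta\<close> are the
  functionals \<open>t\<^sub>i\<close> and \<open>s\<close>.\<close>

definition eps :: "nat \<Rightarrow> g3 weight" where
  "eps i = restrict_weight g3_cartan (\<lambda>(D, _). case D (0, (1, 1, 1), 0, 0) of
     (_, (t1, t2, t3), _, _) \<Rightarrow> if i = 1 then t1 else if i = 2 then t2 else t3)"

definition delta :: "g3 weight" where
  "delta = restrict_weight g3_cartan (\<lambda>(_, ((s, _), _), _). s)"

definition g3_root_space :: "g3 weight \<Rightarrow> g3 set" where
  "g3_root_space = root_space G3 g3_cartan id"

definition J_G3 :: "g3 group_ring set" where
  "J_G3 = sch_ring G3 g3_cartan G3 id"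


section \<open>The algebra \<open>\<gg>\<^sub>x\<close> and the homomorphism \<open>ds\<^sub>x\<close>\<close>

definition gx_embedded :: "g3 lie_super" where
  "gx_embedded = sub_lie G3
     (lie_generated G3 (g3_root_space (eps 1 - eps 2) \<union> g3_root_space (eps 2 - eps 1)))"

definition gx_cartan :: "g3 set" where
  "gx_cartan = g3_cartan \<inter> carrier gx_embedded"

definition gx_coset :: "g3 \<Rightarrow> g3 \<Rightarrow> g3 set" where
  "gx_coset x a = ds_ideal G3 x +>\<^bsub>G3\<^esub> a"

definition J_gx :: "g3 \<Rightarrow> g3 group_ring set" where
  "J_gx x = sch_ring G3 gx_cartan (DS_alg G3 x) (gx_coset x)"

definition gx_roots :: "g3 \<Rightarrow> g3 weight set" where
  "gx_roots x = {\<alpha> \<in> dual G3 gx_cartan. \<alpha> \<noteq> 0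
     \<and> root_space (DS_alg G3 x) gx_cartan (gx_coset x) \<alpha> \<noteq> {\<zero>\<^bsub>DS_alg G3 x\<^esub>}}"

definition is_ds :: "g3 \<Rightarrow> (g3 group_ring \<Rightarrow> g3 group_ring) \<Rightarrow> bool" where
  "is_ds x ds \<longleftrightarrow> ds ` J_G3 \<subseteq> J_gx x \<and> ds 1 = 1
     \<and> (\<forall>f\<in>J_G3. \<forall>g\<in>J_G3. ds (f + g) = ds f + ds g \<and> ds (f * g) = ds f * ds g)
     \<and> (\<forall>M :: (g3, complex vec) rep. fd_rep G3 M \<longrightarrow>
          ds (sch G3 g3_cartan id M) = sch G3 gx_cartan (gx_coset x) (DS_mod M x))"

text \<open>The monomial with exponents \<open>a, b\<close> in \<open>x\<^sub>1, x\<^sub>2\<close>, restricted to \<open>\<hh>\<^sub>x\<close>.\<close>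

definition xmon :: "int \<Rightarrow> int \<Rightarrow> g3 group_ring" where
  "xmon a b = fexp (restrict_weight gx_cartan (\<lambda>h. of_int a * eps 1 h + of_int b * eps 2 h))"

type_synonym laurent2 = "(int \<times> int) \<Rightarrow>\<^sub>0 int"

definition sym_laurent2 :: "laurent2 set" where
  "sym_laurent2 = {f. \<forall>a b. Poly_Mapping.lookup f (a, b) = Poly_Mapping.lookup f (b, a)}"

definition eval_laurent2 :: "laurent2 \<Rightarrow> g3 group_ring" where
  "eval_laurent2 f = (\<Sum>(a, b) \<in> Poly_Mapping.keys f. of_int (Poly_Mapping.lookup f (a, b)) * xmon a b)"

end

theory Submission
  imports Defs "HOL-Computational_Algebra.Fundamental_Theorem_Algebra" "HOL-Library.Nat_Bijection"
begin

text \<open>The coroots of \<open>G(3)\<close> belong to \<open>\<ss>\<ll>(2)\<close>-triples, so the torus acts on every finite-dimensional module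
  \<open>M\<close> diagonally and with integral eigenvalues. Let \<open>y\<close> be a root vector of weight \<open>-\<beta>\<close>. The element \<open>[x, y]\<close> acts
  by zero on \<open>M\<^sub>x\<close>, since \<open>[x, y] v = x (y v)\<close> if \<open>x v = 0\<close>. Up to a scalar, it is the coroot of
  \<open>\<epsilon>\<^sub>1 - \<epsilon>\<^sub>2\<close> plus twice an element with integral eigenvalues, so the weights of \<open>M\<^sub>x\<close> are even; they are symmetric by
  the representation theory of \<open>\<ss>\<ll>(2)\<close>. A Jordan basis of \<open>x\<close> that consists of weight vectors shows that \<open>ds\<^sub>x\<close>
  restricts supercharacters to \<open>\<hh>\<^sub>x\<close>, because \<open>v\<close> and \<open>x v\<close> cancel. Hence the image lies in \<open>\<int>[w\<^sub>x]\<close>. Conversely,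
  the adjoint module is sent to \<open>w\<^sub>x + 1\<close>, whose powers come from its tensor powers.\<close>

section \<open>Linear operators and their spectra\<close>

text \<open>Once the supercharacter of \<open>DS_mod M x0\<close> is known to be the restriction of
  that of M, the map ds is the restriction homomorphism \<open>rest\<close> on \<open>J_G3\<close>.
  Its existence and multiplicativity are then automatic. Tensor products are needed only to see that
  powers of a supercharacter again lie in the supercharacter ring, for G(3) with the adjoint module
  and for g_x with the standard module of sl(2). The kernel of ad \<open>x0\<close> is given by 14
  equations on a space of dimension 31, so the cohomology has dimension 17 - 14 = 3; it is
  represented by the block sl(2) of sl(3) inside G2. Diagonal action of a coroot is obtained without
  complete reducibility. It comes from annihilating products of linear factors and from the operator
  4 F E + (H + 1)^2, whose eigenvalue on a vector killed by E of weight l is (l + 1)^2. The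
  inclusion of the image in the full ring is strict because w_x has the value 2 both at x_1 = 1 and
  at x_1 = -1, whereas x_1 + 1/x_1 has the values 2 and -2 there.\<close>

fun lfac :: "(complex \<Rightarrow> 'u \<Rightarrow> 'u) \<Rightarrow> ('u \<Rightarrow> 'u) \<Rightarrow> complex list \<Rightarrow> 'u \<Rightarrow> ('u::ab_group_add)" where
  "lfac sc T [] v = v"
| "lfac sc T (a # as) v = T (lfac sc T as v) - sc a (lfac sc T as v)"

locale op_space = vector_space scale for scale :: "complex \<Rightarrow> 'u \<Rightarrow> 'u::ab_group_add" (infixr \<open>*s\<close> 75)
begin

abbreviation lin :: "('u \<Rightarrow> 'u) \<Rightarrow> bool" where "lin \<equiv> Vector_Spaces.linear scale scale"

lemma lin_add: "lin T \<Longrightarrow> T (x + y) = T x + T y"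
  and lin_scale: "lin T \<Longrightarrow> T (c *s x) = c *s T x"
  and lin_0: "lin T \<Longrightarrow> T 0 = 0"
  and lin_diff: "lin T \<Longrightarrow> T (x - y) = T x - T y"
  and lin_neg: "lin T \<Longrightarrow> T (- x) = - T x"
  by (simp_all add: linear_iff_module_hom module_hom.add module_hom.scale module_hom.zero module_hom.diff module_hom.neg)

lemmas lin_simps = lin_add lin_scale lin_0 lin_diff lin_neg

lemma linI: "(\<And>x y. T (x + y) = T x + T y) \<Longrightarrow> (\<And>c x. T (c *s x) = c *s T x) \<Longrightarrow> lin T"
  by (simp add: Vector_Spaces.linear_iff vector_space_axioms)

lemmas vs_simps = scale_right_distrib scale_right_diff_distrib scale_left_distrib scale_left_diff_distrib

text \<open>\<open>lfac scale T as\<close> is the product of the factors T - a, with a in the list.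
  Over the complex numbers every nonzero polynomial is such a product up to a scalar, so lists of
  roots stand for polynomials, and removing repetitions or translating roots become list
  operations.\<close>

lemma lin_lfac: "lin T \<Longrightarrow> lin (lfac scale T as)"
proof (induction as)
  case Nil
  then show ?case by (intro linI) auto
next
  case (Cons a as)
  then show ?case
    by (intro linI) (simp_all add: lin_simps vs_simps algebra_simps mult.commute)
qed

lemma lfac_append: "lfac scale T (as @ bs) v = lfac scale T as (lfac scale T bs v)"
  by (induction as) auto

lemma lfac_commute:
  assumes "lin S" "\<And>v. S (T v) = T (S v)"
  shows "S (lfac scale T as v) = lfac scale T as (S v)"
  by (induction as) (auto simp: assms lin_simps)

lemma lfac_swap: "lin T \<Longrightarrow> lfac scale T as (lfac scale T bs v) = lfac scale T bs (lfac scale T as v)"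
  by (rule lfac_commute) (auto simp: lin_lfac lfac_commute)

lemma lfac_Cons_right: "lin T \<Longrightarrow> lfac scale T (a # as) v = lfac scale T as (T v - a *s v)"
  using lfac_swap[of T "[a]" as v] by simp

lemma lfac_eigen: "lin T \<Longrightarrow> T v = l *s v \<Longrightarrow> lfac scale T as v = (\<Prod>a\<leftarrow>as. l - a) *s v"
  by (induction as) (auto simp: lin_simps algebra_simps)

lemma lfac_zero: "lin T \<Longrightarrow> lfac scale T as 0 = 0"
  by (simp add: lin_lfac lin_0)

text \<open>The vector (T - a) v is killed by the shorter product and by the second one, so it
  vanishes by induction. Then v has eigenvalue a, and the second product acts on it by a nonzero
  scalar.\<close>

lemma lfac_coprime:
  assumes T: "lin T" and "lfac scale T as v = 0" "lfac scale T bs v = 0" "set as \<inter> set bs = {}"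
  shows "v = 0"
  using assms(2-)
proof (induction as arbitrary: v)
  case (Cons a as)
  define w where "w = T v - a *s v"
  have "lfac scale T as w = 0" using Cons.prems(1) lfac_Cons_right[OF T] w_def by metis
  moreover have "lfac scale T bs w = 0"
    using lfac_swap[OF T, of bs "[a]" v] Cons.prems(2) T by (simp add: w_def lin_simps)
  ultimately have "w = 0" using Cons by auto
  hence "T v = a *s v" by (simp add: w_def)
  hence "(\<Prod>b\<leftarrow>bs. a - b) *s v = 0" using lfac_eigen[OF T, of v a bs] Cons.prems(2) by simp
  moreover have "(\<Prod>b\<leftarrow>bs. a - b) \<noteq> 0" using Cons.prems(3) by (auto simp: prod_list_zero_iff)
  ultimately show ?case by simp
qed simp

text \<open>The hypothesis says T S = S (T + c), so S turns the factor T - a into T - (a + c):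
  annihilators are translated by the weight c of S.\<close>

lemma lfac_shift:
  assumes "lin S" "\<And>v. T (S v) = S (T v) + c *s S v"
  shows "lfac scale T (map (\<lambda>a. a + c) as) (S v) = S (lfac scale T as v)"
  by (induction as) (auto simp: assms(2) lin_simps[OF assms(1)] vs_simps)

text \<open>The hypothesis \<open>ss\<close> says that no operator \<open>T - k\<close> has a nontrivial Jordan block.\<close>

lemma lfac_remdups:
  assumes T: "lin T" and ss: "\<And>k v. T (T v - k *s v) = k *s (T v - k *s v) \<Longrightarrow> T v = k *s v"
    and "lfac scale T as v = 0"
  shows "lfac scale T (remdups as) v = 0"
  using assms(3)
proof (induction as arbitrary: v)
  case (Cons a as)
  define w where "w = T v - a *s v"
  have w: "lfac scale T (remdups as) w = 0"
    using Cons.IH[of w] Cons.prems lfac_Cons_right[OF T] w_def by metis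
  show ?case
  proof (cases "a \<in> set as")
    case False
    then show ?thesis using w by (simp add: lfac_Cons_right[OF T] w_def del: lfac.simps)
  next
    case True
    then obtain bs cs where bc: "remdups as = bs @ a # cs"
      by (metis set_remdups split_list)
    \<comment> \<open>The factor T - a in w and the one left in \<open>remdups as\<close> together
      act on u as a square; by \<open>ss\<close> a single factor already kills u.\<close>
    define u where "u = lfac scale T bs (lfac scale T cs v)"
    have perm: "lfac scale T (remdups as) z = lfac scale T [a] (lfac scale T bs (lfac scale T cs z))" for z
      unfolding bc using lfac_swap[OF T, of bs "[a]"] by (simp add: lfac_append)
    have "lfac scale T (remdups as) w = lfac scale T [a] (T u - a *s u)"
      unfolding perm u_def w_def
      using lfac_commute[OF T, of T] T by (simp add: lin_simps lin_lfac)
    hence "T (T u - a *s u) = a *s (T u - a *s u)" using w by simp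
    hence "T u = a *s u" by (rule ss)
    hence "lfac scale T (remdups as) v = 0" unfolding perm by (simp add: u_def)
    then show ?thesis using True by simp
  qed
qed simp

end

section \<open>Polynomials in an operator and annihilating products of linear factors\<close>

context op_space begin

definition pact :: "('u \<Rightarrow> 'u) \<Rightarrow> complex poly \<Rightarrow> 'u \<Rightarrow> 'u" where
  "pact T p v = (\<Sum>i\<le>degree p. coeff p i *s (T ^^ i) v)"

lemma pact_eq: "degree p < n \<Longrightarrow> pact T p v = (\<Sum>i<n. coeff p i *s (T ^^ i) v)"
  unfolding pact_def by (rule sum.mono_neutral_left) (auto simp: coeff_eq_0)

lemma lin_pow: "lin T \<Longrightarrow> lin (T ^^ N)"
  by (induction N) (auto intro!: linI simp: lin_simps)

lemma pact_factor:
  assumes "lin T"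
  shows "pact T ([:- a, 1:] * q) v = pact T q (T v - a *s v)"
proof -
  define n where "n = Suc (degree q)"
  have p: "[:- a, 1:] * q = pCons 0 q - Polynomial.smult a q" by simp
  have "degree ([:- a, 1:] * q) \<le> degree [:- a, 1:] + degree q" by (rule degree_mult_le)
  hence "degree ([:- a, 1:] * q) < Suc n" by (simp add: n_def)
  hence "pact T ([:- a, 1:] * q) v = (\<Sum>i<Suc n. coeff (pCons 0 q - Polynomial.smult a q) i *s (T ^^ i) v)"
    unfolding p by (rule pact_eq)
  also have "\<dots> = (\<Sum>i<Suc n. coeff (pCons 0 q) i *s (T ^^ i) v) - (\<Sum>i<Suc n. (a * coeff q i) *s (T ^^ i) v)"
    by (simp add: scale_left_diff_distrib sum_subtractf)
  also have "(\<Sum>i<Suc n. coeff (pCons 0 q) i *s (T ^^ i) v) = (\<Sum>i<n. coeff q i *s (T ^^ i) (T v))"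
    by (subst sum.lessThan_Suc_shift) (simp add: funpow_swap1)
  also have "(\<Sum>i<Suc n. (a * coeff q i) *s (T ^^ i) v) = (\<Sum>i<n. coeff q i *s (T ^^ i) (a *s v))"
    by (simp add: n_def coeff_eq_0 lin_scale[OF lin_pow[OF assms]] mult.commute)
  finally show ?thesis
    by (simp add: pact_eq[of q n] n_def lin_diff[OF lin_pow[OF assms]] scale_right_diff_distrib sum_subtractf)
qed

text \<open>Induction on the degree; the fundamental theorem of algebra splits off one root at a
  time.\<close>

lemma lfac_of_pact:
  assumes T: "lin T"
  shows "p \<noteq> 0 \<Longrightarrow> pact T p v = 0 \<Longrightarrow> \<exists>as. lfac scale T as v = 0"
proof (induction "degree p" arbitrary: p v)
  case 0
  then obtain c where "p = [:c:]" "c \<noteq> 0" by (metis degree_eq_zeroE pCons_0_0)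
  hence "v = 0" using 0 by (simp add: pact_def)
  then show ?case by (intro exI[of _ "[]"]) simp
next
  case (Suc n)
  have "\<not> constant (poly p)" using Suc.hyps(2) by (simp add: constant_degree)
  then obtain a where "poly p a = 0" using fundamental_theorem_of_algebra by blast
  then obtain q where q: "p = [:- a, 1:] * q" by (metis poly_eq_0_iff_dvd dvdE)
  have "q \<noteq> 0" using q Suc.prems by auto
  hence "degree p = Suc (degree q)" unfolding q by (subst degree_mult_eq) auto
  hence "\<exists>as. lfac scale T as (T v - a *s v) = 0"
    using Suc.hyps(1)[of q "T v - a *s v"] Suc.hyps(2) Suc.prems(2) \<open>q \<noteq> 0\<close> pact_factor[OF T] q by auto
  then show ?case using lfac_Cons_right[OF T] by metis
qed

text \<open>Finite-dimensionality is imposed on the image of T only, because the lifted operators to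
  which this applies act on the space of all functions. Hence the dependent vectors are T v, T^2 v,
  ..., and the polynomial has no constant term.\<close>

lemma lfac_vector:
  assumes T: "lin T" and B: "finite B" "\<And>v. T v \<in> span B"
  shows "\<exists>as. lfac scale T as v = 0"
proof -
  define f where "f i = (T ^^ Suc i) v" for i
  have f: "f ` {..card B} \<subseteq> span B" by (auto simp: f_def B)
  have "\<exists>p. p \<noteq> 0 \<and> pact T p v = 0"
  \<comment> \<open>Linear dependence of a set does not see a repeated vector. Coinciding iterates
    give the polynomial X^(j+1) - X^(i+1) directly.\<close>
  proof (cases "inj_on f {..card B}")
    case False
    then obtain i j where ij: "i < j" "f i = f j" by (metis inj_onI linorder_neqE_nat)
    define p :: "complex poly" where "p = monom 1 (Suc j) - monom 1 (Suc i)"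
    have c: "coeff p k = (if k = Suc j then 1 else 0) - (if k = Suc i then 1 else 0)" for k
      by (simp add: p_def)
    have "coeff p (Suc j) \<noteq> 0" using ij c by simp
    hence "p \<noteq> 0" by auto
    moreover have "degree p < Suc (Suc j)"
      using degree_diff_le_max[of "monom 1 (Suc j)" "monom (1::complex) (Suc i)"] ij
      by (simp add: p_def degree_monom_eq)
    hence "pact T p v = (\<Sum>k<Suc (Suc j). coeff p k *s (T ^^ k) v)" by (rule pact_eq)
    hence "pact T p v = (\<Sum>k<Suc (Suc j). (if k = Suc j then (T ^^ k) v else 0) - (if k = Suc i then (T ^^ k) v else 0))"
      unfolding c by (simp add: if_distrib[of "\<lambda>c. c *s _"] scale_left_diff_distrib cong: if_cong)
    hence "pact T p v = (T ^^ Suc j) v - (T ^^ Suc i) v"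
      using ij(1) by (simp add: sum_subtractf del: funpow.simps sum.lessThan_Suc)
    ultimately show ?thesis using ij(2) by (auto simp: f_def)
  next
    case True
    hence "card (f ` {..card B}) = Suc (card B)" by (simp add: card_image)
    hence "dependent (f ` {..card B})"
      using independent_span_bound[OF B(1) _ f] by fastforce
    then obtain S u w where S: "finite S" "S \<subseteq> f ` {..card B}" "(\<Sum>x\<in>S. u x *s x) = 0" "w \<in> S" "u w \<noteq> 0"
      unfolding dependent_explicit by auto
    define c where "c i = (if f i \<in> S then u (f i) else 0)" for i
    have "(\<Sum>i\<le>card B. c i *s f i) = (\<Sum>x\<in>f ` {..card B}. (if x \<in> S then u x else 0) *s x)"
      by (subst sum.reindex[OF True]) (simp add: c_def)
    also have "\<dots> = (\<Sum>x\<in>S. u x *s x)"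
      by (rule sum.mono_neutral_cong_right) (use S in auto)
    finally have c0: "(\<Sum>i\<le>card B. c i *s f i) = 0" using S by simp
    define p where "p = (\<Sum>i\<le>card B. monom (c i) (Suc i))"
    have cp: "coeff p k = (\<Sum>i\<le>card B. if k = Suc i then c i else 0)" for k
      unfolding p_def coeff_sum coeff_monom by (rule sum.cong) auto
    obtain i where i: "i \<le> card B" "w = f i" using S by auto
    have "coeff p (Suc i) = c i" unfolding cp using i by (simp add: sum.delta)
    hence p0: "p \<noteq> 0" using S i by (auto simp: c_def)
    have "degree p < Suc (Suc (card B))"
      unfolding p_def by (intro degree_sum_less) (auto intro: le_less_trans[OF degree_monom_le])
    hence "pact T p v = (\<Sum>k<Suc (Suc (card B)). coeff p k *s (T ^^ k) v)" by (rule pact_eq)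
    also have "\<dots> = (\<Sum>k<Suc (card B). coeff p (Suc k) *s f k)"
      by (subst sum.lessThan_Suc_shift) (simp add: cp f_def)
    also have "\<dots> = (\<Sum>k\<le>card B. c k *s f k)"
      unfolding lessThan_Suc_atMost by (rule sum.cong) (auto simp: cp sum.delta)
    finally show ?thesis using c0 p0 by auto
  qed
  thus ?thesis using lfac_of_pact[OF T] by auto
qed

text \<open>Factors of the same operator commute, so the lists belonging to finitely many vectors
  can be concatenated.\<close>

lemma lfac_annihilates:
  assumes T: "lin T" and B: "finite B" "\<And>v. T v \<in> span B"
  shows "\<exists>as. \<forall>v. lfac scale T as v = 0"
proof -
  have "\<exists>as. \<forall>b\<in>S. lfac scale T as b = 0" if "finite S" for S
    using that
  proof (induction S)
    case (insert x S)
    then obtain as bs where "\<forall>b\<in>S. lfac scale T as b = 0" "lfac scale T bs x = 0"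
      using lfac_vector[OF T B] by metis
    hence "lfac scale T (as @ bs) b = 0" if "b \<in> insert x S" for b
      using that lfac_zero[OF T] lfac_swap[OF T, of as bs b] by (cases "b = x") (simp_all add: lfac_append)
    then show ?case by blast
  qed auto
  then obtain as where as: "\<forall>b\<in>B. lfac scale T as b = 0" using B(1) by metis
  have "subspace {v. lfac scale T as v = 0}"
    using lin_lfac[OF T, of as] by (auto simp: subspace_def lin_simps)
  hence "span B \<subseteq> {v. lfac scale T as v = 0}" using as by (intro span_minimal) auto
  \<comment> \<open>The factor with root 0 acts first and sends an arbitrary v to T v, which lies in
    \<open>span B\<close>.\<close>
  hence "lfac scale T (as @ [0]) v = 0" for v using B(2)[of v] by (auto simp: lfac_append)
  thus ?thesis by blast
qed

end

section \<open>Triples of operators satisfying the relations of sl(2)\<close>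

locale sl2_ops = op_space scale for scale :: "complex \<Rightarrow> 'u \<Rightarrow> 'u::ab_group_add" (infixr \<open>*s\<close> 75) +
  fixes E F H :: "'u \<Rightarrow> 'u"
  assumes linE: "lin E" and linF: "lin F" and linH: "lin H"
    and HE: "H (E v) = E (H v) + 2 *s E v"
    and HF: "H (F v) = F (H v) + (-2) *s F v"
    and EF: "E (F v) = F (E v) + H v"
    and annih: "\<exists>as. \<forall>v. lfac scale H as v = 0"
begin

lemmas L = lin_simps[OF linE] lin_simps[OF linF] lin_simps[OF linH]

text \<open>This is 4 F E + (H + 1)^2, an affine function of the Casimir operator. On a vector of
  weight l killed by E it is the scalar (l + 1)^2, so comparing eigenvalues of C amounts to
  comparing squares.\<close>

definition C :: "'u \<Rightarrow> 'u" where "C v = 4 *s F (E v) + H (H v) + 2 *s H v + v"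

text \<open>Numerical scalars are expanded into sums, so that an identity such as \<open>CE\<close>
  is settled by associativity and commutativity.\<close>

lemma sc_numeral: "2 *s x = x + x" "4 *s x = x + x + (x + x)" "8 *s x = x + x + (x + x) + (x + x + (x + x))"
proof -
  show 2: "2 *s x = x + x" for x :: 'u by (metis scale_left_distrib one_add_one scale_one)
  show 4: "4 *s x = x + x + (x + x)" for x :: 'u using scale_left_distrib[of 2 2 x] by (simp add: 2)
  show "8 *s x = x + x + (x + x) + (x + x + (x + x))" using scale_left_distrib[of 4 4 x] by (simp add: 4)
qed

lemma linC: "lin C"
  by (rule linI) (simp_all add: C_def L vs_simps algebra_simps mult.commute)

lemma CH: "C (H v) = H (C v)"
  by (simp add: C_def L HE HF vs_simps)

lemma CE: "C (E v) = E (C v)"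
proof -
  have 1: "E (F (E v)) = F (E (E v)) + H (E v)" by (simp add: EF)
  have "E (C v) = 4 *s E (F (E v)) + E (H (H v)) + 2 *s E (H v) + E v" by (simp add: C_def L)
  also have "\<dots> = 4 *s F (E (E v)) + 4 *s E (H v) + 8 *s E v + E (H (H v)) + 2 *s E (H v) + E v"
    by (simp add: 1 HE vs_simps algebra_simps)
  finally have a: "E (C v) = \<dots>" .
  have "C (E v) = 4 *s F (E (E v)) + (E (H (H v)) + 2 *s E (H v) + 2 *s E (H v) + 4 *s E v) + (2 *s E (H v) + 4 *s E v) + E v"
    by (simp add: C_def L HE vs_simps add.assoc)
  thus ?thesis unfolding a
    by (simp only: sc_numeral ac_simps)
qed

lemma eig_E: "H y = l *s y \<Longrightarrow> H (E y) = (l + 2) *s E y"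
  by (simp add: HE L vs_simps)

text \<open>The Chevalley involution: every statement about E yields one about F. The product for -
  H with negated roots differs from the product for H by one sign per factor.\<close>

lemma swapped: "sl2_ops scale F E (\<lambda>v. - H v)"
proof
  obtain as where as: "\<forall>v. lfac scale H as v = 0" using annih by auto
  have "lfac scale (\<lambda>v. - H v) (map uminus bs) v = (-1) ^ length bs *s lfac scale H bs v" for bs v
    by (induction bs) (auto simp: L vs_simps)
  thus "\<exists>as. \<forall>v. lfac scale (\<lambda>v. - H v) as v = 0" using as by (metis scale_zero_right)
qed (simp_all add: L vs_simps HE HF EF linE linF linI)

text \<open>E^N translates the roots of the annihilator of H by 2 N. For suitable N the translated
  roots are disjoint from the original ones, and a vector E^N v killed by both products
  vanishes.\<close>

lemma E_nilpotent: "\<exists>N. \<forall>v. (E ^^ N) v = 0"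
proof -
  obtain as where as: "\<forall>v. lfac scale H as v = 0" using annih by auto
  note linN = lin_pow[OF linE]
  have sh: "H ((E ^^ N) v) = (E ^^ N) (H v) + (of_nat (2 * N)) *s (E ^^ N) v" for N v
    by (induction N arbitrary: v) (auto simp: HE L vs_simps algebra_simps)
  have "\<exists>N::nat. set as \<inter> (\<lambda>a. a + of_nat (2 * N)) ` set as = {}"
  proof -
    have "finite (\<Union>a\<in>set as. \<Union>b\<in>set as. {N::nat. a = b + of_nat (2 * N)})"
    proof (intro finite_UN_I finite_set)
      fix a b :: complex
      show "finite {N::nat. a = b + of_nat (2 * N)}"
      proof (rule finite_subset)
        show "{N::nat. a = b + of_nat (2 * N)} \<subseteq> {N. (of_nat (2*N) :: complex) = a - b}" by auto
        show "finite {N. (of_nat (2*N) :: complex) = a - b}"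
        proof (cases "\<exists>N0::nat. (of_nat (2*N0) :: complex) = a - b")
          case True
          then obtain N0 where "(of_nat (2*N0) :: complex) = a - b" by auto
          hence "{N. (of_nat (2*N) :: complex) = a - b} \<subseteq> {N0}"
            using of_nat_eq_iff[where 'a=complex, of "2 * _" "2 * N0"] by auto
          then show ?thesis using finite_subset by blast
        qed simp
      qed
    qed
    then obtain N where "N \<notin> (\<Union>a\<in>set as. \<Union>b\<in>set as. {N::nat. a = b + of_nat (2 * N)})"
      using ex_new_if_finite infinite_UNIV_nat by blast
    thus ?thesis by (intro exI[of _ N]) auto
  qed
  then obtain N :: nat where N: "set as \<inter> (\<lambda>a. a + of_nat (2 * N)) ` set as = {}" by auto
  have "(E ^^ N) v = 0" for v
  proof (rule lfac_coprime[OF linH])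
    show "lfac scale H as ((E ^^ N) v) = 0" using as by auto
    show "lfac scale H (map (\<lambda>a. a + of_nat (2 * N)) as) ((E ^^ N) v) = 0"
      unfolding lfac_shift[OF linN sh] using as lin_0[OF linN] by simp
  qed (use N in auto)
  thus ?thesis by auto
qed

lemma C_kerE: "E z = 0 \<Longrightarrow> H z = l *s z \<Longrightarrow> C z = (l + 1)\<^sup>2 *s z"
  by (simp add: C_def L power2_eq_square scale_left_distrib distrib_left distrib_right sc_numeral add_ac)

text \<open>C commutes with E and H. By induction the factors belonging to E y, of weight l + 2,
  send y into the kernel of E, where C is the scalar (l + 1)^2.\<close>

lemma C_raise:
  assumes "H y = l *s y" "(E ^^ N) y = 0"
  shows "lfac scale C (map (\<lambda>i. (l + 2 * of_nat i + 1)\<^sup>2) [0..<N]) y = 0"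
  using assms
proof (induction N arbitrary: l y)
  case (Suc N)
  let ?as = "map (\<lambda>i. (l + 2 + 2 * of_nat i + 1)\<^sup>2) [0..<N]"
  have "lfac scale C ?as (E y) = 0"
    using Suc.IH[of "E y" "l + 2"] Suc.prems eig_E[of y l] by (simp add: funpow_swap1 algebra_simps)
  hence E0: "E (lfac scale C ?as y) = 0" by (simp add: lfac_commute[OF linE] CE)
  have Hz: "H (lfac scale C ?as y) = l *s lfac scale C ?as y"
    using lfac_commute[OF linH, of C ?as y] CH Suc.prems(1) lin_scale[OF lin_lfac[OF linC]] by simp
  have "C (lfac scale C ?as y) = (l + 1)\<^sup>2 *s lfac scale C ?as y"
    by (rule C_kerE[OF E0 Hz])
  moreover have "map (\<lambda>i. (l + 2 * of_nat i + 1)\<^sup>2) [0..<Suc N] = (l + 1)\<^sup>2 # ?as"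
    by (simp add: upt_conv_Cons map_Suc_upt[symmetric] algebra_simps del: upt_Suc)
  ultimately show ?case by simp
qed simp

text \<open>The standard commutation formula, written with H w because w is not assumed to be a
  weight vector; it is used to prove that H is semisimple on the kernel of E.\<close>

lemma kerE_F_power:
  assumes "E w = 0"
  shows "E ((F ^^ Suc n) w) = of_nat (Suc n) *s (F ^^ n) (H w - of_nat n *s w)"
proof (induction n)
  case 0
  then show ?case by (simp add: EF assms L)
next
  case (Suc n)
  note linN = lin_pow[OF linF]
  have sh: "H ((F ^^ N) v) = (F ^^ N) (H v) - of_nat (2 * N) *s (F ^^ N) v" for N v
  proof (induction N)
    case (Suc N)
    have "H ((F ^^ Suc N) v) = F (H ((F ^^ N) v)) - 2 *s F ((F ^^ N) v)" by (simp add: HF)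
    also have "\<dots> = F ((F ^^ N) (H v)) - (of_nat (2 * N) + 2) *s F ((F ^^ N) v)"
      unfolding Suc by (simp add: L scale_left_distrib)
    finally show ?case by (simp add: add.commute)
  qed simp
  have "E ((F ^^ Suc (Suc n)) w) = F (E ((F ^^ Suc n) w)) + H ((F ^^ Suc n) w)" by (simp add: EF)
  also have "\<dots> = of_nat (Suc n) *s ((F ^^ Suc n) (H w) - of_nat n *s (F ^^ Suc n) w)
      + ((F ^^ Suc n) (H w) - of_nat (2 * Suc n) *s (F ^^ Suc n) w)"
    unfolding Suc sh by (simp add: L lin_simps[OF linN])
  also have "\<dots> = (of_nat (Suc n) *s (F ^^ Suc n) (H w) + 1 *s (F ^^ Suc n) (H w))
     - ((of_nat (Suc n) * of_nat n) *s (F ^^ Suc n) w + of_nat (2 * Suc n) *s (F ^^ Suc n) w)"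
    by (simp add: scale_right_diff_distrib del: of_nat_Suc of_nat_mult)
  also have "\<dots> = of_nat (Suc (Suc n)) *s (F ^^ Suc n) (H w) - (of_nat (Suc (Suc n)) * of_nat (Suc n)) *s (F ^^ Suc n) w"
    unfolding scale_left_distrib[symmetric] by (simp add: algebra_simps)
  finally show ?case by (simp add: lin_simps[OF linN] scale_right_diff_distrib L del: of_nat_Suc)
qed

text \<open>The commutation formula lowers the power of F: if F^(n+1) w = 0, then (H - n) w is
  killed by F^n, and it is still killed by E.\<close>

lemma kerE_annih:
  assumes "E w = 0" "(F ^^ n) w = 0"
  shows "lfac scale H (map of_nat [0..<n]) w = 0"
  using assms
proof (induction n arbitrary: w)
  case (Suc n)
  define w' where "w' = H w - of_nat n *s w"
  have "of_nat (Suc n) *s (F ^^ n) w' = 0"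
    using kerE_F_power[OF Suc.prems(1), of n] Suc.prems(2) by (simp add: L w'_def del: of_nat_Suc)
  hence "(F ^^ n) w' = 0" by (simp del: of_nat_Suc)
  moreover have "E w' = 0"
    using HE[of w] Suc.prems(1) by (simp add: w'_def L)
  ultimately have "lfac scale H (map of_nat [0..<n]) w' = 0" using Suc.IH by auto
  thus ?case
    using lfac_swap[OF linH, of "map of_nat [0..<n]" "[of_nat n]" w] by (simp add: lfac_append w'_def)
qed simp

lemma F_nilpotent: "\<exists>N. \<forall>v. (F ^^ N) v = 0"
  using sl2_ops.E_nilpotent[OF swapped] .

lemma kerE_eig:
  assumes "E w = 0" "H w = k *s w" "w \<noteq> 0"
  shows "k \<in> \<nat>"
proof -
  obtain n where "\<forall>v. (F ^^ n) v = 0" using F_nilpotent by auto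
  hence "(\<Prod>a\<leftarrow>map of_nat [0..<n]. k - a) *s w = 0"
    using kerE_annih[OF assms(1), of n] lfac_eigen[OF linH assms(2)] by metis
  thus ?thesis using assms(3) by (auto simp: prod_list_zero_iff)
qed

text \<open>The roots 0, ..., n - 1 are distinct. So (H - k) w is killed by the factor for k and
  also by a product that does not contain this factor.\<close>

lemma kerE_semisimple:
  assumes "E w = 0" "H (H w - k *s w) = k *s (H w - k *s w)"
  shows "H w = k *s w"
proof -
  obtain n where "\<forall>v. (F ^^ n) v = 0" using F_nilpotent by auto
  hence z: "lfac scale H (map of_nat [0..<n]) w = 0"
    using kerE_annih[OF assms(1), of n] by auto
  define as :: "complex list" where "as = map of_nat [0..<n]"
  define v where "v = H w - k *s w"
  have z': "lfac scale H as v = 0"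
    using lfac_swap[OF linH, of as "[k]" w] z by (simp add: v_def as_def L)
  show ?thesis
  proof (cases "k \<in> set as")
    case False
    have "lfac scale H [k] v = 0" using assms(2) by (simp add: v_def)
    hence "v = 0" using lfac_coprime[OF linH z', of "[k]"] False by auto
    thus ?thesis by (simp add: v_def)
  next
    case True
    then obtain bs cs where bc: "as = bs @ k # cs" by (metis split_list)
    have d: "distinct as" by (simp add: as_def distinct_map)
    have "lfac scale H (bs @ cs) v = lfac scale H as w"
      unfolding bc v_def lfac_append
      using lfac_swap[OF linH, of cs "[k]" w] by simp
    hence "lfac scale H (bs @ cs) v = 0" using z by (simp add: as_def)
    moreover have "lfac scale H [k] v = 0" using assms(2) by (simp add: v_def)
    ultimately have "v = 0" using lfac_coprime[OF linH, of "bs @ cs" v "[k]"] d bc by auto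
    thus ?thesis by (simp add: v_def)
  qed
qed

text \<open>Induction on the order of nilpotency of E at v. Put u = (H - k) v. The induction
  hypothesis for E v gives E u = 0. A polynomial in C moves v into the kernel of E, where H is
  semisimple, and therefore kills u. If u were nonzero, this polynomial would act on it by a nonzero
  scalar.\<close>

lemma semisimple:
  assumes "H (H v - k *s v) = k *s (H v - k *s v)"
  shows "H v = k *s v"
proof -
  obtain N where "\<forall>v. (E ^^ N) v = 0" using E_nilpotent by auto
  hence "(E ^^ N) v = 0" by auto
  thus ?thesis using assms
  proof (induction N arbitrary: v k)
    case 0
    then show ?case by (simp add: L)
  next
    case (Suc N)
    define u where "u = H v - k *s v"
    have Eu: "H (E v) - (k + 2) *s E v = E u" by (simp add: u_def HE L vs_simps)
    have Hu: "H u = k *s u" using Suc.prems(2) by (simp add: u_def)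
    have "H (E v) = (k + 2) *s E v"
    proof (rule Suc.IH)
      show "(E ^^ N) (E v) = 0" using Suc.prems(1) by (simp add: funpow_swap1)
      show "H (H (E v) - (k + 2) *s E v) = (k + 2) *s (H (E v) - (k + 2) *s E v)"
        unfolding Eu using eig_E[OF Hu] .
    qed
    hence E0: "E u = 0" using Eu by simp
    define as where "as = map (\<lambda>i. (k + 2 + 2 * of_nat i + 1)\<^sup>2) [0..<N]"
    define w where "w = lfac scale C as v"
    have "lfac scale C as (E v) = 0"
      using C_raise[of "E v" "k + 2" N, folded as_def] \<open>H (E v) = _\<close> Suc.prems(1) by (simp add: funpow_swap1)
    hence Ew: "E w = 0" unfolding w_def by (simp add: lfac_commute[OF linE] CE)
    have linw: "lin (lfac scale C as)" by (rule lin_lfac[OF linC])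
    have Hw: "H (lfac scale C as z) = lfac scale C as (H z)" for z
      by (rule lfac_commute[OF linH]) (simp add: CH)
    have wu: "H w - k *s w = lfac scale C as u"
      unfolding w_def u_def by (simp add: Hw lin_simps[OF linw])
    have "H w = k *s w"
      by (rule kerE_semisimple[OF Ew]) (simp add: wu Hw Hu lin_simps[OF linw])
    hence u0: "lfac scale C as u = 0" using wu by simp
    show ?case
    proof (cases "u = 0")
      case False
      have "k \<in> \<nat>" using kerE_eig[OF E0 Hu False] .
      \<comment> \<open>As k is natural, (k + 1)^2 differs from all the roots (k + 2 i + 3)^2 of the
        polynomial in C.\<close>
      then obtain n where n: "k = of_nat n" by (auto simp: Nats_def)
      have "C u = (k + 1)\<^sup>2 *s u"
        using C_raise[OF Hu, of 1] E0 by simp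
      hence "(\<Prod>a\<leftarrow>as. (k + 1)\<^sup>2 - a) *s u = 0" using lfac_eigen[OF linC] u0 by metis
      hence "\<exists>i. (k + 1)\<^sup>2 = (k + 2 + 2 * of_nat i + 1)\<^sup>2" using False by (auto simp: prod_list_zero_iff as_def)
      then obtain i where "(k + 1)\<^sup>2 = (k + 2 + 2 * of_nat i + 1)\<^sup>2" ..
      hence "(of_nat ((n + 1)\<^sup>2) :: complex) = of_nat ((n + 2 + 2 * i + 1)\<^sup>2)" by (simp add: n add_ac)
      hence "(n + 1)\<^sup>2 = (n + 2 + 2 * i + 1)\<^sup>2" by (simp only: of_nat_eq_iff)
      hence "n + 1 = n + 2 + 2 * i + 1" by (metis power2_eq_iff_nonneg le0)
      then show ?thesis by simp
    qed (simp add: u_def)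
  qed
qed

lemma eigenvalue_Ints:
  assumes "H v = k *s v" "v \<noteq> 0"
  shows "k \<in> \<int>"
proof -
  obtain N where "\<forall>v. (E ^^ N) v = 0" using E_nilpotent by auto
  hence "(E ^^ N) v = 0" by auto
  thus ?thesis using assms
  proof (induction N arbitrary: v k)
    case (Suc N)
    show ?case
    proof (cases "E v = 0")
      case True
      then show ?thesis using kerE_eig[OF True Suc.prems(2,3)] Nats_subset_Ints by auto
    next
      case False
      have "k + 2 \<in> \<int>"
        using Suc.IH[of "E v" "k + 2"] Suc.prems False eig_E by (simp add: funpow_swap1)
      hence "k + 2 - 2 \<in> \<int>" by (rule Ints_diff) auto
      thus ?thesis by simp
    qed
  qed simp
qed

lemma diagonalizable: "\<exists>as. distinct as \<and> set as \<subseteq> \<int> \<and> (\<forall>v. lfac scale H as v = 0)"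
proof -
  obtain as where as: "\<forall>v. lfac scale H as v = 0" using annih by auto
  have r: "lfac scale H (remdups as) v = 0" for v
    by (rule lfac_remdups[OF linH semisimple]) (use as in auto)
  have f: "lfac scale H bs v = 0 \<Longrightarrow> lfac scale H (filter (\<lambda>a. a \<in> \<int>) bs) v = 0" for bs v
  proof (induction bs arbitrary: v)
    case (Cons b bs)
    show ?case
    proof (cases "b \<in> \<int>")
      case True
      then show ?thesis using Cons by (metis filter.simps(2) lfac_Cons_right linH)
    next
      case False
      have "H (lfac scale H bs v) = b *s lfac scale H bs v" using Cons.prems by simp
      hence "lfac scale H bs v = 0" using eigenvalue_Ints False by blast
      then show ?thesis using Cons.IH False by simp
    qed
  qed simp
  show ?thesis
    by (intro exI[of _ "filter (\<lambda>a. a \<in> \<int>) (remdups as)"]) (auto simp: r f)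
qed

text \<open>If E^k v = 0 for v of weight - k, raising v shows that it is annihilated by factors of C
  whose roots are squares of integers of absolute value below k. Lowering v gives squares of
  integers above k instead. The two products are coprime.\<close>

lemma E_power_inj:
  assumes "H v = (- of_nat k) *s v" "(E ^^ k) v = 0"
  shows "v = 0"
proof -
  interpret s: sl2_ops scale F E "\<lambda>v. - H v" by (rule swapped)
  obtain M where M: "\<forall>v. (F ^^ M) v = 0" using F_nilpotent by auto
  have Cs: "s.C v = C v" for v
    by (simp add: s.C_def C_def EF L vs_simps algebra_simps)
       (metis (no_types, opaque_lifting) scale_left_distrib numeral_Bit0 add.assoc)
  have 1: "lfac scale C (map (\<lambda>i. (- of_nat k + 2 * of_nat i + 1)\<^sup>2) [0..<k]) v = 0"
    using C_raise[OF assms] .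
  have 2: "lfac scale C (map (\<lambda>i. (of_nat k + 2 * of_nat i + 1)\<^sup>2) [0..<M]) v = 0"
    using s.C_raise[of v "of_nat k" M] M assms(1) Cs by (simp add: ext[of s.C C, OF Cs])
  have 3: False if "i < k" "(- of_nat k + 2 * of_nat i + 1 :: complex)\<^sup>2 = (of_nat k + 2 * of_nat j + 1)\<^sup>2" for i j :: nat
  proof -
    have "(of_int ((- int k + 2 * int i + 1)\<^sup>2) :: complex) = of_int ((int k + 2 * int j + 1)\<^sup>2)"
      using that(2) by simp
    hence "(- int k + 2 * int i + 1)\<^sup>2 = (int k + 2 * int j + 1)\<^sup>2" by (simp only: of_int_eq_iff)
    hence "- int k + 2 * int i + 1 = int k + 2 * int j + 1 \<or> - int k + 2 * int i + 1 = - (int k + 2 * int j + 1)"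
      by (simp add: power2_eq_iff)
    thus False using that(1) by linarith
  qed
  show ?thesis
  proof (rule lfac_coprime[OF linC 1 2])
    show "set (map (\<lambda>i. (- of_nat k + 2 * of_nat i + 1 :: complex)\<^sup>2) [0..<k]) \<inter>
      set (map (\<lambda>i. (of_nat k + 2 * of_nat i + 1)\<^sup>2) [0..<M]) = {}"
    proof (rule equals0I)
      fix z assume "z \<in> set (map (\<lambda>i. (- of_nat k + 2 * of_nat i + 1 :: complex)\<^sup>2) [0..<k]) \<inter>
        set (map (\<lambda>i. (of_nat k + 2 * of_nat i + 1)\<^sup>2) [0..<M])"
      then obtain i j where "i < k" "z = (- of_nat k + 2 * of_nat i + 1)\<^sup>2" "z = (of_nat k + 2 * of_nat j + 1)\<^sup>2"
        unfolding set_map Int_iff image_iff set_upt by (metis atLeastLessThan_iff)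
      thus False using 3[of i j] by simp
    qed
  qed
qed

end

section \<open>Complex vector spaces\<close>

text \<open>Subspaces and subquotients occur as spaces in their own right, hence explicit carriers.
  The facts below restate the scalar operations without membership conditions on scalars, since
  every complex number is one.\<close>

locale cvs = vectorspace "class_ring :: complex ring" V
  for V :: "(complex, 'v, 'm) module_scheme" (structure)
begin

lemma smul_closed [simp]: "v \<in> carrier V \<Longrightarrow> c \<odot> v \<in> carrier V"
  using smult_closed[of c v] by simp

lemma smul_0 [simp]: "v \<in> carrier V \<Longrightarrow> 0 \<odot> v = \<zero>"
  using smult_l_null[of v] by simp

lemma smul_zero [simp]: "c \<odot> \<zero> = \<zero>"
  using smult_r_null[of c] by simp

lemma smul_1 [simp]: "v \<in> carrier V \<Longrightarrow> 1 \<odot> v = v"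
  using smult_one[of v] by simp

lemma smul_assoc: "v \<in> carrier V \<Longrightarrow> (a * b) \<odot> v = a \<odot> (b \<odot> v)"
  using smult_assoc1[of a b v] by simp

lemma smul_l_distr: "v \<in> carrier V \<Longrightarrow> (a + b) \<odot> v = a \<odot> v \<oplus> b \<odot> v"
  using smult_l_distr[of a b v] by simp

lemma smul_r_distr: "v \<in> carrier V \<Longrightarrow> w \<in> carrier V \<Longrightarrow> a \<odot> (v \<oplus> w) = a \<odot> v \<oplus> a \<odot> w"
  using smult_r_distr[of a v w] by simp

lemma smul_uminus: "v \<in> carrier V \<Longrightarrow> (- a) \<odot> v = \<ominus> (a \<odot> v)"
  by (rule M.minus_equality[symmetric]) (auto simp: smul_l_distr[symmetric])

lemma smul_eq_0: "v \<in> carrier V \<Longrightarrow> c \<odot> v = \<zero> \<Longrightarrow> c = 0 \<or> v = \<zero>"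
  using smul_assoc[of v "inverse c" c] by (cases "c = 0") auto

lemma smul_cancel: "v \<in> carrier V \<Longrightarrow> v \<noteq> \<zero> \<Longrightarrow> a \<odot> v = b \<odot> v \<Longrightarrow> a = b"
proof -
  assume v: "v \<in> carrier V" "v \<noteq> \<zero>" "a \<odot> v = b \<odot> v"
  hence "(a + - b) \<odot> v = \<zero>" by (simp only: smul_l_distr smul_uminus) (simp add: M.r_neg)
  thus "a = b" using smul_eq_0[of v "a + - b"] v by auto
qed

lemma lc_closed [simp]: "S \<subseteq> carrier V \<Longrightarrow> lincomb a S \<in> carrier V"
  by (rule lincomb_closed) auto

lemma lc_insert: "finite S \<Longrightarrow> x \<notin> S \<Longrightarrow> insert x S \<subseteq> carrier V \<Longrightarrow> lincomb a (insert x S) = a x \<odot> x \<oplus> lincomb a S"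
  by (subst lincomb_insert2) auto

lemma lc_cong: "S \<subseteq> carrier V \<Longrightarrow> (\<And>v. v \<in> S \<Longrightarrow> a v = b v) \<Longrightarrow> lincomb a S = lincomb b S"
  by (rule lincomb_cong) auto

lemma lc_add: "finite S \<Longrightarrow> S \<subseteq> carrier V \<Longrightarrow> lincomb (\<lambda>v. a v + b v) S = lincomb a S \<oplus> lincomb b S"
  using lincomb_sum[of S a b] by simp

lemma lc_smult: "S \<subseteq> carrier V \<Longrightarrow> lincomb (\<lambda>v. c * a v) S = c \<odot> lincomb a S"
  using lincomb_smult[of S a c] by simp

lemma lc_zero: "S \<subseteq> carrier V \<Longrightarrow> (\<And>v. v \<in> S \<Longrightarrow> a v = 0) \<Longrightarrow> lincomb a S = \<zero>"
  by (rule lincomb_zero) auto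

lemma lc_sub:
  assumes "finite S" "S \<subseteq> carrier V" "R \<subseteq> S"
  shows "lincomb a R = lincomb (\<lambda>v. if v \<in> R then a v else 0) S"
proof -
  have "S = R \<union> (S - R)" using assms by auto
  hence "lincomb (\<lambda>v. if v \<in> R then a v else 0) S = lincomb (\<lambda>v. if v \<in> R then a v else 0) R \<oplus> lincomb (\<lambda>v. if v \<in> R then a v else 0) (S - R)"
    using lincomb_union[of R "S - R" "\<lambda>v. if v \<in> R then a v else 0"] assms finite_subset[OF assms(3,1)]
    by (auto simp: Un_absorb1)
  also have "lincomb (\<lambda>v. if v \<in> R then a v else 0) (S - R) = \<zero>" by (rule lc_zero) (use assms in auto)
  also have "lincomb (\<lambda>v. if v \<in> R then a v else 0) R = lincomb a R" by (rule lc_cong) (use assms in auto)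
  moreover have "lincomb a R \<in> carrier V" by (rule lc_closed) (use assms in auto)
  ultimately show ?thesis by simp
qed

lemma lc_single:
  assumes "finite S" "S \<subseteq> carrier V" "x \<in> S"
  shows "lincomb (\<lambda>v. if v = x then c else 0) S = c \<odot> x"
proof -
  have "lincomb (\<lambda>v. c) {x} = lincomb (\<lambda>v. if v \<in> {x} then c else 0) S"
    by (rule lc_sub) (use assms in auto)
  thus ?thesis using assms lc_insert[of "{}" x "\<lambda>_. c"] by auto
qed

lemma lc_hom:
  assumes "finite S" "S \<subseteq> carrier V" "cvs W" "T \<in> LinearCombinations.module_hom \<CC> V W"
  shows "T (lincomb a S) = finsum W (\<lambda>v. a v \<odot>\<^bsub>W\<^esub> T v) S"
  using assms(1,2)
proof (induction S)
  interpret W: cvs W by fact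
  interpret T: mod_hom \<CC> V W T using assms(4) by unfold_locales
  {
    case empty
    show ?case by simp
  next
    case (insert x S)
    have "T v \<in> carrier W" if "v \<in> carrier V" for v using that by auto
    hence "finsum W (\<lambda>v. a v \<odot>\<^bsub>W\<^esub> T v) (insert x S) = a x \<odot>\<^bsub>W\<^esub> T x \<oplus>\<^bsub>W\<^esub> finsum W (\<lambda>v. a v \<odot>\<^bsub>W\<^esub> T v) S"
      using insert by (intro W.M.finsum_insert) auto
    thus ?case using insert by (auto simp: lc_insert)
  }
qed

lemma indep_coeff:
  assumes "lin_indpt S" "finite S" "lincomb a S = \<zero>" "v \<in> S"
  shows "a v = 0"
  using not_lindepD[OF assms(1,2) _ _ assms(3)] assms(4) by auto

lemma indepI:
  assumes "finite S" "S \<subseteq> carrier V" "\<And>a v. lincomb a S = \<zero> \<Longrightarrow> v \<in> S \<Longrightarrow> a v = 0"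
  shows "lin_indpt S"
  by (rule finite_lin_indpt2) (use assms in auto)

lemma span_iff: "finite S \<Longrightarrow> S \<subseteq> carrier V \<Longrightarrow> v \<in> span S \<longleftrightarrow> (\<exists>a. v = lincomb a S)"
  using finite_span[of S] by auto

lemma sub_carrier: "submodule \<CC> W V \<Longrightarrow> W \<subseteq> carrier V"
  by (simp add: submodule_def)

lemma sub_add: "submodule \<CC> W V \<Longrightarrow> v \<in> W \<Longrightarrow> w \<in> W \<Longrightarrow> v \<oplus> w \<in> W"
  and sub_smul: "submodule \<CC> W V \<Longrightarrow> v \<in> W \<Longrightarrow> c \<odot> v \<in> W"
  and sub_zero: "submodule \<CC> W V \<Longrightarrow> \<zero> \<in> W"
  by (simp_all add: submodule_def)

lemma subI:
  assumes "W \<subseteq> carrier V" "\<zero> \<in> W" "\<And>v w. v \<in> W \<Longrightarrow> w \<in> W \<Longrightarrow> v \<oplus> w \<in> W" "\<And>c v. v \<in> W \<Longrightarrow> c \<odot> v \<in> W"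
  shows "submodule \<CC> W V"
  by (rule submodule.intro) (use assms module_axioms in auto)

lemma submodule_subspace: "submodule \<CC> W V \<longleftrightarrow> VectorSpace.subspace \<CC> W V"
  by (simp add: VectorSpace.subspace_def vectorspace_axioms)

lemma sub_cvs: "submodule \<CC> W V \<Longrightarrow> cvs (vs W)"
  unfolding cvs_def by (rule subspace_is_vs) (simp add: submodule_subspace)

lemma sub_lc:
  assumes "submodule \<CC> W V" "finite S" "S \<subseteq> W"
  shows "lincomb a S \<in> W"
  using assms span_is_subset[of S W] span_iff[of S] sub_carrier by blast

text \<open>Independence inside W is independence in V, so \<open>dim\<close> bounds independent
  sets and a maximal one is a finite basis of W.\<close>

lemma fin_dim_sub:
  assumes "fin_dim" "submodule \<CC> W V"
  shows "vectorspace.fin_dim \<CC> (vs W)"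
proof -
  interpret W: cvs "vs W" by (rule sub_cvs[OF assms(2)])
  have li: "W.lin_dep S = lin_dep S" if "S \<subseteq> W" for S
    using span_li_not_depend(2)[OF that assms(2)] .
  have "\<exists>A. finite A \<and> maximal A (\<lambda>S. S \<subseteq> carrier (vs W) \<and> W.lin_indpt S)"
  proof (rule maximal_exists)
    show "{} \<subseteq> carrier (vs W) \<and> W.lin_indpt {}" by (auto simp: W.lin_dep_def)
    fix A assume "A \<subseteq> carrier (vs W) \<and> W.lin_indpt A"
    thus "finite A \<and> card A \<le> dim" using li li_le_dim[OF assms(1)] sub_carrier[OF assms(2)] by auto
  qed
  then obtain A where "finite A" "W.basis A" using W.max_li_is_basis by blast
  thus ?thesis unfolding W.fin_dim_def W.basis_def by auto
qed

lemma dim_sub_basis: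
  assumes "submodule \<CC> W V" "finite S" "S \<subseteq> W" "lin_indpt S" "W \<subseteq> span S"
  shows "vectorspace.dim \<CC> (vs W) = card S"
proof -
  interpret W: cvs "vs W" by (rule sub_cvs[OF assms(1)])
  have "W.basis S"
    using span_li_not_depend[OF assms(3,1)] assms(3-5) span_is_subset[OF assms(3,1)]
    unfolding W.basis_def by auto
  thus ?thesis by (rule W.dim_basis[OF assms(2)])
qed

text \<open>The added vectors come from a prescribed spanning set S. Choosing S among homogeneous
  weight vectors is what makes the bases below homogeneous and adapted to the torus.\<close>

lemma extend_basis:
  assumes fd: "fin_dim" and Z: "submodule \<CC> Z V" "I \<subseteq> Z" "lin_indpt I" "S \<subseteq> Z" "Z \<subseteq> span S"
  shows "\<exists>C\<subseteq>S. C \<inter> I = {} \<and> finite (I \<union> C) \<and> lin_indpt (I \<union> C) \<and> span (I \<union> C) = Z"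
proof -
  have ZV: "Z \<subseteq> carrier V" by (rule sub_carrier[OF Z(1)])
  have "\<exists>C. finite C \<and> maximal C (\<lambda>C. C \<subseteq> S \<and> C \<inter> I = {} \<and> lin_indpt (I \<union> C))"
  proof (rule maximal_exists)
    show "{} \<subseteq> S \<and> {} \<inter> I = {} \<and> lin_indpt (I \<union> {})" using Z by auto
    fix C assume "C \<subseteq> S \<and> C \<inter> I = {} \<and> lin_indpt (I \<union> C)"
    hence "C \<subseteq> carrier V" "lin_indpt C" using Z ZV subset_li_is_li[of "I \<union> C" C] by auto
    thus "finite C \<and> card C \<le> dim" using li_le_dim[OF fd] by auto
  qed
  then obtain C where mx: "maximal C (\<lambda>C. C \<subseteq> S \<and> C \<inter> I = {} \<and> lin_indpt (I \<union> C))" by (elim exE conjE)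
  have C: "C \<subseteq> S" "C \<inter> I = {}" "lin_indpt (I \<union> C)"
    and m: "\<And>D. C \<subseteq> D \<Longrightarrow> D \<subseteq> S \<Longrightarrow> D \<inter> I = {} \<Longrightarrow> lin_indpt (I \<union> D) \<Longrightarrow> D = C"
    using mx[unfolded maximal_def] by metis+
  have IC: "I \<union> C \<subseteq> carrier V" using C Z ZV by auto
  have sp: "submodule \<CC> (span (I \<union> C)) V" by (rule span_is_submodule[OF IC])
  have "s \<in> span (I \<union> C)" if "s \<in> S" for s
  proof (rule ccontr)
    assume n: "s \<notin> span (I \<union> C)"
    hence ns: "s \<notin> I \<union> C" using in_own_span[OF IC] by auto
    have "lin_indpt ((I \<union> C) \<union> {s})"
      using lin_dep_iff_in_span[OF IC C(3) _ ns] n that Z ZV by auto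
    hence "insert s C = C" using m[of "insert s C"] that C ns by auto
    thus False using ns by auto
  qed
  hence "span S \<subseteq> span (I \<union> C)" using span_is_subset[OF _ sp] by auto
  moreover have "span (I \<union> C) \<subseteq> Z" by (rule span_is_subset[OF _ Z(1)]) (use C Z in auto)
  ultimately show ?thesis using C fin_dim_li_fin[OF fd C(3) IC] Z(5) by (intro exI[of _ C]) auto
qed

definition endo :: "('v \<Rightarrow> 'v) \<Rightarrow> bool" where
  "endo T \<longleftrightarrow> T \<in> LinearCombinations.module_hom \<CC> V V"

lemma endoI:
  "(\<And>v. v \<in> carrier V \<Longrightarrow> T v \<in> carrier V) \<Longrightarrow> (\<And>v w. v \<in> carrier V \<Longrightarrow> w \<in> carrier V \<Longrightarrow> T (v \<oplus> w) = T v \<oplus> T w)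
   \<Longrightarrow> (\<And>c v. v \<in> carrier V \<Longrightarrow> T (c \<odot> v) = c \<odot> T v) \<Longrightarrow> endo T"
  by (auto simp: endo_def LinearCombinations.module_hom_def)

lemma endo_closed: "endo T \<Longrightarrow> v \<in> carrier V \<Longrightarrow> T v \<in> carrier V"
  and endo_add: "endo T \<Longrightarrow> v \<in> carrier V \<Longrightarrow> w \<in> carrier V \<Longrightarrow> T (v \<oplus> w) = T v \<oplus> T w"
  and endo_smul: "endo T \<Longrightarrow> v \<in> carrier V \<Longrightarrow> T (c \<odot> v) = c \<odot> T v"
  by (auto simp: endo_def LinearCombinations.module_hom_def)

lemma endo_zero: "endo T \<Longrightarrow> T \<zero> = \<zero>"
  using endo_smul[of T \<zero> 0] endo_closed[of T \<zero>] by simp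

lemmas endo_simps = endo_closed endo_add endo_smul endo_zero

lemma dim_mono:
  assumes fin_dim "submodule \<CC> W V"
  shows "vectorspace.dim \<CC> (vs W) \<le> dim"
proof -
  interpret W: cvs "vs W" by (rule sub_cvs[OF assms(2)])
  obtain S where S: "finite S" "W.basis S" using W.finite_basis_exists[OF fin_dim_sub[OF assms]] by auto
  hence "W.dim = card S" by (rule W.dim_basis)
  also have "\<dots> \<le> dim"
    using S span_li_not_depend(2)[OF _ assms(2), of S] sub_carrier[OF assms(2)]
    by (intro li_le_dim[OF assms(1)]) (auto simp: W.basis_def)
  finally show ?thesis .
qed

lemma dim_le:
  assumes fd: fin_dim and W: "submodule \<CC> W1 V" "submodule \<CC> W2 V"
    and T: "endo T" "\<And>v. v \<in> W1 \<Longrightarrow> T v \<in> W2" "\<And>v. v \<in> W1 \<Longrightarrow> T v = \<zero> \<Longrightarrow> v = \<zero>"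
  shows "vectorspace.dim \<CC> (vs W1) \<le> vectorspace.dim \<CC> (vs W2)"
proof -
  interpret W1: cvs "vs W1" by (rule sub_cvs[OF W(1)])
  interpret W2: cvs "vs W2" by (rule sub_cvs[OF W(2)])
  interpret T: linear_map \<CC> "vs W1" "vs W2" T
    using T(1,2) sub_carrier[OF W(1)]
    by unfold_locales (auto simp: LinearCombinations.module_hom_def endo_simps subset_eq)
  have "carrier (W1.vs T.ker) = {\<zero>\<^bsub>vs W1\<^esub>}"
    using T(3) sub_zero[OF W(1)] endo_zero[OF T(1)] by (auto simp: T.ker_def)
  hence inj: "inj_on T (carrier (vs W1))" by (rule T.Ke0_imp_inj)
  have "W1.dim = vectorspace.dim \<CC> (W2.vs T.im)"
    using T.rank_nullity[OF fin_dim_sub[OF fd W(1)]] T.inj_imp_dim_ker0[OF inj] by simp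
  also have "\<dots> \<le> W2.dim"
    by (rule W2.dim_mono[OF fin_dim_sub[OF fd W(2)] T.im_is_submodule])
  finally show ?thesis .
qed

lemma endo_lc:
  assumes "endo T" "finite S" "S \<subseteq> carrier V" "\<And>v. v \<in> S \<Longrightarrow> T v = t v \<odot> v"
  shows "T (lincomb a S) = lincomb (\<lambda>v. t v * a v) S"
  using assms(2-)
proof (induction S)
  case (insert x S)
  have "T (lincomb a (insert x S)) = a x \<odot> T x \<oplus> T (lincomb a S)"
    using insert assms(1) by (simp add: lc_insert endo_simps)
  also have "T (lincomb a S) = lincomb (\<lambda>v. t v * a v) S" using insert by auto
  also have "a x \<odot> T x = (t x * a x) \<odot> x" using insert by (simp add: smul_assoc[symmetric] mult.commute)
  finally show ?case using insert by (simp add: lc_insert)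
qed (simp add: endo_zero assms(1))

text \<open>The analogue of \<open>lfac\<close> on a carrier. Subtraction is written with the scalar
  - a, so that closure of submodules applies at once.\<close>

fun vfac :: "('v \<Rightarrow> 'v) \<Rightarrow> complex list \<Rightarrow> 'v \<Rightarrow> 'v" where
  "vfac T [] v = v"
| "vfac T (a # as) v = T (vfac T as v) \<oplus> (- a) \<odot> vfac T as v"

lemma endo_vfac: "endo T \<Longrightarrow> endo (vfac T as)"
proof (induction as)
  case (Cons a as)
  note e = endo_simps[OF Cons.IH[OF Cons.prems]] endo_simps[OF Cons.prems]
  show ?case
    by (intro endoI)
      (simp_all add: e smul_r_distr smul_assoc[symmetric] mult.commute M.add.m_ac)
qed (auto intro: endoI)

lemma vfac_eigen: "endo T \<Longrightarrow> v \<in> carrier V \<Longrightarrow> T v = l \<odot> v \<Longrightarrow> vfac T as v = (\<Prod>a\<leftarrow>as. l - a) \<odot> v"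
proof (induction as)
  case (Cons a as)
  have "(\<Prod>a\<leftarrow>a # as. l - a) = (\<Prod>a\<leftarrow>as. l - a) * l + - a * (\<Prod>a\<leftarrow>as. l - a)" by (simp add: algebra_simps)
  hence "(\<Prod>a\<leftarrow>a # as. l - a) \<odot> v = (\<Prod>a\<leftarrow>as. l - a) \<odot> (l \<odot> v) \<oplus> (- a) \<odot> ((\<Prod>a\<leftarrow>as. l - a) \<odot> v)"
    using Cons.prems(2) by (metis smul_l_distr smul_assoc)
  then show ?case using Cons by (simp add: endo_smul)
qed simp

lemma vfac_stable:
  assumes "endo T" "submodule \<CC> Z V" "\<And>v. v \<in> Z \<Longrightarrow> T v \<in> Z" "v \<in> Z"
  shows "vfac T as v \<in> Z"
  using assms(2-) by (induction as) (simp_all add: sub_add sub_smul)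

text \<open>This is Lagrange interpolation, one factor at a time.\<close>

lemma eigenvectors_span:
  assumes T: "endo T" and Z: "submodule \<CC> Z V" "\<And>v. v \<in> Z \<Longrightarrow> T v \<in> Z"
    and "distinct as" "v \<in> Z" "vfac T as v = \<zero>"
  shows "v \<in> span {v \<in> Z. \<exists>a\<in>set as. T v = a \<odot> v}"
  using assms(4-)
proof (induction as arbitrary: v)
  case Nil
  then show ?case by (simp add: span_zero)
next
  case (Cons a as)
  let ?S = "{v \<in> Z. \<exists>a\<in>set as. T v = a \<odot> v}" and ?R = "{v \<in> Z. \<exists>b\<in>set (a # as). T v = b \<odot> v}"
  have ZV: "Z \<subseteq> carrier V" by (rule sub_carrier[OF Z(1)])
  define u where "u = vfac T as v"
  define c where "c = (\<Prod>b\<leftarrow>as. a - b)"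
  have c: "c \<noteq> 0" using Cons.prems(1) by (auto simp: c_def prod_list_zero_iff)
  have uZ: "u \<in> Z" unfolding u_def by (rule vfac_stable[OF T Z Cons.prems(2)])
  have u: "u \<in> carrier V" "T u \<in> carrier V" "v \<in> carrier V" using uZ ZV T Cons.prems by (auto simp: endo_closed)
  have "T u \<oplus> (- a) \<odot> u = \<zero>" using Cons.prems(3) by (simp add: u_def)
  hence Tu: "T u = a \<odot> u" using u by (metis M.minus_equality M.minus_minus smul_closed smul_uminus)
  \<comment> \<open>The remaining factors multiply u by c, and u is an eigenvector for a;
    subtracting u / c from v leaves a vector killed by the remaining factors.\<close>
  define w where "w = v \<oplus> (- inverse c) \<odot> u"
  have wZ: "w \<in> Z" unfolding w_def
    using Cons.prems uZ Z by (simp add: sub_add sub_smul)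
  have "vfac T as w = u \<oplus> (- inverse c) \<odot> (c \<odot> u)"
    unfolding w_def using endo_vfac[OF T, of as] u vfac_eigen[OF T u(1) Tu, of as]
    by (simp add: endo_simps u_def c_def)
  also have "\<dots> = \<zero>" using u c by (simp add: smul_assoc[symmetric] smul_uminus M.r_neg)
  finally have "w \<in> span ?S" using Cons wZ by auto
  moreover have "?S \<subseteq> ?R" by auto
  ultimately have wR: "w \<in> span ?R" using span_is_monotone by blast
  have RV: "?R \<subseteq> carrier V" using ZV by auto
  have uR: "inverse c \<odot> u \<in> span ?R"
  proof -
    have "inverse c \<odot> u \<in> ?R"
      using uZ Z(1) u Tu T
      by (auto simp: sub_smul endo_smul smul_assoc[symmetric] mult.commute)
    thus ?thesis using in_own_span[OF RV] by blast
  qed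
  have "v = w \<oplus> inverse c \<odot> u"
    using u by (simp add: w_def smul_uminus M.add.m_assoc M.l_neg)
  moreover have "w \<oplus> inverse c \<odot> u \<in> span ?R" by (rule sub_add[OF span_is_submodule[OF RV] wR uR])
  ultimately show ?case by simp
qed

text \<open>Integral eigenvalues are part of the notion, because the parity of weights decides the
  image of ds.\<close>

definition diagonal :: "('v \<Rightarrow> 'v) \<Rightarrow> bool" where
  "diagonal T \<longleftrightarrow> endo T \<and> (\<exists>as. distinct as \<and> set as \<subseteq> \<int> \<and> (\<forall>v\<in>carrier V. vfac T as v = \<zero>))"

text \<open>Induction over the operators: an eigenspace of T in Z is stable under the others, which
  commute with T. Leaving the stable subspace Z open makes this induction possible and later allows
  the kernel of an odd element.\<close>

lemma joint_eigenvectors_span: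
  assumes "\<And>T. T \<in> set Ts \<Longrightarrow> diagonal T"
    and "\<And>S T v. S \<in> set Ts \<Longrightarrow> T \<in> set Ts \<Longrightarrow> v \<in> carrier V \<Longrightarrow> S (T v) = T (S v)"
    and "submodule \<CC> Z V" "\<And>T v. T \<in> set Ts \<Longrightarrow> v \<in> Z \<Longrightarrow> T v \<in> Z"
  shows "Z \<subseteq> span {v \<in> Z. \<forall>T\<in>set Ts. \<exists>k\<in>\<int>. T v = k \<odot> v}"
  using assms
proof (induction Ts arbitrary: Z)
  case Nil
  then show ?case using in_own_span[OF sub_carrier] by simp
next
  case (Cons T Ts)
  let ?R = "\<lambda>Z Ts. {v \<in> Z. \<forall>T\<in>set Ts. \<exists>k\<in>\<int>. T v = k \<odot> v}"
  have ZV: "Z \<subseteq> carrier V" by (rule sub_carrier[OF Cons.prems(3)])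
  have RV: "?R Z (T # Ts) \<subseteq> carrier V" using ZV by auto
  have T: "endo T" using Cons.prems(1) by (auto simp: diagonal_def)
  obtain as where as: "distinct as" "set as \<subseteq> \<int>" "\<forall>v\<in>carrier V. vfac T as v = \<zero>"
    using Cons.prems(1)[of T] by (auto simp: diagonal_def)
  show ?case
  proof
    fix v assume v: "v \<in> Z"
    have "v \<in> span {v \<in> Z. \<exists>a\<in>set as. T v = a \<odot> v}"
      by (rule eigenvectors_span[OF T Cons.prems(3)]) (use v as ZV Cons.prems(4) in auto)
    moreover have "{v \<in> Z. \<exists>a\<in>set as. T v = a \<odot> v} \<subseteq> span (?R Z (T # Ts))"
    proof
      fix w assume "w \<in> {v \<in> Z. \<exists>a\<in>set as. T v = a \<odot> v}"
      then obtain a where a: "w \<in> Z" "a \<in> set as" "T w = a \<odot> w" by auto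
      define Y where "Y = {v \<in> Z. T v = a \<odot> v}"
      have Y: "submodule \<CC> Y V"
        by (rule subI) (use ZV Cons.prems(3) T in \<open>auto simp: Y_def sub_zero endo_zero
            sub_add sub_smul endo_simps subset_eq smul_r_distr smul_assoc[symmetric] mult.commute\<close>)
      have st: "S u \<in> Y" if "S \<in> set Ts" "u \<in> Y" for S u
      proof -
        have "S (T u) = T (S u)" using Cons.prems(2) that ZV by (auto simp: Y_def)
        moreover have "endo S" using Cons.prems(1) that by (auto simp: diagonal_def)
        ultimately show ?thesis using that Cons.prems(4) ZV by (auto simp: Y_def endo_smul)
      qed
      have "Y \<subseteq> span (?R Y Ts)"
        by (rule Cons.IH) (use Cons.prems Y st in auto)
      moreover have "?R Y Ts \<subseteq> ?R Z (T # Ts)" using a as by (auto simp: Y_def)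
      ultimately show "w \<in> span (?R Z (T # Ts))" using a span_is_monotone Y_def by blast
    qed
    ultimately show "v \<in> span (?R Z (T # Ts))"
      using span_is_subset[OF _ span_is_submodule[OF RV]] by blast
  qed
qed

end

section \<open>Coordinates with respect to a finite basis, and sl(2)-triples of
  endomorphisms\<close>

lemma sum_fun_apply: "(\<Sum>b\<in>B. g b) x = (\<Sum>b\<in>B. g b x)"
  by (induction B rule: infinite_finite_induct) auto

definition fscale :: "complex \<Rightarrow> ('v \<Rightarrow> complex) \<Rightarrow> 'v \<Rightarrow> complex" where
  "fscale c f = (\<lambda>x. c * f x)"

interpretation fs: op_space fscale
  by unfold_locales (auto simp: fscale_def fun_eq_iff algebra_simps)

locale fin_basis = cvs V for V :: "(complex, 'v, 'm) module_scheme" (structure) +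
  fixes B :: "'v set"
  assumes finB: "finite B" and basB: "basis B"
begin

definition "val f = lincomb f B"
text \<open>The condition outside B makes the coordinate function unique, since \<open>val\<close>
  only sees the values on B.\<close>

definition "coords v = (SOME f. lincomb f B = v \<and> (\<forall>x. x \<notin> B \<longrightarrow> f x = 0))"

lemma B: "finite B" "B \<subseteq> carrier V" "lin_indpt B" "span B = carrier V"
  using finB basB by (auto simp: basis_def)

lemma val [simp]: "val f \<in> carrier V" "val (f + g) = val f \<oplus> val g" "val (fscale c f) = c \<odot> val f"
  using B lc_add[of B f g] lc_smult[of B c f] by (auto simp: val_def fscale_def plus_fun_def)

lemma coords: assumes "v \<in> carrier V" shows "val (coords v) = v" "x \<notin> B \<Longrightarrow> coords v x = 0"
proof -
  obtain a where a: "v = lincomb a B" using assms B span_iff[of B v] by auto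
  have "lincomb (\<lambda>x. if x \<in> B then a x else 0) B = v" unfolding a by (rule lc_cong) (use B in auto)
  hence "\<exists>f. lincomb f B = v \<and> (\<forall>x. x \<notin> B \<longrightarrow> f x = 0)"
    by (intro exI[of _ "\<lambda>x. if x \<in> B then a x else 0"]) auto
  from someI_ex[OF this] show "val (coords v) = v" "x \<notin> B \<Longrightarrow> coords v x = 0"
    by (auto simp: coords_def val_def)
qed

lemma coords_unique:
  assumes "val f = v" "\<And>x. x \<notin> B \<Longrightarrow> f x = 0"
  shows "coords v = f"
proof -
  have v: "v \<in> carrier V" using assms(1) by auto
  have "lincomb (\<lambda>x. f x + (- 1) * coords v x) B = v \<oplus> (-1) \<odot> v"
    using lc_add[of B f "\<lambda>x. (-1) * coords v x"] lc_smult[of B "-1" "coords v"] B coords(1)[OF v] assms(1)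
    by (simp add: val_def)
  hence "lincomb (\<lambda>x. f x + (- 1) * coords v x) B = \<zero>" using v by (simp add: smul_uminus M.r_neg)
  hence "f x + (- 1) * coords v x = 0" if "x \<in> B" for x using indep_coeff[OF B(3,1) _ that] by blast
  thus ?thesis using assms(2) coords(2)[OF v] by (intro ext) (metis add.right_neutral eq_iff_diff_eq_0 mult_minus1 uminus_add_conv_diff add.commute)
qed

lemma coords_add: "v \<in> carrier V \<Longrightarrow> w \<in> carrier V \<Longrightarrow> coords (v \<oplus> w) = coords v + coords w"
  by (rule coords_unique) (auto simp: coords)

lemma coords_smul: "v \<in> carrier V \<Longrightarrow> coords (c \<odot> v) = fscale c (coords v)"
  by (rule coords_unique) (simp_all only: val coords, simp add: fscale_def coords)

lemma coords_inj: "v \<in> carrier V \<Longrightarrow> coords v = 0 \<Longrightarrow> v = \<zero>"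
  using coords(1)[of v] val(3)[of 0 0] val(1)[of 0] by (simp add: fs.scale_zero_left)

lemma coords_lc:
  assumes "endo T" "finite S" "S \<subseteq> carrier V"
  shows "coords (T (lincomb f S)) x = (\<Sum>b\<in>S. f b * coords (T b) x)"
  using assms(2,3)
proof (induction S)
  case empty
  then show ?case using coords_smul[of \<zero> 0] by (simp add: endo_zero[OF assms(1)] fscale_def)
next
  case (insert b S)
  then show ?case
    by (simp add: lc_insert endo_simps[OF assms(1)] coords_add coords_smul fscale_def)
qed

lemma coords_endo:
  assumes "endo T" "v \<in> carrier V"
  shows "coords (T v) x = (\<Sum>b\<in>B. coords v b * coords (T b) x)"
  using coords_lc[OF assms(1) B(1,2), of "coords v"] coords(1)[OF assms(2)] by (simp add: val_def)

end

locale sl2_endos = cvs V for V :: "(complex, 'v, 'm) module_scheme" (structure) +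
  fixes E F H :: "'v \<Rightarrow> 'v"
  assumes fd: fin_dim and E: "endo E" and F: "endo F" and H: "endo H"
    and HE: "v \<in> carrier V \<Longrightarrow> H (E v) = E (H v) \<oplus> 2 \<odot> E v"
    and HF: "v \<in> carrier V \<Longrightarrow> H (F v) = F (H v) \<oplus> (-2) \<odot> F v"
    and EF: "v \<in> carrier V \<Longrightarrow> E (F v) = F (E v) \<oplus> H v"
begin

definition "B = (SOME B. finite B \<and> basis B)"

sublocale fin_basis V B
  using someI_ex[OF finite_basis_exists[OF fd]] by unfold_locales (auto simp: B_def)

text \<open>An arbitrary function is read as a linear combination over B, and the result is
  supported on B. So the image of a lifted operator lies in the span of finitely many indicator
  functions, as \<open>lfac_annihilates\<close> requires.\<close>

definition lift :: "('v \<Rightarrow> 'v) \<Rightarrow> ('v \<Rightarrow> complex) \<Rightarrow> 'v \<Rightarrow> complex" where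
  "lift T f = coords (T (val f))"

lemma lin_lift: "endo T \<Longrightarrow> fs.lin (lift T)"
  by (rule fs.linI) (simp_all add: lift_def endo_simps coords_add coords_smul)

lemma lift_comp: "endo T \<Longrightarrow> lift S (lift T f) = coords (S (T (val f)))"
  by (simp add: lift_def coords endo_closed)

lemma coords_sub: "v \<in> carrier V \<Longrightarrow> coords ((- c) \<odot> v) = - fscale c (coords v)"
  using coords_smul[of v "- c"] by (simp add: fs.scale_minus_left)

sublocale ops: sl2_ops fscale "lift E" "lift F" "lift H"
proof (intro sl2_ops.intro sl2_ops_axioms.intro fs.op_space_axioms)
  show "fs.lin (lift E)" "fs.lin (lift F)" "fs.lin (lift H)" using E F H by (auto intro: lin_lift)
  fix f
  show "lift H (lift E f) = lift E (lift H f) + fscale 2 (lift E f)"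
    using E F H by (simp add: lift_comp HE coords_add coords_smul endo_closed) (simp add: lift_def)
  show "lift H (lift F f) = lift F (lift H f) + fscale (- 2) (lift F f)"
    using E F H by (simp add: lift_comp HF coords_add coords_smul endo_closed) (simp add: lift_def)
  show "lift E (lift F f) = lift F (lift E f) + lift H f"
    using E F H by (simp add: lift_comp EF coords_add endo_closed) (simp add: lift_def)
next
  define D where "D = (\<lambda>b x. if x = b then 1 else 0 :: complex) ` B"
  have "lift H f \<in> fs.span D" for f
  proof -
    have "lift H f x = 0" if "x \<notin> B" for x using coords(2) H that by (simp add: lift_def endo_closed)
    hence "lift H f = (\<Sum>b\<in>B. fscale (lift H f b) (\<lambda>x. if x = b then 1 else 0))"
      by (auto simp: fun_eq_iff fscale_def B sum_fun_apply if_distrib cong: if_cong)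
    also have "\<dots> \<in> fs.span D" by (intro fs.span_sum fs.span_scale fs.span_base) (auto simp: D_def)
    finally show ?thesis .
  qed
  thus "\<exists>as. \<forall>v. lfac fscale (lift H) as v = 0"
    by (intro fs.lfac_annihilates[of _ D] lin_lift H) (auto simp: D_def B)
qed

lemma lfac_coords: "v \<in> carrier V \<Longrightarrow> endo T \<Longrightarrow> lfac fscale (lift T) as (coords v) = coords (vfac T as v)"
proof (induction as)
  case (Cons a as)
  have "vfac T as v \<in> carrier V" using Cons endo_vfac endo_closed by blast
  then show ?case using Cons by (simp add: lift_def coords coords_add coords_sub endo_closed)
qed simp

lemma diagonal_H: "diagonal H"
proof -
  obtain as where as: "distinct as" "set as \<subseteq> \<int>" "\<forall>v. lfac fscale (lift H) as v = 0"
    using ops.diagonalizable by auto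
  have "vfac H as v = \<zero>" if "v \<in> carrier V" for v
    using lfac_coords[OF that H, of as] as(3) coords_inj endo_closed[OF endo_vfac[OF H] that] by metis
  thus ?thesis using as H unfolding diagonal_def by blast
qed

lemma E_power_inj:
  assumes "v \<in> carrier V" "H v = (- of_nat k) \<odot> v" "(E ^^ k) v = \<zero>"
  shows "v = \<zero>"
proof (rule coords_inj[OF assms(1)], rule ops.E_power_inj)
  show "lift H (coords v) = fscale (- of_nat k) (coords v)"
    using assms by (simp add: lift_def coords coords_smul)
  have "(E ^^ n) v \<in> carrier V \<and> (lift E ^^ n) (coords v) = coords ((E ^^ n) v)" for n
    by (induction n) (auto simp: assms lift_def coords endo_closed[OF E])
  hence "(lift E ^^ k) (coords v) = coords \<zero>" using assms(3) by metis
  thus "(lift E ^^ k) (coords v) = 0" using coords_smul[of \<zero> 0] by (simp add: fs.scale_zero_left)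
qed

definition eig :: "complex \<Rightarrow> 'v set" where
  "eig k = {v \<in> carrier V. H v = k \<odot> v}"

lemma eig_sub: "submodule \<CC> (eig k) V"
  by (rule subI) (auto simp: eig_def H endo_simps smul_r_distr smul_assoc[symmetric] mult.commute)

lemma E_power_eig: "v \<in> eig l \<Longrightarrow> (E ^^ n) v \<in> eig (l + 2 * of_nat n)"
proof (induction n)
  case (Suc n)
  define w where "w = (E ^^ n) v"
  have w: "w \<in> carrier V" "H w = (l + 2 * of_nat n) \<odot> w" using Suc by (auto simp: w_def eig_def)
  have "H (E w) = (l + 2 * of_nat n) \<odot> E w \<oplus> 2 \<odot> E w" using HE[OF w(1)] w E by (simp add: endo_simps)
  also have "\<dots> = (l + 2 * of_nat (Suc n)) \<odot> E w"
    using w(1) E by (simp add: endo_simps smul_l_distr[symmetric] algebra_simps)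
  finally show ?case using w(1) E by (simp add: eig_def w_def[symmetric] endo_simps)
qed simp

lemma endo_pow: "endo T \<Longrightarrow> endo (T ^^ n)"
  by (induction n) (auto intro!: endoI simp: endo_simps)

text \<open>E^k maps the weight space of - k injectively to that of k.\<close>

lemma dim_eig_le: "vectorspace.dim \<CC> (vs (eig (- of_nat k))) \<le> vectorspace.dim \<CC> (vs (eig (of_nat k)))"
proof (rule dim_le[OF fd eig_sub eig_sub endo_pow[OF E]])
  show "(E ^^ k) v \<in> eig (of_nat k)" if "v \<in> eig (- of_nat k)" for v
    using E_power_eig[OF that, of k] by simp
  show "v = \<zero>" if "v \<in> eig (- of_nat k)" "(E ^^ k) v = \<zero>" for v
    using E_power_inj that by (auto simp: eig_def)
qed

lemma swapped: "sl2_endos V F E (\<lambda>v. (-1) \<odot> H v)"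
  using fd E F H
  apply unfold_locales
  apply (auto simp: HE HF EF endo_simps smul_r_distr smul_assoc[symmetric] intro!: endoI)
  apply (auto simp: smul_uminus M.add.m_assoc M.r_neg endo_simps)
  done

text \<open>The swapped triple exchanges the weight spaces of k and - k and supplies the reverse
  inequality.\<close>

lemma dim_eig_neg:
  assumes "k \<in> \<int>"
  shows "vectorspace.dim \<CC> (vs (eig (- k))) = vectorspace.dim \<CC> (vs (eig k))"
proof -
  interpret s: sl2_endos V F E "\<lambda>v. (-1) \<odot> H v" by (rule swapped)
  have "s.eig l = eig (- l)" for l
  proof -
    have "(-1) \<odot> H v = l \<odot> v \<longleftrightarrow> H v = (- l) \<odot> v" if "v \<in> carrier V" for v
      using that H by (auto simp: endo_simps smul_uminus) (metis M.minus_minus endo_closed)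
    thus ?thesis by (auto simp: s.eig_def eig_def)
  qed
  hence eq: "vectorspace.dim \<CC> (vs (eig (- of_nat n))) = vectorspace.dim \<CC> (vs (eig (of_nat n)))" for n
    using dim_eig_le[of n] s.dim_eig_le[of n] by simp
  obtain i where i: "k = of_int i" using assms by (auto simp: Ints_def)
  show ?thesis
  proof (cases "i \<ge> 0")
    case True
    then show ?thesis using eq[of "nat i"] i by simp
  next
    case False
    then show ?thesis using eq[of "nat (- i)"] i by simp
  qed
qed

end

section \<open>Weight bases and supercharacters\<close>

lemma UNIV_nontrivial: "carrier \<CC> \<noteq> {\<zero>\<^bsub>\<CC>\<^esub>}"
proof
  assume "carrier \<CC> = {\<zero>\<^bsub>\<CC>\<^esub>}"
  hence "(1::complex) \<in> {0}" by auto
  thus False by simp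
qed

locale sspace = cvs M for M :: "('v, 'm) superspace_scheme" (structure) +
  assumes ss: "superspace M"
begin

lemma parts_sub: "submodule \<CC> (even_part M) M" "submodule \<CC> (odd_part M) M"
  using ss by (auto simp: superspace_def submodule_subspace)

lemma parts_carrier: "even_part M \<subseteq> carrier M" "odd_part M \<subseteq> carrier M"
  using parts_sub sub_carrier by auto

lemma parts_disjoint: "v \<in> even_part M \<Longrightarrow> v \<in> odd_part M \<Longrightarrow> v = \<zero>"
  using ss by (auto simp: superspace_def)

lemma parts_decomp: "v \<in> carrier M \<Longrightarrow> \<exists>u w. u \<in> even_part M \<and> w \<in> odd_part M \<and> v = u \<oplus> w"
  using ss by (auto simp: superspace_def)

lemma sum_parts_zero:
  assumes "u \<in> even_part M" "w \<in> odd_part M" "u \<oplus> w = \<zero>"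
  shows "u = \<zero>" "w = \<zero>"
proof -
  have c: "u \<in> carrier M" "w \<in> carrier M" using assms parts_carrier by auto
  hence u: "u = (-1) \<odot> w" using assms(3) by (simp add: smul_uminus M.minus_equality[symmetric])
  hence "u \<in> odd_part M" using assms(2) parts_sub by (simp add: sub_smul)
  thus u0: "u = \<zero>" using assms(1) parts_disjoint by auto
  thus "w = \<zero>" using assms(3) c by simp
qed

end

lemma (in cvs) sub_right: "a \<in> carrier V \<Longrightarrow> b \<in> carrier V \<Longrightarrow> b = (a \<oplus> b) \<oplus> (-1) \<odot> a"
  using M.add.m_comm[of a b] by (simp add: smul_uminus M.add.m_assoc M.r_neg)

lemma sspaceI: "superspace M \<Longrightarrow> sspace M"
  by (simp add: sspace_def sspace_axioms_def cvs_def superspace_def)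

definition weight_basis ::
  "('h, 'm) superspace_scheme \<Rightarrow> 'h set \<Rightarrow> ('h \<Rightarrow> 'g) \<Rightarrow> ('g, 'v) rep \<Rightarrow> 'v set \<Rightarrow> ('v \<Rightarrow> 'h weight) \<Rightarrow> bool" where
  "weight_basis L H \<iota> M B wt \<longleftrightarrow> finite B \<and> vectorspace.basis \<CC> M B \<and> B \<subseteq> even_part M \<union> odd_part M
     \<and> (\<forall>b\<in>B. wt b \<in> dual L H \<and> (\<forall>h\<in>H. act M (\<iota> h) b = wt b h \<odot>\<^bsub>M\<^esub> b))"

definition par_sign :: "bool \<Rightarrow> int" where "par_sign p = (if p then - 1 else 1)"

text \<open>Every homogeneous weight basis computes the supercharacter. Expanding a vector of weight
  \<mu>, only basis vectors of weight \<mu> occur, and in a homogeneous vector only those of its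
  parity; so each graded weight space has a subset of B as its basis.\<close>

lemma sch_weight_basis:
  fixes M :: "('g, 'v) rep" (structure)
  assumes ss: "superspace M" and wb: "weight_basis L H \<iota> M B wt"
    and en: "\<And>h. h \<in> H \<Longrightarrow> act M (\<iota> h) \<in> LinearCombinations.module_hom \<CC> M M"
  shows "sch L H \<iota> M = (\<Sum>b\<in>B. of_int (par_sign (b \<in> odd_part M)) * fexp (wt b))"
proof -
  interpret sspace M by (rule sspaceI[OF ss])
  have B: "finite B" "B \<subseteq> carrier M" "lin_indpt B" "span B = carrier M" "B \<subseteq> even_part M \<union> odd_part M"
    and wt: "\<And>b. b \<in> B \<Longrightarrow> wt b \<in> dual L H" "\<And>b h. b \<in> B \<Longrightarrow> h \<in> H \<Longrightarrow> act M (\<iota> h) b = wt b h \<odot> b"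
    using wb by (auto simp: weight_basis_def basis_def)
  have nz: "b \<noteq> \<zero>" if "b \<in> B" for b using zero_nin_lin_indpt[OF B(2,3) UNIV_nontrivial] that by auto
  have excl: "b \<notin> odd_part M" if "b \<in> B" "b \<in> even_part M" for b using nz that parts_disjoint by blast
  have en': "endo (act M (\<iota> h))" if "h \<in> H" for h using en that by (simp add: endo_def)
  define W where "W \<mu> = weight_space H \<iota> M \<mu>" for \<mu>
  have Wsub: "submodule \<CC> (W \<mu>) M" for \<mu>
    by (rule subI) (auto simp: W_def weight_space_def endo_simps en' smul_r_distr smul_assoc[symmetric] mult.commute)
  have BW: "b \<in> W (wt b)" if "b \<in> B" for b using that B wt by (auto simp: W_def weight_space_def)
  have coeff: "wt b = \<mu>" if \<mu>: "\<mu> \<in> dual L H" and v: "lincomb a B \<in> W \<mu>" and b: "b \<in> B" "a b \<noteq> 0" for a b \<mu>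
  proof
    fix h
    show "wt b h = \<mu> h"
    proof (cases "h \<in> H")
      case True
      have "lincomb (\<lambda>b. wt b h * a b) B = act M (\<iota> h) (lincomb a B)"
        using endo_lc[OF en'[OF True] B(1,2), of "\<lambda>b. wt b h" a] wt True by simp
      also have "\<dots> = lincomb (\<lambda>b. \<mu> h * a b) B"
        using v True B lc_smult[of B "\<mu> h" a] by (simp add: W_def weight_space_def)
      finally have "lincomb (\<lambda>b. wt b h * a b + (-1) * (\<mu> h * a b)) B = \<zero>"
        using B by (simp only: lc_add lc_smult) (simp add: smul_uminus M.r_neg)
      hence "wt b h * a b + (-1) * (\<mu> h * a b) = 0" using indep_coeff[OF B(3,1) _ b(1)] by blast
      thus ?thesis using b(2) by (simp add: algebra_simps)
    next
      case False
      then show ?thesis using \<mu> wt(1)[OF b(1)] by (auto simp: dual_def)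
    qed
  qed
  \<comment> \<open>The terms outside P sum to a vector that lies in both homogeneous components,
    hence to zero.\<close>
  have parity: "b \<in> P" if P: "(P = even_part M \<and> Q = odd_part M) \<or> (P = odd_part M \<and> Q = even_part M)"
    and v: "lincomb a B \<in> P" and b: "b \<in> B" "a b \<noteq> 0" for a b P Q
  proof (rule ccontr)
    assume "b \<notin> P"
    hence bQ: "b \<in> B - P" using b by auto
    have PQ: "submodule \<CC> P M" "submodule \<CC> Q M" "B \<subseteq> P \<union> Q" using P parts_sub B by auto
    have "lincomb a ((B \<inter> P) \<union> (B - P)) = lincomb a (B \<inter> P) \<oplus> lincomb a (B - P)"
      by (rule lincomb_union) (use B in auto)
    moreover have "(B \<inter> P) \<union> (B - P) = B" by auto
    ultimately have v': "lincomb a B = lincomb a (B \<inter> P) \<oplus> lincomb a (B - P)" by simp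
    have c: "lincomb a (B - P) \<in> carrier M" "lincomb a (B \<inter> P) \<in> carrier M" "lincomb a B \<in> carrier M"
      by (rule lc_closed, use B in auto)+
    have "lincomb a (B - P) = lincomb a B \<oplus> (-1) \<odot> lincomb a (B \<inter> P)"
      unfolding v' by (rule sub_right[OF c(2,1)])
    also have "\<dots> \<in> P" using v PQ(1) B by (auto intro!: sub_add sub_smul sub_lc)
    finally have "lincomb a (B - P) \<in> P" .
    moreover have "lincomb a (B - P) \<in> Q" by (rule sub_lc[OF PQ(2)]) (use B PQ in auto)
    ultimately have z: "lincomb a (B - P) = \<zero>" using P parts_disjoint by auto
    have "lin_indpt (B - P)" by (rule subset_li_is_li[OF B(3)]) auto
    thus False using indep_coeff[OF _ _ z bQ] b B by auto
  qed
  have dimW: "vectorspace.dim \<CC> (vs (W \<mu> \<inter> P)) = card {b \<in> B. b \<in> P \<and> wt b = \<mu>}"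
    if \<mu>: "\<mu> \<in> dual L H" and P: "P = even_part M \<or> P = odd_part M" for \<mu> P
  proof -
    obtain Q where Q: "(P = even_part M \<and> Q = odd_part M) \<or> (P = odd_part M \<and> Q = even_part M)" using P by auto
    let ?S = "{b \<in> B. b \<in> P \<and> wt b = \<mu>}"
    have WP: "submodule \<CC> (W \<mu> \<inter> P) M"
      using Wsub[of \<mu>] P parts_sub sub_carrier by (intro subI) (auto simp: sub_add sub_smul sub_zero)
    show ?thesis
    proof (rule dim_sub_basis[OF WP])
      show "?S \<subseteq> W \<mu> \<inter> P" using BW by auto
      show "lin_indpt ?S" by (rule subset_li_is_li[OF B(3)]) auto
      show "W \<mu> \<inter> P \<subseteq> span ?S"
      proof
        fix v assume v: "v \<in> W \<mu> \<inter> P"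
        hence "v \<in> carrier M" using sub_carrier[OF Wsub] by auto
        hence "v \<in> span B" using B(4) by simp
        then obtain a where a: "v = lincomb a B" using span_iff B by blast
        have "lincomb a ?S = lincomb (\<lambda>b. if b \<in> ?S then a b else 0) B" by (rule lc_sub) (use B in auto)
        also have "\<dots> = v" unfolding a
          by (rule lc_cong[OF B(2)]) (use coeff[OF \<mu>, of a] parity[OF Q, of a] v a in auto)
        finally show "v \<in> span ?S" using span_iff[of ?S v] B by auto
      qed
    qed (use B in auto)
  qed
  have supp: "{\<mu>. \<mu> \<in> dual L H \<and> W \<mu> \<noteq> {\<zero>}} = wt ` B"
  proof (intro equalityI subsetI)
    fix \<mu> assume "\<mu> \<in> {\<mu>. \<mu> \<in> dual L H \<and> W \<mu> \<noteq> {\<zero>}}"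
    then obtain v where v: "\<mu> \<in> dual L H" "v \<in> W \<mu>" "v \<noteq> \<zero>" using sub_zero[OF Wsub] by blast
    hence "v \<in> carrier M" using sub_carrier[OF Wsub] by auto
    hence "v \<in> span B" using B(4) by simp
    then obtain a where a: "v = lincomb a B" using span_iff B by blast
    then obtain b where "b \<in> B" "a b \<noteq> 0" using lc_zero[OF B(2), of a] v by auto
    thus "\<mu> \<in> wt ` B" using coeff[OF v(1)] v a by auto
  next
    fix \<mu> assume "\<mu> \<in> wt ` B"
    then obtain b where "b \<in> B" "\<mu> = wt b" by auto
    thus "\<mu> \<in> {\<mu>. \<mu> \<in> dual L H \<and> W \<mu> \<noteq> {\<zero>}}" using BW[of b] nz[of b] wt by auto
  qed
  have sd: "sdim M (W \<mu>) = (\<Sum>b | b \<in> B \<and> wt b = \<mu>. par_sign (b \<in> odd_part M))" if "\<mu> \<in> dual L H" for \<mu>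
  proof -
    have "(\<Sum>b | b \<in> B \<and> wt b = \<mu>. par_sign (b \<in> odd_part M)) =
      (\<Sum>b\<in>{b \<in> B. b \<in> even_part M \<and> wt b = \<mu>} \<union> {b \<in> B. b \<in> odd_part M \<and> wt b = \<mu>}. par_sign (b \<in> odd_part M))"
      by (rule sum.cong) (use B in auto)
    also have "\<dots> = (\<Sum>b\<in>{b \<in> B. b \<in> even_part M \<and> wt b = \<mu>}. par_sign (b \<in> odd_part M))
      + (\<Sum>b\<in>{b \<in> B. b \<in> odd_part M \<and> wt b = \<mu>}. par_sign (b \<in> odd_part M))"
      by (rule sum.union_disjoint) (use B excl in auto)
    also have "(\<Sum>b\<in>{b \<in> B. b \<in> even_part M \<and> wt b = \<mu>}. par_sign (b \<in> odd_part M)) = (\<Sum>b\<in>{b \<in> B. b \<in> even_part M \<and> wt b = \<mu>}. 1)"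
      by (rule sum.cong) (use excl in \<open>auto simp: par_sign_def\<close>)
    also have "(\<Sum>b\<in>{b \<in> B. b \<in> odd_part M \<and> wt b = \<mu>}. par_sign (b \<in> odd_part M)) = (\<Sum>b\<in>{b \<in> B. b \<in> odd_part M \<and> wt b = \<mu>}. -1)"
      by (rule sum.cong) (auto simp: par_sign_def)
    finally show ?thesis using dimW[OF that] by (simp add: sdim_def)
  qed
  have "sch L H \<iota> M = (\<Sum>\<mu>\<in>wt ` B. of_int (sdim M (W \<mu>)) * fexp \<mu>)"
    unfolding sch_def supp[symmetric] W_def by simp
  also have "\<dots> = (\<Sum>\<mu>\<in>wt ` B. \<Sum>b | b \<in> B \<and> wt b = \<mu>. of_int (par_sign (b \<in> odd_part M)) * fexp (wt b))"
    by (rule sum.cong) (use sd wt in \<open>auto simp: sum_distrib_right\<close>)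
  also have "\<dots> = (\<Sum>b\<in>B. of_int (par_sign (b \<in> odd_part M)) * fexp (wt b))"
    by (rule sum.image_gen[OF B(1), symmetric])
  finally show ?thesis .
qed

section \<open>Homogeneous bases of joint eigenvectors\<close>

context sspace begin

definition joint :: "('v \<Rightarrow> 'v) list \<Rightarrow> 'v set" where
  "joint Ts = {v \<in> even_part M \<union> odd_part M. \<forall>T\<in>set Ts. \<exists>k\<in>\<int>. T v = k \<odot> v}"

lemma joint_carrier: "joint Ts \<subseteq> carrier M"
  using parts_carrier by (auto simp: joint_def)

text \<open>Z is graded, so it suffices to treat its even and odd parts, each of which is stable
  under the parity-preserving operators.\<close>

lemma joint_span:
  assumes T: "\<And>T. T \<in> set Ts \<Longrightarrow> diagonal T"
    "\<And>S T v. S \<in> set Ts \<Longrightarrow> T \<in> set Ts \<Longrightarrow> v \<in> carrier M \<Longrightarrow> S (T v) = T (S v)"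
    "\<And>T v. T \<in> set Ts \<Longrightarrow> v \<in> even_part M \<Longrightarrow> T v \<in> even_part M"
    "\<And>T v. T \<in> set Ts \<Longrightarrow> v \<in> odd_part M \<Longrightarrow> T v \<in> odd_part M"
    and Z: "submodule \<CC> Z M" "\<And>T v. T \<in> set Ts \<Longrightarrow> v \<in> Z \<Longrightarrow> T v \<in> Z"
    "\<And>u w. u \<in> even_part M \<Longrightarrow> w \<in> odd_part M \<Longrightarrow> u \<oplus> w \<in> Z \<Longrightarrow> u \<in> Z \<and> w \<in> Z"
  shows "Z \<subseteq> span (joint Ts \<inter> Z)"
proof
  fix v assume v: "v \<in> Z"
  have JZ: "joint Ts \<inter> Z \<subseteq> carrier M" using joint_carrier by auto
  obtain u w where uw: "u \<in> even_part M" "w \<in> odd_part M" "v = u \<oplus> w"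
    using parts_decomp v sub_carrier[OF Z(1)] by blast
  have *: "y \<in> span (joint Ts \<inter> Z)" if "y \<in> P \<inter> Z" "P = even_part M \<or> P = odd_part M" for y P
  proof -
    have P: "submodule \<CC> (P \<inter> Z) M"
      using that(2) parts_sub Z(1) sub_carrier[OF Z(1)] by (intro subI) (auto simp: sub_add sub_smul sub_zero)
    have "P \<inter> Z \<subseteq> span {v \<in> P \<inter> Z. \<forall>T\<in>set Ts. \<exists>k\<in>\<int>. T v = k \<odot> v}"
      proof (rule joint_eigenvectors_span)
      show "S v \<in> P \<inter> Z" if "S \<in> set Ts" "v \<in> P \<inter> Z" for S v
        using that \<open>P = even_part M \<or> P = odd_part M\<close> T(3,4) Z(2) by auto
    qed (fact T(1) T(2) P)+
    moreover have "{v \<in> P \<inter> Z. \<forall>T\<in>set Ts. \<exists>k\<in>\<int>. T v = k \<odot> v} \<subseteq> joint Ts \<inter> Z"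
      using that(2) by (auto simp: joint_def)
    ultimately show ?thesis using that(1) span_is_monotone by blast
  qed
  have "u \<in> Z" "w \<in> Z" using Z(3)[OF uw(1,2)] uw(3) v by auto
  thus "v \<in> span (joint Ts \<inter> Z)"
    unfolding uw(3) using uw * by (intro sub_add[OF span_is_submodule[OF JZ]]) blast+
qed

lemma joint_basis:
  assumes fin_dim "\<And>T. T \<in> set Ts \<Longrightarrow> diagonal T"
    "\<And>S T v. S \<in> set Ts \<Longrightarrow> T \<in> set Ts \<Longrightarrow> v \<in> carrier M \<Longrightarrow> S (T v) = T (S v)"
    "\<And>T v. T \<in> set Ts \<Longrightarrow> v \<in> even_part M \<Longrightarrow> T v \<in> even_part M"
    "\<And>T v. T \<in> set Ts \<Longrightarrow> v \<in> odd_part M \<Longrightarrow> T v \<in> odd_part M"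
  shows "\<exists>B. finite B \<and> basis B \<and> B \<subseteq> joint Ts"
proof -
  have sc: "submodule \<CC> (carrier M) M" by (rule subI) auto
  have "carrier M \<subseteq> span (joint Ts \<inter> carrier M)"
    proof (rule joint_span)
    show "S v \<in> carrier M" if "S \<in> set Ts" "v \<in> carrier M" for S v
      using that assms(2) by (auto simp: diagonal_def endo_closed)
  qed ((fact assms sc)+, use parts_carrier in auto)
  moreover have "lin_indpt {}" by (auto simp: lin_dep_def)
  ultimately obtain B where "B \<subseteq> joint Ts \<inter> carrier M" "finite ({} \<union> B)" "lin_indpt ({} \<union> B)" "span ({} \<union> B) = carrier M"
    using extend_basis[OF assms(1) sc, of "{}" "joint Ts \<inter> carrier M"] by auto
  thus ?thesis by (intro exI[of _ B]) (auto simp: basis_def)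
qed

text \<open>A Jordan basis of \<open>X\<close>, in which \<open>K\<close> represents a basis of the cohomology.\<close>

lemma square_zero_basis:
  assumes fd: fin_dim and T: "\<And>T. T \<in> set Ts \<Longrightarrow> diagonal T"
    "\<And>S T v. S \<in> set Ts \<Longrightarrow> T \<in> set Ts \<Longrightarrow> v \<in> carrier M \<Longrightarrow> S (T v) = T (S v)"
    "\<And>T v. T \<in> set Ts \<Longrightarrow> v \<in> even_part M \<Longrightarrow> T v \<in> even_part M"
    "\<And>T v. T \<in> set Ts \<Longrightarrow> v \<in> odd_part M \<Longrightarrow> T v \<in> odd_part M"
    and X: "endo X" "\<And>v. v \<in> carrier M \<Longrightarrow> X (X v) = \<zero>"
    "\<And>v. v \<in> even_part M \<Longrightarrow> X v \<in> odd_part M" "\<And>v. v \<in> odd_part M \<Longrightarrow> X v \<in> even_part M"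
    "\<And>T v. T \<in> set Ts \<Longrightarrow> v \<in> carrier M \<Longrightarrow> T (X v) = X (T v)"
  shows "\<exists>K V. finite K \<and> finite V \<and> K \<subseteq> joint Ts \<and> V \<subseteq> joint Ts \<and> X ` V \<subseteq> joint Ts \<and> inj_on X V
     \<and> K \<inter> X ` V = {} \<and> V \<inter> (K \<union> X ` V) = {} \<and> basis (K \<union> V \<union> X ` V)
     \<and> lin_indpt (K \<union> X ` V) \<and> span (X ` V) = X ` carrier M \<and> span (K \<union> X ` V) = {v \<in> carrier M. X v = \<zero>}"
proof -
  have sc: "submodule \<CC> (carrier M) M" by (rule subI) auto
  have jc: "joint Ts \<subseteq> carrier M" by (rule joint_carrier)
  have eT: "endo T" if "T \<in> set Ts" for T using T(1)[OF that] by (simp add: diagonal_def)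
  define ker where "ker = {v \<in> carrier M. X v = \<zero>}"
  define im where "im = X ` carrier M"
  have ker: "submodule \<CC> ker M" unfolding ker_def by (rule subI) (auto simp: X endo_simps)
  have im: "submodule \<CC> im M"
  proof (rule subI)
    show "im \<subseteq> carrier M" using X(1) by (auto simp: im_def endo_simps)
    show "\<zero> \<in> im" using endo_zero[OF X(1)] by (force simp: im_def)
    show "v \<oplus> w \<in> im" if "v \<in> im" "w \<in> im" for v w using that endo_add[OF X(1)] by (auto simp: im_def) (metis M.add.m_closed imageI)
    show "c \<odot> v \<in> im" if "v \<in> im" for c v using that endo_smul[OF X(1)] by (auto simp: im_def) (metis smul_closed imageI)
  qed
  have Xj: "X v \<in> joint Ts" if "v \<in> joint Ts" for v
  proof -
    have "\<exists>k\<in>\<int>. T (X v) = k \<odot> X v" if "T \<in> set Ts" for T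
    proof -
      have "\<forall>T\<in>set Ts. \<exists>k\<in>\<int>. T v = k \<odot> v" using \<open>v \<in> joint Ts\<close> by (simp add: joint_def)
      then obtain k where "k \<in> \<int>" "T v = k \<odot> v" using \<open>T \<in> set Ts\<close> by auto
      moreover have "v \<in> carrier M" using \<open>v \<in> joint Ts\<close> jc by auto
      ultimately show ?thesis using X(5)[OF that, of v] endo_smul[OF X(1), of v k] by auto
    qed
    thus ?thesis using that X(3,4) by (auto simp: joint_def)
  qed
  have span_all: "carrier M \<subseteq> span (joint Ts \<inter> carrier M)"
    proof (rule joint_span)
    show "S v \<in> carrier M" if "S \<in> set Ts" "v \<in> carrier M" for S v
      using that eT by (auto simp: endo_closed)
  qed ((fact T sc)+, use parts_carrier in auto)
  \<comment> \<open>Joint eigenvectors span the whole space, so their images under X span the image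
    of X.\<close>
  have "im \<subseteq> span (X ` joint Ts)"
  proof
    have XJ: "X ` joint Ts \<subseteq> carrier M" using jc X(1) by (auto simp: endo_closed)
    have "submodule \<CC> {v \<in> carrier M. X v \<in> span (X ` joint Ts)} M"
      using span_is_submodule[OF XJ] by (intro subI) (auto simp: endo_simps X sub_add sub_smul sub_zero)
    hence "span (joint Ts \<inter> carrier M) \<subseteq> {v \<in> carrier M. X v \<in> span (X ` joint Ts)}"
      by (intro span_is_subset) (use in_own_span[OF XJ] in auto)
    moreover fix y assume "y \<in> im"
    ultimately show "y \<in> span (X ` joint Ts)" using span_all by (auto simp: im_def)
  qed
  moreover have "lin_indpt {}" by (auto simp: lin_dep_def)
  moreover have "X ` joint Ts \<subseteq> im" using jc by (auto simp: im_def)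
  \<comment> \<open>The basis C of the image is taken among the vectors X v with v in
    \<open>joint Ts\<close>; hence the preimages V can be joint eigenvectors too.\<close>
  ultimately obtain C where C: "C \<subseteq> X ` joint Ts" "finite C" "lin_indpt C" "span C = im"
    using extend_basis[OF fd im, of "{}" "X ` joint Ts"] by auto
  have Cim: "C \<subseteq> im" using C(1) jc by (auto simp: im_def)
  have imker: "im \<subseteq> ker" using X by (auto simp: im_def ker_def endo_closed)
  obtain V where V: "V \<subseteq> joint Ts" "inj_on X V" "C = X ` V" using C(1) subset_image_inj by metis
  have Vf: "finite V" using V C finite_imageD by auto
  have "ker \<subseteq> span (joint Ts \<inter> ker)"
  proof (rule joint_span)
    show "T v \<in> ker" if "T \<in> set Ts" "v \<in> ker" for T v
      using that eT X(5)[of T v] by (auto simp: ker_def endo_simps)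
    show "u \<in> ker \<and> w \<in> ker" if "u \<in> even_part M" "w \<in> odd_part M" "u \<oplus> w \<in> ker" for u w
    proof -
      have "X w \<oplus> X u = \<zero>" using that X(1) parts_carrier by (auto simp: ker_def endo_simps subset_eq M.add.m_comm)
      hence "X w = \<zero>" "X u = \<zero>" using sum_parts_zero[OF X(4)[OF that(2)] X(3)[OF that(1)] \<open>X w \<oplus> X u = \<zero>\<close>] by auto
      thus ?thesis using that parts_carrier by (auto simp: ker_def)
    qed
  qed (fact T ker)+
  then obtain K where K: "K \<subseteq> joint Ts \<inter> ker" "K \<inter> C = {}" "finite (C \<union> K)" "lin_indpt (C \<union> K)" "span (C \<union> K) = ker"
    using extend_basis[OF fd ker _ C(3), of "joint Ts \<inter> ker"] Cim imker by auto
  have CK: "C \<union> K \<subseteq> carrier M" "C \<subseteq> carrier M" using Cim K(1) imker by (auto simp: ker_def)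
  have VM: "V \<subseteq> carrier M" using V jc by auto
  have XV: "X (lincomb a V) = lincomb (\<lambda>c. a (the_inv_into V X c)) C" for a
    using Vf VM V(2) unfolding V(3)
  proof (induction V)
    case (insert x V)
    have i: "the_inv_into (insert x V) X (X v) = v" if "v \<in> insert x V" for v
      using the_inv_into_f_f[OF insert.prems(2) that] .
    have j: "the_inv_into V X (X v) = v" if "v \<in> V" for v
      by (rule the_inv_into_f_f[OF _ that]) (use insert.prems in auto)
    have n: "X x \<notin> X ` V" using insert by auto
    have XM: "X ` V \<subseteq> carrier M" "X x \<in> carrier M" using insert X(1) by (auto simp: endo_closed)
    have "X (lincomb a (insert x V)) = a x \<odot> X x \<oplus> X (lincomb a V)"
      using insert X(1) by (simp add: lc_insert endo_simps)
    also have "X (lincomb a V) = lincomb (\<lambda>c. a (the_inv_into V X c)) (X ` V)"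
      using insert by auto
    also have "\<dots> = lincomb (\<lambda>c. a (the_inv_into (insert x V) X c)) (X ` V)"
      by (rule lc_cong[OF XM(1)]) (auto simp: i j)
    finally show ?case using insert n XM i by (simp add: lc_insert)
  qed (simp add: endo_zero X)
  have Vn: "v \<notin> ker" if "v \<in> V" for v
    using zero_nin_lin_indpt[OF CK(2) C(3) UNIV_nontrivial] V(3) imageI[OF that, of X] by (auto simp: ker_def)
  have disj: "V \<inter> (C \<union> K) = {}" using Vn K(1) Cim imker by auto
  have un: "lincomb a (V \<union> (C \<union> K)) = lincomb a V \<oplus> lincomb a (C \<union> K)" for a
    by (rule lincomb_union) (use VM CK disj Vf K in auto)
  have ckk: "X (lincomb a (C \<union> K)) = \<zero>" for a
  proof -
    have "lincomb a (C \<union> K) \<in> ker" using sub_lc[OF ker] K Cim imker by auto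
    thus ?thesis by (simp add: ker_def)
  qed
  have "lin_indpt (V \<union> (C \<union> K))"
  proof (rule indepI)
    \<comment> \<open>Applying X to a relation leaves a relation on C, which makes the coefficients
      on V vanish; what remains is a relation in the kernel.\<close>
    fix a b assume a: "lincomb a (V \<union> (C \<union> K)) = \<zero>" and b: "b \<in> V \<union> (C \<union> K)"
    have "X (lincomb a V) = \<zero>"
      using arg_cong[OF a, of X] ckk[of a] VM CK unfolding un by (simp add: endo_simps X)
    hence "lincomb (\<lambda>c. a (the_inv_into V X c)) C = \<zero>" by (simp add: XV)
    hence "a (the_inv_into V X c) = 0" if "c \<in> C" for c using indep_coeff[OF C(3,2) _ that] by blast
    hence aV: "a v = 0" if "v \<in> V" for v using that V(3) the_inv_into_f_f[OF V(2) that] by force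
    have "lincomb a V = \<zero>" by (rule lc_zero[OF VM aV])
    hence "lincomb a (C \<union> K) = \<zero>" using a CK un by simp
    thus "a b = 0" using indep_coeff[OF K(4,3)] aV b by auto
  qed (use Vf K VM CK in auto)
  moreover have "carrier M \<subseteq> span (V \<union> (C \<union> K))"
  proof
    fix v assume v: "v \<in> carrier M"
    have all: "V \<union> (C \<union> K) \<subseteq> carrier M" using VM CK by auto
    note sp = span_is_submodule[OF all]
    have "X v \<in> span C" using v C(4) by (auto simp: im_def)
    then obtain c where c: "X v = lincomb c C" using span_iff[OF C(2) CK(2)] by auto
    \<comment> \<open>This combination of V has the same image under X as v, so v - u lies in the
      kernel.\<close>
    define u where "u = lincomb (\<lambda>w. c (X w)) V"
    have uM: "u \<in> carrier M" using VM by (simp add: u_def)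
    have "X u = lincomb c C" unfolding u_def XV
      by (rule lc_cong[OF CK(2)]) (use V(3) f_the_inv_into_f[OF V(2)] in auto)
    moreover have "X (v \<oplus> (-1) \<odot> u) = X v \<oplus> (-1) \<odot> X u"
      using endo_add[OF X(1), of v "(-1) \<odot> u"] endo_smul[OF X(1), of u "-1"] v uM by simp
    moreover have "lincomb c C \<in> carrier M" by (rule lc_closed[OF CK(2)])
    ultimately have "v \<oplus> (-1) \<odot> u \<in> ker"
      using v uM c by (simp add: ker_def smul_uminus M.r_neg)
    hence "v \<oplus> (-1) \<odot> u \<in> span (V \<union> (C \<union> K))" using K(5) span_is_monotone[of "C \<union> K"] by blast
    moreover have "u \<in> span (V \<union> (C \<union> K))"
      unfolding u_def by (rule sub_lc[OF sp Vf]) (use in_own_span[OF all] in auto)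
    ultimately have "(v \<oplus> (-1) \<odot> u) \<oplus> u \<in> span (V \<union> (C \<union> K))" by (rule sub_add[OF sp])
    thus "v \<in> span (V \<union> (C \<union> K))" using v uM by (simp add: smul_uminus M.add.m_assoc M.l_neg)
  qed
  ultimately have "basis (V \<union> (C \<union> K))"
    using VM CK span_is_subset2[of "V \<union> (C \<union> K)"] by (auto simp: basis_def)
  moreover have "V \<union> (C \<union> K) = K \<union> V \<union> X ` V" "C \<union> K = K \<union> X ` V" using V(3) by auto
  ultimately show ?thesis
    using K C V Vf disj Xj unfolding ker_def im_def
    by (intro exI[of _ K] exI[of _ V]) (auto simp: Un_commute)
qed

end

section \<open>Matrix representations and tensor products\<close>

text \<open>Modules in coordinates: the indices are natural numbers, so that a tensor product has the same type
  as its factors.\<close>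

definition wrep ::
  "('h, 'm) superspace_scheme \<Rightarrow> 'h set \<Rightarrow> ('g, 'n) lie_super_scheme \<Rightarrow> ('h \<Rightarrow> 'g) \<Rightarrow> nat set \<Rightarrow> (nat \<Rightarrow> bool)
     \<Rightarrow> (nat \<Rightarrow> 'h weight) \<Rightarrow> ('g \<Rightarrow> nat \<Rightarrow> nat \<Rightarrow> complex) \<Rightarrow> bool" where
  "wrep L H K \<iota> I \<pi> wt \<rho> \<longleftrightarrow> finite I \<and> (\<forall>i\<in>I. wt i \<in> dual L H)
     \<and> (\<forall>a\<in>carrier K. \<forall>b\<in>carrier K. \<forall>i\<in>I. \<forall>j\<in>I. \<rho> (a \<oplus>\<^bsub>K\<^esub> b) i j = \<rho> a i j + \<rho> b i j)
     \<and> (\<forall>c. \<forall>a\<in>carrier K. \<forall>i\<in>I. \<forall>j\<in>I. \<rho> (c \<odot>\<^bsub>K\<^esub> a) i j = c * \<rho> a i j)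
     \<and> (\<forall>p. \<forall>a\<in>part K p. \<forall>i\<in>I. \<forall>j\<in>I. \<rho> a i j \<noteq> 0 \<longrightarrow> \<pi> i = (\<pi> j \<noteq> p))
     \<and> (\<forall>p q. \<forall>a\<in>part K p. \<forall>b\<in>part K q. \<forall>i\<in>I. \<forall>j\<in>I.
          \<rho> (brk K a b) i j = (\<Sum>k\<in>I. \<rho> a i k * \<rho> b k j) - koszul p q * (\<Sum>k\<in>I. \<rho> b i k * \<rho> a k j))
     \<and> (\<forall>h\<in>H. \<forall>i\<in>I. \<forall>j\<in>I. \<rho> (\<iota> h) i j = (if i = j then wt i h else 0))"

lemmas wrep_fin = wrep_def[THEN iffD1, THEN conjunct1, rule_format]
  and wrep_dual = wrep_def[THEN iffD1, THEN conjunct2, THEN conjunct1, rule_format]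
  and wrep_add = wrep_def[THEN iffD1, THEN conjunct2, THEN conjunct2, THEN conjunct1, rule_format]
  and wrep_smul = wrep_def[THEN iffD1, THEN conjunct2, THEN conjunct2, THEN conjunct2, THEN conjunct1, rule_format]
  and wrep_par = wrep_def[THEN iffD1, THEN conjunct2, THEN conjunct2, THEN conjunct2, THEN conjunct2, THEN conjunct1, rule_format]
  and wrep_brk = wrep_def[THEN iffD1, THEN conjunct2, THEN conjunct2, THEN conjunct2, THEN conjunct2, THEN conjunct2, THEN conjunct1, rule_format]
  and wrep_diag = wrep_def[THEN iffD1, THEN conjunct2, THEN conjunct2, THEN conjunct2, THEN conjunct2, THEN conjunct2, THEN conjunct2, rule_format]

definition wch :: "nat set \<Rightarrow> (nat \<Rightarrow> bool) \<Rightarrow> (nat \<Rightarrow> 'h weight) \<Rightarrow> 'h group_ring" where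
  "wch I \<pi> wt = (\<Sum>i\<in>I. of_int (par_sign (\<pi> i)) * fexp (wt i))"

lemma fexp_add: "fexp (\<mu> + \<nu>) = fexp \<mu> * fexp \<nu>"
  by (simp add: fexp_def mult_single)

lemma fexp_zero: "fexp 0 = 1"
  by (simp add: fexp_def)

lemma par_sign_xor: "par_sign (p = (\<not> q)) = par_sign p * par_sign q"
  by (simp add: par_sign_def)

lemma dual_add: "\<mu> \<in> dual L H \<Longrightarrow> \<nu> \<in> dual L H \<Longrightarrow> \<mu> + \<nu> \<in> dual L H"
  by (auto simp: dual_def algebra_simps)

lemma sum_prod_encode: "(\<Sum>n\<in>prod_encode ` (I \<times> J). g n) = (\<Sum>i\<in>I. \<Sum>j\<in>J. g (prod_encode (i, j)))"
proof -
  have "inj_on prod_encode (I \<times> J)" using inj_prod_encode inj_on_subset by blast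
  thus ?thesis by (simp add: sum.reindex sum.cartesian_product case_prod_beta)
qed

text \<open>If \<open>\<rho>2 a k l\<close> is not zero, then \<open>a\<close> has parity \<open>\<pi>2 k \<noteq> \<pi>2 l\<close>; the sign is that of moving \<open>a\<close> past the
  first tensor factor.\<close>

definition tens ::
  "(nat \<Rightarrow> bool) \<Rightarrow> (nat \<Rightarrow> bool) \<Rightarrow> ('g \<Rightarrow> nat \<Rightarrow> nat \<Rightarrow> complex) \<Rightarrow> ('g \<Rightarrow> nat \<Rightarrow> nat \<Rightarrow> complex) \<Rightarrow> 'g \<Rightarrow> nat \<Rightarrow> nat \<Rightarrow> nat \<Rightarrow> nat \<Rightarrow> complex" where
  "tens \<pi>1 \<pi>2 \<rho>1 \<rho>2 a i k j l = (if k = l then \<rho>1 a i j else 0) + (if i = j then koszul (\<pi>2 k \<noteq> \<pi>2 l) (\<pi>1 j) * \<rho>2 a k l else 0)"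

text \<open>The four summands arise when a and b both act on the first factor, when a acts on the
  first and b on the second, when a acts on the second and b on the first, and when both act on the
  second.\<close>

lemma tens_product:
  assumes fin: "finite I" "finite J" and ij: "i \<in> I" "j \<in> I" "k \<in> J" "l \<in> J"
  shows "(\<Sum>m\<in>I. \<Sum>r\<in>J. tens \<pi>1 \<pi>2 \<rho>1 \<rho>2 a i k m r * tens \<pi>1 \<pi>2 \<rho>1 \<rho>2 b m r j l)
    = (if k = l then (\<Sum>m\<in>I. \<rho>1 a i m * \<rho>1 b m j) else 0)
      + \<rho>1 a i j * (koszul (\<pi>2 k \<noteq> \<pi>2 l) (\<pi>1 j) * \<rho>2 b k l)
      + koszul (\<pi>2 k \<noteq> \<pi>2 l) (\<pi>1 i) * \<rho>2 a k l * \<rho>1 b i j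
      + (if i = j then koszul (\<pi>2 k \<noteq> \<pi>2 l) (\<pi>1 j) * (\<Sum>r\<in>J. \<rho>2 a k r * \<rho>2 b r l) else 0)"
proof -
  \<comment> \<open>The parity differences of (k, r) and (r, l) add up to that of (k, l), so the
    signs multiply.\<close>
  have kk: "koszul (\<pi>2 k \<noteq> \<pi>2 r) p * koszul (\<pi>2 r \<noteq> \<pi>2 l) p = koszul (\<pi>2 k \<noteq> \<pi>2 l) p" for r p
    by (auto simp: koszul_def)
  have e: "tens \<pi>1 \<pi>2 \<rho>1 \<rho>2 a i k m r * tens \<pi>1 \<pi>2 \<rho>1 \<rho>2 b m r j l =
     (if k = r then (if r = l then \<rho>1 a i m * \<rho>1 b m j else 0) else 0)
     + (if m = j then (if k = r then \<rho>1 a i m * (koszul (\<pi>2 r \<noteq> \<pi>2 l) (\<pi>1 j) * \<rho>2 b r l) else 0) else 0)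
     + (if i = m then (if r = l then koszul (\<pi>2 k \<noteq> \<pi>2 r) (\<pi>1 m) * \<rho>2 a k r * \<rho>1 b m j else 0) else 0)
     + (if i = m then (if m = j then koszul (\<pi>2 k \<noteq> \<pi>2 l) (\<pi>1 j) * (\<rho>2 a k r * \<rho>2 b r l) else 0) else 0)" for m r
    using kk[of r "\<pi>1 j"] by (auto simp: tens_def algebra_simps)
  have "(\<Sum>m\<in>I. \<Sum>r\<in>J. if k = r then (if r = l then \<rho>1 a i m * \<rho>1 b m j else 0) else 0)
      = (if k = l then (\<Sum>m\<in>I. \<rho>1 a i m * \<rho>1 b m j) else 0)"
    using fin ij by simp
  moreover have "(\<Sum>m\<in>I. \<Sum>r\<in>J. if m = j then (if k = r then \<rho>1 a i m * (koszul (\<pi>2 r \<noteq> \<pi>2 l) (\<pi>1 j) * \<rho>2 b r l) else 0) else 0)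
      = \<rho>1 a i j * (koszul (\<pi>2 k \<noteq> \<pi>2 l) (\<pi>1 j) * \<rho>2 b k l)"
    using fin ij by (subst sum.swap) simp
  moreover have "(\<Sum>m\<in>I. \<Sum>r\<in>J. if i = m then (if r = l then koszul (\<pi>2 k \<noteq> \<pi>2 r) (\<pi>1 m) * \<rho>2 a k r * \<rho>1 b m j else 0) else 0)
      = koszul (\<pi>2 k \<noteq> \<pi>2 l) (\<pi>1 i) * \<rho>2 a k l * \<rho>1 b i j"
    using fin ij by (subst sum.swap) simp
  moreover have "(\<Sum>m\<in>I. \<Sum>r\<in>J. if i = m then (if m = j then koszul (\<pi>2 k \<noteq> \<pi>2 l) (\<pi>1 j) * (\<rho>2 a k r * \<rho>2 b r l) else 0) else 0)
      = (if i = j then koszul (\<pi>2 k \<noteq> \<pi>2 l) (\<pi>1 j) * (\<Sum>r\<in>J. \<rho>2 a k r * \<rho>2 b r l) else 0)"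
    using fin ij by (subst sum.swap) (simp add: sum_distrib_left)
  ultimately show ?thesis unfolding e sum.distrib by simp
qed

text \<open>Mixed terms agree crosswise up to the sign \<kappa> and cancel in the supercommutator,
  leaving the supercommutators of the two factors.\<close>

lemma tens_arith:
  fixes \<kappa> :: complex
  assumes "t1 = \<kappa> * u2" "t2 = \<kappa> * u1"
  shows "(if P then X1 - \<kappa> * Y1 else 0) + (if Q then c * (X2 - \<kappa> * Y2) else 0)
    = (if P then X1 else 0) + t1 + t2 + (if Q then c * X2 else 0) - \<kappa> * ((if P then Y1 else 0) + u1 + u2 + (if Q then c * Y2 else 0))"
  unfolding assms by (simp add: algebra_simps)

lemma wrep_tensor:
  assumes 1: "wrep L H K \<iota> I \<pi>1 wt1 \<rho>1" and 2: "wrep L H K \<iota> J \<pi>2 wt2 \<rho>2"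
  shows "\<exists>I' \<pi> wt \<rho>. wrep L H K \<iota> I' \<pi> wt \<rho> \<and> wch I' \<pi> wt = wch I \<pi>1 wt1 * wch J \<pi>2 wt2"
proof -
  define F :: "nat \<Rightarrow> nat" where "F n = fst (prod_decode n)" for n
  define S :: "nat \<Rightarrow> nat" where "S n = snd (prod_decode n)" for n
  define I' where "I' = prod_encode ` (I \<times> J)"
  define \<pi> where "\<pi> n = (\<pi>1 (F n) \<noteq> \<pi>2 (S n))" for n
  define wt where "wt n = wt1 (F n) + wt2 (S n)" for n
  define \<rho> where "\<rho> a m n = tens \<pi>1 \<pi>2 \<rho>1 \<rho>2 a (F m) (S m) (F n) (S n)" for a m n
  have fin: "finite I" "finite J" using 1 2 by (auto simp: wrep_def)
  have FS [simp]: "F (prod_encode (i, j)) = i" "S (prod_encode (i, j)) = j" for i j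
    by (auto simp: F_def S_def)
  have mem: "n \<in> I' \<longleftrightarrow> F n \<in> I \<and> S n \<in> J" for n
    by (auto simp: I'_def) (metis F_def S_def prod_decode_inverse mem_Sigma_iff image_eqI prod.collapse)
  have eq: "m = n \<longleftrightarrow> F m = F n \<and> S m = S n" for m n
    by (metis F_def S_def prod_decode_inverse prod.collapse)
  note sum = sum_prod_encode[of _ I J, folded I'_def]
  have "wch I' \<pi> wt = (\<Sum>i\<in>I. \<Sum>j\<in>J. (of_int (par_sign (\<pi>1 i)) * fexp (wt1 i)) * (of_int (par_sign (\<pi>2 j)) * fexp (wt2 j)))"
    unfolding wch_def sum by (simp add: \<pi>_def wt_def par_sign_xor fexp_add algebra_simps)
  also have "\<dots> = wch I \<pi>1 wt1 * wch J \<pi>2 wt2" unfolding wch_def by (simp add: sum_product)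
  finally have ch: "wch I' \<pi> wt = wch I \<pi>1 wt1 * wch J \<pi>2 wt2" .
  have "wrep L H K \<iota> I' \<pi> wt \<rho>"
    unfolding wrep_def
  proof (intro conjI ballI allI impI)
    show "finite I'" using fin by (simp add: I'_def)
    show "wt n \<in> dual L H" if "n \<in> I'" for n
      using that 1 2 unfolding wt_def mem wrep_def by (intro dual_add) auto
    show "\<rho> (a \<oplus>\<^bsub>K\<^esub> b) m n = \<rho> a m n + \<rho> b m n" if "a \<in> carrier K" "b \<in> carrier K" "m \<in> I'" "n \<in> I'" for a b m n
      using that 1 2 by (auto simp: \<rho>_def tens_def mem wrep_def algebra_simps)
    show "\<rho> (c \<odot>\<^bsub>K\<^esub> a) m n = c * \<rho> a m n" if "a \<in> carrier K" "m \<in> I'" "n \<in> I'" for c a m n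
      using that 1 2 by (auto simp: \<rho>_def tens_def mem wrep_def algebra_simps)
    show "\<pi> m = (\<pi> n \<noteq> p)" if "a \<in> part K p" "m \<in> I'" "n \<in> I'" "\<rho> a m n \<noteq> 0" for p a m n
    proof -
      have "F m \<in> I" "S m \<in> J" "F n \<in> I" "S n \<in> J" using that mem by auto
      moreover have "(S m = S n \<and> \<rho>1 a (F m) (F n) \<noteq> 0) \<or> (F m = F n \<and> \<rho>2 a (S m) (S n) \<noteq> 0)"
        using that(4) by (auto simp: \<rho>_def tens_def split: if_splits)
      ultimately have "(S m = S n \<and> \<pi>1 (F m) = (\<pi>1 (F n) \<noteq> p)) \<or> (F m = F n \<and> \<pi>2 (S m) = (\<pi>2 (S n) \<noteq> p))"
        using wrep_par[OF 1 that(1), of "F m" "F n"] wrep_par[OF 2 that(1), of "S m" "S n"] by auto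
      thus ?thesis by (auto simp: \<pi>_def)
    qed
    show "\<rho> (\<iota> h) m n = (if m = n then wt m h else 0)" if "h \<in> H" "m \<in> I'" "n \<in> I'" for h m n
    proof -
      have "F m \<in> I" "S m \<in> J" "F n \<in> I" "S n \<in> J" using that mem by auto
      hence "\<rho>1 (\<iota> h) (F m) (F n) = (if F m = F n then wt1 (F m) h else 0)"
        "\<rho>2 (\<iota> h) (S m) (S n) = (if S m = S n then wt2 (S m) h else 0)"
        using wrep_diag[OF 1 that(1)] wrep_diag[OF 2 that(1)] by auto
      thus ?thesis by (auto simp: \<rho>_def tens_def eq[of m n] wt_def koszul_def)
    qed
    fix p q a b m n assume a: "a \<in> part K p" and b: "b \<in> part K q" and mn: "m \<in> I'" "n \<in> I'"
    define i j k l where "i = F m" and "j = F n" and "k = S m" and "l = S n"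
    have ij: "i \<in> I" "j \<in> I" "k \<in> J" "l \<in> J" using mn mem by (auto simp: i_def j_def k_def l_def)
    define s where "s = koszul (\<pi>2 k \<noteq> \<pi>2 l)"
    have r1: "\<rho>1 (brk K a b) i j = (\<Sum>k\<in>I. \<rho>1 a i k * \<rho>1 b k j) - koszul p q * (\<Sum>k\<in>I. \<rho>1 b i k * \<rho>1 a k j)"
      and r2: "\<rho>2 (brk K a b) k l = (\<Sum>j\<in>J. \<rho>2 a k j * \<rho>2 b j l) - koszul p q * (\<Sum>j\<in>J. \<rho>2 b k j * \<rho>2 a j l)"
      using wrep_brk[OF 1 a b] wrep_brk[OF 2 a b] ij by auto
    have "\<rho>1 a i j = 0 \<or> \<pi>1 i = (\<pi>1 j \<noteq> p)" "\<rho>1 b i j = 0 \<or> \<pi>1 i = (\<pi>1 j \<noteq> q)"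
      "\<rho>2 a k l = 0 \<or> \<pi>2 k = (\<pi>2 l \<noteq> p)" "\<rho>2 b k l = 0 \<or> \<pi>2 k = (\<pi>2 l \<noteq> q)"
      using wrep_par[OF 1 a] wrep_par[OF 1 b] wrep_par[OF 2 a] wrep_par[OF 2 b] ij by blast+
    \<comment> \<open>A nonzero entry fixes the parity of its row relative to that of its column,
      which turns the signs of the mixed terms into \<open>koszul p q\<close>.\<close>
    hence c1: "\<rho>1 a i j * (s (\<pi>1 j) * \<rho>2 b k l) = koszul p q * (s (\<pi>1 i) * \<rho>2 b k l * \<rho>1 a i j)"
      and c2: "s (\<pi>1 i) * \<rho>2 a k l * \<rho>1 b i j = koszul p q * (\<rho>1 b i j * (s (\<pi>1 j) * \<rho>2 a k l))"
      by (auto simp: s_def koszul_def)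
    have P: "(\<Sum>r\<in>I'. \<rho> x m r * \<rho> y r n) = (if k = l then (\<Sum>m\<in>I. \<rho>1 x i m * \<rho>1 y m j) else 0)
      + \<rho>1 x i j * (s (\<pi>1 j) * \<rho>2 y k l) + s (\<pi>1 i) * \<rho>2 x k l * \<rho>1 y i j
      + (if i = j then s (\<pi>1 j) * (\<Sum>r\<in>J. \<rho>2 x k r * \<rho>2 y r l) else 0)" for x y
      unfolding sum \<rho>_def FS i_def[symmetric] j_def[symmetric] k_def[symmetric] l_def[symmetric] s_def
      by (rule tens_product[OF fin ij])
    show "\<rho> (brk K a b) m n = (\<Sum>k\<in>I'. \<rho> a m k * \<rho> b k n) - koszul p q * (\<Sum>k\<in>I'. \<rho> b m k * \<rho> a k n)"
      unfolding P unfolding \<rho>_def tens_def i_def[symmetric] j_def[symmetric] k_def[symmetric] l_def[symmetric] s_def[symmetric] r1 r2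
      by (rule tens_arith[OF c1 c2])
  qed
  thus ?thesis using ch by blast
qed

text \<open>The matrix form of a module in a homogeneous weight basis. It is applied to the adjoint
  module of G(3), whose tensor powers are then formed on matrices.\<close>

lemma wrep_of_rep:
  fixes M :: "('g, 'v) rep" (structure)
  assumes fd: "fd_rep K M" and wb: "weight_basis L H \<iota> M B wt" and K: "lie_superalgebra K" and \<iota>: "\<iota> ` H \<subseteq> carrier K"
  shows "\<exists>I \<pi> w \<rho>. wrep L H K \<iota> I \<pi> w \<rho> \<and> wch I \<pi> w = sch L H \<iota> M"
proof -
  have rep: "is_rep K M" using fd by (simp add: fd_rep_def)
  interpret sspace M using rep by (intro sspaceI) (simp add: is_rep_def)
  interpret K: sspace K using K by (intro sspaceI) (simp add: lie_superalgebra_def)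
  interpret fin_basis M B using wb by unfold_locales (auto simp: weight_basis_def)
  have BP: "B \<subseteq> even_part M \<union> odd_part M"
    and wt: "\<And>b. b \<in> B \<Longrightarrow> wt b \<in> dual L H" "\<And>b h. b \<in> B \<Longrightarrow> h \<in> H \<Longrightarrow> act M (\<iota> h) b = wt b h \<odot> b"
    using wb by (auto simp: weight_basis_def)
  have nz: "b \<noteq> \<zero>" if "b \<in> B" for b using zero_nin_lin_indpt[OF B(2,3) UNIV_nontrivial] that by auto
  have en: "endo (act M a)" if "a \<in> carrier K" for a
    using rep that by (auto simp: is_rep_def bilinear_on_def endo_def)
  have lin: "act M (a \<oplus>\<^bsub>K\<^esub> b) v = act M a v \<oplus> act M b v" "act M (c \<odot>\<^bsub>K\<^esub> a) v = c \<odot> act M a v"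
    if "a \<in> carrier K" "b \<in> carrier K" "v \<in> carrier M" for a b c v
    using rep that by (auto simp: is_rep_def bilinear_on_def LinearCombinations.module_hom_def)
  obtain e where e: "bij_betw e {..<card B} B"
    using ex_bij_betw_nat_finite[OF B(1)] by (auto simp: lessThan_atLeast0)
  define I where "I = {..<card B}"
  define \<pi> where "\<pi> i = (e i \<in> odd_part M)" for i
  define w where "w i = wt (e i)" for i
  define \<rho> where "\<rho> a i j = coords (act M a (e j)) (e i)" for a i j
  have eB: "e i \<in> B" "e i \<in> carrier M" if "i \<in> I" for i
    using bij_betwE[OF e] that B(2) by (auto simp: I_def)
  have einj: "e i = e j \<longleftrightarrow> i = j" if "i \<in> I" "j \<in> I" for i j
    using e that by (auto simp: bij_betw_def inj_on_def I_def)
  have sumB: "(\<Sum>b\<in>B. f b) = (\<Sum>i\<in>I. f (e i))" for f :: "'v \<Rightarrow> 'z::comm_monoid_add"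
    unfolding I_def using sum.reindex_bij_betw[OF e, of f] by simp
  have par: "e i \<in> part M (\<pi> i)" if "i \<in> I" for i using eB[OF that] BP by (auto simp: part_def \<pi>_def)
  \<comment> \<open>The coordinates of a homogeneous vector vanish at basis vectors of the opposite
    parity; this gives the parity condition on the matrix entries.\<close>
  have cpart: "v \<in> part M p \<Longrightarrow> i \<in> I \<Longrightarrow> coords v (e i) \<noteq> 0 \<Longrightarrow> \<pi> i = p" for v p i
  proof -
    assume v: "v \<in> part M p" and i: "i \<in> I" and nzc: "coords v (e i) \<noteq> 0"
    define P where "P q = {b \<in> B. (b \<in> odd_part M) = q}" for q
    have BP': "P q \<subseteq> part M q" "P q \<subseteq> carrier M" "finite (P q)" for q using BP B by (auto simp: P_def part_def)
    have sub: "submodule \<CC> (part M q) M" for q using parts_sub by (simp add: part_def)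
    have vM: "v \<in> carrier M" using v parts_carrier by (auto simp: part_def split: if_splits)
    have "lincomb (coords v) (P p \<union> P (\<not> p)) = lincomb (coords v) (P p) \<oplus> lincomb (coords v) (P (\<not> p))"
      by (rule lincomb_union) (use BP' in \<open>auto simp: P_def\<close>)
    moreover have "P p \<union> P (\<not> p) = B" by (auto simp: P_def)
    ultimately have v': "v = lincomb (coords v) (P p) \<oplus> lincomb (coords v) (P (\<not> p))"
      using coords(1)[OF vM] by (simp add: val_def)
    have "lincomb (coords v) (P (\<not> p)) = v \<oplus> (-1) \<odot> lincomb (coords v) (P p)"
      using sub_right[of "lincomb (coords v) (P p)" "lincomb (coords v) (P (\<not> p))"] BP' v' by simp
    also have "\<dots> \<in> part M p" using v sub BP' by (auto intro!: sub_add sub_smul sub_lc)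
    finally have "lincomb (coords v) (P (\<not> p)) \<in> part M p" .
    moreover have "lincomb (coords v) (P (\<not> p)) \<in> part M (\<not> p)" using sub BP' by (auto intro!: sub_lc)
    ultimately have z: "lincomb (coords v) (P (\<not> p)) = \<zero>" using parts_disjoint by (cases p) (auto simp: part_def)
    have li: "lin_indpt (P (\<not> p))" by (rule subset_li_is_li[OF B(3)]) (auto simp: P_def)
    show "\<pi> i = p"
    proof (rule ccontr)
      assume "\<pi> i \<noteq> p"
      hence "e i \<in> P (\<not> p)" using eB[OF i] by (auto simp: P_def \<pi>_def)
      thus False using indep_coeff[OF li BP'(3) z] nzc by auto
    qed
  qed
  have ce: "coords (e j) (e i) = (if i = j then 1 else 0)" if "i \<in> I" "j \<in> I" for i j
  proof -
    have "coords (e j) = (\<lambda>v. if v = e j then 1 else 0)"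
      by (rule coords_unique) (use eB[OF that(2)] lc_single[OF B(1,2)] in \<open>auto simp: val_def\<close>)
    thus ?thesis using einj[OF that] by simp
  qed
  have pc: "part K p \<subseteq> carrier K" for p using K.parts_carrier by (simp add: part_def)
  have "wrep L H K \<iota> I \<pi> w \<rho>"
    unfolding wrep_def
  proof (intro conjI ballI allI impI)
    show "finite I" by (simp add: I_def)
    show "w i \<in> dual L H" if "i \<in> I" for i using that wt(1) eB by (simp add: w_def)
    show "\<rho> (a \<oplus>\<^bsub>K\<^esub> b) i j = \<rho> a i j + \<rho> b i j" if "a \<in> carrier K" "b \<in> carrier K" "i \<in> I" "j \<in> I" for a b i j
      using that eB by (simp add: \<rho>_def lin coords_add endo_closed[OF en])
    show "\<rho> (c \<odot>\<^bsub>K\<^esub> a) i j = c * \<rho> a i j" if "a \<in> carrier K" "i \<in> I" "j \<in> I" for c a i j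
      using that eB by (simp add: \<rho>_def lin coords_smul fscale_def endo_closed[OF en])
    show "\<pi> i = (\<pi> j \<noteq> p)" if "a \<in> part K p" "i \<in> I" "j \<in> I" "\<rho> a i j \<noteq> 0" for p a i j
    proof (rule cpart)
      have "act M a (e j) \<in> part M (p \<noteq> \<pi> j)" using rep that(1) par[OF that(3)] unfolding is_rep_def by blast
      thus "act M a (e j) \<in> part M (\<pi> j \<noteq> p)" by (simp add: eq_commute)
    qed (use that in \<open>auto simp: \<rho>_def\<close>)
    show "\<rho> (\<iota> h) i j = (if i = j then w i h else 0)" if "h \<in> H" "i \<in> I" "j \<in> I" for h i j
      using that eB wt(2) ce by (simp add: \<rho>_def w_def coords_smul fscale_def)
    fix p q a b i j assume a: "a \<in> part K p" and b: "b \<in> part K q" and ij: "i \<in> I" "j \<in> I"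
    have ab: "a \<in> carrier K" "b \<in> carrier K" using a b pc by auto
    have m: "coords (act M x (act M y (e j))) (e i) = (\<Sum>k\<in>I. \<rho> x i k * \<rho> y k j)" if "x \<in> carrier K" "y \<in> carrier K" for x y
      using coords_endo[OF en[OF that(1)], of "act M y (e j)" "e i"] eB[OF ij(2)] endo_closed[OF en[OF that(2)]]
      by (simp add: sumB \<rho>_def mult.commute)
    have "act M (brk K a b) (e j) = act M a (act M b (e j)) \<oplus> (- koszul p q) \<odot> act M b (act M a (e j))"
      using rep a b eB[OF ij(2)] unfolding is_rep_def by blast
    thus "\<rho> (brk K a b) i j = (\<Sum>k\<in>I. \<rho> a i k * \<rho> b k j) - koszul p q * (\<Sum>k\<in>I. \<rho> b i k * \<rho> a k j)"
      using m[OF ab] m[OF ab(2,1)] ab eB[OF ij(2)]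
      by (simp add: \<rho>_def[of "brk K a b"] coords_add coords_smul fscale_def endo_closed[OF en])
  qed
  moreover have "wch I \<pi> w = sch L H \<iota> M"
  proof (subst sch_weight_basis[OF ss wb])
    show "act M (\<iota> h) \<in> LinearCombinations.module_hom \<CC> M M" if "h \<in> H" for h
      using en[of "\<iota> h"] that \<iota> by (auto simp: endo_def)
    show "wch I \<pi> w = (\<Sum>b\<in>B. of_int (par_sign (b \<in> odd_part M)) * fexp (wt b))"
      by (simp add: sumB wch_def \<pi>_def w_def)
  qed
  ultimately show ?thesis by blast
qed

text \<open>An index set may consist of encoded pairs and need not be an initial segment. The module
  is therefore the coordinate subspace of C^N whose entries outside I vanish.\<close>

definition vec_rep :: "nat \<Rightarrow> nat set \<Rightarrow> (nat \<Rightarrow> bool) \<Rightarrow> ('g \<Rightarrow> nat \<Rightarrow> nat \<Rightarrow> complex) \<Rightarrow> ('g, complex vec) rep" where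
  "vec_rep N I \<pi> \<rho> = rep.make {v \<in> carrier_vec N. \<forall>i<N. i \<notin> I \<longrightarrow> v $ i = 0} undefined undefined
     (0\<^sub>v N) (+) (\<cdot>\<^sub>v)
     {v \<in> carrier_vec N. \<forall>i<N. i \<notin> I \<or> \<pi> i \<longrightarrow> v $ i = 0}
     {v \<in> carrier_vec N. \<forall>i<N. i \<notin> I \<or> \<not> \<pi> i \<longrightarrow> v $ i = 0}
     (\<lambda>a v. vec N (\<lambda>i. if i \<in> I then \<Sum>j\<in>I. \<rho> a i j * v $ j else 0))"

lemmas vec_rep_unfold = vec_rep_def rep.defs

lemma cvsI: "Module.module \<CC> V \<Longrightarrow> cvs V"
  unfolding cvs_def vectorspace_def using class_field by blast

lemma cvs_vec_rep: "cvs (vec_rep N I \<pi> \<rho>)"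
proof (rule cvsI, rule module_criteria)
  show "cring \<CC>" by (rule class_cring.cring_axioms)
  let ?M = "vec_rep N I \<pi> \<rho>"
  show "\<forall>v\<in>carrier ?M. \<exists>w\<in>carrier ?M. v \<oplus>\<^bsub>?M\<^esub> w = \<zero>\<^bsub>?M\<^esub>"
    by (rule ballI, rule_tac x = "- v" in bexI) (auto simp: vec_rep_unfold)
qed (auto simp: vec_rep_unfold intro!: eq_vecI simp: algebra_simps smult_add_distrib_vec add_smult_distrib_vec)

lemma superspace_vec_rep: "superspace (vec_rep N I \<pi> \<rho>)"
proof -
  let ?M = "vec_rep N I \<pi> \<rho>"
  interpret cvs ?M by (rule cvs_vec_rep)
  have e: "submodule \<CC> (even_part ?M) ?M" and o: "submodule \<CC> (odd_part ?M) ?M"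
    by (rule subI; auto simp: vec_rep_unfold)+
  have "even_part ?M \<inter> odd_part ?M = {\<zero>\<^bsub>?M\<^esub>}"
    by (auto simp: vec_rep_unfold intro!: eq_vecI)
  moreover have "carrier ?M = {u \<oplus>\<^bsub>?M\<^esub> v |u v. u \<in> even_part ?M \<and> v \<in> odd_part ?M}"
  proof (intro equalityI subsetI)
    fix v assume v: "v \<in> carrier ?M"
    have "v = vec N (\<lambda>i. if \<pi> i then 0 else v $ i) + vec N (\<lambda>i. if \<pi> i then v $ i else 0)"
      using v by (auto simp: vec_rep_unfold intro!: eq_vecI)
    moreover have "vec N (\<lambda>i. if \<pi> i then 0 else v $ i) \<in> even_part ?M" "vec N (\<lambda>i. if \<pi> i then v $ i else 0) \<in> odd_part ?M"
      using v by (auto simp: vec_rep_unfold)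
    moreover have "(\<oplus>\<^bsub>?M\<^esub>) = (+)" by (simp add: vec_rep_unfold)
    ultimately show "v \<in> {u \<oplus>\<^bsub>?M\<^esub> v |u v. u \<in> even_part ?M \<and> v \<in> odd_part ?M}"
      by (auto simp del: index_add_vec)
  qed (auto simp: vec_rep_unfold)
  ultimately show ?thesis
    using e o vectorspace_axioms unfolding superspace_def submodule_subspace by simp
qed

text \<open>The ring \<open>sch_ring\<close> is built from modules on complex vectors, and this
  produces one from matrices. The unit vectors form a homogeneous weight basis, from which the
  supercharacter is read off.\<close>

lemma wrep_realize:
  assumes w: "wrep L H K \<iota> I \<pi> wt \<rho>" and K: "superspace K" and \<iota>: "\<iota> ` H \<subseteq> carrier K"
  shows "\<exists>M :: ('g, complex vec) rep. fd_rep K M \<and> sch L H \<iota> M = wch I \<pi> wt"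
proof -
  interpret K: sspace K by (rule sspaceI[OF K])
  have finI: "finite I" and wt: "\<And>i. i \<in> I \<Longrightarrow> wt i \<in> dual L H"
    and add: "\<And>a b i j. a \<in> carrier K \<Longrightarrow> b \<in> carrier K \<Longrightarrow> i \<in> I \<Longrightarrow> j \<in> I \<Longrightarrow> \<rho> (a \<oplus>\<^bsub>K\<^esub> b) i j = \<rho> a i j + \<rho> b i j"
    and smul: "\<And>c a i j. a \<in> carrier K \<Longrightarrow> i \<in> I \<Longrightarrow> j \<in> I \<Longrightarrow> \<rho> (c \<odot>\<^bsub>K\<^esub> a) i j = c * \<rho> a i j"
    and par: "\<And>p a i j. a \<in> part K p \<Longrightarrow> i \<in> I \<Longrightarrow> j \<in> I \<Longrightarrow> \<rho> a i j \<noteq> 0 \<Longrightarrow> \<pi> i = (\<pi> j \<noteq> p)"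
    and br: "\<And>p q a b i j. a \<in> part K p \<Longrightarrow> b \<in> part K q \<Longrightarrow> i \<in> I \<Longrightarrow> j \<in> I \<Longrightarrow>
          \<rho> (brk K a b) i j = (\<Sum>k\<in>I. \<rho> a i k * \<rho> b k j) - koszul p q * (\<Sum>k\<in>I. \<rho> b i k * \<rho> a k j)"
    and dg: "\<And>h i j. h \<in> H \<Longrightarrow> i \<in> I \<Longrightarrow> j \<in> I \<Longrightarrow> \<rho> (\<iota> h) i j = (if i = j then wt i h else 0)"
    using wrep_fin[OF w] wrep_dual[OF w] wrep_add[OF w] wrep_smul[OF w] wrep_par[OF w] wrep_brk[OF w] wrep_diag[OF w] by auto
  obtain N where N: "\<And>i. i \<in> I \<Longrightarrow> i < N"
    using finI finite_nat_set_iff_bounded[of I] by auto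
  define M where "M = vec_rep N I \<pi> \<rho>"
  have ss: "superspace M" unfolding M_def by (rule superspace_vec_rep)
  interpret sspace M by (rule sspaceI[OF ss])
  have car: "v \<in> carrier M \<longleftrightarrow> v \<in> carrier_vec N \<and> (\<forall>i<N. i \<notin> I \<longrightarrow> v $ i = 0)" for v by (simp add: M_def vec_rep_unfold)
  have part: "v \<in> part M p \<longleftrightarrow> v \<in> carrier_vec N \<and> (\<forall>i<N. i \<notin> I \<or> \<pi> i \<noteq> p \<longrightarrow> v $ i = 0)" for v p
    by (auto simp: M_def vec_rep_unfold part_def)
  have ops: "u \<oplus>\<^bsub>M\<^esub> v = u + v" "c \<odot>\<^bsub>M\<^esub> v = c \<cdot>\<^sub>v v" "\<zero>\<^bsub>M\<^esub> = 0\<^sub>v N" for u v c by (simp_all add: M_def vec_rep_unfold)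
  have act: "act M a v = vec N (\<lambda>i. if i \<in> I then \<Sum>j\<in>I. \<rho> a i j * v $ j else 0)" for a v
    by (simp add: M_def vec_rep_unfold)
  have pK: "part K p \<subseteq> carrier K" for p using K.parts_carrier by (simp add: part_def)
  have bil: "bilinear_on K M M (act M)"
    unfolding bilinear_on_def LinearCombinations.module_hom_def
    by (auto simp: act car ops N add smul sum.distrib sum_distrib_left algebra_simps intro!: eq_vecI sum.cong)
  have is_rep: "is_rep K M"
    unfolding is_rep_def
  proof (intro conjI allI ballI)
    fix p q a v assume a: "a \<in> part K p" and v: "v \<in> part M q"
    have "(\<Sum>j\<in>I. \<rho> a i j * v $ j) = 0" if "i \<in> I" "\<pi> i \<noteq> (p \<noteq> q)" for i
    proof (rule sum.neutral, rule ballI)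
      fix j assume j: "j \<in> I"
      show "\<rho> a i j * v $ j = 0" using par[OF a that(1) j] v N[OF j] that(2) j by (auto simp: part)
    qed
    thus "act M a v \<in> part M (p \<noteq> q)" by (auto simp: part act)
  next
    fix p q a b v assume ab: "a \<in> part K p" "b \<in> part K q" and v: "v \<in> carrier M"
    have s: "(\<Sum>j\<in>I. \<rho> x i j * (act M y v) $ j) = (\<Sum>k\<in>I. (\<Sum>j\<in>I. \<rho> x i j * \<rho> y j k) * v $ k)" for x y i
    proof -
      have "(\<Sum>j\<in>I. \<rho> x i j * (act M y v) $ j) = (\<Sum>j\<in>I. \<Sum>k\<in>I. \<rho> x i j * \<rho> y j k * v $ k)"
        by (rule sum.cong) (auto simp: act N sum_distrib_left mult.assoc)
      also have "\<dots> = (\<Sum>k\<in>I. (\<Sum>j\<in>I. \<rho> x i j * \<rho> y j k) * v $ k)"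
        by (subst sum.swap) (simp add: sum_distrib_right)
      finally show ?thesis .
    qed
    have "act M a (act M b v) \<in> carrier_vec N" "act M b (act M a v) \<in> carrier_vec N" by (simp_all add: act)
    have "act M (brk K a b) v $ i = act M a (act M b v) $ i - koszul p q * act M b (act M a v) $ i" if "i < N" for i
    proof (cases "i \<in> I")
      case True
      have "act M (brk K a b) v $ i = (\<Sum>k\<in>I. \<rho> (brk K a b) i k * v $ k)" using that True by (simp add: act)
      also have "\<dots> = (\<Sum>k\<in>I. (\<Sum>j\<in>I. \<rho> a i j * \<rho> b j k) * v $ k) - koszul p q * (\<Sum>k\<in>I. (\<Sum>j\<in>I. \<rho> b i j * \<rho> a j k) * v $ k)"
        proof -
        have "\<rho> (brk K a b) i k * v $ k = (\<Sum>j\<in>I. \<rho> a i j * \<rho> b j k) * v $ k - koszul p q * ((\<Sum>j\<in>I. \<rho> b i j * \<rho> a j k) * v $ k)"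
          if "k \<in> I" for k unfolding br[OF ab True that] by (simp only: left_diff_distrib mult.assoc)
        thus ?thesis by (simp add: sum_subtractf sum_distrib_left[symmetric])
      qed
      also have "\<dots> = act M a (act M b v) $ i - koszul p q * act M b (act M a v) $ i"
        unfolding s[symmetric] using that True act[of a "act M b v"] act[of b "act M a v"] by simp
      finally show ?thesis .
    qed (use that in \<open>simp add: act\<close>)
    thus "act M (brk K a b) v = act M a (act M b v) \<oplus>\<^bsub>M\<^esub> (- koszul p q) \<odot>\<^bsub>M\<^esub> act M b (act M a v)"
      by (intro eq_vecI) (simp_all add: ops, simp_all add: act)
  qed (fact ss bil)+
  define B :: "complex vec set" where "B = unit_vec N ` I"
  have inj: "inj_on (unit_vec N :: nat \<Rightarrow> complex vec) I"
    by (intro inj_onI) (use N in \<open>auto simp: vec_eq_iff unit_vec_def split: if_splits\<close>)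
  have BM: "B \<subseteq> carrier M" using N by (auto simp: B_def car)
  have fB: "finite B" by (simp add: B_def finI)
  have lc: "i < N \<Longrightarrow> lincomb f (unit_vec N ` S) $ i = (if i \<in> S then f (unit_vec N i) else 0)" if "finite S" "S \<subseteq> I" for f S i
    using that
  proof (induction S)
    case empty
    then show ?case by (simp add: ops)
  next
    case (insert s S)
    have "lincomb f (unit_vec N ` insert s S) = f (unit_vec N s) \<odot>\<^bsub>M\<^esub> unit_vec N s \<oplus>\<^bsub>M\<^esub> lincomb f (unit_vec N ` S)"
      unfolding image_insert
      proof (rule lc_insert)
      show "insert (unit_vec N s) (unit_vec N ` S) \<subseteq> carrier M"
        using insert.prems BM unfolding B_def by blast
      show "(unit_vec N s :: complex vec) \<notin> unit_vec N ` S"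
        proof
        assume "(unit_vec N s :: complex vec) \<in> unit_vec N ` S"
        then obtain t where "t \<in> S" "unit_vec N s = (unit_vec N t :: complex vec)" by auto
        moreover have "s \<in> I" "t \<in> I" using insert.prems calculation by auto
        ultimately show False using inj_onD[OF inj] insert.hyps(2) by metis
      qed
    qed (use insert.hyps in simp)
    moreover have "lincomb f (unit_vec N ` S) \<in> carrier M"
      by (rule lc_closed) (use insert.prems BM in \<open>unfold B_def, blast\<close>)
    ultimately show ?case using insert N[of s] by (auto simp: ops car)
  qed
  have lin: "lin_indpt B"
  proof (rule indepI[OF fB BM])
    fix f b assume f: "lincomb f B = \<zero>\<^bsub>M\<^esub>" and "b \<in> B"
    then obtain i where i: "i \<in> I" "b = unit_vec N i" by (auto simp: B_def)
    show "f b = 0" using lc[OF finI subset_refl N[OF i(1)], of f] f i N[OF i(1)] by (simp add: B_def ops)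
  qed
  have "v \<in> span B" if v: "v \<in> carrier M" for v
  proof -
    \<comment> \<open>Coefficients of a linear combination are indexed by vectors, so each is
      recovered from the position of its unit vector.\<close>
    define f :: "complex vec \<Rightarrow> complex" where "f b = (THE c. \<exists>i\<in>I. b = unit_vec N i \<and> c = v $ i)" for b
    have f: "f (unit_vec N i) = v $ i" if "i \<in> I" for i
      unfolding f_def by (rule the_equality) (use that inj in \<open>auto simp: inj_on_def\<close>)
    have "lincomb f B \<in> carrier M" by (rule lc_closed[OF BM])
    hence "v = lincomb f B" using v lc[OF finI subset_refl, of _ f] f
      by (intro eq_vecI) (auto simp: car B_def[symmetric])
    thus ?thesis using span_iff[OF fB BM] by blast
  qed
  hence bas: "basis B" using lin BM span_is_subset2[OF BM] by (auto simp: basis_def)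
  define wB where "wB b = wt (the_inv_into I (unit_vec N) b)" for b :: "complex vec"
  have wB: "wB (unit_vec N i) = wt i" if "i \<in> I" for i
    using the_inv_into_f_f[OF inj that] by (simp add: wB_def)
  have "weight_basis L H \<iota> M B wB"
    unfolding weight_basis_def
  proof (intro conjI ballI)
    show "B \<subseteq> even_part M \<union> odd_part M"
      proof
      fix b assume "b \<in> B"
      then obtain i where i: "i \<in> I" "b = unit_vec N i" by (auto simp: B_def)
      have "unit_vec N i \<in> part M (\<pi> i)" using N[OF i(1)] i(1) by (auto simp: part)
      thus "b \<in> even_part M \<union> odd_part M" using i by (auto simp: part_def split: if_splits)
    qed
    show "wB b \<in> dual L H" if "b \<in> B" for b using that wB wt by (auto simp: B_def)
    show "act M (\<iota> h) b = wB b h \<odot>\<^bsub>M\<^esub> b" if "b \<in> B" "h \<in> H" for b h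
    proof -
      from \<open>b \<in> B\<close> obtain i where i: "i \<in> I" "b = unit_vec N i" unfolding B_def by blast
      have s: "(\<Sum>j\<in>I. \<rho> (\<iota> h) k j * unit_vec N i $ j) = (if k = i then wt i h else 0)" if "k \<in> I" for k
      proof -
        have "(\<Sum>j\<in>I. \<rho> (\<iota> h) k j * unit_vec N i $ j) = (\<Sum>j\<in>I. if j = i then \<rho> (\<iota> h) k i else 0)"
          by (rule sum.cong) (use N i in auto)
        thus ?thesis using i(1) finI dg[OF \<open>h \<in> H\<close> that i(1)] by simp
      qed
      show ?thesis unfolding act ops i(2) wB[OF i(1)]
      proof (rule eq_vecI)
        fix k assume "k < dim_vec (wt i h \<cdot>\<^sub>v unit_vec N i)"
        hence k: "k < N" by simp
        show "vec N (\<lambda>k. if k \<in> I then \<Sum>j\<in>I. \<rho> (\<iota> h) k j * unit_vec N i $ j else 0) $ k = (wt i h \<cdot>\<^sub>v unit_vec N i) $ k"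
        proof (cases "k \<in> I")
          case True
          then show ?thesis using k N[OF i(1)] by (simp only: index_vec s if_True) simp
        next
          case False
          then show ?thesis using k N[OF i(1)] i(1) by auto
        qed
      qed simp
    qed
  qed (fact fB bas)+
  note wb = this
  have en: "act M (\<iota> h) \<in> LinearCombinations.module_hom \<CC> M M" if "h \<in> H" for h
    using bil \<iota> that by (auto simp: bilinear_on_def)
  have "unit_vec N i \<in> odd_part M \<longleftrightarrow> \<pi> i" if "i \<in> I" for i
    using part[of "unit_vec N i" True] N[OF that] that by (auto simp: part_def)
  hence "sch L H \<iota> M = wch I \<pi> wt"
    using sch_weight_basis[OF ss wb en] unfolding wch_def B_def
    by (simp add: sum.reindex[OF inj] wB)
  moreover have "fin_dim" unfolding fin_dim_def using fB bas by (auto simp: basis_def)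
  ultimately show ?thesis using is_rep by (intro exI[of _ M]) (simp add: fd_rep_def)
qed

section \<open>Octonions and their derivations\<close>

lemma vec3_zero [simp]: "vscale c 0 = 0" "vdot 0 u = 0" "vdot u 0 = 0" "vcross 0 u = 0" "vcross u 0 = 0"
  by (cases u; simp add: zero_prod_def)+

lemma zorn_cases:
  obtains a u1 u2 u3 v1 v2 v3 b where "p = ((a, (u1, u2, u3), (v1, v2, v3), b) :: zorn)"
  by (metis prod.collapse)

lemma zscale_simps [simp]:
  "zscale c (p + q) = zscale c p + zscale c q" "zscale (c + d) p = zscale c p + zscale d p"
  "zscale c (zscale d p) = zscale (c * d) p" "zscale 1 p = p" "zscale 0 p = 0" "zscale c 0 = 0"
  "zscale c (- p) = - zscale c p" "zscale (- c) p = - zscale c p" "zscale c (p - q) = zscale c p - zscale c q"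
  "zscale (c - d) p = zscale c p - zscale d p"
  by (cases p rule: zorn_cases; cases q rule: zorn_cases; simp add: algebra_simps zero_prod_def)+

lemma zscale_double: "zscale (a * 2) p = zscale a p + zscale a p" "zscale (a * (b * 2)) p = zscale (a * b) p + zscale (a * b) p"
  "zscale (2 * a) p = zscale a p + zscale a p"
  by (cases p rule: zorn_cases; simp add: algebra_simps)+

lemma zmul_add: "(p + q) \<cdot> r = p \<cdot> r + q \<cdot> r" "r \<cdot> (p + q) = r \<cdot> p + r \<cdot> q"
  by (cases p rule: zorn_cases; cases q rule: zorn_cases; cases r rule: zorn_cases; simp add: algebra_simps)+

lemma zmul_scale: "zscale c p \<cdot> q = zscale c (p \<cdot> q)" "p \<cdot> zscale c q = zscale c (p \<cdot> q)"
  by (cases p rule: zorn_cases; cases q rule: zorn_cases; simp add: algebra_simps)+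

lemma zmul_zero [simp]: "0 \<cdot> p = 0" "p \<cdot> 0 = 0"
  by (cases p rule: zorn_cases; simp add: zero_prod_def)+

lemma zmul_minus: "(- p) \<cdot> r = - (p \<cdot> r)" "r \<cdot> (- p) = - (r \<cdot> p)"
  "(p - q) \<cdot> r = p \<cdot> r - q \<cdot> r" "r \<cdot> (p - q) = r \<cdot> p - r \<cdot> q"
  by (cases p rule: zorn_cases; cases q rule: zorn_cases; cases r rule: zorn_cases; simp add: algebra_simps)+

lemma ztrace_simps [simp]:
  "ztrace (p + q) r = ztrace p r + ztrace q r" "ztrace r (p + q) = ztrace r p + ztrace r q"
  "ztrace (zscale c p) r = c * ztrace p r" "ztrace r (zscale c p) = c * ztrace r p"
  "ztrace 0 r = 0" "ztrace r 0 = 0" "ztrace (- p) r = - ztrace p r" "ztrace r (- p) = - ztrace r p"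
  "ztrace (p - q) r = ztrace p r - ztrace q r" "ztrace r (p - q) = ztrace r p - ztrace r q"
  by (cases p rule: zorn_cases; cases q rule: zorn_cases; cases r rule: zorn_cases; simp add: ztrace_def algebra_simps zero_prod_def)+

lemma ztrace_commute: "ztrace p q = ztrace q p"
  by (simp add: ztrace_def add.commute)

lemma zder_bilin:
  "zder (p + q) r w = zder p r w + zder q r w" "zder r (p + q) w = zder r p w + zder r q w"
  "zder (zscale c p) r w = zscale c (zder p r w)" "zder r (zscale c p) w = zscale c (zder r p w)"
  "zder 0 r w = 0" "zder r 0 w = 0" "zder (- p) r w = - zder p r w" "zder r (- p) w = - zder r p w"
  "zder p r 0 = 0" "zder (p - q) r w = zder p r w - zder q r w" "zder r (p - q) w = zder r p w - zder r q w"
  by (simp_all add: zder_def zmul_add zmul_scale zmul_minus algebra_simps)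

text \<open>The general element of G2 as sl(3) plus its standard module plus the dual. The three
  rows form a matrix acting on u, and by minus its transpose on v; y and z mix the diagonal entries
  with the vectors.\<close>

fun dermap :: "vec3 \<Rightarrow> vec3 \<Rightarrow> vec3 \<Rightarrow> vec3 \<Rightarrow> vec3 \<Rightarrow> zorn \<Rightarrow> zorn" where
  "dermap (a11, a12, a13) (a21, a22, a23) (a31, a32, a33) y z (a, u, v, b) =
     (- vdot z u - vdot y v,
      vscale (a - b) y + (vdot (a11, a12, a13) u, vdot (a21, a22, a23) u, vdot (a31, a32, a33) u) + vcross z v,
      vscale (a - b) z + vcross y u - (vdot (a11, a21, a31) v, vdot (a12, a22, a32) v, vdot (a13, a23, a33) v),
      vdot z u + vdot y v)"

lemma DerI: "(\<And>p q. D (p + q) = D p + D q) \<Longrightarrow> (\<And>c p. D (zscale c p) = zscale c (D p))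
    \<Longrightarrow> (\<And>p q. D (p \<cdot> q) = D p \<cdot> q + p \<cdot> D q) \<Longrightarrow> D \<in> Der"
  unfolding Der_def by blast

text \<open>Trace zero is what makes the matrix compatible with the two cross products.\<close>

lemma dermap_Der:
  assumes "a33 = - a11 - a22"
  shows "dermap (a11, a12, a13) (a21, a22, a23) (a31, a32, a33) y z \<in> Der"
proof -
  obtain y1 y2 y3 z1 z2 z3 where yz: "y = (y1, y2, y3)" "z = (z1, z2, z3)" by (cases y; cases z)
  let ?D = "dermap (a11, a12, a13) (a21, a22, a23) (a31, a32, a33) y z"
  have "?D (p + q) = ?D p + ?D q" for p q by (cases p rule: zorn_cases; cases q rule: zorn_cases; simp add: yz algebra_simps)
  moreover have "?D (zscale c p) = zscale c (?D p)" for c p by (cases p rule: zorn_cases; simp add: yz algebra_simps)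
  moreover have "?D (p \<cdot> q) = ?D p \<cdot> q + p \<cdot> ?D q" for p q
    by (cases p rule: zorn_cases; cases q rule: zorn_cases; simp add: yz assms algebra_simps)
  ultimately show ?thesis unfolding Der_def by blast
qed

lemma Der_simps:
  assumes "D \<in> Der"
  shows "D (p + q) = D p + D q" "D (zscale c p) = zscale c (D p)" "D (p \<cdot> q) = D p \<cdot> q + p \<cdot> D q"
    "D 0 = 0" "D (- p) = - D p" "D (p - q) = D p - D q"
proof -
  show *: "D (p + q) = D p + D q" "D (zscale c p) = zscale c (D p)" "D (p \<cdot> q) = D p \<cdot> q + p \<cdot> D q" for p q c
    using assms unfolding Der_def by blast+
  show 0: "D 0 = 0" using *(2)[of 0 0] by simp
  show m: "D (- p) = - D p" for p using *(2)[of "-1" p] by (metis zscale_simps(4) zscale_simps(8))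
  show "D (p - q) = D p - D q" using *(1)[of p "- q"] m by simp
qed

abbreviation "zE \<equiv> (1, (0, 0, 0), (0, 0, 0), 0) :: zorn"
abbreviation "zF \<equiv> (0, (0, 0, 0), (0, 0, 0), 1) :: zorn"
abbreviation "zU1 \<equiv> (0, (1, 0, 0), (0, 0, 0), 0) :: zorn"
abbreviation "zU2 \<equiv> (0, (0, 1, 0), (0, 0, 0), 0) :: zorn"
abbreviation "zU3 \<equiv> (0, (0, 0, 1), (0, 0, 0), 0) :: zorn"
abbreviation "zV1 \<equiv> (0, (0, 0, 0), (1, 0, 0), 0) :: zorn"
abbreviation "zV2 \<equiv> (0, (0, 0, 0), (0, 1, 0), 0) :: zorn"
abbreviation "zV3 \<equiv> (0, (0, 0, 0), (0, 0, 1), 0) :: zorn"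

lemma Der_basis:
  assumes "D \<in> Der"
  shows "D (a, (u1, u2, u3), (v1, v2, v3), b) = zscale a (D zE) + zscale u1 (D zU1) + zscale u2 (D zU2) + zscale u3 (D zU3)
     + zscale v1 (D zV1) + zscale v2 (D zV2) + zscale v3 (D zV3) + zscale b (D zF)"
  unfolding Der_simps(1,2)[OF assms, symmetric] by simp

text \<open>The Leibniz rule on products of basis vectors determines D: the idempotents E and F with
  E F = F E = 0 give the diagonal entries and D F = - D E. The relations E u = u, u E = 0, F v = v,
  v F = 0 express the mixing terms through D E, and u_i v_j = E or 0 relates the actions on u and on
  v.\<close>

lemma Der_imp_dermap:
  assumes D: "D \<in> Der"
  shows "\<exists>a11 a12 a13 a21 a22 a23 a31 a32 a33 y z. a33 = - a11 - a22
    \<and> D = dermap (a11, a12, a13) (a21, a22, a23) (a31, a32, a33) y z"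
proof -
  note m = Der_simps(3)[OF D]
  note z = Der_simps(4)[OF D, unfolded zero_prod_def]
  obtain e0 e1 e2 e3 e4 e5 e6 e7 where E: "D zE = (e0, (e1, e2, e3), (e4, e5, e6), e7)" by (metis prod.collapse)
  obtain f0 f1 f2 f3 f4 f5 f6 f7 where F: "D zF = (f0, (f1, f2, f3), (f4, f5, f6), f7)" by (metis prod.collapse)
  obtain p0 p1 p2 p3 p4 p5 p6 p7 where U1: "D zU1 = (p0, (p1, p2, p3), (p4, p5, p6), p7)" by (metis prod.collapse)
  obtain q0 q1 q2 q3 q4 q5 q6 q7 where U2: "D zU2 = (q0, (q1, q2, q3), (q4, q5, q6), q7)" by (metis prod.collapse)
  obtain r0 r1 r2 r3 r4 r5 r6 r7 where U3: "D zU3 = (r0, (r1, r2, r3), (r4, r5, r6), r7)" by (metis prod.collapse)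
  obtain s0 s1 s2 s3 s4 s5 s6 s7 where V1: "D zV1 = (s0, (s1, s2, s3), (s4, s5, s6), s7)" by (metis prod.collapse)
  obtain t0 t1 t2 t3 t4 t5 t6 t7 where V2: "D zV2 = (t0, (t1, t2, t3), (t4, t5, t6), t7)" by (metis prod.collapse)
  obtain w0 w1 w2 w3 w4 w5 w6 w7 where V3: "D zV3 = (w0, (w1, w2, w3), (w4, w5, w6), w7)" by (metis prod.collapse)
  note X = E F U1 U2 U3 V1 V2 V3
  have ee: "e0 = 0" "e7 = 0" using m[of zE zE] by (simp_all add: E zero_prod_def)
  have ff: "f0 = 0" "f7 = 0" using m[of zF zF] by (simp_all add: F zero_prod_def)
  have ef: "f1 = - e1" "f2 = - e2" "f3 = - e3" "f4 = - e4" "f5 = - e5" "f6 = - e6"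
    using m[of zE zF] m[of zF zE] by (auto simp: zero_prod_def E F z ee ff add_eq_0_iff2 add_eq_0_iff)
  have eu: "p4 = 0" "p5 = e3" "p6 = - e2" "p7 = e4" "q4 = - e3" "q5 = 0" "q6 = e1" "q7 = e5" "r4 = e2" "r5 = - e1" "r6 = 0" "r7 = e6"
    using m[of zE zU1] m[of zE zU2] m[of zE zU3] by (auto simp: zero_prod_def X ee)
  have ue: "p0 = - e4" "q0 = - e5" "r0 = - e6"
    using m[of zU1 zE] m[of zU2 zE] m[of zU3 zE] by (auto simp: zero_prod_def X z ee eq_neg_iff_add_eq_0 add.commute)
  have fv: "s1 = 0" "s2 = e6" "s3 = - e5" "s0 = - e1" "t1 = - e6" "t2 = 0" "t3 = e4" "t0 = - e2" "w1 = e5" "w2 = - e4" "w3 = 0" "w0 = - e3"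
    using m[of zF zV1] m[of zF zV2] m[of zF zV3] by (auto simp: zero_prod_def X ef ff ee)
  have vf: "s7 = e1" "t7 = e2" "w7 = e3"
    using m[of zV1 zF] m[of zV2 zF] m[of zV3 zF] by (auto simp: zero_prod_def X z ef ff ee)
  have uv: "s4 = - p1" "t4 = - p2" "w4 = - p3" "s5 = - q1" "t5 = - q2" "w5 = - q3" "s6 = - r1" "t6 = - r2" "w6 = - r3"
    using m[of zU1 zV1] m[of zU1 zV2] m[of zU1 zV3] m[of zU2 zV1] m[of zU2 zV2] m[of zU2 zV3] m[of zU3 zV1] m[of zU3 zV2] m[of zU3 zV3]
    by (auto simp: zero_prod_def X z ee eq_neg_iff_add_eq_0 add.commute)
  \<comment> \<open>The product of \<open>zU1\<close> and \<open>zU2\<close> is \<open>zV3\<close>,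
    which forces trace zero.\<close>
  have "- r3 = p1 + q2"
    using m[of zU1 zU2] by (auto simp: zero_prod_def X z uv algebra_simps)
  hence "r3 = - (p1 + q2)" by (metis minus_minus)
  hence tr: "r3 = - p1 - q2" by simp
  have "D = dermap (p1, q1, r1) (p2, q2, r2) (p3, q3, r3) (e1, e2, e3) (e4, e5, e6)"
  proof
    fix w :: zorn
    obtain a u1 u2 u3 v1 v2 v3 b where w: "w = (a, (u1, u2, u3), (v1, v2, v3), b)" by (metis prod.collapse)
    show "D w = dermap (p1, q1, r1) (p2, q2, r2) (p3, q3, r3) (e1, e2, e3) (e4, e5, e6) w"
      unfolding w by (subst Der_basis[OF D], unfold X ee ff ef eu ue fv vf uv, simp add: algebra_simps)
  qed
  thus ?thesis using tr by blast
qed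

lemma Der_iff: "D \<in> Der \<longleftrightarrow> (\<exists>a11 a12 a13 a21 a22 a23 a31 a32 a33 y z. a33 = - a11 - a22
    \<and> D = dermap (a11, a12, a13) (a21, a22, a23) (a31, a32, a33) y z)"
  using Der_imp_dermap dermap_Der by metis

lemma Der_imaginary: "D \<in> Der \<Longrightarrow> D p \<in> imaginary"
  by (cases p) (auto simp: Der_iff imaginary_def)

lemma imaginary_iff: "p \<in> imaginary \<longleftrightarrow> fst p + snd (snd (snd p)) = 0"
  by (cases p rule: zorn_cases) (simp add: imaginary_def)

lemma zscale_fst: "fst (zscale c p) = c * fst p" "snd (snd (snd (zscale c p))) = c * snd (snd (snd p))"
  by (cases p rule: zorn_cases; simp)+

lemma imaginary_simps: "p \<in> imaginary \<Longrightarrow> q \<in> imaginary \<Longrightarrow> p + q \<in> imaginary" "p \<in> imaginary \<Longrightarrow> zscale c p \<in> imaginary"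
  "0 \<in> imaginary" "p \<in> imaginary \<Longrightarrow> - p \<in> imaginary" "p \<in> imaginary \<Longrightarrow> q \<in> imaginary \<Longrightarrow> p - q \<in> imaginary"
  by (simp_all add: imaginary_iff zscale_fst add_eq_0_iff algebra_simps)

lemma imaginaryE:
  assumes "p \<in> imaginary"
  obtains a u1 u2 u3 v1 v2 v3 where "p = (a, (u1, u2, u3), (v1, v2, v3), - a)"
  using assms by (cases p) (auto simp: imaginary_def add_eq_0_iff)

lemma Der_ztrace:
  assumes "D \<in> Der" "p \<in> imaginary" "q \<in> imaginary"
  shows "ztrace (D p) q = - ztrace p (D q)"
proof -
  obtain a u1 u2 u3 v1 v2 v3 where p: "p = (a, (u1, u2, u3), (v1, v2, v3), - a)" by (rule imaginaryE[OF assms(2)])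
  obtain b s1 s2 s3 t1 t2 t3 where q: "q = (b, (s1, s2, s3), (t1, t2, t3), - b)" by (rule imaginaryE[OF assms(3)])
  obtain a11 a12 a13 a21 a22 a23 a31 a32 a33 y z where
    D: "D = dermap (a11, a12, a13) (a21, a22, a23) (a31, a32, a33) y z" using assms(1) Der_iff by auto
  obtain y1 y2 y3 z1 z2 z3 where yz: "y = (y1, y2, y3)" "z = (z1, z2, z3)" by (cases y; cases z)
  show ?thesis unfolding p q D yz ztrace_def by (simp add: algebra_simps)
qed

text \<open>In this form inner derivations are visibly derivations, and their identities become
  polynomial identities in the coordinates.\<close>

lemma zder_explicit:
  "zder (a, (u1, u2, u3), (v1, v2, v3), - a) (b, (s1, s2, s3), (t1, t2, t3), - b) = dermap
    (2 * t1 * u1 - 2 * s1 * v1 + s2 * v2 + s3 * v3 - t2 * u2 - t3 * u3, 3 * (t2 * u1 - s1 * v2), 3 * (t3 * u1 - s1 * v3))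
    (3 * (t1 * u2 - s2 * v1), 2 * t2 * u2 - 2 * s2 * v2 + s1 * v1 + s3 * v3 - t1 * u1 - t3 * u3, 3 * (t3 * u2 - s2 * v3))
    (3 * (t1 * u3 - s3 * v1), 3 * (t2 * u3 - s3 * v2), 2 * t3 * u3 - 2 * s3 * v3 + s1 * v1 + s2 * v2 - t1 * u1 - t2 * u2)
    (t2 * v3 - t3 * v2 + 2 * (b * u1 - a * s1), t3 * v1 - t1 * v3 + 2 * (b * u2 - a * s2), t1 * v2 - t2 * v1 + 2 * (b * u3 - a * s3))
    (s2 * u3 - s3 * u2 + 2 * (b * v1 - a * t1), s3 * u1 - s1 * u3 + 2 * (b * v2 - a * t2), s1 * u2 - s2 * u1 + 2 * (b * v3 - a * t3))"
  (is "zder ?p ?q = ?D")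
proof
  fix w :: zorn
  show "zder ?p ?q w = ?D w"
    by (cases w rule: zorn_cases) (simp add: zder_def algebra_simps)
qed

lemma zder_Der:
  assumes "p \<in> imaginary" "q \<in> imaginary"
  shows "zder p q \<in> Der"
  by (rule imaginaryE[OF assms(1)], rule imaginaryE[OF assms(2)]) (simp add: zder_explicit dermap_Der)

lemma zder_antisym:
  assumes "p \<in> imaginary" "q \<in> imaginary"
  shows "zder q p w = - zder p q w"
  by (rule imaginaryE[OF assms(1)], rule imaginaryE[OF assms(2)], cases w rule: zorn_cases)
    (simp add: zder_explicit algebra_simps)

text \<open>The octonionic identity behind the Jacobi identity for three odd elements; its
  coefficients match the relative factor 2 in the odd bracket.\<close>

lemma zder_cyclic:
  assumes "p \<in> imaginary" "q \<in> imaginary" "r \<in> imaginary"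
  shows "zder p q r + zder p r q + zscale (2 * ztrace p q) r + zscale (2 * ztrace p r) q = zscale (4 * ztrace q r) p"
  by (rule imaginaryE[OF assms(1)], rule imaginaryE[OF assms(2)], rule imaginaryE[OF assms(3)])
    (simp add: zder_explicit ztrace_def algebra_simps)

text \<open>\<open>zder\<close> is built from the product, which D differentiates. This is the
  derivation component of the Jacobi identity for a derivation and two odd elements.\<close>

lemma Der_zder: "D \<in> Der \<Longrightarrow> D (zder p q w) = zder (D p) q w + zder p (D q) w + zder p q (D w)"
  by (simp add: zder_def Der_simps zmul_add zmul_minus algebra_simps)

lemma Der_closed:
  "D \<in> Der \<Longrightarrow> D' \<in> Der \<Longrightarrow> D + D' \<in> Der" "D \<in> Der \<Longrightarrow> (\<lambda>w. zscale c (D w)) \<in> Der" "0 \<in> Der"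
  "D \<in> Der \<Longrightarrow> D' \<in> Der \<Longrightarrow> (\<lambda>w. D (D' w) - D' (D w)) \<in> Der"
  "D \<in> Der \<Longrightarrow> D' \<in> Der \<Longrightarrow> (\<lambda>w. D w + D' w) \<in> Der" "D \<in> Der \<Longrightarrow> D' \<in> Der \<Longrightarrow> (\<lambda>w. D w - D' w) \<in> Der"
  by (intro DerI; simp add: Der_simps zmul_add zmul_scale zmul_minus algebra_simps)+

section \<open>\<open>G(3)\<close> is a Lie superalgebra\<close>

lemma mat2_cases:
  obtains m11 m12 m21 m22 where "A = (((m11, m12), (m21, m22)) :: mat2)"
  by (metis prod.collapse)

lemma mat2_zero: "(0 :: mat2) = ((0, 0), (0, 0))"
  by (simp add: zero_prod_def)

lemma mat_simps [simp]:
  "mmul 0 A = 0" "mmul A 0 = 0" "mscale 1 A = A" "mscale c 0 = 0"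
  by (cases A rule: mat2_cases; simp add: mat2_zero)+

lemma mat_act_zero [simp]: "mat_act 0 x = 0" "mat_act A 0 = 0"
  by (cases x rule: prod.exhaust; cases A rule: mat2_cases; simp add: mat2_zero zero_prod_def[where 'a = zorn and 'b = zorn])+

lemma mat_act_pair_zero: "mat_act A (0, 0) = (0, 0)"
  by (cases A rule: mat2_cases) simp

lemma G3_simps [simp]:
  "carrier G3 = Der \<times> traceless \<times> imaginary \<times> imaginary" "\<zero>\<^bsub>G3\<^esub> = 0" "(\<oplus>\<^bsub>G3\<^esub>) = (+)" "(\<odot>\<^bsub>G3\<^esub>) = g3_scale"
  "even_part G3 = Der \<times> traceless \<times> {0} \<times> {0}" "odd_part G3 = {0} \<times> {0} \<times> imaginary \<times> imaginary"
  "brk G3 = g3_brk"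
  by (simp_all add: G3_def)

lemma traceless_neg: "((a, b), (c, d)) \<in> traceless \<longleftrightarrow> d = - a"
  by (simp add: traceless_def add_eq_0_iff)

lemma traceless_simps:
  "A \<in> traceless \<Longrightarrow> B \<in> traceless \<Longrightarrow> A + B \<in> traceless" "A \<in> traceless \<Longrightarrow> mscale c A \<in> traceless"
  "A \<in> traceless \<Longrightarrow> B \<in> traceless \<Longrightarrow> A - B \<in> traceless" "A \<in> traceless \<Longrightarrow> - A \<in> traceless" "0 \<in> traceless"
  "mmul A B - mmul B A \<in> traceless" "odd_brk_sl2 p q r s \<in> traceless"
  by (cases A rule: mat2_cases; cases B rule: mat2_cases; simp add: traceless_neg zero_prod_def odd_brk_sl2_def algebra_simps)+

lemma g3_zero: "(0 :: g3) = (0, 0, 0, 0)"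
  by (simp add: zero_prod_def)

lemma g3_cases:
  obtains D m11 m12 m21 m22 p q where "a = ((D, ((m11, m12), (m21, m22)), p, q) :: g3)"
  by (metis prod.collapse)

lemma g3_scale_sel: "fst (g3_scale c a) = (\<lambda>w. zscale c (fst a w))" "fst (snd (g3_scale c a)) = mscale c (fst (snd a))"
  "fst (snd (snd (g3_scale c a))) = zscale c (fst (snd (snd a)))" "snd (snd (snd (g3_scale c a))) = zscale c (snd (snd (snd a)))"
  by (cases a rule: g3_cases; simp)+

lemma fun_zscale: "(\<lambda>w. zscale 1 (D w)) = D" "(\<lambda>w. zscale 0 (D w)) = 0"
  by auto

lemma Der_uminus: "D \<in> Der \<Longrightarrow> - D \<in> Der"
  by (intro DerI; simp add: Der_simps zmul_minus)

lemma cvs_G3: "cvs G3"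
proof (rule cvsI, rule module_criteria)
  show "cring \<CC>" by (rule class_cring.cring_axioms)
  show "\<forall>v\<in>carrier G3. \<exists>w\<in>carrier G3. v \<oplus>\<^bsub>G3\<^esub> w = \<zero>\<^bsub>G3\<^esub>"
  proof
    fix v assume "v \<in> carrier G3"
    hence "- v \<in> carrier G3" by (simp add: mem_Times_iff Der_uminus traceless_simps imaginary_simps)
    thus "\<exists>w\<in>carrier G3. v \<oplus>\<^bsub>G3\<^esub> w = \<zero>\<^bsub>G3\<^esub>" by (intro bexI[of _ "- v"]) simp
  qed
qed (simp_all add: mem_Times_iff g3_scale_sel Der_closed traceless_simps imaginary_simps prod_eq_iff fun_eq_iff algebra_simps)

lemma g3_parts:
  "v \<in> even_part G3 \<longleftrightarrow> fst v \<in> Der \<and> fst (snd v) \<in> traceless \<and> fst (snd (snd v)) = 0 \<and> snd (snd (snd v)) = 0"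
  "v \<in> odd_part G3 \<longleftrightarrow> fst v = 0 \<and> fst (snd v) = 0 \<and> fst (snd (snd v)) \<in> imaginary \<and> snd (snd (snd v)) \<in> imaginary"
  by (cases v; simp add: mem_Times_iff)+ 

lemma superspace_G3: "superspace G3"
proof -
  interpret cvs G3 by (rule cvs_G3)
  have "submodule \<CC> (even_part G3) G3" "submodule \<CC> (odd_part G3) G3"
    by (rule subI; simp del: G3_simps(5,6) add: g3_parts subset_iff mem_Times_iff g3_scale_sel Der_closed traceless_simps imaginary_simps fun_zscale zero_fun_def[symmetric])+
  moreover have "even_part G3 \<inter> odd_part G3 = {\<zero>\<^bsub>G3\<^esub>}"
    by (auto simp: g3_zero Der_closed traceless_simps imaginary_simps)
  moreover have "carrier G3 = {u \<oplus>\<^bsub>G3\<^esub> v |u v. u \<in> even_part G3 \<and> v \<in> odd_part G3}"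
  proof (intro equalityI subsetI)
    fix v assume "v \<in> carrier G3"
    then obtain D A p q where v: "v = (D, A, p, q)" "D \<in> Der" "A \<in> traceless" "p \<in> imaginary" "q \<in> imaginary" by auto
    have "v = (D, A, 0, 0) \<oplus>\<^bsub>G3\<^esub> (0, 0, p, q)" by (simp add: v)
    moreover have "(D, A, 0, 0) \<in> even_part G3" "(0, 0, p, q) \<in> odd_part G3" using v by auto
    ultimately show "v \<in> {u \<oplus>\<^bsub>G3\<^esub> v |u v. u \<in> even_part G3 \<and> v \<in> odd_part G3}" by blast
  next
    fix v assume "v \<in> {u \<oplus>\<^bsub>G3\<^esub> v |u v. u \<in> even_part G3 \<and> v \<in> odd_part G3}"
    then obtain u w where "u \<in> even_part G3" "w \<in> odd_part G3" "v = u + w" by (auto simp del: G3_simps(5,6))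
    thus "v \<in> carrier G3" by (simp del: G3_simps(5,6) add: g3_parts mem_Times_iff)
  qed
  ultimately show ?thesis
    using vectorspace_axioms unfolding superspace_def submodule_subspace by blast
qed

lemma g3_brk_closed: "a \<in> carrier G3 \<Longrightarrow> b \<in> carrier G3 \<Longrightarrow> g3_brk a b \<in> carrier G3"
proof -
  assume a: "a \<in> carrier G3" and b: "b \<in> carrier G3"
  obtain D m11 m12 m21 m22 p q where A: "a = (D, ((m11, m12), (m21, m22)), p, q)" by (rule g3_cases)
  obtain D' n11 n12 n21 n22 p' q' where B: "b = (D', ((n11, n12), (n21, n22)), p', q')" by (rule g3_cases)
  have h: "D \<in> Der" "D' \<in> Der" "p \<in> imaginary" "q \<in> imaginary" "p' \<in> imaginary" "q' \<in> imaginary" using a b by (auto simp: A B)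
  have "(\<lambda>w. D (D' w) - D' (D w) + zder p q' w - zder q p' w) \<in> Der"
    using h by (intro Der_closed(6)[of "\<lambda>w. _ w + _ w"] Der_closed(5)[of "\<lambda>w. _ w - _ w"] Der_closed(4)) (auto intro: zder_Der)
  thus ?thesis
    using h traceless_simps(1)[OF traceless_simps(6,7), of "((m11, m12), (m21, m22))" "((n11, n12), (n21, n22))" p q p' q']
    by (simp add: A B imaginary_simps Der_imaginary)
qed

lemma g3_brk_linear:
  assumes "a \<in> carrier G3" "b \<in> carrier G3" "c \<in> carrier G3"
  shows "g3_brk (a + b) c = g3_brk a c + g3_brk b c" "g3_brk a (b + c) = g3_brk a b + g3_brk a c"
    "g3_brk (g3_scale k a) b = g3_scale k (g3_brk a b)" "g3_brk a (g3_scale k b) = g3_scale k (g3_brk a b)"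
proof -
  obtain D m11 m12 m21 m22 p q where A: "a = (D, ((m11, m12), (m21, m22)), p, q)" by (rule g3_cases)
  obtain D' n11 n12 n21 n22 p' q' where B: "b = (D', ((n11, n12), (n21, n22)), p', q')" by (rule g3_cases)
  obtain D'' o11 o12 o21 o22 p'' q'' where C: "c = (D'', ((o11, o12), (o21, o22)), p'', q'')" by (rule g3_cases)
  have h: "D \<in> Der" "D' \<in> Der" "D'' \<in> Der" using assms by (auto simp: A B C)
  show "g3_brk (a + b) c = g3_brk a c + g3_brk b c" "g3_brk a (b + c) = g3_brk a b + g3_brk a c"
    "g3_brk (g3_scale k a) b = g3_scale k (g3_brk a b)" "g3_brk a (g3_scale k b) = g3_scale k (g3_brk a b)"
    unfolding A B C
    by (simp_all add: fun_eq_iff Der_simps[OF h(1)] Der_simps[OF h(2)] Der_simps[OF h(3)] zder_bilin odd_brk_sl2_def algebra_simps)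
qed

text \<open>The components along e_1 and e_2 of the cyclic sum for the odd elements (p, q), (r, s),
  (t, u). Each is a signed sum of three instances of \<open>zder_cyclic\<close>, brought to the form
  J = 0.\<close>

lemma g3_odd_jacobi:
  assumes "p \<in> imaginary" "q \<in> imaginary" "r \<in> imaginary" "s \<in> imaginary" "t \<in> imaginary" "u \<in> imaginary"
  shows "zder p s t - zder q r t - zscale (2 * (ztrace p s + ztrace q r)) t + zscale (4 * ztrace p r) u
    + (zder r u p - zder s t p - zscale (2 * (ztrace r u + ztrace s t)) p + zscale (4 * ztrace r t) q)
    + (zder p u r - zder q t r - zscale (2 * (ztrace p u + ztrace q t)) r + zscale (4 * ztrace p t) s) = 0" (is "?L1 = 0")
    "zder p s u - zder q r u - zscale (4 * ztrace q s) t + zscale (2 * (ztrace p s + ztrace q r)) u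
    + (zder r u q - zder s t q - zscale (4 * ztrace s u) p + zscale (2 * (ztrace r u + ztrace s t)) q)
    + (zder p u s - zder q t s - zscale (4 * ztrace q u) r + zscale (2 * (ztrace p u + ztrace q t)) s) = 0" (is "?L2 = 0")
proof -
  define J where "J x y z = zder x y z + zder x z y + zscale (2 * ztrace x y) z + zscale (2 * ztrace x z) y - zscale (4 * ztrace y z) x" for x y z
  have J: "J x y z = 0" if "x \<in> imaginary" "y \<in> imaginary" "z \<in> imaginary" for x y z
    using zder_cyclic[OF that] by (simp add: J_def)
  note a = zder_antisym[OF assms(1,4)] zder_antisym[OF assms(3,6)] zder_antisym[OF assms(1,6)]
  note b = zder_antisym[OF assms(2,3)] zder_antisym[OF assms(4,5)] zder_antisym[OF assms(2,5)]
  have "?L1 = - J q r t - J s p t - J u r p"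
    by (simp add: J_def a ztrace_commute[of s p] ztrace_commute[of u p] ztrace_commute[of u r] ztrace_commute[of r p] algebra_simps)
  thus "?L1 = 0" using J assms by simp
  have "?L2 = J p s u + J r q u + J t s q"
    by (simp add: J_def b ztrace_commute[of r q] ztrace_commute[of t s] ztrace_commute[of t q] ztrace_commute[of s q] algebra_simps)
  thus "?L2 = 0" using J assms by simp
qed

text \<open>The parities of a and b decide the sign. If one of them is even, the Leibniz rule,
  \<open>Der_zder\<close> and invariance of the trace form suffice; for two odd elements the odd
  part of c also requires \<open>g3_odd_jacobi\<close>.\<close>

lemma g3_jacobi:
  assumes a: "a \<in> part G3 P" and b: "b \<in> part G3 Q" and c: "c \<in> carrier G3"
  shows "g3_brk (g3_brk a b) c = g3_brk a (g3_brk b c) + g3_scale (- koszul P Q) (g3_brk b (g3_brk a c))"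
proof -
  obtain D m11 m12 m21 m22 p q where A: "a = (D, ((m11, m12), (m21, m22)), p, q)" by (rule g3_cases)
  obtain D' n11 n12 n21 n22 r s where B: "b = (D', ((n11, n12), (n21, n22)), r, s)" by (rule g3_cases)
  obtain D'' o11 o12 o21 o22 t u where C: "c = (D'', ((o11, o12), (o21, o22)), t, u)" by (rule g3_cases)
  have oc: "o22 = - o11" "D'' \<in> Der" "t \<in> imaginary" "u \<in> imaginary" using c by (auto simp: C traceless_neg)
   
  consider "\<not> P" "\<not> Q" | "\<not> P" Q | P "\<not> Q" | P Q by blast
  thus ?thesis
  proof cases
    case 1
    hence h: "D \<in> Der" "D' \<in> Der" "p = 0" "q = 0" "r = 0" "s = 0" "m22 = - m11" "n22 = - n11"
      using a b by (auto simp: part_def A B traceless_neg)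
    show ?thesis unfolding A B C h(3-) using 1 h(1,2) oc
      by (simp add: koszul_def zscale_double fun_eq_iff Der_simps[OF h(1)] Der_simps[OF h(2)] Der_simps[OF oc(2)] zder_bilin odd_brk_sl2_def algebra_simps)
  next
    case 2
    hence h: "D \<in> Der" "D' = 0" "p = 0" "q = 0" "r \<in> imaginary" "s \<in> imaginary" "m22 = - m11" "n11 = 0" "n12 = 0" "n21 = 0" "n22 = 0"
      using a b by (auto simp: part_def A B traceless_neg zero_prod_def)
    note tr = Der_ztrace[OF h(1)]
    show ?thesis unfolding A B C h(2-4,7-) using 2 h(1,5,6) oc
      by (simp add: koszul_def zscale_double fun_eq_iff Der_simps[OF h(1)] Der_simps[OF oc(2)] Der_zder[OF h(1)] zder_bilin odd_brk_sl2_def tr algebra_simps)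
  next
    case 3
    hence h: "D' \<in> Der" "D = 0" "r = 0" "s = 0" "p \<in> imaginary" "q \<in> imaginary" "n22 = - n11" "m11 = 0" "m12 = 0" "m21 = 0" "m22 = 0"
      using a b by (auto simp: part_def A B traceless_neg zero_prod_def)
    note tr = Der_ztrace[OF h(1)]
    show ?thesis unfolding A B C h(2-4,7-) using 3 h(1,5,6) oc
      by (simp add: koszul_def zscale_double fun_eq_iff Der_simps[OF h(1)] Der_simps[OF oc(2)] Der_zder[OF h(1)] zder_bilin odd_brk_sl2_def tr algebra_simps)
  next
    case 4
    hence h: "D = 0" "D' = 0" "r \<in> imaginary" "s \<in> imaginary" "p \<in> imaginary" "q \<in> imaginary" "n11 = 0" "n12 = 0" "n21 = 0" "n22 = 0" "m11 = 0" "m12 = 0" "m21 = 0" "m22 = 0"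
      using a b by (auto simp: part_def A B traceless_neg zero_prod_def)
    note im = Der_imaginary[OF oc(2)]
    note an = zder_antisym[OF im h(3), of q] zder_antisym[OF im h(4), of p] zder_antisym[OF h(5,3)] zder_antisym[OF h(6,3)] zder_antisym[OF h(5,4)] zder_antisym[OF h(6,4)]
    have tr: "ztrace y (D'' x) = - ztrace x (D'' y)" if "x \<in> imaginary" "y \<in> imaginary" for x y
      using Der_ztrace[OF oc(2) that] ztrace_commute[of y] by simp
    note tc = ztrace_commute[of r p] ztrace_commute[of r q] ztrace_commute[of s p] ztrace_commute[of s q]
      tr[OF h(6,3)] tr[OF h(5,4)] tr[OF h(5,3)] tr[OF h(6,4)]
    note j = g3_odd_jacobi[OF h(5,6,3,4) oc(3,4)]
    have d: "zder p s \<in> Der" "zder q r \<in> Der" using h by (auto intro: zder_Der)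
    show ?thesis unfolding A B C h(1,2,7-) using 4 h(3-6) oc j
      by (simp add: koszul_def fun_eq_iff Der_simps[OF oc(2)] Der_zder[OF oc(2)] zder_bilin odd_brk_sl2_def an tc algebra_simps)
  qed
qed

lemma g3_brk_part: "a \<in> part G3 P \<Longrightarrow> b \<in> part G3 Q \<Longrightarrow> g3_brk a b \<in> part G3 (P \<noteq> Q)"
proof -
  assume a: "a \<in> part G3 P" and b: "b \<in> part G3 Q"
  obtain D A p q where A: "a = (D, A, p, q)" by (metis prod.collapse)
  obtain D' B r s where B: "b = (D', B, r, s)" by (metis prod.collapse)
  have "a \<in> carrier G3" "b \<in> carrier G3" using a b by (auto simp: part_def Der_closed traceless_simps imaginary_simps split: if_splits)
  hence "g3_brk a b \<in> carrier G3" by (rule g3_brk_closed)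
  thus ?thesis using a b
    by (cases P; cases Q; simp add: part_def A B zder_bilin odd_brk_sl2_def mat2_zero[symmetric] Der_simps zero_fun_def[symmetric] mat_act_pair_zero;
        (simp add: zero_prod_def[where 'a = zorn and 'b = zorn])?)
qed

lemma g3_brk_skew: "a \<in> part G3 P \<Longrightarrow> b \<in> part G3 Q \<Longrightarrow> g3_brk a b = g3_scale (- koszul P Q) (g3_brk b a)"
proof -
  assume a: "a \<in> part G3 P" and b: "b \<in> part G3 Q"
  obtain D m11 m12 m21 m22 p q where A: "a = (D, ((m11, m12), (m21, m22)), p, q)" by (rule g3_cases)
  obtain D' n11 n12 n21 n22 r s where B: "b = (D', ((n11, n12), (n21, n22)), r, s)" by (rule g3_cases)
  consider "\<not> P" "\<not> Q" | "\<not> P" Q | P "\<not> Q" | P Q by blast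
  thus ?thesis
  proof cases
    case 4
    hence h: "D = 0" "D' = 0" "r \<in> imaginary" "s \<in> imaginary" "p \<in> imaginary" "q \<in> imaginary" "n11 = 0" "n12 = 0" "n21 = 0" "n22 = 0" "m11 = 0" "m12 = 0" "m21 = 0" "m22 = 0"
      using a b by (auto simp: part_def A B traceless_neg mat2_zero)
    show ?thesis unfolding A B h(1,2,7-) using 4 h(3-6)
      by (simp add: fun_eq_iff koszul_def odd_brk_sl2_def zder_antisym[OF h(5,4)] zder_antisym[OF h(6,3)]
        ztrace_commute[of r p] ztrace_commute[of r q] ztrace_commute[of s p] ztrace_commute[of s q] algebra_simps)
  qed (use a b in \<open>auto simp: A B part_def koszul_def fun_eq_iff zder_bilin odd_brk_sl2_def mat2_zero Der_simps algebra_simps\<close>)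
qed

lemma lie_superalgebra_G3: "lie_superalgebra G3"
proof -
  have "bilinear_on G3 G3 G3 (brk G3)"
    using g3_brk_linear g3_brk_closed unfolding bilinear_on_def LinearCombinations.module_hom_def
    by (auto simp del: G3_simps(1) simp: Pi_iff) 
  thus ?thesis
    unfolding lie_superalgebra_def G3_simps(3,4,7)
    by (intro conjI allI ballI superspace_G3 g3_brk_part g3_brk_skew g3_jacobi)
qed

section \<open>Subquotients\<close>

lemma (in sspace) homogeneous_coeff:
  assumes "finite B" "lin_indpt B" "B \<subseteq> even_part M \<union> odd_part M" "lincomb a B \<in> part M p" "b \<in> B" "a b \<noteq> 0"
  shows "b \<in> part M p"
proof (rule ccontr)
  assume "b \<notin> part M p"
  let ?P = "part M p" and ?Q = "part M (\<not> p)"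
  have bQ: "b \<in> B - ?P" using assms(5) \<open>b \<notin> ?P\<close> by auto
  have PQ: "submodule \<CC> ?P M" "submodule \<CC> ?Q M" "B \<subseteq> ?P \<union> ?Q" using parts_sub assms(3) by (auto simp: part_def)
  have BM: "B \<subseteq> carrier M" using assms(3) parts_carrier by auto
  have "lincomb a ((B \<inter> ?P) \<union> (B - ?P)) = lincomb a (B \<inter> ?P) \<oplus> lincomb a (B - ?P)"
    by (rule lincomb_union) (use assms(1) BM in auto)
  moreover have "(B \<inter> ?P) \<union> (B - ?P) = B" by auto
  ultimately have v': "lincomb a B = lincomb a (B \<inter> ?P) \<oplus> lincomb a (B - ?P)" by simp
  have c: "lincomb a (B - ?P) \<in> carrier M" "lincomb a (B \<inter> ?P) \<in> carrier M"
    by (rule lc_closed, use BM in auto)+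
  have "lincomb a (B - ?P) = lincomb a B \<oplus> (-1) \<odot> lincomb a (B \<inter> ?P)" unfolding v' by (rule sub_right[OF c(2,1)])
  also have "\<dots> \<in> ?P" using assms(1,4) PQ(1) by (auto intro!: sub_add sub_smul sub_lc)
  finally have "lincomb a (B - ?P) \<in> ?P" .
  moreover have "lincomb a (B - ?P) \<in> ?Q" by (rule sub_lc[OF PQ(2)]) (use assms(1) PQ in auto)
  ultimately have z: "lincomb a (B - ?P) = \<zero>" using parts_disjoint by (cases p) (auto simp: part_def)
  have "lin_indpt (B - ?P)" by (rule subset_li_is_li[OF assms(2)]) auto
  thus False using indep_coeff[OF _ _ z bQ] assms(1,6) by auto
qed

lemma (in sspace) dim_eigenspace:
  assumes B: "finite B" "basis B" "B \<subseteq> even_part M \<union> odd_part M" and T: "endo T" "\<And>b. b \<in> B \<Longrightarrow> T b = t b \<odot> b"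
  shows "vectorspace.dim \<CC> (vs {v \<in> part M p. T v = k \<odot> v}) = card {b \<in> B. b \<in> part M p \<and> t b = k}"
proof (rule dim_sub_basis)
  have li: "lin_indpt B" and BM: "B \<subseteq> carrier M" and sp: "span B = carrier M" using B(2) by (auto simp: basis_def)
  have P: "submodule \<CC> (part M p) M" using parts_sub by (simp add: part_def)
  have PM: "part M p \<subseteq> carrier M" by (rule sub_carrier[OF P])
  show "submodule \<CC> {v \<in> part M p. T v = k \<odot> v} M"
    by (rule subI) (use PM P T(1) in \<open>auto simp: sub_add sub_smul sub_zero subset_eq endo_simps smul_r_distr smul_assoc[symmetric] mult.commute\<close>)
  show "finite {b \<in> B. b \<in> part M p \<and> t b = k}" using B(1) by auto
  show "{b \<in> B. b \<in> part M p \<and> t b = k} \<subseteq> {v \<in> part M p. T v = k \<odot> v}" using T(2) by auto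
  show "lin_indpt {b \<in> B. b \<in> part M p \<and> t b = k}" by (rule subset_li_is_li[OF li]) auto
  show "{v \<in> part M p. T v = k \<odot> v} \<subseteq> span {b \<in> B. b \<in> part M p \<and> t b = k}" (is "_ \<subseteq> span ?S")
  proof
    fix v assume v: "v \<in> {v \<in> part M p. T v = k \<odot> v}"
    hence "v \<in> span B" using sp PM by auto
    then obtain a where a: "v = lincomb a B" using span_iff[OF B(1) BM] by blast
    have "lincomb (\<lambda>b. t b * a b + (-1) * (k * a b)) B = T v \<oplus> (-1) \<odot> (k \<odot> v)"
      using endo_lc[OF T(1) B(1) BM T(2), of a] B(1) BM unfolding a by (simp only: lc_add lc_smult)
    also have "\<dots> = \<zero>" using v PM by (auto simp: smul_uminus M.r_neg)
    finally have "t b * a b + (-1) * (k * a b) = 0" if "b \<in> B" for b using indep_coeff[OF li B(1) _ that] by blast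
    hence "a b = 0 \<or> t b = k" if "b \<in> B" for b using that by (fastforce simp: algebra_simps)
    hence s: "b \<in> ?S" if "b \<in> B" "a b \<noteq> 0" for b
      using that homogeneous_coeff[OF B(1) li B(3), of a p b] v a by auto
    have "lincomb a ?S = lincomb (\<lambda>b. if b \<in> ?S then a b else 0) B" by (rule lc_sub) (use B BM in auto)
    also have "\<dots> = v" unfolding a by (rule lc_cong[OF BM]) (use s in auto)
    finally show "v \<in> span ?S" using span_iff[of ?S v] B(1) BM by auto
  qed
qed

lemma (in cvs) eq_of_diff: "u \<in> carrier V \<Longrightarrow> v \<in> carrier V \<Longrightarrow> u \<oplus> (-1) \<odot> v = \<zero> \<Longrightarrow> u = v"
  by (metis M.add.inv_closed M.minus_equality M.minus_minus smul_1 smul_uminus M.add.m_comm)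

text \<open>Q is any record with the fields of the subquotient, so that \<open>DS_mod\<close>, which
  carries an action in addition, is an instance. The conditions \<open>Zgr\<close> and
  \<open>Wgr\<close> say that Z and W are graded; they make the two parts of Q span it and meet only
  in zero.\<close>

locale subquot = sspace V for V :: "('v, 'm) superspace_scheme" (structure) +
  fixes Z W :: "'v set" and Q :: "('v set, 'n) superspace_scheme"
  assumes Z: "submodule \<CC> Z V" and W: "submodule \<CC> W V" and WZ: "W \<subseteq> Z"
    and Zgr: "u \<in> even_part V \<Longrightarrow> w \<in> odd_part V \<Longrightarrow> u \<oplus> w \<in> Z \<Longrightarrow> u \<in> Z \<and> w \<in> Z"
    and Wgr: "u \<in> even_part V \<Longrightarrow> w \<in> odd_part V \<Longrightarrow> u \<oplus> w \<in> W \<Longrightarrow> u \<in> W \<and> w \<in> W"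
    and Q: "carrier Q = (\<lambda>v. W +> v) ` Z" "\<zero>\<^bsub>Q\<^esub> = W" "(\<oplus>\<^bsub>Q\<^esub>) = set_add V"
      "(\<odot>\<^bsub>Q\<^esub>) = (\<lambda>c A. \<Union>a\<in>A. W +> (c \<odot> a))"
      "even_part Q = (\<lambda>v. W +> v) ` (Z \<inter> even_part V)" "odd_part Q = (\<lambda>v. W +> v) ` (Z \<inter> odd_part V)"
begin

abbreviation q :: "'v \<Rightarrow> 'v set" where "q v \<equiv> W +> v"

lemma ZV: "v \<in> Z \<Longrightarrow> v \<in> carrier V" and WV: "v \<in> W \<Longrightarrow> v \<in> carrier V"
  using sub_carrier[OF Z] sub_carrier[OF W] by auto

lemma q_def: "q v = {w \<oplus> v |w. w \<in> W}"
  by (auto simp: a_r_coset_def')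

lemma mem_q: "u \<in> carrier V \<Longrightarrow> v \<in> carrier V \<Longrightarrow> u \<in> q v \<longleftrightarrow> u \<oplus> (-1) \<odot> v \<in> W"
proof
  assume u: "u \<in> carrier V" "v \<in> carrier V"
  show "u \<oplus> (-1) \<odot> v \<in> W" if "u \<in> q v"
  proof -
    from that obtain w where w: "w \<in> W" "u = w \<oplus> v" by (auto simp: q_def)
    have "u \<oplus> (-1) \<odot> v = w" using w u WV by (simp add: M.add.m_assoc smul_uminus M.r_neg)
    thus ?thesis using w by simp
  qed
  show "u \<in> q v" if "u \<oplus> (-1) \<odot> v \<in> W"
  proof -
    have "u = (u \<oplus> (-1) \<odot> v) \<oplus> v" using u by (simp add: M.add.m_assoc smul_uminus M.l_neg)
    thus ?thesis using that by (auto simp: q_def)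
  qed
qed

lemma q_self: "v \<in> carrier V \<Longrightarrow> v \<in> q v"
  using sub_zero[OF W] by (auto simp: q_def intro!: exI[of _ \<zero>])

lemma q_eqI: "w \<in> W \<Longrightarrow> v \<in> carrier V \<Longrightarrow> q (w \<oplus> v) = q v"
proof -
  assume w: "w \<in> W" and v: "v \<in> carrier V"
  show ?thesis
  proof (intro equalityI subsetI)
    fix y assume "y \<in> q (w \<oplus> v)"
    then obtain w' where "w' \<in> W" "y = w' \<oplus> (w \<oplus> v)" by (auto simp: q_def)
    hence "y = (w' \<oplus> w) \<oplus> v" "w' \<oplus> w \<in> W" using w v WV by (auto simp: M.add.m_assoc sub_add[OF W])
    thus "y \<in> q v" by (auto simp: q_def)
  next
    fix y assume "y \<in> q v"
    then obtain w' where w': "w' \<in> W" "y = w' \<oplus> v" by (auto simp: q_def)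
    have "y = (w' \<oplus> (-1) \<odot> w) \<oplus> (w \<oplus> v)" using w w' v WV
      by (simp add: M.add.m_assoc smul_uminus M.r_neg1)
    moreover have "w' \<oplus> (-1) \<odot> w \<in> W" using w w' by (auto intro!: sub_add[OF W] sub_smul[OF W])
    ultimately show "y \<in> q (w \<oplus> v)" by (auto simp: q_def)
  qed
qed

lemma q_eq_iff: "u \<in> carrier V \<Longrightarrow> v \<in> carrier V \<Longrightarrow> q u = q v \<longleftrightarrow> u \<oplus> (-1) \<odot> v \<in> W"
proof
  assume u: "u \<in> carrier V" "v \<in> carrier V"
  show "u \<oplus> (-1) \<odot> v \<in> W" if "q u = q v" using that q_self[OF u(1)] mem_q[OF u] by auto
  show "q u = q v" if "u \<oplus> (-1) \<odot> v \<in> W"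
    using q_eqI[OF that u(2)] u by (simp add: M.add.m_assoc smul_uminus M.l_neg)
qed

lemma q_zero: "q \<zero> = W" using WV by (auto simp: q_def intro!: exI)

lemma q_eq_zero: "v \<in> carrier V \<Longrightarrow> q v = W \<longleftrightarrow> v \<in> W"
  using q_eq_iff[of v \<zero>] q_zero by simp

lemma q_add: "u \<in> carrier V \<Longrightarrow> v \<in> carrier V \<Longrightarrow> q u \<oplus>\<^bsub>Q\<^esub> q v = q (u \<oplus> v)"
proof -
  assume u: "u \<in> carrier V" and v: "v \<in> carrier V"
  show ?thesis unfolding Q set_add_def'
  proof (intro equalityI subsetI)
    fix y assume "y \<in> (\<Union>h\<in>q u. \<Union>k\<in>q v. {h \<oplus> k})"
    then obtain w w' where w: "w \<in> W" "w' \<in> W" "y = (w \<oplus> u) \<oplus> (w' \<oplus> v)" by (auto simp: q_def)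
    hence "y = (w \<oplus> w') \<oplus> (u \<oplus> v)" using u v WV by (simp add: M.add.m_ac)
    thus "y \<in> q (u \<oplus> v)" using sub_add[OF W] w by (auto simp: q_def)
  next
    fix y assume "y \<in> q (u \<oplus> v)"
    then obtain w where w: "w \<in> W" "y = w \<oplus> (u \<oplus> v)" by (auto simp: q_def)
    hence "y = (w \<oplus> u) \<oplus> v" "w \<oplus> u \<in> q u" using u v WV by (auto simp: M.add.m_assoc q_def)
    thus "y \<in> (\<Union>h\<in>q u. \<Union>k\<in>q v. {h \<oplus> k})" using q_self[OF v] by auto
  qed
qed

text \<open>Operations on cosets are unions over representatives; independence of the representative
  collapses the union to one coset.\<close>

lemma q_UN:
  assumes "v \<in> carrier V" "\<And>w. w \<in> W \<Longrightarrow> q (f (w \<oplus> v)) = q (f v)"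
  shows "(\<Union>a\<in>q v. q (f a)) = q (f v)"
  using assms q_self[OF assms(1)] by (auto simp: q_def[of v])

lemma q_smul: "v \<in> carrier V \<Longrightarrow> c \<odot>\<^bsub>Q\<^esub> q v = q (c \<odot> v)"
  unfolding Q by (rule q_UN) (auto simp: smul_r_distr WV sub_smul[OF W] q_eqI)

lemma superspace_Q: "superspace Q" and q_hom: "q \<in> LinearCombinations.module_hom \<CC> (vs Z) Q"
proof -
  have c: "carrier Q = q ` Z" by (rule Q)
  interpret Q: cvs Q
  proof (rule cvsI, rule module_criteria)
    show "cring \<CC>" by (rule class_cring.cring_axioms)
    show "\<zero>\<^bsub>Q\<^esub> \<in> carrier Q" using imageI[OF sub_zero[OF Z], of q] by (simp add: c Q(2) q_zero)
    show "\<forall>v w. v \<in> carrier Q \<and> w \<in> carrier Q \<longrightarrow> v \<oplus>\<^bsub>Q\<^esub> w \<in> carrier Q"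
      using sub_add[OF Z] by (auto simp: c q_add ZV)
    show "\<forall>v\<in>carrier Q. \<exists>w\<in>carrier Q. v \<oplus>\<^bsub>Q\<^esub> w = \<zero>\<^bsub>Q\<^esub>"
    proof
      fix v assume "v \<in> carrier Q"
      then obtain u where u: "u \<in> Z" "v = q u" by (auto simp: c)
      have "v \<oplus>\<^bsub>Q\<^esub> q ((-1) \<odot> u) = \<zero>\<^bsub>Q\<^esub>" using u ZV[OF u(1)] by (simp add: q_add smul_uminus M.r_neg Q(2) q_zero)
      thus "\<exists>w\<in>carrier Q. v \<oplus>\<^bsub>Q\<^esub> w = \<zero>\<^bsub>Q\<^esub>" using sub_smul[OF Z u(1)] c by blast
    qed
    show "\<forall>c v. c \<in> carrier \<CC> \<and> v \<in> carrier Q \<longrightarrow> c \<odot>\<^bsub>Q\<^esub> v \<in> carrier Q"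
      using sub_smul[OF Z] by (auto simp: c q_smul ZV)
    show "\<forall>v\<in>carrier Q. v \<oplus>\<^bsub>Q\<^esub> \<zero>\<^bsub>Q\<^esub> = v"
    proof
      fix v assume "v \<in> carrier Q"
      then obtain u where u: "u \<in> Z" "v = q u" by (auto simp: c)
      show "v \<oplus>\<^bsub>Q\<^esub> \<zero>\<^bsub>Q\<^esub> = v" using q_add[of u \<zero>] u ZV[OF u(1)] by (simp add: Q(2) q_zero)
    qed
  qed (auto simp: c q_add q_smul ZV smul_assoc smul_l_distr smul_r_distr M.add.m_ac)
  show hom: "q \<in> LinearCombinations.module_hom \<CC> (vs Z) Q"
    by (auto simp: LinearCombinations.module_hom_def c q_add q_smul ZV)
  have sub: "submodule \<CC> (q ` (Z \<inter> P)) Q" if P: "submodule \<CC> P V" for P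
  proof (rule Q.subI)
    show "\<zero>\<^bsub>Q\<^esub> \<in> q ` (Z \<inter> P)"
      using imageI[of \<zero> "Z \<inter> P" q] sub_zero[OF Z] sub_zero[OF P] by (simp add: Q(2) q_zero)
  qed (use sub_add[OF Z] sub_add[OF P] sub_smul[OF Z] sub_smul[OF P] in \<open>auto simp: c q_add q_smul ZV\<close>)
  have "even_part Q \<inter> odd_part Q = {\<zero>\<^bsub>Q\<^esub>}"
  proof (intro equalityI subsetI)
    fix A assume "A \<in> even_part Q \<inter> odd_part Q"
    then obtain u w where u: "u \<in> Z" "u \<in> even_part V" "A = q u" and w: "w \<in> Z" "w \<in> odd_part V" "A = q w" by (auto simp: Q)
    have "u \<oplus> (-1) \<odot> w \<in> W" using q_eq_iff[of u w] u w ZV by auto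
    hence "u \<in> W" using Wgr[OF u(2), of "(-1) \<odot> w"] w parts_sub by (auto simp: sub_smul)
    thus "A \<in> {\<zero>\<^bsub>Q\<^esub>}" using q_eq_zero u ZV by (auto simp: Q)
  next
    fix A assume "A \<in> {\<zero>\<^bsub>Q\<^esub>}"
    thus "A \<in> even_part Q \<inter> odd_part Q"
      using Q.sub_zero[OF sub[OF parts_sub(1)]] Q.sub_zero[OF sub[OF parts_sub(2)]] by (simp add: Q(5,6))
  qed
  moreover have "carrier Q = {u \<oplus>\<^bsub>Q\<^esub> v |u v. u \<in> even_part Q \<and> v \<in> odd_part Q}"
  proof (intro equalityI subsetI)
    fix A assume "A \<in> carrier Q"
    then obtain v where v: "v \<in> Z" "A = q v" by (auto simp: c)
    obtain u w where uw: "u \<in> even_part V" "w \<in> odd_part V" "v = u \<oplus> w" using parts_decomp[OF ZV[OF v(1)]] by blast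
    have "u \<in> Z" "w \<in> Z" using Zgr[OF uw(1,2)] uw v by auto
    hence "A = q u \<oplus>\<^bsub>Q\<^esub> q w" "q u \<in> even_part Q" "q w \<in> odd_part Q" using uw v ZV by (auto simp: q_add Q(5,6))
    thus "A \<in> {u \<oplus>\<^bsub>Q\<^esub> v |u v. u \<in> even_part Q \<and> v \<in> odd_part Q}" by blast
  next
    fix A assume "A \<in> {u \<oplus>\<^bsub>Q\<^esub> v |u v. u \<in> even_part Q \<and> v \<in> odd_part Q}"
    thus "A \<in> carrier Q" using sub_add[OF Z] by (auto simp: c Q(5,6) q_add ZV)
  qed
  ultimately show "superspace Q"
    using Q.vectorspace_axioms sub[OF parts_sub(1)] sub[OF parts_sub(2)] Q(5,6)
    unfolding superspace_def Q.submodule_subspace by simp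
qed

lemma q_lc:
  assumes "finite S" "S \<subseteq> Z"
  shows "q (lincomb a S) = finsum Q (\<lambda>v. a v \<odot>\<^bsub>Q\<^esub> q v) S"
proof -
  interpret Z: cvs "vs Z" by (rule sub_cvs[OF Z])
  have "cvs Q" using superspace_Q by (simp add: superspace_def cvs_def)
  have "lincomb a S = Z.lincomb a S"
    by (rule lincomb_not_depend) (use assms Z in auto)
  thus ?thesis using Z.lc_hom[OF assms(1) _ \<open>cvs Q\<close> q_hom, of a] assms(2) by simp
qed

text \<open>A relation between the classes of C is a combination of C lying in W, hence also a
  combination of I; independence of C and I together makes it trivial.\<close>

lemma basis_Q:
  assumes C: "finite C" "finite I" "C \<subseteq> Z" "I \<subseteq> W" "C \<inter> I = {}" "lin_indpt (C \<union> I)" and sI: "W \<subseteq> span I" and sCI: "Z \<subseteq> span (C \<union> I)"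
  shows "vectorspace.basis \<CC> Q (q ` C)" "inj_on q C"
proof -
  interpret Q: sspace Q by (rule sspaceI[OF superspace_Q])
  have CV: "C \<subseteq> carrier V" "I \<subseteq> carrier V" using C ZV WV by auto
  have un: "lincomb a (C \<union> I) = lincomb a C \<oplus> lincomb a I" for a
    by (rule lincomb_union) (use C CV in auto)
  have key: "a v = 0" if "lincomb a C \<in> W" "v \<in> C" for a v
  proof -
    have "lincomb a C \<in> span I" using that(1) sI by blast
    then obtain b where b: "lincomb a C = lincomb b I" unfolding span_iff[OF C(2) CV(2)] by blast
    define c where "c v = (if v \<in> C then a v else (-1) * b v)" for v
    have "lincomb c I = lincomb (\<lambda>v. (-1) * b v) I" by (rule lc_cong[OF CV(2)]) (use C(5) in \<open>auto simp: c_def\<close>)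
    also have "\<dots> = (-1) \<odot> lincomb b I" by (rule lc_smult[OF CV(2)])
    finally have "lincomb c I = (-1) \<odot> lincomb b I" .
    moreover have "lincomb c C = lincomb a C" by (rule lc_cong[OF CV(1)]) (auto simp: c_def)
    ultimately have "lincomb c (C \<union> I) = lincomb b I \<oplus> (-1) \<odot> lincomb b I" unfolding un b by simp
    also have "\<dots> = \<zero>" using CV by (simp add: smul_uminus M.r_neg)
    finally have "c v = 0" using indep_coeff[OF C(6)] C that(2) by blast
    thus ?thesis using that(2) by (simp add: c_def)
  qed
  show inj: "inj_on q C"
  proof (rule inj_onI, rule ccontr)
    fix c d assume cd: "c \<in> C" "d \<in> C" "q c = q d" "c \<noteq> d"
    have "lincomb (\<lambda>v. (if v = c then 1 else 0) + (if v = d then -1 else 0)) C = c \<oplus> (-1) \<odot> d"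
      using cd CV lc_single[OF C(1) CV(1)] by (subst lc_add[OF C(1) CV(1)]) auto
    also have "\<dots> \<in> W" using cd CV q_eq_iff[of c d] by auto
    finally show False using key[OF _ cd(1)] cd(4) by force
  qed
  have QC: "q ` C \<subseteq> carrier Q" using C by (auto simp: Q)
  have lcQ: "Q.lincomb a (q ` C) = q (lincomb (\<lambda>v. a (q v)) C)" for a
  proof -
    have "Q.lincomb a (q ` C) = finsum Q (\<lambda>v. a (q v) \<odot>\<^bsub>Q\<^esub> q v) C"
      unfolding Q.lincomb_def by (rule Q.M.finsum_reindex[OF _ inj]) (use QC in \<open>auto simp: Pi_iff\<close>)
    thus ?thesis using q_lc[OF C(1,3)] by simp
  qed
  have "Q.lin_indpt (q ` C)"
  proof (rule Q.indepI)
    fix a A assume a: "Q.lincomb a (q ` C) = \<zero>\<^bsub>Q\<^esub>" and "A \<in> q ` C"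
    then obtain c where c: "c \<in> C" "A = q c" by auto
    have "lincomb (\<lambda>v. a (q v)) C \<in> W" using a q_eq_zero CV by (simp add: lcQ Q(2))
    thus "a A = 0" using key[of "\<lambda>v. a (q v)", OF _ c(1)] c by simp
  qed (use C QC in auto)
  moreover have "carrier Q \<subseteq> Q.span (q ` C)"
  proof
    fix A assume "A \<in> carrier Q"
    then obtain v where v: "v \<in> Z" "A = q v" by (auto simp: Q)
    then obtain a where a: "v = lincomb a (C \<union> I)" using sCI span_iff[of "C \<union> I" v] C CV by auto
    have "v = lincomb a I \<oplus> lincomb a C" using CV by (simp add: a un M.add.m_comm)
    moreover have "lincomb a I \<in> W" by (rule sub_lc[OF W C(2,4)])
    ultimately have "A = q (lincomb a C)" using q_eqI CV by (simp add: v)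
    also have "lincomb a C = lincomb (\<lambda>v. a (the_inv_into C q (q v))) C"
      by (rule lc_cong[OF CV(1)]) (simp add: the_inv_into_f_f[OF inj])
    finally have "A = Q.lincomb (\<lambda>B. a (the_inv_into C q B)) (q ` C)" by (simp add: lcQ)
    thus "A \<in> Q.span (q ` C)" using Q.span_iff[OF finite_imageI[OF C(1)] QC] by blast
  qed
  ultimately show "Q.basis (q ` C)" using QC Q.span_is_subset2[OF QC] by (auto simp: Q.basis_def)
qed

end

section \<open>Representations and the Duflo--Serganova functor\<close>

locale fd_repn = K: sspace K + sspace M
  for K :: "('g, 'n) lie_super_scheme" and M :: "('g, 'v) rep" (structure) +
  assumes lie: "lie_superalgebra K" and rep: "fd_rep K M"
begin

lemma fd: fin_dim and is_rep: "is_rep K M"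
  using rep by (auto simp: fd_rep_def)

lemma part_carrier: "a \<in> part K p \<Longrightarrow> a \<in> carrier K" "v \<in> part M p \<Longrightarrow> v \<in> carrier M"
  using K.parts_carrier parts_carrier by (auto simp: part_def split: if_splits)

lemma act_endo: "a \<in> carrier K \<Longrightarrow> endo (act M a)"
  using is_rep by (auto simp: is_rep_def bilinear_on_def endo_def)

lemmas act_simps = endo_simps[OF act_endo]

lemma act_add: "a \<in> carrier K \<Longrightarrow> b \<in> carrier K \<Longrightarrow> v \<in> carrier M \<Longrightarrow> act M (a \<oplus>\<^bsub>K\<^esub> b) v = act M a v \<oplus> act M b v"
  and act_smul: "a \<in> carrier K \<Longrightarrow> v \<in> carrier M \<Longrightarrow> act M (c \<odot>\<^bsub>K\<^esub> a) v = c \<odot> act M a v"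
  using is_rep by (auto simp: is_rep_def bilinear_on_def LinearCombinations.module_hom_def)

lemma act_zero: "v \<in> carrier M \<Longrightarrow> act M \<zero>\<^bsub>K\<^esub> v = \<zero>"
  using act_smul[of "\<zero>\<^bsub>K\<^esub>" v 0] act_simps(1)[of "\<zero>\<^bsub>K\<^esub>" v] by simp

lemma act_part: "a \<in> part K p \<Longrightarrow> v \<in> part M r \<Longrightarrow> act M a v \<in> part M (p \<noteq> r)"
  using is_rep by (auto simp: is_rep_def)

lemma act_brk: "a \<in> part K p \<Longrightarrow> b \<in> part K r \<Longrightarrow> v \<in> carrier M \<Longrightarrow>
    act M (brk K a b) v = act M a (act M b v) \<oplus> (- koszul p r) \<odot> act M b (act M a v)"
  using is_rep unfolding is_rep_def by blast

lemma even_commute: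
  assumes "a \<in> part K False" "b \<in> part K r" "v \<in> carrier M"
  shows "act M a (act M b v) = act M b (act M a v) \<oplus> act M (brk K a b) v"
proof -
  have c: "act M a (act M b v) \<in> carrier M" "act M b (act M a v) \<in> carrier M"
    using assms part_carrier by (simp_all add: act_simps)
  have "act M (brk K a b) v = act M a (act M b v) \<oplus> (-1) \<odot> act M b (act M a v)"
    using act_brk[OF assms] by (simp add: koszul_def)
  thus ?thesis using c by (simp add: smul_uminus M.add.m_lcomm M.add.m_assoc M.r_neg)
qed

text \<open>For odd x the bracket [x, x] acts as 2 x^2.\<close>

lemma odd_square:
  assumes "x \<in> part K True" "brk K x x = \<zero>\<^bsub>K\<^esub>" "v \<in> carrier M"
  shows "act M x (act M x v) = \<zero>"
proof -
  have c: "act M x (act M x v) \<in> carrier M" using assms part_carrier by (simp add: act_simps)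
  have "act M (brk K x x) v = act M x (act M x v) \<oplus> (- koszul True True) \<odot> act M x (act M x v)"
    by (rule act_brk[OF assms(1,1,3)])
  hence "(1 + 1) \<odot> act M x (act M x v) = \<zero>"
    using assms c unfolding smul_l_distr[OF c] by (simp add: act_zero koszul_def)
  thus ?thesis using smul_eq_0[OF c, of "1 + 1"] by simp
qed

text \<open>The subspace P is the whole module for diagonalizability and a homogeneous component for
  the symmetry of weights.\<close>

lemma sl2_endos_part:
  assumes e: "e \<in> part K False" and f: "f \<in> part K False" and h: "h \<in> part K False"
    and he: "brk K h e = 2 \<odot>\<^bsub>K\<^esub> e" and hf: "brk K h f = (-2) \<odot>\<^bsub>K\<^esub> f" and ef: "brk K e f = h"
    and P: "submodule \<CC> P M" "\<And>a v. a \<in> part K False \<Longrightarrow> v \<in> P \<Longrightarrow> act M a v \<in> P"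
  shows "sl2_endos (vs P) (act M e) (act M f) (act M h)"
proof -
  interpret P: cvs "vs P" by (rule sub_cvs[OF P(1)])
  have PM: "v \<in> carrier M" if "v \<in> P" for v using that sub_carrier[OF P(1)] by auto
  note c = part_carrier(1)[OF e] part_carrier(1)[OF f] part_carrier(1)[OF h]
  show ?thesis
  proof
    show P.fin_dim by (rule fin_dim_sub[OF fd P(1)])
    show "P.endo (act M e)" "P.endo (act M f)" "P.endo (act M h)"
      using c P(2) e f h by (auto intro!: P.endoI simp: PM act_simps)
    show "act M h (act M e v) = act M e (act M h v) \<oplus>\<^bsub>vs P\<^esub> 2 \<odot>\<^bsub>vs P\<^esub> act M e v" if "v \<in> carrier (vs P)" for v
      using even_commute[OF h e] he act_smul c that PM by simp
    show "act M h (act M f v) = act M f (act M h v) \<oplus>\<^bsub>vs P\<^esub> (-2) \<odot>\<^bsub>vs P\<^esub> act M f v" if "v \<in> carrier (vs P)" for v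
      using even_commute[OF h f] hf act_smul c that PM by simp
    show "act M e (act M f v) = act M f (act M e v) \<oplus>\<^bsub>vs P\<^esub> act M h v" if "v \<in> carrier (vs P)" for v
      using even_commute[OF e f] ef that PM by simp
  qed
qed

lemma sl2_diagonal:
  assumes "e \<in> part K False" "f \<in> part K False" "h \<in> part K False"
    "brk K h e = 2 \<odot>\<^bsub>K\<^esub> e" "brk K h f = (-2) \<odot>\<^bsub>K\<^esub> f" "brk K e f = h"
  shows "diagonal (act M h)"
proof -
  have "sl2_endos (vs (carrier M)) (act M e) (act M f) (act M h)"
    by (rule sl2_endos_part[OF assms]) (auto intro!: subI simp: act_simps part_carrier)
  hence "sl2_endos M (act M e) (act M f) (act M h)" by simp
  thus ?thesis by (rule sl2_endos.diagonal_H)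
qed

text \<open>The triple is even, so the symmetry holds in each parity separately, as the signs in a
  supercharacter require.\<close>

lemma sl2_weights_symmetric:
  assumes sl2: "e \<in> part K False" "f \<in> part K False" "h \<in> part K False"
    "brk K h e = 2 \<odot>\<^bsub>K\<^esub> e" "brk K h f = (-2) \<odot>\<^bsub>K\<^esub> f" "brk K e f = h"
    and B: "finite B" "basis B" "B \<subseteq> even_part M \<union> odd_part M" "\<And>b. b \<in> B \<Longrightarrow> act M h b = t b \<odot> b" and k: "k \<in> \<int>"
  shows "card {b \<in> B. b \<in> part M p \<and> t b = - k} = card {b \<in> B. b \<in> part M p \<and> t b = k}"
proof -
  have P: "submodule \<CC> (part M p) M" using parts_sub by (simp add: part_def)
  interpret S: sl2_endos "vs (part M p)" "act M e" "act M f" "act M h"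
    by (rule sl2_endos_part[OF sl2 P]) (use act_part[of _ False] in auto)
  have "card {b \<in> B. b \<in> part M p \<and> t b = l} = vectorspace.dim \<CC> (vs (S.eig l))" for l
    using dim_eigenspace[OF B(1-3) act_endo[OF part_carrier(1)[OF sl2(3)]] B(4)] by (simp add: S.eig_def)
  thus ?thesis using S.dim_eig_neg[OF k] by simp
qed

end

section \<open>The cohomology of an odd element of square zero and the action on it\<close>

locale ds_repn = fd_repn K M
  for K :: "('g, 'n) lie_super_scheme" and M :: "('g, 'v) rep" (structure) +
  fixes x :: 'g
  assumes xodd: "x \<in> part K True" and xx: "brk K x x = \<zero>\<^bsub>K\<^esub>"
begin

definition "ker = {v \<in> carrier M. act M x v = \<zero>}"
definition "im = act M x ` carrier M"

lemma xK: "x \<in> carrier K" by (rule part_carrier(1)[OF xodd])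

lemma brk_hom: "brk K x \<in> LinearCombinations.module_hom \<CC> K K"
  using lie xK by (simp add: lie_superalgebra_def bilinear_on_def)

lemma brk_x: "a \<in> carrier K \<Longrightarrow> brk K x a \<in> carrier K"
  "a \<in> carrier K \<Longrightarrow> b \<in> carrier K \<Longrightarrow> brk K x (a \<oplus>\<^bsub>K\<^esub> b) = brk K x a \<oplus>\<^bsub>K\<^esub> brk K x b"
  "a \<in> carrier K \<Longrightarrow> brk K x (c \<odot>\<^bsub>K\<^esub> a) = c \<odot>\<^bsub>K\<^esub> brk K x a"
  using LinearCombinations.module_hom_closed[OF brk_hom] LinearCombinations.module_hom_add[OF brk_hom]
    LinearCombinations.module_hom_smult[OF brk_hom] by auto

lemma brk_part: "a \<in> part K p \<Longrightarrow> brk K x a \<in> part K (True \<noteq> p)"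
  using lie xodd unfolding lie_superalgebra_def by blast

lemma ker_sub: "submodule \<CC> ker M"
  by (rule subI) (auto simp: ker_def act_simps xK)

lemma im_sub: "submodule \<CC> im M"
proof (rule subI)
  show "im \<subseteq> carrier M" by (auto simp: im_def act_simps xK)
  show "\<zero> \<in> im" using act_simps(4)[OF xK] by (force simp: im_def)
  show "v \<oplus> w \<in> im" if vw: "v \<in> im" "w \<in> im" for v w
  proof -
    obtain a b where "a \<in> carrier M" "v = act M x a" "b \<in> carrier M" "w = act M x b" using vw by (auto simp: im_def)
    hence "v \<oplus> w = act M x (a \<oplus> b)" "a \<oplus> b \<in> carrier M" by (auto simp: act_simps xK)
    thus ?thesis by (auto simp: im_def)
  qed
  show "c \<odot> v \<in> im" if v: "v \<in> im" for c v
  proof -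
    obtain a where "a \<in> carrier M" "v = act M x a" using v by (auto simp: im_def)
    hence "c \<odot> v = act M x (c \<odot> a)" "c \<odot> a \<in> carrier M" by (auto simp: act_simps xK)
    thus ?thesis by (auto simp: im_def)
  qed
qed

lemma im_ker: "im \<subseteq> ker"
  using odd_square[OF xodd xx] by (auto simp: im_def ker_def act_simps xK)

lemma x_parts: "v \<in> even_part M \<Longrightarrow> act M x v \<in> odd_part M" "v \<in> odd_part M \<Longrightarrow> act M x v \<in> even_part M"
  using act_part[OF xodd, of v False] act_part[OF xodd, of v True] by (auto simp: part_def)

lemma ker_graded: "u \<in> even_part M \<Longrightarrow> w \<in> odd_part M \<Longrightarrow> u \<oplus> w \<in> ker \<Longrightarrow> u \<in> ker \<and> w \<in> ker"
proof -
  assume u: "u \<in> even_part M" and w: "w \<in> odd_part M" and uw: "u \<oplus> w \<in> ker"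
  have c: "u \<in> carrier M" "w \<in> carrier M" using u w parts_carrier by auto
  have "act M x w \<oplus> act M x u = \<zero>" using uw c by (simp add: ker_def act_simps xK M.add.m_comm)
  hence "act M x w = \<zero>" "act M x u = \<zero>" using sum_parts_zero[OF x_parts(2)[OF w] x_parts(1)[OF u]] by auto
  thus ?thesis using c by (simp add: ker_def)
qed

text \<open>If u + w = x (a + b) with a even and b odd, comparing parities gives u = x b and w = x
  a.\<close>

lemma im_graded: "u \<in> even_part M \<Longrightarrow> w \<in> odd_part M \<Longrightarrow> u \<oplus> w \<in> im \<Longrightarrow> u \<in> im \<and> w \<in> im"
proof -
  assume u: "u \<in> even_part M" and w: "w \<in> odd_part M" and uw: "u \<oplus> w \<in> im"
  then obtain v where v: "v \<in> carrier M" "u \<oplus> w = act M x v" by (auto simp: im_def)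
  obtain a b where ab: "a \<in> even_part M" "b \<in> odd_part M" "v = a \<oplus> b" using parts_decomp[OF v(1)] by blast
  have c: "a \<in> carrier M" "b \<in> carrier M" "u \<in> carrier M" "w \<in> carrier M" using ab u w parts_carrier by auto
  note xa = x_parts(1)[OF ab(1)] x_parts(2)[OF ab(2)]
  have d: "act M x a \<in> carrier M" "act M x b \<in> carrier M" using c by (auto simp: act_simps xK)
  have "u \<oplus> w = act M x b \<oplus> act M x a" using v ab c by (simp add: act_simps xK M.add.m_comm)
  hence "(u \<oplus> (-1) \<odot> act M x b) \<oplus> (w \<oplus> (-1) \<odot> act M x a) = (act M x b \<oplus> act M x a) \<oplus> ((-1) \<odot> act M x b \<oplus> (-1) \<odot> act M x a)"
    using c d by (simp add: M.add.m_ac) (metis M.add.m_assoc M.add.m_lcomm M.add.m_closed smul_closed)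
  also have "\<dots> = \<zero>" using d by (simp add: smul_uminus M.minus_add[symmetric] M.r_neg)
  finally have z: "(u \<oplus> (-1) \<odot> act M x b) \<oplus> (w \<oplus> (-1) \<odot> act M x a) = \<zero>" .
  have "u \<oplus> (-1) \<odot> act M x b \<in> even_part M" "w \<oplus> (-1) \<odot> act M x a \<in> odd_part M"
    using u w xa parts_sub by (simp_all add: sub_add sub_smul)
  note * = sum_parts_zero[OF this z]
  have "u = act M x b" "w = act M x a" using * eq_of_diff c d by blast+
  thus ?thesis using c by (auto simp: im_def)
qed

sublocale quo: subquot M ker im "DS_mod M x"
proof (intro subquot.intro subquot_axioms.intro sspace_axioms ker_sub im_sub im_ker)
  show "u \<in> ker \<and> w \<in> ker" if "u \<in> even_part M" "w \<in> odd_part M" "u \<oplus> w \<in> ker" for u w by (rule ker_graded[OF that])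
  show "u \<in> im \<and> w \<in> im" if "u \<in> even_part M" "w \<in> odd_part M" "u \<oplus> w \<in> im" for u w by (rule im_graded[OF that])
qed (simp_all add: DS_mod_def superspace.defs rep.defs subquotient_def ker_def im_def)

lemma homogeneous_commute:
  assumes "a \<in> part K p" "brk K x a = \<zero>\<^bsub>K\<^esub>" "u \<in> carrier M"
  shows "act M a (act M x u) = koszul True p \<odot> act M x (act M a u)"
proof -
  have aK: "a \<in> carrier K" by (rule part_carrier(1)[OF assms(1)])
  have c: "act M a (act M x u) \<in> carrier M" "act M x (act M a u) \<in> carrier M" using assms(3) aK xK by (auto simp: act_simps)
  have "\<zero> = act M x (act M a u) \<oplus> (- koszul True p) \<odot> act M a (act M x u)"
    using act_brk[OF xodd assms(1,3)] assms by (simp add: act_zero)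
  hence "koszul True p \<odot> act M a (act M x u) = act M x (act M a u)"
    using c by (metis M.add.inv_closed M.minus_equality M.minus_minus smul_closed smul_uminus)
  hence "koszul True p \<odot> (koszul True p \<odot> act M a (act M x u)) = koszul True p \<odot> act M x (act M a u)" by simp
  thus ?thesis using c by (simp add: smul_assoc[symmetric] koszul_def split: if_splits)
qed

lemma brk_parts_zero:
  assumes "a0 \<in> even_part K" "a1 \<in> odd_part K" "brk K x (a0 \<oplus>\<^bsub>K\<^esub> a1) = \<zero>\<^bsub>K\<^esub>"
  shows "brk K x a0 = \<zero>\<^bsub>K\<^esub>" "brk K x a1 = \<zero>\<^bsub>K\<^esub>"
proof -
  have c: "a0 \<in> carrier K" "a1 \<in> carrier K" using assms K.parts_carrier by auto
  have "brk K x (a0 \<oplus>\<^bsub>K\<^esub> a1) = brk K x a0 \<oplus>\<^bsub>K\<^esub> brk K x a1" "brk K x a0 \<in> carrier K" "brk K x a1 \<in> carrier K"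
    using c brk_x by auto
  hence z: "brk K x a1 \<oplus>\<^bsub>K\<^esub> brk K x a0 = \<zero>\<^bsub>K\<^esub>" using assms(3) by (simp add: K.M.add.m_comm)
  have "a0 \<in> part K False" "a1 \<in> part K True" using assms by (simp_all add: part_def)
  hence "brk K x a0 \<in> part K (True \<noteq> False)" "brk K x a1 \<in> part K (True \<noteq> True)" using brk_part by blast+
  thus "brk K x a0 = \<zero>\<^bsub>K\<^esub>" "brk K x a1 = \<zero>\<^bsub>K\<^esub>"
    using K.sum_parts_zero[OF _ _ z] by (auto simp: part_def)
qed

lemma act_im:
  assumes a: "a \<in> carrier K" "brk K x a = \<zero>\<^bsub>K\<^esub>" and v: "v \<in> im"
  shows "act M a v \<in> im"
proof -
  obtain a0 a1 where a01: "a0 \<in> even_part K" "a1 \<in> odd_part K" "a = a0 \<oplus>\<^bsub>K\<^esub> a1" using K.parts_decomp[OF a(1)] by blast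
  obtain u where u: "u \<in> carrier M" "v = act M x u" using v by (auto simp: im_def)
  have p: "a0 \<in> part K False" "a1 \<in> part K True" using a01 by (auto simp: part_def)
  have z: "brk K x a0 = \<zero>\<^bsub>K\<^esub>" "brk K x a1 = \<zero>\<^bsub>K\<^esub>" using brk_parts_zero a01 a(2) by auto
  have "act M b v \<in> im" if "b \<in> part K p" "brk K x b = \<zero>\<^bsub>K\<^esub>" for b p
    unfolding u(2) homogeneous_commute[OF that u(1)]
    using act_simps(1)[OF part_carrier(1)[OF that(1)] u(1)] by (intro sub_smul[OF im_sub]) (auto simp: im_def)
  hence "act M a0 v \<in> im" "act M a1 v \<in> im" using p z by auto
  moreover have "v \<in> carrier M" using v sub_carrier[OF im_sub] by auto
  ultimately show ?thesis using p part_carrier unfolding a01(3) by (subst act_add) (auto intro: sub_add[OF im_sub])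
qed

text \<open>For homogeneous z and v in the kernel, [x, z] v = x (z v). So the brackets [x, z] act by
  zero on the cohomology, and cosets act on it without ambiguity.\<close>

lemma brk_im_act_ker:
  assumes z: "z \<in> carrier K" and v: "v \<in> ker"
  shows "act M (brk K x z) v \<in> im"
proof -
  obtain z0 z1 where z01: "z0 \<in> even_part K" "z1 \<in> odd_part K" "z = z0 \<oplus>\<^bsub>K\<^esub> z1" using K.parts_decomp[OF z] by blast
  have vM: "v \<in> carrier M" "act M x v = \<zero>" using v by (auto simp: ker_def)
  have *: "act M (brk K x b) v \<in> im" if "b \<in> part K p" for b p
  proof -
    have bK: "b \<in> carrier K" by (rule part_carrier(1)[OF that])
    have "act M (brk K x b) v = act M x (act M b v)"
      using act_brk[OF xodd that vM(1)] vM bK xK by (simp add: act_simps)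
    thus ?thesis using vM bK by (auto simp: im_def act_simps)
  qed
  have c: "z0 \<in> carrier K" "z1 \<in> carrier K" using z01 K.parts_carrier by auto
  have b: "brk K x (z0 \<oplus>\<^bsub>K\<^esub> z1) = brk K x z0 \<oplus>\<^bsub>K\<^esub> brk K x z1" "brk K x z0 \<in> carrier K" "brk K x z1 \<in> carrier K"
    using c brk_x by auto
  show ?thesis unfolding z01(3) b(1) act_add[OF b(2,3) vM(1)]
    using *[of z0 False] *[of z1 True] z01 by (intro sub_add[OF im_sub]) (auto simp: part_def)
qed

lemma act_coset:
  assumes a: "a \<in> carrier K" "brk K x a = \<zero>\<^bsub>K\<^esub>" and v: "v \<in> ker"
  shows "(\<Union>a'\<in>ds_ideal K x +>\<^bsub>K\<^esub> a. \<Union>v'\<in>im +> v. im +> act M a' v') = im +> act M a v"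
proof -
  have vM: "v \<in> carrier M" using v by (simp add: ker_def)
  note brkc = brk_x(1)
  have "im +> act M (brk K x z \<oplus>\<^bsub>K\<^esub> a) (w \<oplus> v) = im +> act M a v" if z: "z \<in> carrier K" and w: "w \<in> im" for z w
  proof -
    have wk: "w \<oplus> v \<in> ker" using w im_ker v by (auto intro: sub_add[OF ker_sub])
    have c: "w \<in> carrier M" "w \<oplus> v \<in> carrier M" using w sub_carrier[OF im_sub] vM by auto
    have d: "act M (brk K x z) (w \<oplus> v) \<in> carrier M" "act M a w \<in> carrier M" "act M a v \<in> carrier M"
      using c vM a brkc[OF z] by (auto simp: act_simps)
    have "act M (brk K x z \<oplus>\<^bsub>K\<^esub> a) (w \<oplus> v) = act M (brk K x z) (w \<oplus> v) \<oplus> (act M a w \<oplus> act M a v)"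
      using act_add[OF brkc[OF z] a(1) c(2)] act_simps(2)[OF a(1) c(1) vM] by simp
    also have "\<dots> = (act M (brk K x z) (w \<oplus> v) \<oplus> act M a w) \<oplus> act M a v"
      using d by (simp add: M.add.m_assoc)
    finally have "act M (brk K x z \<oplus>\<^bsub>K\<^esub> a) (w \<oplus> v) = (act M (brk K x z) (w \<oplus> v) \<oplus> act M a w) \<oplus> act M a v" .
    moreover have "act M (brk K x z) (w \<oplus> v) \<oplus> act M a w \<in> im"
      by (rule sub_add[OF im_sub brk_im_act_ker[OF z wk] act_im[OF a w]])
    ultimately show ?thesis using quo.q_eqI d by simp
  qed
  hence *: "im +> act M a' v' = im +> act M a v" if a': "a' \<in> ds_ideal K x +>\<^bsub>K\<^esub> a" and v': "v' \<in> im +> v" for a' v'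
  proof -
    obtain z where "z \<in> carrier K" "a' = brk K x z \<oplus>\<^bsub>K\<^esub> a" using a' unfolding a_r_coset_def' ds_ideal_def by blast
    moreover obtain w where "w \<in> im" "v' = w \<oplus> v" using v' unfolding a_r_coset_def' by blast
    ultimately show ?thesis using \<open>\<And>z w. z \<in> carrier K \<Longrightarrow> w \<in> im \<Longrightarrow> im +> act M (brk K x z \<oplus>\<^bsub>K\<^esub> a) (w \<oplus> v) = im +> act M a v\<close> by blast
  qed
  have "\<zero>\<^bsub>K\<^esub> \<in> ds_ideal K x"
  proof -
    have "brk K x \<zero>\<^bsub>K\<^esub> = \<zero>\<^bsub>K\<^esub>"
      using brk_x(3)[of "\<zero>\<^bsub>K\<^esub>" 0] brk_x(1)[of "\<zero>\<^bsub>K\<^esub>"] by simp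
    thus ?thesis by (force simp: ds_ideal_def)
  qed
  hence "a \<in> ds_ideal K x +>\<^bsub>K\<^esub> a" using a by (force simp: a_r_coset_def')
  moreover have "v \<in> im +> v" by (rule quo.q_self[OF vM])
  ultimately show ?thesis using * by blast
qed

lemma act_DS:
  assumes "a \<in> carrier K" "brk K x a = \<zero>\<^bsub>K\<^esub>" "v \<in> ker"
  shows "act (DS_mod M x) (ds_ideal K x +>\<^bsub>K\<^esub> a) (im +> v) = im +> act M a v"
  using act_coset[OF assms] by (simp add: DS_mod_def superspace.defs rep.defs subquotient_def im_def)

end

section \<open>Transport of structure\<close>

lemma cvs_cong:
  assumes V: "cvs V" and eq: "carrier V' = carrier V" "\<zero>\<^bsub>V'\<^esub> = \<zero>\<^bsub>V\<^esub>" "(\<oplus>\<^bsub>V'\<^esub>) = (\<oplus>\<^bsub>V\<^esub>)" "(\<odot>\<^bsub>V'\<^esub>) = (\<odot>\<^bsub>V\<^esub>)"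
  shows "cvs V'"
proof -
  interpret cvs V by fact
  show ?thesis
  proof (rule cvsI, rule module_criteria)
    show "cring \<CC>" by (rule class_cring.cring_axioms)
    show "\<forall>v\<in>carrier V'. \<exists>w\<in>carrier V'. v \<oplus>\<^bsub>V'\<^esub> w = \<zero>\<^bsub>V'\<^esub>"
      unfolding eq by (intro ballI, rule_tac x = "\<ominus>\<^bsub>V\<^esub> v" in bexI) (auto simp: M.r_neg)
  qed (auto simp: eq smul_assoc smul_l_distr smul_r_distr M.add.m_ac)
qed

lemma submodule_cong:
  assumes "LinearCombinations.submodule \<CC> W V" "cvs V'" "carrier V' = carrier V" "\<zero>\<^bsub>V'\<^esub> = \<zero>\<^bsub>V\<^esub>" "(\<oplus>\<^bsub>V'\<^esub>) = (\<oplus>\<^bsub>V\<^esub>)" "(\<odot>\<^bsub>V'\<^esub>) = (\<odot>\<^bsub>V\<^esub>)"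
  shows "LinearCombinations.submodule \<CC> W V'"
  using assms unfolding submodule_def cvs_def vectorspace_def by simp

lemma superspace_cong:
  assumes V: "superspace V" and eq: "carrier V' = carrier V" "\<zero>\<^bsub>V'\<^esub> = \<zero>\<^bsub>V\<^esub>" "(\<oplus>\<^bsub>V'\<^esub>) = (\<oplus>\<^bsub>V\<^esub>)" "(\<odot>\<^bsub>V'\<^esub>) = (\<odot>\<^bsub>V\<^esub>)"
    "even_part V' = even_part V" "odd_part V' = odd_part V"
  shows "superspace V'"
proof -
  interpret V: sspace V by (rule sspaceI[OF V])
  interpret V': cvs V' by (rule cvs_cong[OF V.cvs_axioms eq(1-4)])
  show ?thesis
    using V V'.vectorspace_axioms submodule_cong[OF V.parts_sub(1) V'.cvs_axioms eq(1-4)]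
      submodule_cong[OF V.parts_sub(2) V'.cvs_axioms eq(1-4)]
    unfolding superspace_def V'.submodule_subspace eq by blast
qed

text \<open>Only the source is assumed to be a Lie superalgebra; the axioms of K are the images of
  those of L. In this way \<open>gx_embedded\<close> and \<open>DS_alg\<close> are recognized as Lie
  superalgebras.\<close>

lemma lie_iso_transfer:
  assumes L: "lie_superalgebra L" and K: "superspace K" and hom: "f \<in> LinearCombinations.module_hom \<CC> L K"
    and bij: "bij_betw f (carrier L) (carrier K)" and parts: "\<And>p. f ` part L p = part K p"
    and br: "\<And>a b. a \<in> carrier L \<Longrightarrow> b \<in> carrier L \<Longrightarrow> f (brk L a b) = brk K (f a) (f b)"
  shows "lie_iso L K f"
proof -
  interpret L: sspace L using L by (intro sspaceI) (simp add: lie_superalgebra_def)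
  interpret K: sspace K by (rule sspaceI[OF K])
  have fa: "\<And>a b. a \<in> carrier L \<Longrightarrow> b \<in> carrier L \<Longrightarrow> f (a \<oplus>\<^bsub>L\<^esub> b) = f a \<oplus>\<^bsub>K\<^esub> f b"
    "\<And>a c. a \<in> carrier L \<Longrightarrow> f (c \<odot>\<^bsub>L\<^esub> a) = c \<odot>\<^bsub>K\<^esub> f a" "\<And>a. a \<in> carrier L \<Longrightarrow> f a \<in> carrier K"
    using hom by (auto simp: LinearCombinations.module_hom_def)
    have h1: "brk L a \<in> LinearCombinations.module_hom \<CC> L L" and h2: "(\<lambda>u. brk L u a) \<in> LinearCombinations.module_hom \<CC> L L"
    if "a \<in> carrier L" for a using L that by (simp_all add: lie_superalgebra_def bilinear_on_def)
  have bc: "brk L a b \<in> carrier L" if "a \<in> carrier L" "b \<in> carrier L" for a b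
    using funcset_mem[OF LinearCombinations.module_hom_closed[OF h1[OF that(1)]] that(2)] .
  have bl: "brk L (a \<oplus>\<^bsub>L\<^esub> c) b = brk L a b \<oplus>\<^bsub>L\<^esub> brk L c b" "brk L (k \<odot>\<^bsub>L\<^esub> a) b = k \<odot>\<^bsub>L\<^esub> brk L a b"
    "brk L a (b \<oplus>\<^bsub>L\<^esub> c) = brk L a b \<oplus>\<^bsub>L\<^esub> brk L a c" "brk L a (k \<odot>\<^bsub>L\<^esub> b) = k \<odot>\<^bsub>L\<^esub> brk L a b"
    if "a \<in> carrier L" "b \<in> carrier L" "c \<in> carrier L" for a b c k
    using LinearCombinations.module_hom_add[OF h1[OF that(1)] that(2,3)]
      LinearCombinations.module_hom_smult[OF h1[OF that(1)] _ that(2), of k] LinearCombinations.module_hom_add[OF h2[OF that(2)] that(1,3)]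
      LinearCombinations.module_hom_smult[OF h2[OF that(2)] _ that(1), of k] by simp_all
  have car: "carrier K = f ` carrier L" using bij by (simp add: bij_betw_def)
  have pc: "a \<in> carrier L" if "a \<in> part L p" for a p using that L.parts_carrier by (auto simp: part_def split: if_splits)
  have "bilinear_on K K K (brk K)"
    unfolding bilinear_on_def LinearCombinations.module_hom_def car
    by (auto simp: fa(1,2)[symmetric] br[symmetric] bl bc)
  moreover have "brk K A B \<in> part K (p \<noteq> q)" if "A \<in> part K p" "B \<in> part K q" for A B p q
  proof -
    from that obtain a b where "a \<in> part L p" "b \<in> part L q" "A = f a" "B = f b" unfolding parts[symmetric] by auto
    moreover have "brk L a b \<in> part L (p \<noteq> q)" using L calculation unfolding lie_superalgebra_def by blast
    ultimately show ?thesis using br[of a b] pc unfolding parts[symmetric] by (metis imageI)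
  qed
  moreover have "brk K A B = (- koszul p q) \<odot>\<^bsub>K\<^esub> brk K B A" if "A \<in> part K p" "B \<in> part K q" for A B p q
  proof -
    from that obtain a b where ab: "a \<in> part L p" "b \<in> part L q" "A = f a" "B = f b" unfolding parts[symmetric] by auto
    have "brk L a b = (- koszul p q) \<odot>\<^bsub>L\<^esub> brk L b a" using L ab unfolding lie_superalgebra_def by blast
        hence "f (brk L a b) = f ((- koszul p q) \<odot>\<^bsub>L\<^esub> brk L b a)" by simp
    thus ?thesis using pc[OF ab(1)] pc[OF ab(2)] unfolding ab(3,4) by (simp add: br fa bc)
  qed
  moreover have "brk K (brk K A B) D = brk K A (brk K B D) \<oplus>\<^bsub>K\<^esub> (- koszul p q) \<odot>\<^bsub>K\<^esub> brk K B (brk K A D)"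
    if "A \<in> part K p" "B \<in> part K q" "D \<in> carrier K" for A B D p q
  proof -
    from that obtain a b d where ab: "a \<in> part L p" "b \<in> part L q" "d \<in> carrier L" "A = f a" "B = f b" "D = f d"
      unfolding parts[symmetric] car by auto
    have c: "a \<in> carrier L" "b \<in> carrier L" using ab pc by auto
    have "brk L (brk L a b) d = brk L a (brk L b d) \<oplus>\<^bsub>L\<^esub> (- koszul p q) \<odot>\<^bsub>L\<^esub> brk L b (brk L a d)"
      using L ab unfolding lie_superalgebra_def by blast
    hence "f (brk L (brk L a b) d) = f (brk L a (brk L b d) \<oplus>\<^bsub>L\<^esub> (- koszul p q) \<odot>\<^bsub>L\<^esub> brk L b (brk L a d))" by simp
    thus ?thesis using c ab(3) L.smul_closed unfolding ab(4-6) by (simp add: fa bc br)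
  qed
  ultimately have "lie_superalgebra K" using K unfolding lie_superalgebra_def by blast
  thus ?thesis using L hom bij parts br by (simp add: lie_iso_def)
qed

lemma lie_iso_trans:
  assumes f: "lie_iso L K f" and g: "lie_iso K N g"
  shows "lie_iso L N (g \<circ> f)"
proof -
  have fc: "f a \<in> carrier K" if "a \<in> carrier L" for a using f that by (auto simp: lie_iso_def bij_betw_def)
  have "bij_betw (g \<circ> f) (carrier L) (carrier N)" using f g by (auto simp: lie_iso_def intro: bij_betw_trans)
  moreover have "(g \<circ> f) ` part L p = part N p" for p using f g by (metis lie_iso_def image_comp)
  ultimately show ?thesis
    using f g fc unfolding lie_iso_def LinearCombinations.module_hom_def by (auto simp: Pi_iff)
qed

text \<open>The bracket field becomes an action on the same superspace. \<open>DS_alg\<close> then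
  has the fields of \<open>DS_mod\<close> of the adjoint module, so what is proved for modules
  applies to g_x itself.\<close>

definition adj_rep :: "('g, 'm) lie_super_scheme \<Rightarrow> ('g, 'g) rep" where
  "adj_rep K = superspace.extend (superspace.truncate K) (rep.fields (brk K))"

lemma adj_rep_simps [simp]:
  "carrier (adj_rep K) = carrier K" "\<zero>\<^bsub>adj_rep K\<^esub> = \<zero>\<^bsub>K\<^esub>" "(\<oplus>\<^bsub>adj_rep K\<^esub>) = (\<oplus>\<^bsub>K\<^esub>)" "(\<odot>\<^bsub>adj_rep K\<^esub>) = (\<odot>\<^bsub>K\<^esub>)"
  "even_part (adj_rep K) = even_part K" "odd_part (adj_rep K) = odd_part K" "act (adj_rep K) = brk K"
  by (simp_all add: adj_rep_def superspace.defs rep.defs)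

lemma is_rep_adj: "lie_superalgebra K \<Longrightarrow> is_rep K (adj_rep K)"
proof -
  assume K: "lie_superalgebra K"
  have ss: "superspace (adj_rep K)" by (rule superspace_cong[of K]) (use K in \<open>auto simp: lie_superalgebra_def\<close>)
  have p: "part (adj_rep K) p = part K p" for p by (simp add: part_def)
  have b: "bilinear_on K (adj_rep K) (adj_rep K) (brk K)"
    using K by (simp add: lie_superalgebra_def bilinear_on_def LinearCombinations.module_hom_def)
  show ?thesis using K ss b unfolding is_rep_def p adj_rep_simps lie_superalgebra_def by blast
qed

section \<open>\<open>\<ss>\<ll>(2)\<close> inside \<open>G(3)\<close>\<close>

definition gder :: "(zorn \<Rightarrow> zorn) \<Rightarrow> g3" where "gder D = (D, 0, 0, 0)"
definition gmat :: "mat2 \<Rightarrow> g3" where "gmat A = (0, A, 0, 0)"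

text \<open>The block of sl(3) on the indices 1 and 2, inside G2; it is the subalgebra generated by
  the root spaces of g_x.\<close>

fun gsl :: "mat2 \<Rightarrow> g3" where "gsl ((a, b), (c, d)) = gder (dermap (a, b, 0) (c, d, 0) (0, 0, 0) 0 0)"

abbreviation "mE \<equiv> ((0, 1), (0, 0)) :: mat2"
abbreviation "mF \<equiv> ((0, 0), (1, 0)) :: mat2"
abbreviation "mH \<equiv> ((1, 0), (0, -1)) :: mat2"

lemma torus_dermap: "torus_der (t1, t2, t3) = dermap (t1, 0, 0) (0, t2, 0) (0, 0, t3) 0 0"
  by (rule ext, case_tac x rule: zorn_cases) simp

text \<open>\<open>h12\<close>, \<open>h23\<close> and \<open>hs\<close> are the middle elements of
  sl(2)-triples, and together they span the torus. \<open>h12\<close> is the coroot of \<epsilon>_1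
  - \<epsilon>_2 and spans the Cartan subalgebra of g_x.\<close>

definition "h12 = gder (torus_der (1, -1, 0))"
definition "h23 = gder (torus_der (0, 1, -1))"
definition "hs = gmat mH"
definition "e23 = gder (dermap (0, 0, 0) (0, 0, 1) (0, 0, 0) 0 0)"
definition "f23 = gder (dermap (0, 0, 0) (0, 0, 0) (0, 1, 0) 0 0)"

lemma gder_even: "D \<in> Der \<Longrightarrow> gder D \<in> part G3 False"
  by (simp add: part_def gder_def traceless_simps)

lemma gmat_even: "A \<in> traceless \<Longrightarrow> gmat A \<in> part G3 False"
  by (simp add: part_def gmat_def Der_closed)

lemma gsl_h12: "gsl mH = h12"
  by (simp add: h12_def torus_dermap)

lemma even_elements: "A \<in> traceless \<Longrightarrow> gsl A \<in> part G3 False" "h12 \<in> part G3 False" "h23 \<in> part G3 False" "hs \<in> part G3 False"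
  "e23 \<in> part G3 False" "f23 \<in> part G3 False" "gmat mE \<in> part G3 False" "gmat mF \<in> part G3 False"
  by (cases A rule: mat2_cases; auto simp: traceless_neg h12_def h23_def hs_def e23_def f23_def torus_dermap intro!: gder_even gmat_even dermap_Der)+

lemma gder_brk: "D \<in> Der \<Longrightarrow> D' \<in> Der \<Longrightarrow> g3_brk (gder D) (gder D') = gder (\<lambda>w. D (D' w) - D' (D w))"
  by (simp add: gder_def mat2_zero zder_bilin odd_brk_sl2_def Der_simps zero_prod_def[where 'a = zorn and 'b = zorn])

lemma g3_scale_gder: "g3_scale c (gder D) = gder (\<lambda>w. zscale c (D w))"
  by (simp add: gder_def)

lemma gder_eq: "(\<And>w. D w = D' w) \<Longrightarrow> gder D = gder D'"
  by (auto simp: gder_def)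

lemma gsl_linear: "gsl (A + B) = gsl A + gsl B" "gsl (mscale c A) = g3_scale c (gsl A)"
  by (cases A rule: mat2_cases; cases B rule: mat2_cases;
      auto simp: gder_def fun_eq_iff algebra_simps zero_prod_def[where 'a = zorn and 'b = zorn] zero_prod_def[where 'a = mat2 and 'b = "zorn \<times> zorn"])+

lemma gsl_brk: "A \<in> traceless \<Longrightarrow> B \<in> traceless \<Longrightarrow> gsl (mmul A B - mmul B A) = g3_brk (gsl A) (gsl B)"
  by (cases A rule: mat2_cases; cases B rule: mat2_cases)
    (simp add: gder_brk traceless_neg dermap_Der, rule gder_eq, case_tac w rule: zorn_cases, simp add: algebra_simps)

lemma gder_brk_eq:
  assumes "D \<in> Der" "D' \<in> Der" "\<And>w. D (D' w) - D' (D w) = D'' w"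
  shows "g3_brk (gder D) (gder D') = gder D''"
  using assms by (simp add: gder_brk)

lemma sl2_triple_12: "g3_brk h12 (gsl mE) = g3_scale 2 (gsl mE)" "g3_brk h12 (gsl mF) = g3_scale (-2) (gsl mF)" "g3_brk (gsl mE) (gsl mF) = h12"
  unfolding gsl_h12[symmetric] by (simp_all add: gsl_brk[symmetric] traceless_neg gsl_linear(2)[symmetric] del: gsl.simps) (simp_all add: zero_prod_def)

lemma sl2_triple_23: "g3_brk h23 e23 = g3_scale 2 e23" "g3_brk h23 f23 = g3_scale (-2) f23" "g3_brk e23 f23 = h23"
  unfolding h23_def e23_def f23_def torus_dermap g3_scale_gder
  by (rule gder_brk_eq; (intro dermap_Der)?; simp?; case_tac w rule: zorn_cases; simp)+

lemma sl2_triple_s: "g3_brk hs (gmat mE) = g3_scale 2 (gmat mE)" "g3_brk hs (gmat mF) = g3_scale (-2) (gmat mF)" "g3_brk (gmat mE) (gmat mF) = hs"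
  unfolding hs_def gmat_def by (simp_all add: fun_eq_iff zder_bilin odd_brk_sl2_def zero_prod_def[where 'a = zorn and 'b = zorn])

text \<open>Free coordinates on the Cartan subalgebra, namely the values of \<open>eps 1\<close>,
  \<open>eps 2\<close> and \<open>delta\<close>; the value of \<open>eps 3\<close> is forced by
  trace zero.\<close>

definition cart :: "complex \<Rightarrow> complex \<Rightarrow> complex \<Rightarrow> g3" where
  "cart t1 t2 s = (torus_der (t1, t2, - t1 - t2), ((s, 0), (0, - s)), 0, 0)"

lemma g3_cartan_iff: "h \<in> g3_cartan \<longleftrightarrow> (\<exists>t1 t2 s. h = cart t1 t2 s)"
proof
  assume "h \<in> g3_cartan"
  then obtain t1 t2 t3 s where "h = (torus_der (t1, t2, t3), ((s, 0), (0, - s)), 0, 0)" "t1 + t2 + t3 = 0"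
    by (auto simp: g3_cartan_def)
  moreover from this have "t3 = - t1 - t2" by (simp add: eq_neg_iff_add_eq_0 add.commute add.left_commute algebra_simps)
  ultimately show "\<exists>t1 t2 s. h = cart t1 t2 s" by (auto simp: cart_def)
qed (force simp: g3_cartan_def cart_def)

lemma cart_weights: "eps 1 (cart t1 t2 s) = t1" "eps 2 (cart t1 t2 s) = t2" "eps 3 (cart t1 t2 s) = - t1 - t2" "delta (cart t1 t2 s) = s"
proof -
  have c: "cart t1 t2 s \<in> g3_cartan" by (auto simp: g3_cartan_iff)
  show "eps 1 (cart t1 t2 s) = t1" "eps 2 (cart t1 t2 s) = t2" "eps 3 (cart t1 t2 s) = - t1 - t2" "delta (cart t1 t2 s) = s"
    using c by (simp_all add: eps_def delta_def restrict_weight_def) (simp_all add: cart_def zero_prod_def)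
qed

lemma cart_add: "cart t1 t2 s + cart u1 u2 r = cart (t1 + u1) (t2 + u2) (s + r)"
  by (simp add: cart_def fun_eq_iff algebra_simps zero_prod_def[where 'a = zorn and 'b = zorn])

lemma cart_scale: "g3_scale c (cart t1 t2 s) = cart (c * t1) (c * t2) (c * s)"
  by (simp add: cart_def fun_eq_iff algebra_simps zero_prod_def[where 'a = zorn and 'b = zorn])

lemma cart_h: "h12 = cart 1 (-1) 0" "h23 = cart 0 1 0" "hs = cart 0 0 1"
  by (simp_all add: cart_def h12_def h23_def hs_def gder_def gmat_def mat2_zero fun_eq_iff zero_prod_def[where 'a = zorn and 'b = zorn])
    (simp add: zero_prod_def)?

lemma cart_decomp: "cart t1 t2 s = g3_scale t1 h12 + (g3_scale (t1 + t2) h23 + g3_scale s hs)"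
  by (simp add: cart_h cart_scale cart_add)

lemma cart_even: "cart t1 t2 s \<in> part G3 False"
  by (simp add: cart_def part_def torus_dermap dermap_Der traceless_neg)

lemma cart_brk: "g3_brk (cart t1 t2 s) (D, A, p, q) = ((\<lambda>w. torus_der (t1, t2, - t1 - t2) (D w) - D (torus_der (t1, t2, - t1 - t2) w)),
    mmul ((s, 0), (0, - s)) A - mmul A ((s, 0), (0, - s)),
    torus_der (t1, t2, - t1 - t2) p + zscale s p, torus_der (t1, t2, - t1 - t2) q - zscale s q)" if "D \<in> Der"
  using that by (cases A rule: mat2_cases)
    (simp add: cart_def zder_bilin odd_brk_sl2_def Der_simps zero_prod_def[where 'a = zorn and 'b = zorn])

lemma cart_commute: "g3_brk (cart t1 t2 s) (cart u1 u2 r) = 0"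
  unfolding cart_def[of u1] using dermap_Der
  by (subst cart_brk) (auto simp: torus_dermap fun_eq_iff zero_prod_def algebra_simps)

text \<open>Elements of \<open>g3\<close> are tuples, and from here on quantifiers over them are
  kept whole.\<close>

declare split_paired_All [simp del] split_paired_Ex [simp del]

section \<open>Root spaces and \<open>\<gg>\<^sub>x\<close>\<close>

lemma g3_root_spaceD:
  assumes "a \<in> g3_root_space \<alpha>"
  shows "a \<in> carrier G3" "g3_brk (cart t1 t2 s) a = g3_scale (\<alpha> (cart t1 t2 s)) a"
  proof -
  show "a \<in> carrier G3" using assms unfolding g3_root_space_def root_space_def by blast
  have "cart t1 t2 s \<in> g3_cartan" using g3_cartan_iff by blast
  hence "brk G3 (id (cart t1 t2 s)) a = \<alpha> (cart t1 t2 s) \<odot>\<^bsub>G3\<^esub> a"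
    using assms unfolding g3_root_space_def root_space_def by blast
  thus "g3_brk (cart t1 t2 s) a = g3_scale (\<alpha> (cart t1 t2 s)) a" by simp
qed

lemma g3_root_spaceI:
  assumes "a \<in> carrier G3" "\<And>t1 t2 s. g3_brk (cart t1 t2 s) a = g3_scale (\<alpha> (cart t1 t2 s)) a"
  shows "a \<in> g3_root_space \<alpha>"
proof -
  have "brk G3 (id h) a = \<alpha> h \<odot>\<^bsub>G3\<^esub> a" if h: "h \<in> g3_cartan" for h
  proof -
    obtain t1 t2 s where "h = cart t1 t2 s" using h g3_cartan_iff by blast
    thus ?thesis using assms(2) by simp
  qed
  thus ?thesis using assms(1) unfolding g3_root_space_def root_space_def by blast
qed

lemmas cart_weights' = cart_weights cart_weights(1)[unfolded One_nat_def]

interpretation G3: sspace G3 by (rule sspaceI[OF superspace_G3])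

text \<open>The tensor of \<open>zU3\<close>, of weight \<open>eps 3\<close>, with e_1, of weight
  \<open>delta\<close>.\<close>

definition x0 :: g3 where "x0 = (0, 0, zU3, 0)"

text \<open>The weight equation at three torus elements isolates the components and leaves only the
  line of \<open>zU3\<close> in p. So the given root vector is a multiple of
  \<open>x0\<close>.\<close>

lemma root_space_beta:
  assumes "x \<in> g3_root_space (eps 3 + delta)"
  shows "\<exists>c. x = g3_scale c x0"
proof -
  obtain D A p q where x: "x = (D, A, p, q)" using g3_cases by metis
  obtain a u1 u2 u3 v1 v2 v3 b where p: "p = (a, (u1, u2, u3), (v1, v2, v3), b)" by (rule zorn_cases)
  have D: "D \<in> Der" using g3_root_spaceD(1)[OF assms] x by simp
  have e: "g3_brk (cart t1 t2 s) (D, A, p, q) = g3_scale (- t1 - t2 + s) (D, A, p, q)" for t1 t2 s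
    using g3_root_spaceD(2)[OF assms, of t1 t2 s] by (simp add: x cart_weights')
  note e = e[unfolded cart_brk[OF D]]
  have t0: "torus_der (0, 0, 0) w = 0" for w by (cases w rule: zorn_cases) (simp add: zero_prod_def)
  have "D w = 0" for w
    using fun_cong[OF arg_cong[OF e[of 0 0 1], of fst, unfolded fst_conv g3_scale.simps], of w] by (simp add: t0 Der_simps[OF D])
  hence "D = 0" by (simp add: fun_eq_iff)
  moreover have "A = 0" using e[of 1 0 0] by (cases A rule: mat2_cases) (simp add: zero_prod_def)
  moreover have "q = 0" using e[of 0 0 1] by (cases q rule: zorn_cases) (simp add: zero_prod_def)
  moreover have "p = zscale u3 zU3" using e[of 1 0 0] e[of 0 1 0] by (simp add: p)
  ultimately have "x = g3_scale u3 x0" by (simp add: x x0_def zero_prod_def fun_eq_iff)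
  thus ?thesis by blast
qed

text \<open>A weight that does not involve \<open>delta\<close> and involves t1 lives on derivations
  only. This covers \<epsilon>_1 - \<epsilon>_2 and its negative at once.\<close>

lemma cart_brk_dermap:
  assumes "D \<in> Der" and e: "\<And>t1 t2 s. g3_brk (cart t1 t2 s) (D, A, p, q) = g3_scale (t1 * k1 + t2 * k2) (D, A, p, q)" and k: "k1 \<noteq> 0"
  shows "A = 0" "p = 0" "q = 0" "torus_der (t1, t2, - t1 - t2) (D w) - D (torus_der (t1, t2, - t1 - t2) w) = zscale (t1 * k1 + t2 * k2) (D w)"
proof -
  note e = e[unfolded cart_brk[OF assms(1)]]
  show "torus_der (t1, t2, - t1 - t2) (D w) - D (torus_der (t1, t2, - t1 - t2) w) = zscale (t1 * k1 + t2 * k2) (D w)"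
    using fun_cong[OF arg_cong[OF e[of t1 t2 0], of fst, unfolded fst_conv g3_scale.simps], of w] by simp
  show "A = 0" using e[of 1 0 0] k by (cases A rule: mat2_cases) (auto simp: zero_prod_def)
  show "p = 0" "q = 0" using e[of 0 0 1] by (cases p rule: zorn_cases; cases q rule: zorn_cases; simp add: zero_prod_def)+
qed

text \<open>Evaluating the weight equations at octonion basis vectors kills every parameter of the
  derivation except the matrix entry in row 1 and column 2.\<close>

lemma root_space_12: "g3_root_space (eps 1 - eps 2) = {gsl ((0, c), (0, 0)) |c. True}"
proof (intro equalityI subsetI)
  fix x assume x: "x \<in> g3_root_space (eps 1 - eps 2)"
  obtain D A p q where x': "x = (D, A, p, q)" using g3_cases by metis
  have D: "D \<in> Der" using g3_root_spaceD(1)[OF x] x' by simp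
  have e: "g3_brk (cart t1 t2 s) (D, A, p, q) = g3_scale (t1 * 1 + t2 * (-1)) (D, A, p, q)" for t1 t2 s
    using g3_root_spaceD(2)[OF x, of t1 t2 s] by (simp add: x' cart_weights')
  note f = cart_brk_dermap[OF D e one_neq_zero]
  obtain a11 a12 a13 a21 a22 a23 a31 a32 a33 y z where D': "D = dermap (a11, a12, a13) (a21, a22, a23) (a31, a32, a33) y z"
    using D unfolding Der_iff by blast
  obtain y1 y2 y3 z1 z2 z3 where yz: "y = (y1, y2, y3)" "z = (z1, z2, z3)" by (cases y; cases z)
  note f' = f(4)[of 1 0, unfolded D' yz] f(4)[of 0 1, unfolded D' yz]
  have "y1 = 0" "y2 = 0" "y3 = 0" "z1 = 0" "z2 = 0" "z3 = 0"
    using f'[of zE] by (auto simp: zero_prod_def)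
  moreover have "a11 = 0" "a21 = 0" "a31 = 0" using f'[of zU1] by (auto simp: zero_prod_def)
  moreover have "a22 = 0" "a32 = 0" using f'[of zU2] by (auto simp: zero_prod_def)
  moreover have "a13 = 0" "a23 = 0" "a33 = 0" using f'[of zU3] by (auto simp: zero_prod_def)
  ultimately have "x = gsl ((0, a12), (0, 0))" using f(1-3) by (simp add: x' D' yz gder_def zero_prod_def)
  thus "x \<in> {gsl ((0, c), (0, 0)) |c. True}" by blast
next
  fix x assume "x \<in> {gsl ((0, c), (0, 0)) |c. True}"
  then obtain c where x: "x = gsl ((0, c), (0, 0))" by blast
  have "gsl ((0, c), (0, 0)) \<in> part G3 False" by (rule even_elements) (simp add: traceless_neg)
  hence c: "x \<in> carrier G3" using G3.parts_carrier unfolding x part_def by auto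
  have "g3_brk (cart t1 t2 s) x = g3_scale (t1 - t2) x" for t1 t2 s
    unfolding x gsl.simps gder_def by (subst cart_brk, rule dermap_Der)
      (auto simp: fun_eq_iff zero_prod_def algebra_simps)
  thus "x \<in> g3_root_space (eps 1 - eps 2)"
    by (intro g3_root_spaceI[OF c]) (simp add: cart_weights')
qed

lemma root_space_21: "g3_root_space (eps 2 - eps 1) = {gsl ((0, 0), (c, 0)) |c. True}"
proof (intro equalityI subsetI)
  fix x assume x: "x \<in> g3_root_space (eps 2 - eps 1)"
  obtain D A p q where x': "x = (D, A, p, q)" using g3_cases by metis
  have D: "D \<in> Der" using g3_root_spaceD(1)[OF x] x' by simp
  have e: "g3_brk (cart t1 t2 s) (D, A, p, q) = g3_scale (t1 * (-1) + t2 * 1) (D, A, p, q)" for t1 t2 s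
    using g3_root_spaceD(2)[OF x, of t1 t2 s] by (simp add: x' cart_weights')
  have "(-1::complex) \<noteq> 0" by simp
  note f = cart_brk_dermap[OF D e this]
  obtain a11 a12 a13 a21 a22 a23 a31 a32 a33 y z where D': "D = dermap (a11, a12, a13) (a21, a22, a23) (a31, a32, a33) y z"
    using D unfolding Der_iff by blast
  obtain y1 y2 y3 z1 z2 z3 where yz: "y = (y1, y2, y3)" "z = (z1, z2, z3)" by (cases y; cases z)
  note f' = f(4)[of 1 0, unfolded D' yz] f(4)[of 0 1, unfolded D' yz]
  have "y1 = 0" "y2 = 0" "y3 = 0" "z1 = 0" "z2 = 0" "z3 = 0"
    using f'[of zE] by (auto simp: zero_prod_def)
  moreover have "a11 = 0" "a31 = 0" using f'[of zU1] by (auto simp: zero_prod_def)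
  moreover have "a12 = 0" "a22 = 0" "a32 = 0" using f'[of zU2] by (auto simp: zero_prod_def)
  moreover have "a13 = 0" "a23 = 0" "a33 = 0" using f'[of zU3] by (auto simp: zero_prod_def)
  ultimately have "x = gsl ((0, 0), (a21, 0))" using f(1-3) by (simp add: x' D' yz gder_def zero_prod_def)
  thus "x \<in> {gsl ((0, 0), (c, 0)) |c. True}" by blast
next
  fix x assume "x \<in> {gsl ((0, 0), (c, 0)) |c. True}"
  then obtain c where x: "x = gsl ((0, 0), (c, 0))" by blast
  have "gsl ((0, 0), (c, 0)) \<in> part G3 False" by (rule even_elements) (simp add: traceless_neg)
  hence c: "x \<in> carrier G3" using G3.parts_carrier unfolding x part_def by auto
  have "g3_brk (cart t1 t2 s) x = g3_scale (t2 - t1) x" for t1 t2 s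
    unfolding x gsl.simps gder_def by (subst cart_brk, rule dermap_Der)
      (auto simp: fun_eq_iff zero_prod_def algebra_simps)
  thus "x \<in> g3_root_space (eps 2 - eps 1)"
    by (intro g3_root_spaceI[OF c]) (simp add: cart_weights')
qed

section \<open>The subalgebra generated by the two root spaces\<close>

lemma gsl_carrier: "A \<in> traceless \<Longrightarrow> gsl A \<in> carrier G3" "A \<in> traceless \<Longrightarrow> gsl A \<in> even_part G3"
  using even_elements(1)[of A] G3.parts_carrier unfolding part_def by auto

lemma traceless_mat: "mE \<in> traceless" "mF \<in> traceless" "mH \<in> traceless"
  by (simp_all add: traceless_neg)

lemma gsl_zero: "gsl 0 = 0"
  using gsl_linear(2)[of 0 mE] g3_cases[of "gsl mE"] by (metis G3.smul_0 G3_simps(2,4) gsl_carrier(1) traceless_mat(1) mat2_zero mscale.simps mult_zero_left)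

lemma submodule_gsl: "LinearCombinations.submodule \<CC> (gsl ` traceless) G3"
proof (rule G3.subI)
  
  show "\<zero>\<^bsub>G3\<^esub> \<in> gsl ` traceless" using gsl_zero by (auto simp: traceless_simps intro!: image_eqI[of _ _ 0])
  show "gsl ` traceless \<subseteq> carrier G3" using gsl_carrier(1) by blast
  show "v \<oplus>\<^bsub>G3\<^esub> w \<in> gsl ` traceless" if "v \<in> gsl ` traceless" "w \<in> gsl ` traceless" for v w
  proof -
    from that obtain A B where "A \<in> traceless" "B \<in> traceless" "v = gsl A" "w = gsl B" by blast
    hence "v \<oplus>\<^bsub>G3\<^esub> w = gsl (A + B)" "A + B \<in> traceless" by (simp_all only: gsl_linear G3_simps traceless_simps)
    thus ?thesis by blast
  qed
  show "c \<odot>\<^bsub>G3\<^esub> v \<in> gsl ` traceless" if "v \<in> gsl ` traceless" for c v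
  proof -
    from that obtain A where "A \<in> traceless" "v = gsl A" by blast
    hence "c \<odot>\<^bsub>G3\<^esub> v = gsl (mscale c A)" "mscale c A \<in> traceless" by (simp_all only: gsl_linear G3_simps traceless_simps)
    thus ?thesis by blast
  qed
qed

lemma mat_commutator_traceless: "mmul A B - mmul B A \<in> traceless"
  by (cases A rule: mat2_cases; cases B rule: mat2_cases) (simp add: traceless_neg algebra_simps)

lemma gsl_decomp: "gsl ((a, b), (c, - a)) = g3_scale a h12 + (g3_scale b (gsl mE) + g3_scale c (gsl mF))"
  unfolding gsl_h12[symmetric] gsl_linear[symmetric] by (simp add: zero_prod_def)

text \<open>The root spaces are the lines of the images of \<open>mE\<close> and \<open>mF\<close>,
  whose bracket is \<open>h12\<close>; these three span the block.\<close>

lemma carrier_gx: "carrier gx_embedded = gsl ` traceless"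
proof -
  let ?R = "g3_root_space (eps 1 - eps 2) \<union> g3_root_space (eps 2 - eps 1)"
  have "lie_subalgebra G3 (gsl ` traceless)"
    unfolding lie_subalgebra_def G3.submodule_subspace[symmetric]
    using submodule_gsl by (auto simp: gsl_brk[symmetric] mat_commutator_traceless simp del: gsl.simps)
  moreover have "?R \<subseteq> gsl ` traceless" unfolding root_space_12 root_space_21 by (auto simp: traceless_neg simp del: gsl.simps)
  moreover have "gsl ` traceless \<subseteq> T" if T: "lie_subalgebra G3 T" "?R \<subseteq> T" for T
  proof
    have sT: "LinearCombinations.submodule \<CC> T G3" using T(1) by (simp add: lie_subalgebra_def G3.submodule_subspace)
    have 1: "gsl mE \<in> T" "gsl mF \<in> T" using T(2) unfolding root_space_12 root_space_21 by blast+
    hence 2: "h12 \<in> T" using T(1) sl2_triple_12(3) unfolding lie_subalgebra_def by (metis G3_simps(7))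
    fix a assume "a \<in> gsl ` traceless"
    then obtain A where A: "A \<in> traceless" "a = gsl A" by blast
    obtain m1 m2 m3 m4 where "A = ((m1, m2), (m3, m4))" by (rule mat2_cases)
    hence "a = g3_scale m1 h12 + (g3_scale m2 (gsl mE) + g3_scale m3 (gsl mF))"
      using A gsl_decomp[of m1 m2 m3] by (simp add: traceless_neg del: gsl.simps)
    thus "a \<in> T" using G3.sub_add[OF sT] G3.sub_smul[OF sT] 1 2 by simp
  qed
  ultimately have "lie_generated G3 ?R = gsl ` traceless" unfolding lie_generated_def by blast
  thus ?thesis by (simp add: gx_embedded_def sub_lie_def)
qed

lemma gx_embedded_simps:
  "\<zero>\<^bsub>gx_embedded\<^esub> = 0" "(\<oplus>\<^bsub>gx_embedded\<^esub>) = (+)" "(\<odot>\<^bsub>gx_embedded\<^esub>) = g3_scale" "brk gx_embedded = g3_brk"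
  "even_part gx_embedded = gsl ` traceless" "odd_part gx_embedded = {0}"
proof -
  show "\<zero>\<^bsub>gx_embedded\<^esub> = 0" "(\<oplus>\<^bsub>gx_embedded\<^esub>) = (+)" "(\<odot>\<^bsub>gx_embedded\<^esub>) = g3_scale" "brk gx_embedded = g3_brk"
    by (simp_all add: gx_embedded_def sub_lie_def)
  have *: "even_part gx_embedded = carrier gx_embedded \<inter> even_part G3" "odd_part gx_embedded = carrier gx_embedded \<inter> odd_part G3"
    by (simp_all add: gx_embedded_def sub_lie_def)
  show "even_part gx_embedded = gsl ` traceless" unfolding * carrier_gx using gsl_carrier(2) by blast
  have "gsl ` traceless \<inter> odd_part G3 = {0}"
      proof (intro equalityI subsetI)
    fix a assume "a \<in> gsl ` traceless \<inter> odd_part G3"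
    hence "a \<in> even_part G3" "a \<in> odd_part G3" using gsl_carrier(2) by blast+
    thus "a \<in> {0}" using G3.parts_disjoint[of a] by simp
  next
    fix a :: g3 assume "a \<in> {0}"
    thus "a \<in> gsl ` traceless \<inter> odd_part G3" using G3.sub_zero[OF submodule_gsl] G3.sub_zero[OF G3.parts_sub(2)] by simp
  qed
  thus "odd_part gx_embedded = {0}" unfolding * carrier_gx .
qed

text \<open>The block acts by zero on \<open>zU3\<close> and has no matrix component, so
  \<open>eps 3\<close> and \<open>delta\<close> must vanish.\<close>

lemma cart_gsl: "cart t1 t2 s \<in> gsl ` traceless \<longleftrightarrow> t2 = - t1 \<and> s = 0"
proof
  assume "cart t1 t2 s \<in> gsl ` traceless"
  then obtain A where A: "A \<in> traceless" "cart t1 t2 s = gsl A" by blast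
  obtain m1 m2 m3 m4 where A': "A = ((m1, m2), (m3, m4))" by (rule mat2_cases)
  have 1: "torus_der (t1, t2, - t1 - t2) zU3 = dermap (m1, m2, 0) (m3, m4, 0) (0, 0, 0) 0 0 zU3" and "s = 0"
    using A(2) by (auto simp: A' cart_def gder_def mat2_zero zero_prod_def)
  hence "- t1 - t2 = 0" by (simp add: zero_prod_def)
  hence "t2 = - t1" by (simp add: algebra_simps eq_neg_iff_add_eq_0)
  thus "t2 = - t1 \<and> s = 0" using \<open>s = 0\<close> by simp
next
  assume "t2 = - t1 \<and> s = 0"
  hence "cart t1 t2 s = gsl (mscale t1 mH)" by (simp only: gsl_linear gsl_h12 cart_h cart_scale) simp
  thus "cart t1 t2 s \<in> gsl ` traceless" using traceless_mat(3) traceless_simps(2) by blast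
qed

lemma gx_cartan_iff: "h \<in> gx_cartan \<longleftrightarrow> (\<exists>t. h = g3_scale t h12)"
  proof
  assume "h \<in> gx_cartan"
  hence h: "h \<in> g3_cartan" "h \<in> gsl ` traceless" unfolding gx_cartan_def carrier_gx by blast+
  then obtain t1 t2 s where "h = cart t1 t2 s" unfolding g3_cartan_iff by blast
  hence "h = g3_scale t1 h12" using h(2) by (simp add: cart_gsl cart_h cart_scale)
  thus "\<exists>t. h = g3_scale t h12" ..
next
  assume "\<exists>t. h = g3_scale t h12"
  then obtain t where "h = cart t (- t) 0" by (auto simp: cart_h cart_scale)
  thus "h \<in> gx_cartan" using cart_gsl[of t "- t" 0] by (simp add: gx_cartan_def carrier_gx g3_cartan_iff del: gsl.simps split_paired_Ex) blast
qed

lemma gx_cartan_sub: "gx_cartan \<subseteq> g3_cartan" "gx_cartan \<subseteq> carrier G3" "g3_cartan \<subseteq> carrier G3"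
proof -
  show 1: "gx_cartan \<subseteq> g3_cartan" by (auto simp: gx_cartan_def)
  show 2: "g3_cartan \<subseteq> carrier G3" proof
    fix h assume "h \<in> g3_cartan"
    then obtain t1 t2 s where "h = cart t1 t2 s" unfolding g3_cartan_iff by blast
    moreover have "cart t1 t2 s \<in> even_part G3" using cart_even[of t1 t2 s] by (simp add: part_def)
    ultimately show "h \<in> carrier G3" using G3.parts_carrier(1) by blast
  qed
  show "gx_cartan \<subseteq> carrier G3" using 1 2 by blast
qed

lemma superspace_gx: "superspace gx_embedded"
proof -
  interpret T: cvs "G3\<lparr>carrier := gsl ` traceless\<rparr>" by (rule G3.sub_cvs[OF submodule_gsl])
  interpret X: cvs gx_embedded
    by (rule cvs_cong[OF T.cvs_axioms]) (auto simp: carrier_gx gx_embedded_simps)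
  have "LinearCombinations.submodule \<CC> (gsl ` traceless) gx_embedded" "LinearCombinations.submodule \<CC> {0} gx_embedded"
            unfolding carrier_gx[symmetric] gx_embedded_simps(1)[symmetric] by (rule X.subI; auto)+
  thus ?thesis
    unfolding superspace_def gx_embedded_simps X.submodule_subspace[symmetric]
    using X.vectorspace_axioms X.M.zero_closed unfolding carrier_gx gx_embedded_simps by (force simp del: gsl.simps split_paired_Ex)
qed

lemma gsl_inj: "gsl A = gsl B \<Longrightarrow> A \<in> traceless \<Longrightarrow> B \<in> traceless \<Longrightarrow> A = B"
proof -
  assume g: "gsl A = gsl B"
  obtain a1 a2 a3 a4 b1 b2 b3 b4 where A: "A = ((a1, a2), (a3, a4))" "B = ((b1, b2), (b3, b4))" by (metis mat2_cases)
  have e: "dermap (a1, a2, 0) (a3, a4, 0) (0, 0, 0) 0 0 w = dermap (b1, b2, 0) (b3, b4, 0) (0, 0, 0) 0 0 w" for w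
    using arg_cong[OF g, of fst] unfolding A gsl.simps gder_def fst_conv by (rule fun_cong)
  show "A = B" using e[of zU1] e[of zU2] by (simp add: A zero_prod_def)
qed

section \<open>The matrix algebra sl(2) and its isomorphism with the embedded block\<close>

lemma sl2_simps [simp]:
  "carrier sl2 = traceless" "\<zero>\<^bsub>sl2\<^esub> = 0" "(\<oplus>\<^bsub>sl2\<^esub>) = (+)" "(\<odot>\<^bsub>sl2\<^esub>) = mscale"
  "even_part sl2 = traceless" "odd_part sl2 = {0}" "brk sl2 = (\<lambda>A B. mmul A B - mmul B A)"
  by (simp_all add: sl2_def)

lemma mscale_linear:
  "mscale (a + b) A = mscale a A + mscale b A" "mscale a (A + B) = mscale a A + mscale a B" "mscale (a * b) A = mscale a (mscale b A)"
  by (cases A rule: mat2_cases; cases B rule: mat2_cases; simp add: algebra_simps)+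

lemma mmul_linear:
  "mmul (A + B) C = mmul A C + mmul B C" "mmul C (A + B) = mmul C A + mmul C B"
  "mmul (mscale c A) C = mscale c (mmul A C)" "mmul C (mscale c A) = mscale c (mmul C A)"
  "mmul (A - B) C = mmul A C - mmul B C" "mmul C (A - B) = mmul C A - mmul C B" "mscale c (A - B) = mscale c A - mscale c B"
  by (cases A rule: mat2_cases; cases B rule: mat2_cases; cases C rule: mat2_cases; simp add: algebra_simps)+

lemma mmul_assoc: "mmul (mmul A B) C = mmul A (mmul B C)"
  by (cases A rule: mat2_cases; cases B rule: mat2_cases; cases C rule: mat2_cases; simp add: algebra_simps)

lemma superspace_sl2: "superspace sl2"
proof -
  interpret S: cvs sl2
  proof (rule cvsI, rule module_criteria)
    show "cring \<CC>" by (rule class_cring.cring_axioms)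
    show "\<forall>v\<in>carrier sl2. \<exists>w\<in>carrier sl2. v \<oplus>\<^bsub>sl2\<^esub> w = \<zero>\<^bsub>sl2\<^esub>"
    proof
      fix v assume v: "v \<in> carrier sl2"
      obtain m1 m2 m3 m4 where "v = ((m1, m2), (m3, m4))" by (rule mat2_cases)
      hence "v + mscale (-1) v = 0" by (simp add: zero_prod_def)
      moreover have "mscale (-1) v \<in> carrier sl2" using v by (simp add: traceless_simps)
      ultimately show "\<exists>w\<in>carrier sl2. v \<oplus>\<^bsub>sl2\<^esub> w = \<zero>\<^bsub>sl2\<^esub>" by (intro bexI) simp_all
    qed
  qed (simp_all add: traceless_simps mscale_linear add_ac)
  have "LinearCombinations.submodule \<CC> traceless sl2" "LinearCombinations.submodule \<CC> {0} sl2"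
    by (rule S.subI; simp add: traceless_simps)+
    moreover have "traceless = {u + v |u v. u \<in> traceless \<and> v \<in> {0}}" by auto
  ultimately show ?thesis unfolding superspace_def S.submodule_subspace[symmetric] using S.vectorspace_axioms
    by (simp add: traceless_simps)
qed

lemma lie_superalgebra_sl2: "lie_superalgebra sl2"
proof -
  have p: "part sl2 p = (if p then {0} else traceless)" for p by (simp add: part_def)
  have s: "mscale (-1) A = - A" for A by (cases A rule: mat2_cases) simp
  have "bilinear_on sl2 sl2 sl2 (brk sl2)"
    unfolding bilinear_on_def LinearCombinations.module_hom_def
    by (simp add: mat_commutator_traceless mmul_linear mscale_linear Pi_iff)
  thus ?thesis using superspace_sl2 unfolding lie_superalgebra_def p koszul_def
    by (simp add: all_bool_eq traceless_simps mat_commutator_traceless mmul_linear mmul_assoc s)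
qed

lemma lie_iso_gsl: "lie_iso sl2 gx_embedded gsl"
proof (rule lie_iso_transfer[OF lie_superalgebra_sl2 superspace_gx])
  show "gsl \<in> LinearCombinations.module_hom \<CC> sl2 gx_embedded"
    unfolding LinearCombinations.module_hom_def carrier_gx gx_embedded_simps sl2_simps by (simp add: gsl_linear Pi_iff del: gsl.simps)
  show "bij_betw gsl (carrier sl2) (carrier gx_embedded)"
    unfolding bij_betw_def carrier_gx sl2_simps using gsl_inj by (blast intro: inj_onI)
  show "gsl ` part sl2 p = part gx_embedded p" for p
    by (simp add: part_def gx_embedded_simps gsl_zero del: gsl.simps)
  show "gsl (brk sl2 A B) = brk gx_embedded (gsl A) (gsl B)" if "A \<in> carrier sl2" "B \<in> carrier sl2" for A B
    using that gsl_brk by (simp add: gx_embedded_simps del: gsl.simps)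
qed

section \<open>The adjoint representation\<close>

text \<open>The coordinates number 31 = 14 + 3 + 7 + 7: a derivation, a traceless matrix and two
  imaginary octonions.\<close>

definition g3_of_vec :: "complex vec \<Rightarrow> g3" where
  "g3_of_vec v = (dermap (v $ 0, v $ 1, v $ 2) (v $ 3, v $ 4, v $ 5) (v $ 6, v $ 7, - v $ 0 - v $ 4) (v $ 8, v $ 9, v $ 10) (v $ 11, v $ 12, v $ 13),
     ((v $ 14, v $ 15), (v $ 16, - v $ 14)), (v $ 17, (v $ 18, v $ 19, v $ 20), (v $ 21, v $ 22, v $ 23), - v $ 17),
     (v $ 24, (v $ 25, v $ 26, v $ 27), (v $ 28, v $ 29, v $ 30), - v $ 24))"

lemma g3_of_vec_surj: "a \<in> carrier G3 \<Longrightarrow> \<exists>v\<in>carrier_vec 31. a = g3_of_vec v"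
proof -
  assume a: "a \<in> carrier G3"
  obtain D A p q where a': "a = (D, A, p, q)" using g3_cases by metis
  have D: "D \<in> Der" and A: "A \<in> traceless" and p: "p \<in> imaginary" and q: "q \<in> imaginary" using a a' by auto
  obtain a11 a12 a13 a21 a22 a23 a31 a32 y z where D': "D = dermap (a11, a12, a13) (a21, a22, a23) (a31, a32, - a11 - a22) y z"
    using D unfolding Der_iff by blast
  obtain y1 y2 y3 z1 z2 z3 where yz: "y = (y1, y2, y3)" "z = (z1, z2, z3)" by (cases y; cases z)
  obtain m1 m2 m3 m4 where m: "A = ((m1, m2), (m3, m4))" by (rule mat2_cases)
  have m4: "m4 = - m1" using A m by (simp add: traceless_neg)
  obtain b u1 u2 u3 v1 v2 v3 where p': "p = (b, (u1, u2, u3), (v1, v2, v3), - b)" by (rule imaginaryE[OF p])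
  obtain c s1 s2 s3 t1 t2 t3 where q': "q = (c, (s1, s2, s3), (t1, t2, t3), - c)" by (rule imaginaryE[OF q])
  let ?v = "vec 31 (nth [a11, a12, a13, a21, a22, a23, a31, a32, y1, y2, y3, z1, z2, z3, m1, m2, m3, b, u1, u2, u3, v1, v2, v3, c, s1, s2, s3, t1, t2, t3])"
  have "?v \<in> carrier_vec 31" by (intro carrier_vecI) simp
  moreover have "a = g3_of_vec ?v" by (simp add: a' D' yz m m4 p' q' g3_of_vec_def)
  ultimately show ?thesis by blast
qed

lemma fd_rep_adj: "fd_rep G3 (adj_rep G3)"
proof -
  interpret A: sspace "adj_rep G3" using is_rep_adj[OF lie_superalgebra_G3] by (intro sspaceI) (simp add: is_rep_def)
  interpret V: vec_space "TYPE(complex)" 31 .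
  have c: "g3_of_vec v \<in> carrier G3" for v by (simp add: g3_of_vec_def dermap_Der traceless_neg imaginary_def)
  interpret T: linear_map \<CC> "module_vec TYPE(complex) 31" "adj_rep G3" g3_of_vec
  proof unfold_locales
    show "g3_of_vec \<in> LinearCombinations.module_hom \<CC> (module_vec TYPE(complex) 31) (adj_rep G3)"
      unfolding LinearCombinations.module_hom_def using c
      by (auto simp: g3_of_vec_def fun_eq_iff module_vec_simps algebra_simps case_prod_beta) 
  qed
  have "g3_of_vec ` carrier (module_vec TYPE(complex) 31) = carrier (adj_rep G3)"
    unfolding adj_rep_simps module_vec_simps using c g3_of_vec_surj by blast
  hence "vectorspace.fin_dim \<CC> (adj_rep G3)" by (rule T.surj_fin_dim[OF V.fin_dim])
  thus ?thesis using is_rep_adj[OF lie_superalgebra_G3] by (simp add: fd_rep_def)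
qed

section \<open>The algebra \<open>DS\<^sub>x(\<gg>)\<close>\<close>

lemma x0_part: "x0 \<in> part G3 True"
  by (simp add: x0_def part_def imaginary_simps(3)) (simp add: imaginary_def)

lemma dermap_eq_iff:
  "dermap (a11, a12, a13) (a21, a22, a23) (a31, a32, a33) (y1, y2, y3) (z1, z2, z3)
   = dermap (b11, b12, b13) (b21, b22, b23) (b31, b32, b33) (w1, w2, w3) (x1, x2, x3)
   \<longleftrightarrow> (a11, a12, a13, a21, a22, a23, a31, a32, a33) = (b11, b12, b13, b21, b22, b23, b31, b32, b33)
     \<and> (y1, y2, y3, z1, z2, z3) = (w1, w2, w3, x1, x2, x3)" (is "?D = ?E \<longleftrightarrow> ?R")
proof
  assume "?D = ?E"
  hence "?D w = ?E w" for w by simp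
  from this[of zE] this[of zU1] this[of zU2] this[of zU3] show ?R by simp
qed simp

lemma dermap_zero: "0 = dermap (0, 0, 0) (0, 0, 0) (0, 0, 0) (0, 0, 0) (0, 0, 0)"
  by (rule ext, case_tac x rule: zorn_cases) (simp add: zero_prod_def)

lemma dermap_add:
  "dermap (a11, a12, a13) (a21, a22, a23) (a31, a32, a33) (y1, y2, y3) (z1, z2, z3)
   + dermap (b11, b12, b13) (b21, b22, b23) (b31, b32, b33) (w1, w2, w3) (x1, x2, x3)
   = dermap (a11 + b11, a12 + b12, a13 + b13) (a21 + b21, a22 + b22, a23 + b23) (a31 + b31, a32 + b32, a33 + b33)
      (y1 + w1, y2 + w2, y3 + w3) (z1 + x1, z2 + x2, z3 + x3)"
  by (rule ext, case_tac x rule: zorn_cases) (simp add: algebra_simps)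

text \<open>The operator ad \<open>x0\<close> in coordinates; its kernel and image, and the bracket
  with the opposite root vector, are read off from this formula.\<close>

lemma x0_brk:
  "g3_brk x0 (dermap (a11, a12, a13) (a21, a22, a23) (a31, a32, - a11 - a22) (y1, y2, y3) (z1, z2, z3), ((a, b), (c, d)),
     (e, (u1, u2, u3), (v1, v2, v3), - e), (f, (s1, s2, s3), (t1, t2, t3), - f))
   = (dermap (- t3, 0, 0) (0, - t3, 0) (3 * t1, 3 * t2, 2 * t3) (0, 0, 2 * f) (s2, - s1, 0),
      ((- 2 * t3, 4 * v3), (0, 2 * t3)), (z3, (- a13, - a23, a11 + a22 - a), (- y2, y1, 0), - z3), (0, (0, 0, - c), (0, 0, 0), 0))"
proof -
  let ?q = "(f, (s1, s2, s3), (t1, t2, t3), - f)"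
  have "zder zU3 ?q = dermap (- t3, 0, 0) (0, - t3, 0) (3 * t1, 3 * t2, 2 * t3) (0, 0, 2 * f) (s2, - s1, 0)"
    using zder_explicit[of 0 0 0 1 0 0 0 f s1 s2 s3 t1 t2 t3] by simp
  moreover have "dermap m1 m2 m3 m4 m5 0 = 0" for m1 m2 m3 m4 m5
    by (cases m1; cases m2; cases m3; cases m4; cases m5) (simp add: zero_prod_def)
  ultimately show ?thesis
        by (simp add: x0_def zder_bilin odd_brk_sl2_def ztrace_def)
qed

lemma x0_square: "brk G3 x0 x0 = \<zero>\<^bsub>G3\<^esub>"
  proof -
  have "x0 = (dermap (0, 0, 0) (0, 0, 0) (0, 0, - 0 - 0) (0, 0, 0) (0, 0, 0), ((0, 0), (0, 0)),
     (0, (0, 0, 1), (0, 0, 0), - 0), (0, (0, 0, 0), (0, 0, 0), - 0))"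
    by (simp add: x0_def dermap_zero) (simp add: zero_prod_def)
  hence "g3_brk x0 x0 = g3_brk x0 (dermap (0, 0, 0) (0, 0, 0) (0, 0, - 0 - 0) (0, 0, 0) (0, 0, 0), ((0, 0), (0, 0)),
     (0, (0, 0, 1), (0, 0, 0), - 0), (0, (0, 0, 0), (0, 0, 0), - 0))" by simp
  also have "\<dots> = 0" unfolding x0_brk by (simp add: zero_prod_def dermap_zero)
  finally show ?thesis by simp
qed

interpretation ad: ds_repn G3 "adj_rep G3" x0
proof (intro ds_repn.intro fd_repn.intro fd_repn_axioms.intro ds_repn_axioms.intro)
  show "sspace (adj_rep G3)" using is_rep_adj[OF lie_superalgebra_G3] by (intro sspaceI) (simp add: is_rep_def)
qed (fact G3.sspace_axioms lie_superalgebra_G3 fd_rep_adj x0_part x0_square)+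

lemma G3_form:
  assumes "k \<in> carrier G3"
  obtains a11 a12 a13 a21 a22 a23 a31 a32 y1 y2 y3 z1 z2 z3 a b c e u1 u2 u3 v1 v2 v3 f s1 s2 s3 t1 t2 t3 where
   "k = (dermap (a11, a12, a13) (a21, a22, a23) (a31, a32, - a11 - a22) (y1, y2, y3) (z1, z2, z3), ((a, b), (c, - a)),
     (e, (u1, u2, u3), (v1, v2, v3), - e), (f, (s1, s2, s3), (t1, t2, t3), - f))"
  proof -
  obtain v where "k = g3_of_vec v" using g3_of_vec_surj[OF assms] by blast
  thus ?thesis unfolding g3_of_vec_def by (rule that)
qed

text \<open>The 14 equations for the kernel make the upper left block of the derivation arbitrary,
  with its trace tied to a; its traceless part represents the class, and all the rest is a bracket
  with \<open>x0\<close>.\<close>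

lemma ker_decomp:
  assumes "k \<in> ad.ker"
  shows "\<exists>A\<in>traceless. \<exists>i\<in>ad.im. k = gsl A + i"
proof -
  have k: "k \<in> carrier G3" "g3_brk x0 k = 0" using assms by (simp_all add: ad.ker_def)
  obtain a11 a12 a13 a21 a22 a23 a31 a32 y1 y2 y3 z1 z2 z3 a b c e u1 u2 u3 v1 v2 v3 f s1 s2 s3 t1 t2 t3 where
   k': "k = (dermap (a11, a12, a13) (a21, a22, a23) (a31, a32, - a11 - a22) (y1, y2, y3) (z1, z2, z3), ((a, b), (c, - a)),
     (e, (u1, u2, u3), (v1, v2, v3), - e), (f, (s1, s2, s3), (t1, t2, t3), - f))"
    by (rule G3_form[OF k(1)])
  have "t3 = 0 \<and> t1 = 0 \<and> t2 = 0 \<and> f = 0 \<and> s2 = 0 \<and> s1 = 0 \<and> v3 = 0 \<and> z3 = 0 \<and> a13 = 0 \<and> a23 = 0 \<and> a11 + a22 = a \<and> y2 = 0 \<and> y1 = 0 \<and> c = 0"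
    using k(2) by (simp add: k' x0_brk zero_prod_def dermap_zero dermap_eq_iff)
  hence k0: "t3 = 0" "t1 = 0" "t2 = 0" "f = 0" "s2 = 0" "s1 = 0" "v3 = 0" "z3 = 0" "a13 = 0" "a23 = 0" "a = a11 + a22" "y2 = 0" "y1 = 0" "c = 0"
    by simp_all
  \<comment> \<open>\<open>?A\<close> is the traceless part of the upper left block of k. The
    entries of \<open>?m\<close> solve the linear equations of \<open>x0_brk\<close> for the
    remainder; the trace a of the block accounts for the entry - a / 2.\<close>
  let ?A = "(((a11 - a22) / 2, a12), (a21, (a22 - a11) / 2)) :: mat2"
  let ?m = "(dermap (0, 0, - u1) (0, 0, - u2) (0, 0, - 0 - 0) (v2, - v1, 0) (0, 0, e), ((- u3, 0), (- s3, u3)),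
    (0, (0, 0, 0), (0, 0, b / 4), - 0), (y3 / 2, (- z2, z1, 0), (a31 / 3, a32 / 3, - a / 2), - (y3 / 2)))"
  have "?A \<in> traceless" by (simp add: traceless_neg minus_divide_left)
  moreover have "?m \<in> carrier G3" by (simp add: dermap_Der traceless_neg imaginary_def)
  hence "g3_brk x0 ?m \<in> ad.im" unfolding ad.im_def adj_rep_simps G3_simps(7) by (rule imageI)
  moreover have "k = gsl ?A + g3_brk x0 ?m"
    unfolding x0_brk by (simp add: k' k0 gder_def zero_prod_def dermap_add dermap_eq_iff add_divide_distrib[symmetric] diff_divide_distrib[symmetric])
  ultimately show ?thesis by blast
qed

text \<open>By \<open>x0_brk\<close> the upper left block of an element of the image is scalar, and
  a traceless scalar block is zero.\<close>

lemma gsl_im: "gsl A \<in> ad.im \<Longrightarrow> A \<in> traceless \<Longrightarrow> A = 0"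
proof -
  assume g: "gsl A \<in> ad.im" and A: "A \<in> traceless"
  obtain k where k: "k \<in> carrier G3" "gsl A = g3_brk x0 k" using g by (auto simp: ad.im_def simp del: gsl.simps)
  obtain a11 a12 a13 a21 a22 a23 a31 a32 y1 y2 y3 z1 z2 z3 a b c e u1 u2 u3 v1 v2 v3 f s1 s2 s3 t1 t2 t3 where
   k': "k = (dermap (a11, a12, a13) (a21, a22, a23) (a31, a32, - a11 - a22) (y1, y2, y3) (z1, z2, z3), ((a, b), (c, - a)),
     (e, (u1, u2, u3), (v1, v2, v3), - e), (f, (s1, s2, s3), (t1, t2, t3), - f))"
    by (rule G3_form[OF k(1)])
  obtain m1 m2 m3 m4 where m: "A = ((m1, m2), (m3, m4))" by (rule mat2_cases)
  show "A = 0" using k(2) by (simp add: k' m x0_brk zero_prod_def dermap_eq_iff gder_def)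
qed

lemma gsl_ker: "A \<in> traceless \<Longrightarrow> gsl A \<in> ad.ker"
proof -
  assume A: "A \<in> traceless"
  obtain m1 m2 m3 m4 where m: "A = ((m1, m2), (m3, m4))" by (rule mat2_cases)
  have "gsl A = (dermap (m1, m2, 0) (m3, m4, 0) (0, 0, - m1 - m4) (0, 0, 0) (0, 0, 0), ((0, 0), (0, 0)), (0, (0, 0, 0), (0, 0, 0), - 0), (0, (0, 0, 0), (0, 0, 0), - 0))"
    using A by (simp add: m gder_def zero_prod_def traceless_neg)
  hence "g3_brk x0 (gsl A) = 0" using A unfolding m traceless_neg
    by (simp only: x0_brk) (simp add: zero_prod_def dermap_zero)
  thus ?thesis using gsl_carrier(1)[OF A] by (simp add: ad.ker_def del: gsl.simps)
qed

abbreviation "gq \<equiv> gx_coset x0"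

lemma gq_eq: "gq a = ad.quo.q a"
  by (simp add: gx_coset_def ds_ideal_def ad.im_def a_r_coset_def')

lemma DS_alg_simps:
  "carrier (DS_alg G3 x0) = carrier (DS_mod (adj_rep G3) x0)" "\<zero>\<^bsub>DS_alg G3 x0\<^esub> = \<zero>\<^bsub>DS_mod (adj_rep G3) x0\<^esub>"
  "(\<oplus>\<^bsub>DS_alg G3 x0\<^esub>) = (\<oplus>\<^bsub>DS_mod (adj_rep G3) x0\<^esub>)" "(\<odot>\<^bsub>DS_alg G3 x0\<^esub>) = (\<odot>\<^bsub>DS_mod (adj_rep G3) x0\<^esub>)"
  "even_part (DS_alg G3 x0) = even_part (DS_mod (adj_rep G3) x0)" "odd_part (DS_alg G3 x0) = odd_part (DS_mod (adj_rep G3) x0)"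
  "brk (DS_alg G3 x0) = act (DS_mod (adj_rep G3) x0)"
  by (simp_all add: DS_alg_def DS_mod_def superspace.defs lie_super.defs rep.defs subquotient_def ds_ideal_def a_r_coset_def' set_add_def' fun_eq_iff)

lemma superspace_DS_alg: "superspace (DS_alg G3 x0)"
  by (rule superspace_cong[OF ad.quo.superspace_Q DS_alg_simps(1-6)])

lemma brk_DS_alg: "a \<in> ad.ker \<Longrightarrow> b \<in> ad.ker \<Longrightarrow> brk (DS_alg G3 x0) (gq a) (gq b) = gq (g3_brk a b)"
proof -
  assume a: "a \<in> ad.ker" and b: "b \<in> ad.ker"
  have a': "a \<in> carrier G3" "brk G3 x0 a = \<zero>\<^bsub>G3\<^esub>" using a by (simp_all add: ad.ker_def)
  have "gq a = ds_ideal G3 x0 +>\<^bsub>G3\<^esub> a" by (simp add: gx_coset_def)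
  thus ?thesis using ad.act_DS[OF a' b] unfolding DS_alg_simps gq_eq[symmetric] by simp
qed

lemma gq_gsl_eq_zero: "A \<in> traceless \<Longrightarrow> gq (gsl A) = \<zero>\<^bsub>DS_alg G3 x0\<^esub> \<longleftrightarrow> A = 0"
  proof -
  assume A: "A \<in> traceless"
  have "gq (gsl A) = \<zero>\<^bsub>DS_alg G3 x0\<^esub> \<longleftrightarrow> gsl A \<in> ad.im"
    unfolding gq_eq DS_alg_simps(2) ad.quo.Q(2) using gsl_carrier(1)[OF A] by (intro ad.quo.q_eq_zero) simp
  moreover have "gsl 0 \<in> ad.im" using ad.sub_zero[OF ad.im_sub] by (simp add: gsl_zero)
  ultimately show ?thesis using gsl_im[OF _ A] by blast
qed

lemma gq_add_scale: "a \<in> carrier G3 \<Longrightarrow> b \<in> carrier G3 \<Longrightarrow> gq (a + b) = gq a \<oplus>\<^bsub>DS_alg G3 x0\<^esub> gq b"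
  "a \<in> carrier G3 \<Longrightarrow> gq (g3_scale c a) = c \<odot>\<^bsub>DS_alg G3 x0\<^esub> gq a"
  using ad.quo.q_add[of a b] ad.quo.q_smul[of a c] unfolding gq_eq DS_alg_simps by simp_all

lemma gq_ker: "k \<in> ad.ker \<Longrightarrow> \<exists>A\<in>traceless. gq k = gq (gsl A)"
proof -
  assume "k \<in> ad.ker"
  then obtain A i where A: "A \<in> traceless" "i \<in> ad.im" "k = i + gsl A" using ker_decomp by (metis add.commute)
  have "gq k = gq (gsl A)" using ad.quo.q_eqI[OF A(2), of "gsl A"] gsl_carrier(1)[OF A(1)] A(3)
    unfolding gq_eq by (simp del: gsl.simps)
  thus ?thesis using A(1) by blast
qed

text \<open>Every class has a representative in the block, which is even; an odd class is then even
  as well, hence zero.\<close>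

lemma carrier_DS_alg: "carrier (DS_alg G3 x0) = gq ` gsl ` traceless"
  "even_part (DS_alg G3 x0) = gq ` gsl ` traceless" "odd_part (DS_alg G3 x0) = {\<zero>\<^bsub>DS_alg G3 x0\<^esub>}"
proof -
  interpret Q: sspace "DS_alg G3 x0" by (rule sspaceI[OF superspace_DS_alg])
  have c: "carrier (DS_alg G3 x0) = gq ` ad.ker" unfolding DS_alg_simps ad.quo.Q gq_eq ..
  show 1: "carrier (DS_alg G3 x0) = gq ` gsl ` traceless"
    unfolding c
  proof (intro equalityI subsetI)
    fix B assume "B \<in> gq ` ad.ker"
    then obtain k where "k \<in> ad.ker" "B = gq k" by blast
    thus "B \<in> gq ` gsl ` traceless" using gq_ker[of k] by blast
  next
    fix B assume "B \<in> gq ` gsl ` traceless"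
    then obtain A where "A \<in> traceless" "B = gq (gsl A)" by blast
    thus "B \<in> gq ` ad.ker" using gsl_ker by blast
  qed
  have "even_part (DS_alg G3 x0) = gq ` (ad.ker \<inter> even_part G3)" unfolding DS_alg_simps ad.quo.Q gq_eq adj_rep_simps ..
  moreover have "gsl ` traceless \<subseteq> ad.ker \<inter> even_part G3" using gsl_ker gsl_carrier(2) by blast
  ultimately have "gq ` gsl ` traceless \<subseteq> even_part (DS_alg G3 x0)" by (simp only: image_mono)
  thus 2: "even_part (DS_alg G3 x0) = gq ` gsl ` traceless" using Q.parts_carrier(1) unfolding 1 by (rule antisym[rotated])
  show "odd_part (DS_alg G3 x0) = {\<zero>\<^bsub>DS_alg G3 x0\<^esub>}"
    proof
    show "odd_part (DS_alg G3 x0) \<subseteq> {\<zero>\<^bsub>DS_alg G3 x0\<^esub>}"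
    proof
      fix B assume B: "B \<in> odd_part (DS_alg G3 x0)"
      hence "B \<in> even_part (DS_alg G3 x0)" using Q.parts_carrier(2) unfolding 1 2 by (rule subsetD[rotated])
      thus "B \<in> {\<zero>\<^bsub>DS_alg G3 x0\<^esub>}" using Q.parts_disjoint[OF _ B] by simp
    qed
  qed (use Q.sub_zero[OF Q.parts_sub(2)] in simp)
qed

lemma gq_gsl_inj: "A \<in> traceless \<Longrightarrow> B \<in> traceless \<Longrightarrow> gq (gsl A) = gq (gsl B) \<Longrightarrow> A = B"
proof -
  assume A: "A \<in> traceless" and B: "B \<in> traceless" and e: "gq (gsl A) = gq (gsl B)"
  have s: "mscale (-1) B = - B" by (cases B rule: mat2_cases) simp
  have t: "A - B \<in> traceless" using traceless_simps(1)[OF A, of "- B"] traceless_simps(2)[OF B, of "-1"] s by simp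
  have "gsl A \<oplus>\<^bsub>adj_rep G3\<^esub> (-1) \<odot>\<^bsub>adj_rep G3\<^esub> gsl B \<in> ad.im"
    using e ad.quo.q_eq_iff[of "gsl A" "gsl B"] gsl_carrier(1)[OF A] gsl_carrier(1)[OF B] unfolding gq_eq by (simp del: gsl.simps)
  hence "gsl (A - B) \<in> ad.im" using gsl_linear(1)[of A "- B"] gsl_linear(2)[of "-1" B] s by (simp del: gsl.simps)
  hence "A - B = 0" by (rule gsl_im[OF _ t])
  thus "A = B" by simp
qed

lemma lie_iso_gx: "lie_iso gx_embedded (DS_alg G3 x0) gq"
proof (rule lie_iso_transfer)
  show "lie_superalgebra gx_embedded" using lie_iso_gsl by (simp add: lie_iso_def)
  show "superspace (DS_alg G3 x0)" by (rule superspace_DS_alg)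
  have gc: "gsl ` traceless \<subseteq> carrier G3" using gsl_carrier(1) by blast
  show "gq \<in> LinearCombinations.module_hom \<CC> gx_embedded (DS_alg G3 x0)"
        unfolding LinearCombinations.module_hom_def carrier_gx gx_embedded_simps carrier_DS_alg
  proof (intro CollectI conjI ballI allI impI Pi_I)
    show "gq (a + b) = gq a \<oplus>\<^bsub>DS_alg G3 x0\<^esub> gq b" if "a \<in> gsl ` traceless \<and> b \<in> gsl ` traceless" for a b
      using gc that by (intro gq_add_scale(1)) blast+
    show "gq (g3_scale c a) = c \<odot>\<^bsub>DS_alg G3 x0\<^esub> gq a" if "c \<in> carrier \<CC> \<and> a \<in> gsl ` traceless" for c a
      using gc that by (intro gq_add_scale(2)) blast
  qed (rule imageI)
  show "bij_betw gq (carrier gx_embedded) (carrier (DS_alg G3 x0))"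
    unfolding bij_betw_def carrier_gx carrier_DS_alg
  proof (intro conjI inj_onI refl)
    fix a b assume "a \<in> gsl ` traceless" "b \<in> gsl ` traceless" "gq a = gq b"
    then obtain A B where "A \<in> traceless" "B \<in> traceless" "a = gsl A" "b = gsl B" "gq (gsl A) = gq (gsl B)" by blast
    thus "a = b" using gq_gsl_inj by blast
  qed
  have "gq 0 = \<zero>\<^bsub>DS_alg G3 x0\<^esub>" using gq_gsl_eq_zero[of 0] gsl_zero by (simp add: traceless_simps)
  thus "gq ` part gx_embedded p = part (DS_alg G3 x0) p" for p
    by (simp add: part_def gx_embedded_simps carrier_DS_alg)
  show "gq (brk gx_embedded a b) = brk (DS_alg G3 x0) (gq a) (gq b)" if "a \<in> carrier gx_embedded" "b \<in> carrier gx_embedded" for a b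
    proof -
    from that have "a \<in> ad.ker" "b \<in> ad.ker" using gsl_ker unfolding carrier_gx by blast+
    thus ?thesis unfolding gx_embedded_simps by (rule brk_DS_alg[symmetric])
  qed
qed

lemma lie_superalgebra_DS_alg: "lie_superalgebra (DS_alg G3 x0)"
  using lie_iso_gx by (simp add: lie_iso_def)

section \<open>Functionals on the Cartan subalgebra of g_x, and the roots\<close>

lemma gx_cart: "cart t (- t) 0 \<in> gx_cartan"
  unfolding gx_cartan_iff by (rule exI[of _ t]) (simp add: cart_h cart_scale)

lemma gx_cartanE:
  assumes "h \<in> gx_cartan"
  obtains t where "h = cart t (- t) 0"
proof -
  obtain t where "h = g3_scale t h12" using assms unfolding gx_cartan_iff by blast
  thus ?thesis by (intro that[of t]) (simp add: cart_h cart_scale)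
qed

lemma gx_dualI:
  assumes "\<And>h. h \<notin> gx_cartan \<Longrightarrow> \<mu> h = 0" "\<And>t. \<mu> (cart t (- t) 0) = t * c"
  shows "\<mu> \<in> dual G3 gx_cartan"
  unfolding dual_def
proof (intro CollectI conjI allI impI ballI)
  fix h k :: g3 and a :: complex
  show "\<mu> h = 0" if "h \<notin> gx_cartan" using assms(1) that by blast
  assume h: "h \<in> gx_cartan"
  show "\<mu> (h \<oplus>\<^bsub>G3\<^esub> k) = \<mu> h + \<mu> k" if k: "k \<in> gx_cartan"
  proof -
    obtain t u where "h = cart t (- t) 0" "k = cart u (- u) 0" using gx_cartanE h k by metis
    thus ?thesis using assms(2)[of "t + u"] by (simp add: cart_add assms(2) algebra_simps)
  qed
  show "\<mu> (a \<odot>\<^bsub>G3\<^esub> h) = a * \<mu> h"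
  proof -
    obtain t where "h = cart t (- t) 0" using gx_cartanE h by metis
    thus ?thesis using assms(2)[of "a * t"] by (simp add: cart_scale assms(2))
  qed
qed

lemma h12_gx: "h12 \<in> gx_cartan"
  using gx_cart[of 1] by (simp add: cart_h)

lemma gx_dual_apply:
  assumes "\<alpha> \<in> dual G3 gx_cartan"
  shows "h \<notin> gx_cartan \<Longrightarrow> \<alpha> h = 0" "\<alpha> (cart t (- t) 0) = t * \<alpha> h12"
proof -
  show "\<alpha> h = 0" if "h \<notin> gx_cartan" using assms that unfolding dual_def by blast
  have "\<alpha> (t \<odot>\<^bsub>G3\<^esub> h12) = t * \<alpha> h12" using assms h12_gx unfolding dual_def by blast
  thus "\<alpha> (cart t (- t) 0) = t * \<alpha> h12" by (simp add: cart_h cart_scale)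
qed

lemma gx_dual_ext:
  assumes "\<alpha> \<in> dual G3 gx_cartan" "\<beta> \<in> dual G3 gx_cartan" "\<alpha> h12 = \<beta> h12"
  shows "\<alpha> = \<beta>"
proof
  fix h
  show "\<alpha> h = \<beta> h"
  proof (cases "h \<in> gx_cartan")
    case True
    then obtain t where "h = cart t (- t) 0" by (rule gx_cartanE)
    thus ?thesis using assms(3) by (simp add: gx_dual_apply[OF assms(1)] gx_dual_apply[OF assms(2)])
  qed (simp add: gx_dual_apply[OF assms(1)] gx_dual_apply[OF assms(2)])
qed

lemma restrict_eps_dual:
  "restrict_weight gx_cartan (\<lambda>h. a * eps 1 h + b * eps 2 h) \<in> dual G3 gx_cartan"
  "restrict_weight gx_cartan (\<lambda>h. a * eps 1 h + b * eps 2 h) h12 = a - b"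
proof -
  have *: "restrict_weight gx_cartan (\<lambda>h. a * eps 1 h + b * eps 2 h) (cart t (- t) 0) = t * (a - b)" for t
    using gx_cart[of t] by (simp add: restrict_weight_def cart_weights' algebra_simps)
  show "restrict_weight gx_cartan (\<lambda>h. a * eps 1 h + b * eps 2 h) \<in> dual G3 gx_cartan"
    by (rule gx_dualI[OF _ *]) (simp add: restrict_weight_def)
  show "restrict_weight gx_cartan (\<lambda>h. a * eps 1 h + b * eps 2 h) h12 = a - b"
    using *[of 1] by (simp add: cart_h)
qed

text \<open>Under the isomorphism with traceless matrices, the roots are given by the nonzero
  eigenvalues 2 and - 2 of the bracket with \<open>mH\<close>; these are the values of \<epsilon>_1
  - \<epsilon>_2 and its negative at \<open>h12\<close>.\<close>

lemma gx_roots_x0: "gx_roots x0 = {restrict_weight gx_cartan (eps 1 - eps 2), restrict_weight gx_cartan (eps 2 - eps 1)}"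
proof -
  let ?r = "\<lambda>a b. restrict_weight gx_cartan (\<lambda>h. a * eps 1 h + b * eps 2 h)"
  let ?Z = "\<zero>\<^bsub>DS_alg G3 x0\<^esub>"
  have r: "restrict_weight gx_cartan (eps 1 - eps 2) = ?r 1 (-1)" "restrict_weight gx_cartan (eps 2 - eps 1) = ?r (-1) 1"
    by (auto simp: restrict_weight_def fun_eq_iff)
  interpret Q: sspace "DS_alg G3 x0" by (rule sspaceI[OF superspace_DS_alg])
  have m: "gq (gsl A) \<in> root_space (DS_alg G3 x0) gx_cartan gq \<alpha> \<longleftrightarrow> mmul mH A - mmul A mH = mscale (\<alpha> h12) A"
    if A: "A \<in> traceless" and \<alpha>: "\<alpha> \<in> dual G3 gx_cartan" for A \<alpha>
  proof -
    have b: "brk (DS_alg G3 x0) (gq (g3_scale t h12)) (gq (gsl A)) = t \<odot>\<^bsub>DS_alg G3 x0\<^esub> gq (gsl (mmul mH A - mmul A mH))" for t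
    proof -
      have "gsl (mscale t mH) \<in> ad.ker" by (rule gsl_ker) (simp add: traceless_neg)
      hence "brk (DS_alg G3 x0) (gq (gsl (mscale t mH))) (gq (gsl A)) = gq (g3_brk (gsl (mscale t mH)) (gsl A))"
        by (intro brk_DS_alg gsl_ker A traceless_simps traceless_mat)
      also have "g3_brk (gsl (mscale t mH)) (gsl A) = gsl (mmul (mscale t mH) A - mmul A (mscale t mH))"
        by (rule gsl_brk[symmetric]) (use A in \<open>simp_all only: traceless_simps traceless_mat\<close>)
      also have "\<dots> = g3_scale t (gsl (mmul mH A - mmul A mH))" unfolding gsl_linear(2)[symmetric] mmul_linear ..
      finally show ?thesis unfolding gsl_linear(2) gsl_h12 by (simp add: gq_add_scale(2) gsl_carrier(1) mat_commutator_traceless del: gsl.simps G3_simps)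
    qed
    have \<alpha>t: "\<alpha> (g3_scale t h12) = t * \<alpha> h12" for t using gx_dual_apply(2)[OF \<alpha>, of t] by (simp add: cart_h cart_scale)
    have c: "gq (gsl A) \<in> carrier (DS_alg G3 x0)" "gq (gsl (mmul mH A - mmul A mH)) \<in> carrier (DS_alg G3 x0)"
      using A mat_commutator_traceless unfolding carrier_DS_alg by blast+
    have s: "\<alpha> h12 \<odot>\<^bsub>DS_alg G3 x0\<^esub> gq (gsl A) = gq (gsl (mscale (\<alpha> h12) A))"
      unfolding gsl_linear(2) by (rule gq_add_scale(2)[symmetric, OF gsl_carrier(1)[OF A]])
    have "gq (gsl A) \<in> root_space (DS_alg G3 x0) gx_cartan gq \<alpha> \<longleftrightarrow>
       (\<forall>t. t \<odot>\<^bsub>DS_alg G3 x0\<^esub> gq (gsl (mmul mH A - mmul A mH)) = (t * \<alpha> h12) \<odot>\<^bsub>DS_alg G3 x0\<^esub> gq (gsl A))"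
      proof -
      have *: "(\<forall>h\<in>gx_cartan. P h) \<longleftrightarrow> (\<forall>t. P (g3_scale t h12))" for P using gx_cartan_iff by metis
      show ?thesis unfolding root_space_def mem_Collect_eq * b \<alpha>t using c by blast
    qed
    also have "\<dots> \<longleftrightarrow> gq (gsl (mmul mH A - mmul A mH)) = \<alpha> h12 \<odot>\<^bsub>DS_alg G3 x0\<^esub> gq (gsl A)"
      using c Q.smul_assoc Q.smul_1 by (metis mult_1)
    also have "\<dots> \<longleftrightarrow> mmul mH A - mmul A mH = mscale (\<alpha> h12) A"
      unfolding s using gq_gsl_inj[OF mat_commutator_traceless traceless_simps(2)[OF A]] by metis
    finally show ?thesis .
  qed
  have "\<alpha> \<in> gx_roots x0 \<longleftrightarrow> \<alpha> = ?r 1 (-1) \<or> \<alpha> = ?r (-1) 1" for \<alpha>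
  proof
    assume "\<alpha> \<in> gx_roots x0"
    hence \<alpha>: "\<alpha> \<in> dual G3 gx_cartan" "\<alpha> \<noteq> 0" and "root_space (DS_alg G3 x0) gx_cartan gq \<alpha> \<noteq> {?Z}"
      unfolding gx_roots_def by auto
    moreover have "?Z \<in> root_space (DS_alg G3 x0) gx_cartan gq \<alpha>"
      using m[OF _ \<alpha>(1), of 0] gq_gsl_eq_zero[of 0] by (simp add: traceless_simps del: gsl.simps)
    ultimately obtain B where B: "B \<in> root_space (DS_alg G3 x0) gx_cartan gq \<alpha>" "B \<noteq> ?Z" by blast
    then obtain A where A: "A \<in> traceless" "B = gq (gsl A)" unfolding root_space_def carrier_DS_alg by blast
    hence A0: "A \<noteq> 0" using B(2) gq_gsl_eq_zero by blast
    have "\<alpha> h12 \<noteq> 0" using gx_dual_ext[OF \<alpha>(1) gx_dualI[of 0 0]] \<alpha>(2) by auto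
    obtain m1 m2 m3 m4 where m': "A = ((m1, m2), (m3, m4))" by (rule mat2_cases)
    have "mmul mH A - mmul A mH = mscale (\<alpha> h12) A" using m[OF A(1) \<alpha>(1)] B(1) A(2) by simp
    hence "\<alpha> h12 = 2 \<or> \<alpha> h12 = - 2" using A0 A(1) \<open>\<alpha> h12 \<noteq> 0\<close>
      by (auto simp: m' zero_prod_def traceless_neg) (metis mult_cancel_right mult_minus_left)
        hence "\<alpha> h12 = ?r 1 (-1) h12 \<or> \<alpha> h12 = ?r (-1) 1 h12" unfolding restrict_eps_dual(2) by simp
    thus "\<alpha> = ?r 1 (-1) \<or> \<alpha> = ?r (-1) 1"
      using gx_dual_ext[OF \<alpha>(1) restrict_eps_dual(1)] by blast
  next
    assume "\<alpha> = ?r 1 (-1) \<or> \<alpha> = ?r (-1) 1"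
    then obtain A where A: "A \<in> traceless" "A \<noteq> 0" "mmul mH A - mmul A mH = mscale (\<alpha> h12) A" and \<alpha>: "\<alpha> \<in> dual G3 gx_cartan" "\<alpha> h12 \<noteq> 0"
    proof
      assume a: "\<alpha> = ?r 1 (-1)" 
            have "\<alpha> h12 = 2" unfolding a restrict_eps_dual(2) by simp
      thus ?thesis using restrict_eps_dual(1)[of 1 "-1"] by (intro that[of mE]) (simp_all add: a traceless_neg zero_prod_def)
    next
      assume a: "\<alpha> = ?r (-1) 1" 
            have "\<alpha> h12 = - 2" unfolding a restrict_eps_dual(2) by simp
      thus ?thesis using restrict_eps_dual(1)[of "-1" 1] by (intro that[of mF]) (simp_all add: a traceless_neg zero_prod_def)
    qed
    have "gq (gsl A) \<in> root_space (DS_alg G3 x0) gx_cartan gq \<alpha>" "gq (gsl A) \<noteq> ?Z" using m[OF A(1) \<alpha>(1)] A gq_gsl_eq_zero by auto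
    thus "\<alpha> \<in> gx_roots x0" using \<alpha> unfolding gx_roots_def by auto
  qed
  thus ?thesis unfolding r by blast
qed

section \<open>Weights of \<open>G(3)\<close>-modules\<close>

text \<open>Joint eigenvectors span, and on each of them the eigenvalue of the sum is a sum of two
  roots. This is used for \<open>h23\<close> + \<open>hs\<close>, whose two terms belong to
  sl(2)-triples.\<close>

lemma (in cvs) diagonal_add:
  assumes S: "diagonal S" and T: "diagonal T" and ST: "\<And>v. v \<in> carrier V \<Longrightarrow> S (T v) = T (S v)"
  shows "diagonal (\<lambda>v. S v \<oplus> T v)" (is "diagonal ?U")
proof -
  obtain as bs where as: "set as \<subseteq> \<int>" "\<And>v. v \<in> carrier V \<Longrightarrow> vfac S as v = \<zero>"
    and bs: "set bs \<subseteq> \<int>" "\<And>v. v \<in> carrier V \<Longrightarrow> vfac T bs v = \<zero>" using S T unfolding diagonal_def by metis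
  have e: "endo S" "endo T" using S T by (simp_all add: diagonal_def)
  have U: "endo ?U" by (rule endoI) (simp_all add: endo_simps[OF e(1)] endo_simps[OF e(2)] smul_r_distr M.add.m_ac)
  let ?cs = "remdups [a + b. a \<leftarrow> as, b \<leftarrow> bs]"
  let ?J = "{v \<in> carrier V. \<forall>R\<in>set [S, T]. \<exists>k\<in>\<int>. R v = k \<odot> v}"
  let ?N = "{v \<in> carrier V. vfac ?U ?cs v = \<zero>}"
  note eU = endo_simps[OF endo_vfac[OF U]]
  have N: "submodule \<CC> ?N V" by (rule subI) (auto simp: eU)
  have "carrier V \<subseteq> span ?J"
  proof (rule joint_eigenvectors_span)
    show "submodule \<CC> (carrier V) V" by (rule subI) auto
  qed (use S T ST e in \<open>auto simp: endo_simps\<close>)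
  moreover have "?J \<subseteq> ?N"
  proof
    fix v assume "v \<in> ?J"
    then obtain k l where v: "v \<in> carrier V" "S v = k \<odot> v" "T v = l \<odot> v" by auto
    show "v \<in> ?N"
    proof (cases "v = \<zero>")
      case False
      have "(\<Prod>a\<leftarrow>as. k - a) \<odot> v = \<zero>" "(\<Prod>a\<leftarrow>bs. l - a) \<odot> v = \<zero>"
        using vfac_eigen[OF e(1) v(1,2), of as] vfac_eigen[OF e(2) v(1,3), of bs] as(2)[OF v(1)] bs(2)[OF v(1)] by auto
      hence "(\<Prod>a\<leftarrow>as. k - a) = 0" "(\<Prod>a\<leftarrow>bs. l - a) = 0" using smul_eq_0[OF v(1)] False by blast+
      hence "k \<in> set as" "l \<in> set bs" by (auto simp: prod_list_zero_iff)
      hence "k + l \<in> set ?cs" by auto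
      hence p: "(\<Prod>a\<leftarrow>?cs. (k + l) - a) = 0" by (force simp: prod_list_zero_iff)
      have "?U v = (k + l) \<odot> v" using v by (simp add: smul_l_distr)
      hence "vfac ?U ?cs v = 0 \<odot> v" using vfac_eigen[OF U v(1), of "k + l" ?cs] unfolding p by simp
      thus ?thesis using v(1) by simp
    qed (simp add: eU)
  qed
  ultimately have "vfac ?U ?cs v = \<zero>" if "v \<in> carrier V" for v using span_is_subset[OF _ N] that by blast
  moreover have "set ?cs \<subseteq> \<int>" using as(1) bs(1) by (auto intro!: Ints_add)
  ultimately show ?thesis using U unfolding diagonal_def by (intro conjI exI[of _ ?cs]) auto
qed

text \<open>\<open>om c\<close> is the functional with value c at \<open>h12\<close>, where
  \<open>eps 1\<close> has the value 1. With the exponentials \<open>zz\<close>, x_1 restricts to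
  \<open>zz 1\<close> and x_2 to \<open>zz (-1)\<close>.\<close>

definition om :: "complex \<Rightarrow> g3 weight" where "om c = restrict_weight gx_cartan (\<lambda>h. c * eps 1 h)"
definition zz :: "int \<Rightarrow> g3 group_ring" where "zz k = fexp (om (of_int k))"

lemma om_apply: "om c (cart t (- t) 0) = t * c" "h \<notin> gx_cartan \<Longrightarrow> om c h = 0" "om c h12 = c"
  using gx_cart[of t] gx_cart[of 1] by (simp_all add: om_def restrict_weight_def cart_weights' cart_h)

lemma om_dual: "om c \<in> dual G3 gx_cartan"
  by (rule gx_dualI[of _ c]) (simp_all add: om_apply)

lemma om_add: "om (c + d) = om c + om d"
  by (auto simp: om_def restrict_weight_def fun_eq_iff algebra_simps)

lemma om_unique: "\<alpha> \<in> dual G3 gx_cartan \<Longrightarrow> \<alpha> = om (\<alpha> h12)"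
  by (rule gx_dual_ext[OF _ om_dual]) (simp_all add: om_apply)

lemma zz_add: "zz (j + k) = zz j * zz k"
  by (simp add: zz_def om_add fexp_add)

lemma zz_0: "zz 0 = 1"
  using gx_dual_ext[OF om_dual[of 0] gx_dualI[of 0 0]] by (simp add: zz_def om_apply fexp_zero)

locale g3_repn = ds_repn G3 M x0 for M :: "(g3, 'v) rep" (structure)

lemma g3_repnI: "fd_rep G3 M \<Longrightarrow> g3_repn M"
proof -
  assume M: "fd_rep G3 M"
  have "sspace M" using M by (intro sspaceI) (simp add: fd_rep_def is_rep_def)
    show ?thesis
    by (intro g3_repn.intro ds_repn.intro fd_repn.intro fd_repn_axioms.intro ds_repn_axioms.intro)
      (fact G3.sspace_axioms lie_superalgebra_G3 x0_part x0_square \<open>sspace M\<close> M)+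
qed

context g3_repn
begin

lemma h_diagonal: "diagonal (act M h12)" "diagonal (act M h23)" "diagonal (act M hs)"
  using sl2_diagonal[of "gsl mE" "gsl mF" h12] sl2_diagonal[of e23 f23 h23] sl2_diagonal[of "gmat mE" "gmat mF" hs]
    even_elements traceless_mat sl2_triple_12 sl2_triple_23 sl2_triple_s by (simp_all del: gsl.simps)

lemma cart_carrier: "cart t1 t2 s \<in> carrier G3" "cart t1 t2 s \<in> part G3 False"
  using cart_even part_carrier(1) by blast+

lemma cart_act_commute: "v \<in> carrier M \<Longrightarrow> act M (cart t1 t2 s) (act M (cart u1 u2 r) v) = act M (cart u1 u2 r) (act M (cart t1 t2 s) v)"
  using even_commute[OF cart_even cart_even, of v t1 t2 s u1 u2 r] act_zero[of v]
  by (simp add: cart_commute act_simps cart_carrier del: G3_simps(1))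

lemma x_weight: "g3_brk (cart t1 t2 s) x0 = g3_scale (- t1 - t2 + s) x0"
  unfolding x0_def by (subst cart_brk) (auto simp: Der_closed zero_prod_def fun_eq_iff)

text \<open>The condition s = t1 + t2 says that \<open>eps 3 + delta\<close>, the weight of
  \<open>x0\<close>, vanishes on the torus element.\<close>

lemma cart_x_commute:
  assumes "v \<in> carrier M" "s = t1 + t2"
  shows "act M (cart t1 t2 s) (act M x0 v) = act M x0 (act M (cart t1 t2 s) v)"
proof -
  have "brk G3 (cart t1 t2 s) x0 = \<zero>\<^bsub>G3\<^esub>" using x_weight[of t1 t2 s] assms(2) G3.smul_0[OF xK] by simp
  thus ?thesis using even_commute[OF cart_even xodd assms(1), of t1 t2 s] assms(1)
    by (simp add: act_zero act_simps cart_carrier xK del: G3_simps(1,2))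
qed

lemma even_parts: "a \<in> part G3 False \<Longrightarrow> v \<in> even_part M \<Longrightarrow> act M a v \<in> even_part M"
  "a \<in> part G3 False \<Longrightarrow> v \<in> odd_part M \<Longrightarrow> act M a v \<in> odd_part M"
  using act_part[of a False v False] act_part[of a False v True] by (simp_all add: part_def)

lemma act_cart:
  assumes "v \<in> carrier M"
  shows "act M (cart t1 t2 s) v = t1 \<odot> act M h12 v \<oplus> ((t1 + t2) \<odot> act M h23 v \<oplus> s \<odot> act M hs v)"
proof -
  have c: "h12 \<in> carrier G3" "h23 \<in> carrier G3" "hs \<in> carrier G3" unfolding cart_h by (rule cart_carrier)+
  note sc = G3.smul_closed[OF c(1)] G3.smul_closed[OF c(2)] G3.smul_closed[OF c(3)]
  have "cart t1 t2 s = t1 \<odot>\<^bsub>G3\<^esub> h12 \<oplus>\<^bsub>G3\<^esub> ((t1 + t2) \<odot>\<^bsub>G3\<^esub> h23 \<oplus>\<^bsub>G3\<^esub> s \<odot>\<^bsub>G3\<^esub> hs)"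
    unfolding G3_simps by (rule cart_decomp)
  thus ?thesis using c sc assms by (simp add: act_add act_smul del: G3_simps)
qed

lemma g3_weight_basis: "\<exists>B wt. weight_basis G3 g3_cartan id M B wt \<and> finite B \<and> basis B
   \<and> B \<subseteq> even_part M \<union> odd_part M \<and> (\<forall>b\<in>B. \<exists>k. wt b h12 = of_int k)"
proof -
  let ?Ts = "[act M h12, act M h23, act M hs]"
  have "\<exists>B. finite B \<and> basis B \<and> B \<subseteq> joint ?Ts"
  proof (rule joint_basis)
    show "S (T v) = T (S v)" if "S \<in> set ?Ts" "T \<in> set ?Ts" "v \<in> carrier M" for S T v
      using that cart_act_commute unfolding cart_h by auto
    next
        show "T v \<in> even_part M" if "T \<in> set ?Ts" "v \<in> even_part M" for T v
      using that(1) even_parts(1)[OF _ that(2)] even_elements(2-4) unfolding list.set by (elim insertE emptyE) simp_all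
  next
        show "T v \<in> odd_part M" if "T \<in> set ?Ts" "v \<in> odd_part M" for T v
      using that(1) even_parts(2)[OF _ that(2)] even_elements(2-4) unfolding list.set by (elim insertE emptyE) simp_all
  qed (use fd h_diagonal in auto)
  then obtain B where B: "finite B" "basis B" "B \<subseteq> joint ?Ts" by blast
  hence "\<forall>b\<in>B. \<exists>j k l. act M h12 b = of_int j \<odot> b \<and> act M h23 b = of_int k \<odot> b \<and> act M hs b = of_int l \<odot> b"
        unfolding joint_def by (auto elim!: Ints_cases)
  then obtain j k l where jkl: "\<And>b. b \<in> B \<Longrightarrow> act M h12 b = of_int (j b) \<odot> b \<and> act M h23 b = of_int (k b) \<odot> b \<and> act M hs b = of_int (l b) \<odot> b"
    by metis
  \<comment> \<open>j, k, l are the eigenvalues of the three coroots, and t1, t1 + t2, s are the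
    coordinates of a torus element with respect to them.\<close>
  define wt where "wt b = restrict_weight g3_cartan (\<lambda>h. of_int (j b) * eps 1 h + of_int (k b) * (eps 1 h + eps 2 h) + of_int (l b) * delta h)" for b
  have cc: "cart t1 t2 s \<in> g3_cartan" for t1 t2 s using g3_cartan_iff by blast
  have wt: "wt b (cart t1 t2 s) = t1 * of_int (j b) + ((t1 + t2) * of_int (k b) + s * of_int (l b))" for b t1 t2 s
    using cc by (simp add: wt_def restrict_weight_def cart_weights' algebra_simps)
  have dual: "wt b \<in> dual G3 g3_cartan" for b
    unfolding dual_def
  proof (intro CollectI conjI allI impI ballI)
    fix h k :: g3 and a :: complex
    show "wt b h = 0" if "h \<notin> g3_cartan" using that by (simp add: wt_def restrict_weight_def)
    assume "h \<in> g3_cartan"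
    then obtain t1 t2 s where h: "h = cart t1 t2 s" unfolding g3_cartan_iff by blast
    show "wt b (h \<oplus>\<^bsub>G3\<^esub> k) = wt b h + wt b k" if "k \<in> g3_cartan"
    proof -
      from that obtain u1 u2 r where "k = cart u1 u2 r" unfolding g3_cartan_iff by blast
      thus ?thesis by (simp add: h cart_add wt algebra_simps)
    qed
    show "wt b (a \<odot>\<^bsub>G3\<^esub> h) = a * wt b h" by (simp add: h cart_scale wt algebra_simps)
  qed
  have BM: "B \<subseteq> carrier M" and Bp: "B \<subseteq> even_part M \<union> odd_part M" using B(3) joint_carrier unfolding joint_def by blast+
  have act: "act M (id h) b = wt b h \<odot> b" if h: "h \<in> g3_cartan" and b: "b \<in> B" for h b
  proof -
    obtain t1 t2 s where h': "h = cart t1 t2 s" using h unfolding g3_cartan_iff by blast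
    have bM: "b \<in> carrier M" using BM b by blast
    show ?thesis using jkl[OF b] bM by (simp add: h' act_cart wt smul_assoc smul_l_distr)
  qed
  have "weight_basis G3 g3_cartan id M B wt" unfolding weight_basis_def using B(1,2) Bp dual act by blast
  moreover have "wt b h12 = of_int (j b)" for b by (simp add: cart_h wt)
  ultimately show ?thesis using B(1,2) Bp by blast
qed

lemma gx_act:
  assumes "b \<in> carrier M" "act M h12 b = of_int k \<odot> b" "h \<in> gx_cartan"
  shows "act M h b = om (of_int k) h \<odot> b"
proof -
  obtain t where h: "h = cart t (- t) 0" by (rule gx_cartanE[OF assms(3)])
  have c: "act M h23 b \<in> carrier M" "act M hs b \<in> carrier M"
    unfolding cart_h using assms(1) cart_carrier by (simp_all add: act_simps del: G3_simps)
  show ?thesis using assms(1,2) c by (simp add: h act_cart om_apply smul_assoc)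
qed

lemma sch_gx:
  assumes "finite B" "basis B" "B \<subseteq> even_part M \<union> odd_part M" "\<And>b. b \<in> B \<Longrightarrow> act M h12 b = of_int (k b) \<odot> b"
  shows "sch G3 gx_cartan id M = (\<Sum>b\<in>B. of_int (par_sign (b \<in> odd_part M)) * zz (k b))"
proof -
  have "weight_basis G3 gx_cartan id M B (\<lambda>b. om (of_int (k b)))"
    unfolding weight_basis_def using assms om_dual gx_act parts_carrier by (auto simp: subset_iff)
  moreover have "act M (id h) \<in> LinearCombinations.module_hom \<CC> M M" if "h \<in> gx_cartan" for h
    using that gx_cartan_sub act_endo unfolding endo_def by (simp add: subset_iff del: G3_simps)
  ultimately show ?thesis unfolding zz_def by (intro sch_weight_basis[OF ss])
qed

end

text \<open>The function \<phi> is left open: \<open>zz\<close> gives the statement for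
  supercharacters, the indicator of an integer the one for signed multiplicities.\<close>

lemma sum_cancel:
  fixes \<phi> :: "int \<Rightarrow> 'r::comm_ring_1"
  assumes "finite C" "finite V" "inj_on X V" "C \<inter> X ` V = {}" "V \<inter> (C \<union> X ` V) = {}"
    and "\<And>b. b \<in> V \<Longrightarrow> k (X b) = k b" "\<And>b. b \<in> V \<Longrightarrow> s (X b) = - s b"
  shows "(\<Sum>b\<in>C \<union> V \<union> X ` V. of_int (s b) * \<phi> (k b)) = (\<Sum>b\<in>C. of_int (s b) * \<phi> (k b))"
proof -
  have "(\<Sum>b\<in>C \<union> V \<union> X ` V. of_int (s b) * \<phi> (k b))
      = (\<Sum>b\<in>C \<union> V. of_int (s b) * \<phi> (k b)) + (\<Sum>b\<in>X ` V. of_int (s b) * \<phi> (k b))"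
    by (rule sum.union_disjoint) (use assms in auto)
  also have "(\<Sum>b\<in>C \<union> V. of_int (s b) * \<phi> (k b)) = (\<Sum>b\<in>C. of_int (s b) * \<phi> (k b)) + (\<Sum>b\<in>V. of_int (s b) * \<phi> (k b))"
    by (rule sum.union_disjoint) (use assms in auto)
  also have "(\<Sum>b\<in>X ` V. of_int (s b) * \<phi> (k b)) = - (\<Sum>b\<in>V. of_int (s b) * \<phi> (k b))"
    using assms(6,7) by (simp add: sum.reindex[OF assms(3)] sum_negf)
  finally show ?thesis by simp
qed

text \<open>The bracket of \<open>x0\<close> with the vector \<open>y0\<close> of weight \<open>-\<beta>\<close> is \<open>- (h12 + 2 (h23 + hs))\<close>, and \<open>x0\<close> commutes with
  \<open>h23 + hs\<close>.\<close>

definition y0 :: g3 where "y0 = (0, 0, 0, zV3)"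

lemma y0_part: "y0 \<in> part G3 True"
  by (simp add: y0_def part_def imaginary_simps(3)) (simp add: imaginary_def)

lemma x0_y0: "g3_brk x0 y0 = cart (-1) (-1) (-2)"
proof -
  have "y0 = (dermap (0, 0, 0) (0, 0, 0) (0, 0, - 0 - 0) (0, 0, 0) (0, 0, 0), ((0, 0), (0, 0)),
     (0, (0, 0, 0), (0, 0, 0), - 0), (0, (0, 0, 0), (0, 0, 1), - 0))"
    by (simp add: y0_def dermap_zero) (simp add: zero_prod_def)
  hence "g3_brk x0 y0 = g3_brk x0 (dermap (0, 0, 0) (0, 0, 0) (0, 0, - 0 - 0) (0, 0, 0) (0, 0, 0), ((0, 0), (0, 0)),
     (0, (0, 0, 0), (0, 0, 0), - 0), (0, (0, 0, 0), (0, 0, 1), - 0))" by simp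
  also have "\<dots> = cart (-1) (-1) (-2)" unfolding x0_brk by (simp add: cart_def torus_dermap zero_prod_def)
  finally show ?thesis .
qed

text \<open>A signed multiplicity is a difference of two cardinalities, each of them symmetric by
  hypothesis.\<close>

lemma symmetric_counts:
  assumes "finite B" "\<And>b. b \<in> B \<Longrightarrow> b \<in> E \<longleftrightarrow> b \<notin> D"
    and "\<And>P j. P = E \<or> P = D \<Longrightarrow> card {b \<in> B. b \<in> P \<and> k b = - j} = card {b \<in> B. b \<in> P \<and> k b = (j :: int)}"
  shows "(\<Sum>b\<in>B. of_int (par_sign (b \<in> D)) * (if k b = - j then 1 else 0)) = (\<Sum>b\<in>B. of_int (par_sign (b \<in> D)) * (if k b = j then 1 else 0 :: int))"
proof -
  have "(\<Sum>b\<in>B. of_int (par_sign (b \<in> D)) * (if k b = i then 1 else 0 :: int))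
      = int (card {b \<in> B. b \<in> E \<and> k b = i}) - int (card {b \<in> B. b \<in> D \<and> k b = i})" for i
  proof -
    have "(\<Sum>b\<in>B. of_int (par_sign (b \<in> D)) * (if k b = i then 1 else 0 :: int))
      = (\<Sum>b\<in>B. (if b \<in> E \<and> k b = i then 1 else 0) - (if b \<in> D \<and> k b = i then 1 else 0))"
      by (rule sum.cong) (use assms(2) in \<open>auto simp: par_sign_def\<close>)
    thus ?thesis using assms(1) by (simp add: sum_subtractf sum.inter_filter[symmetric])
  qed
  thus ?thesis using assms(3) by presburger
qed

section \<open>The supercharacter of the cohomology of a G(3)-module\<close>

context g3_repn
begin

lemma DS_act:
  assumes "h \<in> gx_cartan" "v \<in> ker"
  shows "act (DS_mod M x0) (gq h) (quo.q v) = quo.q (act M h v)" "act M h v \<in> ker"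
proof -
  obtain t where h: "h = cart t (- t) 0" by (rule gx_cartanE[OF assms(1)])
  have v: "v \<in> carrier M" "act M x0 v = \<zero>" using assms(2) by (simp_all add: ker_def)
  have "h \<in> gsl ` traceless" using assms(1) unfolding gx_cartan_def carrier_gx by blast
  hence "h \<in> ad.ker" using gsl_ker by blast
  hence "h \<in> carrier G3" "brk G3 x0 h = \<zero>\<^bsub>G3\<^esub>" by (simp_all add: ad.ker_def)
  thus "act (DS_mod M x0) (gq h) (quo.q v) = quo.q (act M h v)" unfolding gx_coset_def by (rule act_DS[OF _ _ assms(2)])
  show "act M h v \<in> ker"
    using v cart_x_commute[OF v(1), of 0 t "- t"] by (simp add: ker_def h act_simps cart_carrier del: G3_simps)
qed

lemma DS_act_hom:
  assumes h: "h \<in> gx_cartan"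
  shows "act (DS_mod M x0) (gq h) \<in> LinearCombinations.module_hom \<CC> (DS_mod M x0) (DS_mod M x0)"
proof -
  have hK: "h \<in> carrier G3" using h gx_cartan_sub by blast
  have car: "carrier (DS_mod M x0) = quo.q ` ker" by (rule quo.Q(1))
  show ?thesis
    unfolding LinearCombinations.module_hom_def car
    using DS_act[OF h] hK sub_add[OF ker_sub] sub_smul[OF ker_sub]
    by (auto simp: quo.q_add quo.q_smul quo.ZV act_simps simp del: G3_simps)
qed

text \<open>The same C computes both supercharacters. The exponents and their signed multiplicities
  are kept in the statement because evenness and symmetry decide membership in the ring generated by
  w_x.\<close>

lemma ds_sch:
  "\<exists>C k. finite C \<and> (\<forall>c\<in>C. even (k c))
    \<and> (\<forall>j. (\<Sum>c\<in>C. of_int (par_sign (c \<in> odd_part M)) * (if k c = - j then 1 else 0))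
          = (\<Sum>c\<in>C. of_int (par_sign (c \<in> odd_part M)) * (if k c = j then 1 else 0 :: int)))
    \<and> sch G3 gx_cartan gq (DS_mod M x0) = (\<Sum>c\<in>C. of_int (par_sign (c \<in> odd_part M)) * zz (k c))
    \<and> sch G3 gx_cartan id M = (\<Sum>c\<in>C. of_int (par_sign (c \<in> odd_part M)) * zz (k c))"
proof -
  let ?N = "\<lambda>v. act M h23 v \<oplus> act M hs v" and ?X = "act M x0"
  \<comment> \<open>\<open>hs\<close> alone does not commute with \<open>x0\<close>; the centralizer
    of \<open>x0\<close> in the torus is spanned by \<open>h12\<close> and \<open>h23\<close> +
    \<open>hs\<close>.\<close>
  let ?Ts = "[act M h12, ?N]"
  have hc: "h12 \<in> carrier G3" "h23 \<in> carrier G3" "hs \<in> carrier G3" unfolding cart_h by (rule cart_carrier)+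
  have N: "?N v = act M (cart 0 1 1) v" if "v \<in> carrier M" for v
    using that hc by (simp add: act_cart act_simps del: G3_simps)
  have TA: "\<exists>t1 t2. \<forall>v\<in>carrier M. T v = act M (cart t1 t2 (t1 + t2)) v" if "T \<in> set ?Ts" for T
  proof -
    from that consider "T = act M h12" | "T = ?N" by auto
    thus ?thesis
    proof cases
      case 1
      thus ?thesis unfolding cart_h(1) by (intro exI[of _ 1] exI[of _ "-1"]) simp
    next
      case 2
      thus ?thesis using N by (intro exI[of _ 0] exI[of _ 1]) simp
    qed
  qed
  have "diagonal ?N"
    by (rule diagonal_add[OF h_diagonal(2,3)]) (unfold cart_h, rule cart_act_commute)
  hence "\<exists>C V. finite C \<and> finite V \<and> C \<subseteq> joint ?Ts \<and> V \<subseteq> joint ?Ts \<and> ?X ` V \<subseteq> joint ?Ts \<and> inj_on ?X V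
     \<and> C \<inter> ?X ` V = {} \<and> V \<inter> (C \<union> ?X ` V) = {} \<and> basis (C \<union> V \<union> ?X ` V)
     \<and> lin_indpt (C \<union> ?X ` V) \<and> span (?X ` V) = ?X ` carrier M \<and> span (C \<union> ?X ` V) = {v \<in> carrier M. ?X v = \<zero>}"
  proof (intro square_zero_basis)
    show "T \<in> set ?Ts \<Longrightarrow> diagonal T" if "diagonal ?N" for T using that h_diagonal(1) by auto
    show "S (T v) = T (S v)" if "S \<in> set ?Ts" "T \<in> set ?Ts" "v \<in> carrier M" for S T v
    proof -
            from TA[OF that(1)] TA[OF that(2)] obtain a b c d where
        "\<forall>v\<in>carrier M. S v = act M (cart a b (a + b)) v" "\<forall>v\<in>carrier M. T v = act M (cart c d (c + d)) v" by blast
      thus ?thesis using that(3) cart_act_commute by (simp add: act_simps cart_carrier del: G3_simps)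
    qed
    show "T v \<in> even_part M" if "T \<in> set ?Ts" "v \<in> even_part M" for T v
          proof -
      from TA[OF that(1)] obtain a b where "\<forall>v\<in>carrier M. T v = act M (cart a b (a + b)) v" by blast
      moreover have "v \<in> carrier M" using that(2) parts_carrier by blast
      ultimately show ?thesis using even_parts(1)[OF cart_even that(2)] by simp
    qed
    show "T v \<in> odd_part M" if "T \<in> set ?Ts" "v \<in> odd_part M" for T v
          proof -
      from TA[OF that(1)] obtain a b where "\<forall>v\<in>carrier M. T v = act M (cart a b (a + b)) v" by blast
      moreover have "v \<in> carrier M" using that(2) parts_carrier by blast
      ultimately show ?thesis using even_parts(2)[OF cart_even that(2)] by simp
    qed
    show "T (?X v) = ?X (T v)" if "T \<in> set ?Ts" "v \<in> carrier M" for T v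
    proof -
      from TA[OF that(1)] obtain a b where "\<forall>v\<in>carrier M. T v = act M (cart a b (a + b)) v" by blast
      thus ?thesis using that(2) cart_x_commute by (simp add: act_simps xK del: G3_simps)
    qed
  qed (use fd act_endo[OF xK] odd_square[OF xodd xx] x_parts in auto)
  then obtain C V where fin: "finite C" "finite V" and J: "C \<subseteq> joint ?Ts" "V \<subseteq> joint ?Ts" "?X ` V \<subseteq> joint ?Ts"
    and inj: "inj_on ?X V" and disj: "C \<inter> ?X ` V = {}" "V \<inter> (C \<union> ?X ` V) = {}"
    and bas: "basis (C \<union> V \<union> ?X ` V)" and li: "lin_indpt (C \<union> ?X ` V)"
    and sp: "span (?X ` V) = ?X ` carrier M" "span (C \<union> ?X ` V) = {v \<in> carrier M. ?X v = \<zero>}"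
    by (elim exE conjE) (rule that)
  let ?B = "C \<union> V \<union> ?X ` V"
  have BJ: "?B \<subseteq> joint ?Ts" using J by blast
  have BM: "?B \<subseteq> carrier M" using BJ joint_carrier by blast
  have Bp: "?B \<subseteq> even_part M \<union> odd_part M" using BJ unfolding joint_def by blast
  have "\<forall>b\<in>?B. \<exists>j l. act M h12 b = of_int j \<odot> b \<and> ?N b = of_int l \<odot> b"
    using BJ unfolding joint_def by (auto elim!: Ints_cases)
  then obtain k l where k: "\<And>b. b \<in> ?B \<Longrightarrow> act M h12 b = of_int (k b) \<odot> b" and l: "\<And>b. b \<in> ?B \<Longrightarrow> ?N b = of_int (l b) \<odot> b" by metis
  have nz: "b \<noteq> \<zero>" if "b \<in> ?B" for b using that bas zero_nin_lin_indpt[of ?B] BM UNIV_nontrivial unfolding basis_def by metis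
  have par: "b \<in> even_part M \<longleftrightarrow> b \<notin> odd_part M" if "b \<in> ?B" for b using that nz parts_disjoint Bp by blast
  have kX: "k (?X b) = k b" if b: "b \<in> V" for b
  proof -
    have bM: "b \<in> carrier M" "?X b \<in> carrier M" using b BM by auto
    have "of_int (k (?X b)) \<odot> ?X b = act M h12 (?X b)" using k[of "?X b"] b by simp
    also have "\<dots> = ?X (act M h12 b)" unfolding cart_h using cart_x_commute[OF bM(1), of 0 1 "-1"] by simp
    also have "\<dots> = of_int (k b) \<odot> ?X b" using k[of b] b bM by (simp add: act_simps xK del: G3_simps)
    finally have "of_int (k (?X b)) = (of_int (k b) :: complex)" using smul_cancel bM(2) nz b by blast
    thus ?thesis by simp
  qed
  have sX: "par_sign (?X b \<in> odd_part M) = - par_sign (b \<in> odd_part M)" if b: "b \<in> V" for b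
    using x_parts[of b] par[of b] par[of "?X b"] b unfolding par_sign_def by auto
    have cancel: "(\<Sum>b\<in>?B. of_int (par_sign (b \<in> odd_part M)) * zz (k b)) = (\<Sum>b\<in>C. of_int (par_sign (b \<in> odd_part M)) * zz (k b))"
    by (rule sum_cancel[OF fin inj disj]) (simp_all add: kX sX)
  have cancel_int: "(\<Sum>b\<in>?B. of_int (par_sign (b \<in> odd_part M)) * (if k b = j then 1 else 0 :: int))
      = (\<Sum>b\<in>C. of_int (par_sign (b \<in> odd_part M)) * (if k b = j then 1 else 0))" for j
    by (rule sum_cancel[OF fin inj disj, of k _ "\<lambda>i. if i = j then 1 else 0"]) (simp_all add: kX sX)
  have finB: "finite ?B" using fin by simp
  have sch: "sch G3 gx_cartan id M = (\<Sum>c\<in>C. of_int (par_sign (c \<in> odd_part M)) * zz (k c))"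
    unfolding cancel[symmetric] by (rule sch_gx[OF finB bas Bp k])
  \<comment> \<open>The span of C need not be stable under sl(2). Symmetry is therefore proved for
    the whole basis of M and passed to C by cancellation.\<close>
  have sym: "(\<Sum>c\<in>C. of_int (par_sign (c \<in> odd_part M)) * (if k c = - j then 1 else 0))
          = (\<Sum>c\<in>C. of_int (par_sign (c \<in> odd_part M)) * (if k c = j then 1 else 0 :: int))" for j
    unfolding cancel_int[symmetric]
  proof (rule symmetric_counts[where E = "even_part M"])
    fix P and i :: int assume "P = even_part M \<or> P = odd_part M"
    then obtain p where p: "P = part M p" unfolding part_def by metis
    have "card {b \<in> ?B. b \<in> part M p \<and> (of_int (k b) :: complex) = - of_int i} = card {b \<in> ?B. b \<in> part M p \<and> (of_int (k b) :: complex) = of_int i}"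
      by (rule sl2_weights_symmetric[where e = "gsl mE" and f = "gsl mF" and h = h12 and t = "\<lambda>b. of_int (k b)" and k = "of_int i"])
        (use even_elements traceless_mat sl2_triple_12 finB bas Bp k in \<open>simp_all del: gsl.simps\<close>)
    moreover have "(of_int (k b) = - (of_int i :: complex)) = (k b = - i)" for b by (metis of_int_eq_iff of_int_minus)
    ultimately show "card {b \<in> ?B. b \<in> P \<and> k b = - i} = card {b \<in> ?B. b \<in> P \<and> k b = i}" unfolding p by simp
  qed (use finB par in auto)
  have im: "im = span (?X ` V)" unfolding im_def sp ..
  have ker: "ker = span (C \<union> ?X ` V)" unfolding ker_def sp ..
  have Cker: "C \<subseteq> ker" unfolding ker using in_own_span[of "C \<union> ?X ` V"] BM by blast
  have XVim: "?X ` V \<subseteq> im" unfolding im using in_own_span[of "?X ` V"] BM by blast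
  have Qb: "vectorspace.basis \<CC> (DS_mod M x0) (quo.q ` C)" "inj_on quo.q C"
    using quo.basis_Q[of C "?X ` V"] fin Cker XVim disj(1) li im ker by auto
  interpret Q: sspace "DS_mod M x0" by (rule sspaceI[OF quo.superspace_Q])
  have qz: "quo.q c \<noteq> \<zero>\<^bsub>DS_mod M x0\<^esub>" if "c \<in> C" for c
    using that Qb(1) Q.zero_nin_lin_indpt[of "quo.q ` C"] UNIV_nontrivial unfolding Q.basis_def by blast
  have cim: "c \<notin> im" if "c \<in> C" for c
    using qz[OF that] quo.q_eq_zero[of c] that BM unfolding quo.Q by blast
  have ev: "even (k c)" if c: "c \<in> C" for c
  proof (rule ccontr)
    assume "odd (k c)"
    \<comment> \<open>For odd k c this integer is nonzero, and dividing by it exhibits c as an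
      element of the image of x, contrary to the choice of C.\<close>
    hence nz: "k c + 2 * l c \<noteq> 0" by presburger
    let ?m = "of_int (k c + 2 * l c) :: complex"
    have cM: "c \<in> carrier M" "?X c = \<zero>" using c Cker by (auto simp: ker_def)
    have yK: "y0 \<in> carrier G3" by (rule part_carrier(1)[OF y0_part])
    have yc: "act M y0 c \<in> carrier M" using cM yK by (simp add: act_simps del: G3_simps)
    have "act M (brk G3 x0 y0) c = ?X (act M y0 c)"
      using act_brk[OF xodd y0_part cM(1)] cM yK yc by (simp add: koszul_def act_simps xK del: G3_simps)
    moreover have "act M (cart (-1) (-1) (-2)) c = (- ?m) \<odot> c"
    proof -
      have e: "cart (-1) (-1) (-2) = cart (-1) 1 0 \<oplus>\<^bsub>G3\<^esub> (-2) \<odot>\<^bsub>G3\<^esub> cart 0 1 1" by (simp add: cart_add cart_scale)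
      have d: "cart (-1) 1 0 = (-1) \<odot>\<^bsub>G3\<^esub> h12" by (simp add: cart_h cart_scale)
      have "act M (cart (-1) (-1) (-2)) c = (-1) \<odot> act M h12 c \<oplus> (-2) \<odot> ?N c"
        unfolding e d N[OF cM(1)] using cM hc cart_carrier(1) by (simp add: act_add act_smul G3.smul_closed del: G3_simps)
      also have "\<dots> = (- ?m) \<odot> c"
        using k[of c] l[of c] c cM(1) by (simp add: smul_assoc[symmetric] smul_l_distr[symmetric])
      finally show ?thesis .
    qed
    ultimately have "(- ?m) \<odot> c = ?X (act M y0 c)" by (simp add: x0_y0)
    hence "(- ?m) \<odot> c \<in> im" using yc by (auto simp: im_def)
    hence "inverse (- ?m) \<odot> ((- ?m) \<odot> c) \<in> im" by (rule sub_smul[OF im_sub])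
    moreover have "- ?m \<noteq> 0" using nz by (metis neg_equal_0_iff_equal of_int_eq_0_iff)
    ultimately have "c \<in> im" using cM(1) by (simp add: smul_assoc[symmetric] del: of_int_add of_int_mult)
    thus False using cim[OF c] by simp
  qed
  have "sch G3 gx_cartan gq (DS_mod M x0) = (\<Sum>B\<in>quo.q ` C. of_int (par_sign (B \<in> odd_part (DS_mod M x0)))
      * fexp (om (of_int (k (inv_into C quo.q B)))))"
  proof (rule sch_weight_basis[OF quo.superspace_Q])
    show "weight_basis G3 gx_cartan gq (DS_mod M x0) (quo.q ` C) (\<lambda>B. om (of_int (k (inv_into C quo.q B))))"
      unfolding weight_basis_def
    proof (intro conjI ballI om_dual Qb(1))
      show "finite (quo.q ` C)" using fin by simp
      show "quo.q ` C \<subseteq> even_part (DS_mod M x0) \<union> odd_part (DS_mod M x0)"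
        using Cker Bp unfolding quo.Q by blast
      fix B h assume B: "B \<in> quo.q ` C" and h: "h \<in> gx_cartan"
      then obtain c where c: "c \<in> C" "B = quo.q c" by blast
      have cM: "c \<in> carrier M" using c BM by blast
      have "act (DS_mod M x0) (gq h) B = quo.q (om (of_int (k c)) h \<odot> c)"
        using DS_act(1)[OF h] gx_act[OF cM k h] c Cker by auto
      thus "act (DS_mod M x0) (gq h) B = om (of_int (k (inv_into C quo.q B))) h \<odot>\<^bsub>DS_mod M x0\<^esub> B"
        using c inv_into_f_f[OF Qb(2) c(1)] quo.q_smul[OF cM] by simp
    qed
  qed (rule DS_act_hom)
  also have "\<dots> = (\<Sum>c\<in>C. of_int (par_sign (c \<in> odd_part M)) * zz (k c))"
    unfolding sum.reindex[OF Qb(2)] o_def zz_def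
  proof (rule sum.cong[OF refl])
    fix c assume c: "c \<in> C"
    have "quo.q c \<in> odd_part (DS_mod M x0) \<longleftrightarrow> c \<in> odd_part M"
    proof
      assume o: "quo.q c \<in> odd_part (DS_mod M x0)"
      show "c \<in> odd_part M"
      proof (rule ccontr)
        assume "c \<notin> odd_part M"
        hence "c \<in> ker \<inter> even_part M" using c Cker Bp by blast
        hence "quo.q c \<in> even_part (DS_mod M x0)" unfolding quo.Q by blast
        thus False using Q.parts_disjoint o qz[OF c] by blast
      qed
    next
      assume "c \<in> odd_part M"
      thus "quo.q c \<in> odd_part (DS_mod M x0)" using c Cker unfolding quo.Q by blast
    qed
    thus "of_int (par_sign (quo.q c \<in> odd_part (DS_mod M x0))) * fexp (om (of_int (k (inv_into C quo.q (quo.q c)))))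
      = of_int (par_sign (c \<in> odd_part M)) * fexp (om (of_int (k c)))" using c Qb(2) by (simp add: inv_into_f_f)
  qed
  finally have "sch G3 gx_cartan gq (DS_mod M x0) = (\<Sum>c\<in>C. of_int (par_sign (c \<in> odd_part M)) * zz (k c))" .
  thus ?thesis using fin(1) ev sym sch by blast
qed

end

section \<open>Group rings and Laurent polynomials\<close>

abbreviation "lookup \<equiv> Poly_Mapping.lookup"
abbreviation "keys \<equiv> Poly_Mapping.keys"
abbreviation "single \<equiv> Poly_Mapping.single"

lemma poly_mapping_sum_single: "(\<Sum>m\<in>keys f. single m (lookup f m)) = f" for f :: "'a \<Rightarrow>\<^sub>0 'b::comm_monoid_add"
  by (rule poly_mapping_eqI) (simp add: Poly_Mapping.lookup_sum lookup_single when_def in_keys_iff)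

lemma poly_mapping_induct [case_names single add]:
  fixes f :: "'a \<Rightarrow>\<^sub>0 'b::comm_monoid_add"
  assumes "\<And>k v. P (single k v)" "\<And>f g. P f \<Longrightarrow> P g \<Longrightarrow> P (f + g)"
  shows "P f"
proof -
  have "P (\<Sum>m\<in>A. single m (lookup f m))" if "finite A" for A
    using that by induction (use assms(1)[of _ 0] assms in simp_all)
  thus ?thesis using poly_mapping_sum_single[of f] by (metis finite_keys)
qed

text \<open>The linear extension of \<phi> to the group ring, a ring homomorphism when \<phi> is
  multiplicative. Restriction to the Cartan subalgebra of g_x, evaluation of Laurent polynomials and
  evaluation at points of the torus are all of this kind.\<close>

definition mlift :: "('a \<Rightarrow> 'r::comm_ring_1) \<Rightarrow> ('a \<Rightarrow>\<^sub>0 int) \<Rightarrow> 'r" where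
  "mlift \<phi> f = (\<Sum>m\<in>keys f. of_int (lookup f m) * \<phi> m)"

lemma mlift_superset: "finite A \<Longrightarrow> keys f \<subseteq> A \<Longrightarrow> mlift \<phi> f = (\<Sum>m\<in>A. of_int (lookup f m) * \<phi> m)"
  unfolding mlift_def by (rule sum.mono_neutral_left) (auto simp: in_keys_iff)

lemma mlift_zero [simp]: "mlift \<phi> 0 = 0"
  by (simp add: mlift_def)

lemma mlift_add: "mlift \<phi> (f + g) = mlift \<phi> f + mlift \<phi> g"
proof -
  let ?A = "keys f \<union> keys g"
  have "keys (f + g) \<subseteq> ?A" by (rule Poly_Mapping.keys_add)
  thus ?thesis using mlift_superset[of ?A f \<phi>] mlift_superset[of ?A g \<phi>] mlift_superset[of ?A "f + g" \<phi>]
    by (simp add: lookup_add sum.distrib distrib_right)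
qed

lemma mlift_uminus: "mlift \<phi> (- f) = - mlift \<phi> f"
  using mlift_add[of \<phi> f "- f"] by (simp add: eq_neg_iff_add_eq_0 add.commute)

lemma mlift_diff: "mlift \<phi> (f - g) = mlift \<phi> f - mlift \<phi> g"
  using mlift_add[of \<phi> f "- g"] by (simp add: mlift_uminus)

lemma mlift_single [simp]: "mlift \<phi> (single m c) = of_int c * \<phi> m"
  by (simp add: mlift_def)

lemma mlift_sum: "mlift \<phi> (sum f A) = (\<Sum>a\<in>A. mlift \<phi> (f a))"
  by (induction A rule: infinite_finite_induct) (simp_all add: mlift_add)

lemma mlift_mult:
  assumes "\<And>a b. \<phi> (a + b) = \<phi> a * \<phi> (b :: 'a::monoid_add)"
  shows "mlift \<phi> (f * g) = mlift \<phi> f * mlift \<phi> g"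
proof (induction f rule: poly_mapping_induct)
  case (single k v)
  show ?case
    by (induction g rule: poly_mapping_induct) (simp_all add: mult_single assms distrib_left mlift_add)
qed (simp add: distrib_right mlift_add)

lemma of_int_single: "(of_int c :: 'a::monoid_add \<Rightarrow>\<^sub>0 int) = single 0 c"
proof (induction c rule: int_induct[where k = 0])
  case (step1 i)
  thus ?case by (simp add: single_add)
next
  case (step2 i)
  thus ?case by (simp add: single_diff)
qed simp

lemma of_int_mult_single: "of_int c * single m d = single m (c * d :: int)"
  by (simp add: of_int_single mult_single)

lemma mlift_of_int:
  assumes "\<And>a b. \<phi> (a + b) = \<phi> a * \<phi> (b :: 'a::monoid_add)" "\<phi> 0 = 1"
  shows "mlift \<phi> (of_int c) = of_int c" "mlift \<phi> 1 = 1" "mlift \<phi> (f ^ n) = mlift \<phi> f ^ n"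
proof -
  show "mlift \<phi> (of_int c) = of_int c" for c by (simp add: of_int_single assms)
  from this[of 1] show "mlift \<phi> 1 = 1" by simp
  thus "mlift \<phi> (f ^ n) = mlift \<phi> f ^ n" by (induction n) (simp_all add: mlift_mult[of \<phi>, OF assms(1)])
qed

lemma lookup_shift: "lookup (single k 1 * g) m = lookup g (m - k)" for g :: "'a::ab_group_add \<Rightarrow>\<^sub>0 int"
proof (induction g rule: poly_mapping_induct)
  case (single l v)
  have "k + l = m \<longleftrightarrow> l = m - k" by (auto simp: algebra_simps)
  thus ?case by (simp add: mult_single lookup_single)
qed (simp add: distrib_left lookup_add)

section \<open>The subring generated by one element\<close>

lemma ipoly_pCons: "ipoly w (pCons a p) = of_int a + w * ipoly w p"
  by (simp add: ipoly_def map_poly_pCons)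

lemma ipoly_0: "ipoly w 0 = 0"
  by (simp add: ipoly_def)

lemma ipoly_add: "ipoly w (p + q) = ipoly w p + ipoly w q"
  by (induction p q rule: poly_induct2) (simp_all add: ipoly_pCons ipoly_0 algebra_simps)

lemma ipoly_smult: "ipoly w (Polynomial.smult a p) = of_int a * ipoly w p"
  by (induction p) (simp_all add: ipoly_pCons ipoly_0 algebra_simps)

lemma ipoly_mult: "ipoly w (p * q) = ipoly w p * ipoly w q"
  by (induction p) (simp_all add: ipoly_pCons ipoly_0 ipoly_add ipoly_smult algebra_simps)

lemma ipoly_minus: "ipoly w (- p) = - ipoly w p"
  using ipoly_smult[of w "-1" p] by simp

lemma ipoly_pcompose: "ipoly w (pcompose p q) = ipoly (ipoly w q) p"
  by (induction p) (simp_all add: pcompose_pCons ipoly_pCons ipoly_0 ipoly_add ipoly_mult)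

lemma int_adjoin_closed:
  "a \<in> int_adjoin w \<Longrightarrow> b \<in> int_adjoin w \<Longrightarrow> a + b \<in> int_adjoin w"
  "a \<in> int_adjoin w \<Longrightarrow> b \<in> int_adjoin w \<Longrightarrow> a * b \<in> int_adjoin w"
  "a \<in> int_adjoin w \<Longrightarrow> - a \<in> int_adjoin w" "of_int n \<in> int_adjoin w" "w \<in> int_adjoin w" "0 \<in> int_adjoin w"
proof -
  show "a \<in> int_adjoin w \<Longrightarrow> b \<in> int_adjoin w \<Longrightarrow> a + b \<in> int_adjoin w"
    by (auto simp: ipoly_add[symmetric])
  show "a \<in> int_adjoin w \<Longrightarrow> b \<in> int_adjoin w \<Longrightarrow> a * b \<in> int_adjoin w"
    by (auto simp: ipoly_mult[symmetric])
  show "a \<in> int_adjoin w \<Longrightarrow> - a \<in> int_adjoin w" by (auto simp: ipoly_minus[symmetric])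
  show "of_int n \<in> int_adjoin w" by (rule range_eqI[of _ _ "[:n:]"]) (simp add: ipoly_pCons ipoly_0)
  show "w \<in> int_adjoin w" by (rule range_eqI[of _ _ "[:0, 1:]"]) (simp add: ipoly_pCons ipoly_0)
  show "0 \<in> int_adjoin w" by (rule range_eqI[of _ _ 0]) (simp add: ipoly_0)
qed

lemma int_adjoin_sum: "(\<And>a. a \<in> A \<Longrightarrow> f a \<in> int_adjoin w) \<Longrightarrow> sum f A \<in> int_adjoin w"
  by (induction A rule: infinite_finite_induct) (simp_all add: int_adjoin_closed)

text \<open>Products in S are not asked for: an integral span is closed under sums and integer
  multiples, and only the powers of w have to be exhibited.\<close>

lemma int_adjoin_subset:
  assumes "\<And>a b. a \<in> S \<Longrightarrow> b \<in> S \<Longrightarrow> a + b \<in> S" "\<And>a n. a \<in> S \<Longrightarrow> of_int n * a \<in> S" "\<And>n. w ^ n \<in> S"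
  shows "int_adjoin w \<subseteq> S"
proof
  fix a assume "a \<in> int_adjoin w"
  then obtain p where "a = ipoly w p" by blast
  hence "a = (\<Sum>i\<le>degree (map_poly of_int p :: 'a poly). of_int (coeff p i) * w ^ i)"
    by (simp add: ipoly_def poly_altdef coeff_map_poly)
  moreover have "(\<Sum>i\<in>I. of_int (coeff p i) * w ^ i) \<in> S" if "finite I" for I
    using that
  proof induction
    case empty
    show ?case using assms(2)[OF assms(3)[of 0], of 0] by simp
  qed (use assms in simp)
  ultimately show "a \<in> S" by simp
qed

section \<open>Integral spans\<close>

lemma int_spanI: "finite F \<Longrightarrow> F \<subseteq> S \<Longrightarrow> (\<Sum>s\<in>F. of_int (c s) * s) \<in> int_span S"
  unfolding int_span_def by blast

lemma int_span_base: "s \<in> S \<Longrightarrow> s \<in> int_span S"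
  using int_spanI[of "{s}" S "\<lambda>_. 1"] by simp

lemma int_span_zero: "0 \<in> int_span S"
  using int_spanI[of "{}" S] by simp

lemma int_span_scale: "a \<in> int_span S \<Longrightarrow> of_int n * a \<in> int_span S"
proof -
  assume "a \<in> int_span S"
  then obtain F c where "finite F" "F \<subseteq> S" "a = (\<Sum>s\<in>F. of_int (c s) * s)" unfolding int_span_def by blast
  thus ?thesis using int_spanI[of F S "\<lambda>s. n * c s"] by (simp add: sum_distrib_left mult.assoc)
qed

lemma int_span_add: "a \<in> int_span S \<Longrightarrow> b \<in> int_span S \<Longrightarrow> a + b \<in> int_span S"
proof -
  assume "a \<in> int_span S" "b \<in> int_span S"
  then obtain F c G d where F: "finite F" "F \<subseteq> S" "a = (\<Sum>s\<in>F. of_int (c s) * s)"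
    and G: "finite G" "G \<subseteq> S" "b = (\<Sum>s\<in>G. of_int (d s) * s)" unfolding int_span_def by blast
  have "a = (\<Sum>s\<in>F \<union> G. of_int (if s \<in> F then c s else 0) * s)"
    unfolding F(3) by (rule sum.mono_neutral_cong_left) (use F G in auto)
  moreover have "b = (\<Sum>s\<in>F \<union> G. of_int (if s \<in> G then d s else 0) * s)"
    unfolding G(3) by (rule sum.mono_neutral_cong_left) (use F G in auto)
    ultimately have ab: "a + b = (\<Sum>s\<in>F \<union> G. of_int ((if s \<in> F then c s else 0) + (if s \<in> G then d s else 0)) * s)"
    by (simp only: of_int_add distrib_right sum.distrib)
      show ?thesis unfolding ab by (rule int_spanI) (use F(1,2) G(1,2) in auto)
qed

text \<open>The steps supply membership in the span, because \<open>ds\<close> is known to be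
  additive only on \<open>J_G3\<close>.\<close>

lemma int_span_induct [consumes 1, case_names zero base add uminus]:
  assumes a: "a \<in> int_span S" and 0: "P 0" and b: "\<And>s. s \<in> S \<Longrightarrow> P s"
    and add: "\<And>a b. a \<in> int_span S \<Longrightarrow> b \<in> int_span S \<Longrightarrow> P a \<Longrightarrow> P b \<Longrightarrow> P (a + b)"
    and neg: "\<And>a. a \<in> int_span S \<Longrightarrow> - a \<in> int_span S \<Longrightarrow> P a \<Longrightarrow> P (- a)"
  shows "P a"
proof -
  obtain F c where F: "finite F" "F \<subseteq> S" "a = (\<Sum>s\<in>F. of_int (c s) * s)" using a unfolding int_span_def by blast
  have n: "P (of_nat n * s)" if "s \<in> S" for n s
  proof (induction n)
    case (Suc n)
    have "of_nat n * s \<in> int_span S" using int_span_scale[OF int_span_base[OF that], of "int n"] by simp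
    thus ?case using add[OF int_span_base[OF that] _ b[OF that] Suc] by (simp add: distrib_right)
  qed (simp add: 0)
  have s: "P (of_int k * s)" if "s \<in> S" for k s
  proof (cases k rule: int_cases2)
    case (nonpos m)
    have "of_nat m * s \<in> int_span S" "- (of_nat m * s) \<in> int_span S"
      using int_span_scale[OF int_span_base[OF that], of "int m"] int_span_scale[OF int_span_base[OF that], of "- int m"] by simp_all
    thus ?thesis using neg[OF _ _ n[OF that, of m]] nonpos by simp
  qed (use n that in simp)
  have "P (\<Sum>s\<in>F. of_int (c s) * s)" using F(1,2)
  proof induction
    case (insert x F)
    thus ?case using add[OF int_span_scale[OF int_span_base] int_spanI s] by simp
  qed (simp add: 0)
  thus ?thesis using F(3) by simp
qed

section \<open>Characters of the one-dimensional torus\<close>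

text \<open>The values of \<open>Theta \<theta>\<close> for all \<open>\<theta>\<close> separate the Laurent polynomials in \<open>zz 1\<close>.\<close>

definition Theta :: "complex \<Rightarrow> g3 group_ring \<Rightarrow> complex" where
  "Theta \<theta> = mlift (\<lambda>\<mu>. exp (\<theta> * \<mu> h12))"

lemma Theta_zz: "Theta \<theta> (zz k) = exp (\<theta> * of_int k)"
  by (simp add: Theta_def zz_def fexp_def om_apply)

lemma Theta_hom: "Theta \<theta> (f + g) = Theta \<theta> f + Theta \<theta> g" "Theta \<theta> (f * g) = Theta \<theta> f * Theta \<theta> g"
  "Theta \<theta> (of_int c) = of_int c" "Theta \<theta> 0 = 0"
  unfolding Theta_def by (simp_all add: mlift_add mlift_mult mlift_of_int exp_add[symmetric] algebra_simps)

lemma Theta_ipoly: "Theta \<theta> (ipoly w p) = ipoly (Theta \<theta> w) p"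
  by (induction p) (simp_all add: ipoly_pCons ipoly_0 Theta_hom)

text \<open>The equation t + 1/t = z is quadratic with nonzero roots, and a nonzero complex number
  is an exponential.\<close>

lemma exp_plus_inverse: "\<exists>\<theta>::complex. exp \<theta> + exp (- \<theta>) = z"
proof -
  have "\<not> constant (poly [:1, - z, 1:])" by (simp add: constant_degree)
  then obtain t where t: "poly [:1, - z, 1:] t = 0" using fundamental_theorem_of_algebra by blast
  hence "t \<noteq> 0" by auto
  hence "t = exp (of_real (ln (cmod t)) + \<i> * of_real (Arg t))"
    using rcis_cmod_Arg[of t] by (simp add: exp_add rcis_def cis_conv_exp exp_of_real)
  then obtain \<theta> where \<theta>: "t = exp \<theta>" by blast
  have "t * (t + inverse t) = t * z" using t \<open>t \<noteq> 0\<close> by (simp add: algebra_simps)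
  hence "t + inverse t = z" using \<open>t \<noteq> 0\<close> by simp
  thus ?thesis unfolding \<theta> by (auto simp: exp_minus)
qed

text \<open>The generator takes every complex value on the torus, so the difference of two
  polynomials that agree at it vanishes everywhere.\<close>

lemma inj_ipoly:
  assumes "d \<noteq> 0"
  shows "inj (ipoly (zz d + zz (- d)))"
proof (rule injI)
  fix p q assume e: "ipoly (zz d + zz (- d)) p = ipoly (zz d + zz (- d)) q"
  have "poly (map_poly of_int (p - q)) z = 0" for z :: complex
  proof -
    obtain \<theta> where "exp \<theta> + exp (- \<theta>) = z" using exp_plus_inverse by blast
    hence z: "Theta (\<theta> / of_int d) (zz d + zz (- d)) = z" using assms by (simp add: Theta_hom Theta_zz)
    have "ipoly z p = ipoly z q" using arg_cong[OF e, of "Theta (\<theta> / of_int d)"] by (simp add: Theta_ipoly z)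
    hence "ipoly z (p - q) = 0" using ipoly_add[of z p "- q"] by (simp add: ipoly_minus)
    thus ?thesis by (simp add: ipoly_def)
  qed
  hence "map_poly of_int (p - q) = (0 :: complex poly)" using poly_all_0_iff_0 by blast
  hence "coeff (map_poly of_int (p - q)) n = (0 :: complex)" for n by simp
  thus "p = q" by (intro poly_eqI) (simp add: coeff_map_poly)
qed

text \<open>At \<theta> = 0 and \<theta> = i pi the generator has the same value 2, whereas
  \<open>zz 1 + zz (-1)\<close> has the values 2 and - 2. A polynomial in the generator cannot
  separate these points.\<close>

lemma zz_notin_adjoin: "zz 1 + zz (-1) \<notin> int_adjoin (zz 2 + zz (-2))"
proof
  assume "zz 1 + zz (-1) \<in> int_adjoin (zz 2 + zz (-2))"
  then obtain p where p: "zz 1 + zz (-1) = ipoly (zz 2 + zz (-2)) p" by blast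
  have "exp (\<i> * of_real pi * 2) = 1" "exp (- (\<i> * of_real pi * 2)) = 1"
    using exp_two_pi_i by (simp_all add: exp_minus mult_ac)
  moreover have "exp (- (\<i> * of_real pi)) = -1" by (simp add: exp_minus)
  ultimately have "ipoly 2 p = - (2 :: complex)" using arg_cong[OF p, of "Theta (\<i> * of_real pi)"]
    by (simp add: Theta_ipoly Theta_hom Theta_zz)
  moreover have "ipoly 2 p = (2 :: complex)" using arg_cong[OF p, of "Theta 0"]
    by (simp add: Theta_ipoly Theta_hom Theta_zz)
  ultimately show False by simp
qed

text \<open>The Chebyshev recurrence: s_(n+2) = s_1 s_(n+1) - s_n for s_n = z^n + z^(-n).\<close>

lemma zz_chebyshev: "zz (d * int n) + zz (- (d * int n)) \<in> int_adjoin (zz d + zz (- d))"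
proof (induction n rule: less_induct)
  case (less n)
  consider "n = 0" | "n = 1" | m where "n = Suc (Suc m)" by (metis One_nat_def not0_implies_Suc)
  thus ?case
  proof cases
    case 1
    have "(of_int 2 :: g3 group_ring) \<in> int_adjoin (zz d + zz (- d))" by (rule int_adjoin_closed(4))
    thus ?thesis using 1 by (simp add: zz_0)
  next
    case 2
    thus ?thesis by (simp add: int_adjoin_closed(5))
  next
    case 3
    let ?e = "d * int m"
    have "zz (d * int n) + zz (- (d * int n)) =
      (zz d + zz (- d)) * (zz (d * int (Suc m)) + zz (- (d * int (Suc m)))) + - (zz ?e + zz (- ?e))"
      unfolding 3 by (simp add: distrib_left distrib_right zz_add[symmetric]) (simp add: algebra_simps)
    also have "\<dots> \<in> int_adjoin (zz d + zz (- d))"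
      by (intro int_adjoin_closed(1)[OF int_adjoin_closed(2)[OF int_adjoin_closed(5)] int_adjoin_closed(3)] less.IH) (simp_all add: 3)
    finally show ?thesis .
  qed
qed

text \<open>Collecting equal exponents yields a constant and multiples of z^j + z^(-j). The case d =
  2 treats the image of ds; d = 1 treats modules over g_x and symmetric Laurent polynomials.\<close>

lemma sym_adjoin:
  assumes C: "finite C" and d: "\<And>c. c \<in> C \<Longrightarrow> d dvd k c"
    and sym: "\<And>j. (\<Sum>c\<in>C. s c * (if k c = - j then 1 else 0 :: int)) = (\<Sum>c\<in>C. s c * (if k c = j then 1 else 0))"
  shows "(\<Sum>c\<in>C. of_int (s c) * zz (k c)) \<in> int_adjoin (zz d + zz (- d))"
proof -
  define N where "N j = (\<Sum>c\<in>C. s c * (if k c = j then 1 else 0))" for j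
  define m where "m = Max (insert 0 ((\<lambda>c. \<bar>k c\<bar>) ` C))"
  have m: "\<bar>k c\<bar> \<le> m" if "c \<in> C" for c using C that by (simp add: m_def)
  have m0: "0 \<le> m" using C by (simp add: m_def)
  have "of_int (s c) * zz (k c) = (\<Sum>j\<in>{-m..m}. of_int (s c * (if k c = j then 1 else 0)) * zz j)" if "c \<in> C" for c
  proof -
    have "(\<Sum>j\<in>{-m..m}. of_int (s c * (if k c = j then 1 else 0)) * zz j) = (\<Sum>j\<in>{-m..m}. if k c = j then of_int (s c) * zz j else 0)"
      by (rule sum.cong) auto
    thus ?thesis using m[OF that] by (simp add: sum.delta' abs_le_iff)
  qed
  hence "(\<Sum>c\<in>C. of_int (s c) * zz (k c)) = (\<Sum>c\<in>C. \<Sum>j\<in>{-m..m}. of_int (s c * (if k c = j then 1 else 0)) * zz j)" by simp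
  also have "\<dots> = (\<Sum>j\<in>{-m..m}. of_int (N j) * zz j)"
    unfolding N_def by (subst sum.swap) (simp only: of_int_sum sum_distrib_right)
  also have "{-m..m} = {-m..-1} \<union> ({0} \<union> {1..m})" using m0 by auto
  also have "(\<Sum>j\<in>{-m..-1} \<union> ({0} \<union> {1..m}). of_int (N j) * zz j)
      = (\<Sum>j\<in>{-m..-1}. of_int (N j) * zz j) + (of_int (N 0) * zz 0 + (\<Sum>j\<in>{1..m}. of_int (N j) * zz j))"
    by (subst sum.union_disjoint; simp)+
  also have "(\<Sum>j\<in>{-m..-1}. of_int (N j) * zz j) = (\<Sum>j\<in>{1..m}. of_int (N j) * zz (- j))"
  proof (rule sum.reindex_bij_witness[of _ uminus uminus])
    have "N (- j) = N j" for j unfolding N_def by (rule sym)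
    thus "of_int (N (- j)) * zz (- (- j)) = of_int (N j) * zz j" for j by simp
  qed auto
  finally have "(\<Sum>c\<in>C. of_int (s c) * zz (k c)) = of_int (N 0) + (\<Sum>j\<in>{1..m}. of_int (N j) * (zz j + zz (- j)))"
    by (simp add: zz_0 sum.distrib distrib_left add.commute add.left_commute)
  also have "\<dots> \<in> int_adjoin (zz d + zz (- d))"
  proof (intro int_adjoin_closed(1) int_adjoin_closed(4) int_adjoin_sum)
    fix j :: int
    show "of_int (N j) * (zz j + zz (- j)) \<in> int_adjoin (zz d + zz (- d))"
    \<comment> \<open>Divisibility by d is known only for exponents that occur, and an exponent with
      N j nonzero does occur.\<close>
    proof (cases "N j = 0")
      case False
      have "\<exists>c\<in>C. k c = j"
      proof (rule ccontr)
        assume "\<not> (\<exists>c\<in>C. k c = j)"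
        hence "N j = 0" unfolding N_def by (intro sum.neutral) auto
        thus False using False by simp
      qed
      then obtain c where "c \<in> C" "k c = j" by blast
      then obtain i where i: "j = d * i" using d by blast
      have "zz j + zz (- j) \<in> int_adjoin (zz d + zz (- d))"
        using zz_chebyshev[of d "nat i"] zz_chebyshev[of d "nat (- i)"] i by (cases "i \<ge> 0") (simp_all add: add.commute)
      thus ?thesis by (rule int_adjoin_closed(2)[OF int_adjoin_closed(4)])
    qed (simp add: int_adjoin_closed)
  qed
  finally show ?thesis .
qed

section \<open>Symmetric Laurent polynomials in two variables\<close>

text \<open>On the Cartan subalgebra of g_x, \<open>eps 2\<close> is the negative of
  \<open>eps 1\<close>; this is the relation x_1 x_2 = 1.\<close>

lemma xmon_zz: "xmon a b = zz (a - b)"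
proof -
  have "restrict_weight gx_cartan (\<lambda>h. of_int a * eps 1 h + of_int b * eps 2 h) = om (of_int (a - b))"
    using om_unique[OF restrict_eps_dual(1)[of "of_int a" "of_int b"]] by (simp add: restrict_eps_dual(2)[simplified])
  thus ?thesis by (simp add: xmon_def zz_def)
qed

lemma eval_mlift: "eval_laurent2 f = mlift (\<lambda>m. zz (fst m - snd m)) f"
  by (simp add: eval_laurent2_def mlift_def xmon_zz case_prod_beta)

lemma eval_hom: "eval_laurent2 (f + g) = eval_laurent2 f + eval_laurent2 g" "eval_laurent2 (f - g) = eval_laurent2 f - eval_laurent2 g"
  "eval_laurent2 (f * g) = eval_laurent2 f * eval_laurent2 g" "eval_laurent2 (of_int c) = of_int c" "eval_laurent2 (f ^ n) = eval_laurent2 f ^ n"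
  "eval_laurent2 (single m c) = of_int c * zz (fst m - snd m)"
proof -
  have z: "zz (fst (a + b) - snd (a + b)) = zz (fst a - snd a) * zz (fst b - snd b)" for a b
    by (simp add: zz_add[symmetric] algebra_simps)
  show "eval_laurent2 (f + g) = eval_laurent2 f + eval_laurent2 g" "eval_laurent2 (f - g) = eval_laurent2 f - eval_laurent2 g"
    "eval_laurent2 (single m c) = of_int c * zz (fst m - snd m)"
    unfolding eval_mlift by (simp_all add: mlift_add mlift_diff)
  show "eval_laurent2 (f * g) = eval_laurent2 f * eval_laurent2 g" unfolding eval_mlift by (rule mlift_mult[OF z])
  show "eval_laurent2 (of_int c) = of_int c" "eval_laurent2 (f ^ n) = eval_laurent2 f ^ n"
    unfolding eval_mlift by (rule mlift_of_int[OF z]; simp add: zz_0)+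
qed

lemma sym_laurent2_iff: "f \<in> sym_laurent2 \<longleftrightarrow> (\<forall>a b. lookup f (a, b) = lookup f (b, a))"
  by (simp add: sym_laurent2_def)

lemma lookup_of_int_mult: "lookup (of_int n * f) m = n * lookup f m" for f :: "'a::ab_group_add \<Rightarrow>\<^sub>0 int"
proof (induction f rule: poly_mapping_induct)
  case (single k v)
  show ?case by (simp add: of_int_mult_single lookup_single when_def)
qed (simp add: distrib_left lookup_add)

lemma sym_laurent2_closed: "f \<in> sym_laurent2 \<Longrightarrow> g \<in> sym_laurent2 \<Longrightarrow> f + g \<in> sym_laurent2"
  "f \<in> sym_laurent2 \<Longrightarrow> of_int n * f \<in> sym_laurent2" "f \<in> sym_laurent2 \<Longrightarrow> (single (1, 0) 1 + single (0, 1) 1) * f \<in> sym_laurent2"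
  "f \<in> sym_laurent2 \<Longrightarrow> (single (1, 1) 1 - 1) * f \<in> sym_laurent2" "1 \<in> sym_laurent2"
  unfolding sym_laurent2_iff
  by (auto simp: lookup_add lookup_minus lookup_of_int_mult distrib_right left_diff_distrib lookup_shift lookup_one zero_prod_def when_def)

text \<open>Exchanging the two variables reverses the exponent a - b, so symmetry of f becomes
  symmetry of the exponents.\<close>

lemma eval_sym_subset: "eval_laurent2 ` sym_laurent2 \<subseteq> int_adjoin (zz 1 + zz (-1))"
proof (intro image_subsetI)
  fix f assume f: "f \<in> sym_laurent2"
  have "(\<Sum>m\<in>keys f. lookup f m * (if fst m - snd m = - j then 1 else 0))
     = (\<Sum>m\<in>keys f. lookup f m * (if fst m - snd m = j then 1 else 0))" for j :: int
  proof (rule sum.reindex_bij_witness[of _ prod.swap prod.swap])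
    fix m assume m: "m \<in> keys f"
    have "lookup f (prod.swap m) = lookup f m" using f by (cases m) (simp add: sym_laurent2_iff)
    thus "prod.swap m \<in> keys f" using m by (simp add: in_keys_iff)
    show "lookup f (prod.swap m) * (if fst (prod.swap m) - snd (prod.swap m) = j then 1 else 0)
      = lookup f m * (if fst m - snd m = - j then 1 else 0)"
      using \<open>lookup f (prod.swap m) = lookup f m\<close> by auto
  next
    fix m assume m: "m \<in> keys f"
    have "lookup f (prod.swap m) = lookup f m" using f by (cases m) (simp add: sym_laurent2_iff)
    thus "prod.swap m \<in> keys f" using m by (simp add: in_keys_iff)
  qed auto
  thus "eval_laurent2 f \<in> int_adjoin (zz 1 + zz (-1))"
    unfolding eval_mlift mlift_def by (intro sym_adjoin) simp_all
qed

lemma eval_sym: "eval_laurent2 ` sym_laurent2 = int_adjoin (zz 1 + zz (-1))"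
proof (intro antisym eval_sym_subset int_adjoin_subset)
  show "a + b \<in> eval_laurent2 ` sym_laurent2" if "a \<in> eval_laurent2 ` sym_laurent2" "b \<in> eval_laurent2 ` sym_laurent2" for a b
    using that sym_laurent2_closed(1) by (auto simp: eval_hom(1)[symmetric])
  show "of_int n * a \<in> eval_laurent2 ` sym_laurent2" if "a \<in> eval_laurent2 ` sym_laurent2" for a n
    using that sym_laurent2_closed(2) by (auto simp: eval_hom(3,4)[symmetric])
  let ?u = "single (1, 0) 1 + single (0, 1) 1 :: laurent2"
  have "?u ^ n \<in> sym_laurent2" for n by (induction n) (simp_all add: sym_laurent2_closed)
  moreover have "eval_laurent2 (?u ^ n) = (zz 1 + zz (-1)) ^ n" for n by (simp add: eval_hom)
  ultimately show "(zz 1 + zz (-1)) ^ n \<in> eval_laurent2 ` sym_laurent2" for n by (metis image_eqI)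
qed

lemma om_inj: "om c = om d \<longleftrightarrow> c = d"
  by (metis om_apply(3))

text \<open>Modulo \<open>X Y - 1\<close>, the monomial \<open>X\<^sup>a Y\<^sup>b\<close> is \<open>X\<^sup>a\<^sup>-\<^sup>b\<close>.\<close>

lemma diagonal_monomial: "\<exists>h. single (b, b) 1 - 1 = (single (1, 1) 1 - 1) * (h :: laurent2)"
proof (induction b rule: int_induct[where k = 0])
  case base
  show ?case by (rule exI[of _ 0]) (simp add: zero_prod_def[symmetric])
next
  case (step1 i)
  then obtain h where h: "single (i, i) 1 - 1 = (single (1, 1) 1 - 1) * (h :: laurent2)" by blast
  have "(single (i + 1, i + 1) 1 :: laurent2) - 1 = single (1, 1) 1 * (single (i, i) 1 - 1) + (single (1, 1) 1 - 1)"
    by (simp add: right_diff_distrib mult_single add.commute)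
  also have "\<dots> = (single (1, 1) 1 - 1) * (single (1, 1) 1 * h + 1)" unfolding h by (simp add: algebra_simps)
  finally show ?case by blast
next
  case (step2 i)
  then obtain h where h: "single (i, i) 1 - 1 = (single (1, 1) 1 - 1) * (h :: laurent2)" by blast
  have "(single (i - 1, i - 1) 1 :: laurent2) - 1 = single (-1, -1) 1 * (single (i, i) 1 - 1) - single (-1, -1) 1 * (single (1, 1) 1 - 1)"
    by (simp add: right_diff_distrib mult_single zero_prod_def[symmetric])
  also have "\<dots> = (single (1, 1) 1 - 1) * (single (-1, -1) 1 * h - single (-1, -1) 1)" unfolding h by (simp add: algebra_simps)
  finally show ?case by blast
qed

lemma laurent_normal_form: "\<exists>h. f = (\<Sum>m\<in>keys f. single (fst m - snd m, 0) (lookup f m)) + (single (1, 1) 1 - 1) * (h :: laurent2)"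
proof -
  have "\<exists>h. (\<Sum>m\<in>A. single m (lookup f m)) = (\<Sum>m\<in>A. single (fst m - snd m, 0) (lookup f m)) + (single (1, 1) 1 - 1) * (h :: laurent2)"
    if "finite A" for A
    using that
  proof induction
    case empty
    show ?case by (rule exI[of _ 0]) simp
  next
    case (insert m A)
    then obtain h where h: "(\<Sum>m\<in>A. single m (lookup f m)) = (\<Sum>m\<in>A. single (fst m - snd m, 0) (lookup f m)) + (single (1, 1) 1 - 1) * (h :: laurent2)" by blast
    obtain k where k: "single (snd m, snd m) 1 - 1 = (single (1, 1) 1 - 1) * (k :: laurent2)" using diagonal_monomial by blast
    let ?s = "single (fst m - snd m, 0) (lookup f m)"
    have "single m (lookup f m) = ?s + ?s * (single (snd m, snd m) 1 - 1)"
      by (simp add: right_diff_distrib mult_single)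
    also have "\<dots> = ?s + (single (1, 1) 1 - 1) * (?s * k)" unfolding k by (simp only: mult.left_commute)
    finally have "single m (lookup f m) = ?s + (single (1, 1) 1 - 1) * (?s * k)" .
    hence "(\<Sum>m\<in>insert m A. single m (lookup f m)) = (\<Sum>m\<in>insert m A. single (fst m - snd m, 0) (lookup f m)) + (single (1, 1) 1 - 1) * (?s * k + h)"
      using insert(1,2) h by (simp add: distrib_left add.assoc add.left_commute)
    thus ?case by blast
  qed
    from this[OF finite_keys[of f]] show ?thesis unfolding poly_mapping_sum_single .
qed

text \<open>The normal form makes a kernel element f divisible by X Y - 1, but the quotient h has
  yet to be symmetric. Symmetry of f makes the antisymmetrization D of h constant along diagonals,
  and finite support forces it to vanish.\<close>

lemma eval_kernel: "{f \<in> sym_laurent2. eval_laurent2 f = 0} = {(single (1, 1) 1 - 1) * g |g. g \<in> sym_laurent2}"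
proof (intro equalityI subsetI)
  fix f assume "f \<in> {(single (1, 1) 1 - 1) * g |g. g \<in> sym_laurent2}"
  then obtain g where g: "g \<in> sym_laurent2" "f = (single (1, 1) 1 - 1) * g" by blast
  moreover have "eval_laurent2 (single (1, 1) 1 - 1) = 0"
    using eval_hom(4)[of 1] by (simp add: eval_hom zz_0)
  ultimately show "f \<in> {f \<in> sym_laurent2. eval_laurent2 f = 0}"
    using sym_laurent2_closed(4) by (simp add: eval_hom(3))
next
  fix f assume "f \<in> {f \<in> sym_laurent2. eval_laurent2 f = 0}"
  hence f: "f \<in> sym_laurent2" "eval_laurent2 f = 0" by auto
  obtain h where h: "f = (\<Sum>m\<in>keys f. single (fst m - snd m, 0) (lookup f m)) + (single (1, 1) 1 - 1) * h"
    using laurent_normal_form by blast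
  have "(\<Sum>m\<in>keys f. single (fst m - snd m, 0 :: int) (lookup f m)) = 0"
  proof (rule poly_mapping_eqI)
    fix n :: "int \<times> int"
    obtain d e where n: "n = (d, e)" by (cases n)
    have "(\<Sum>m\<in>keys f. lookup f m when fst m - snd m = d) = lookup (eval_laurent2 f) (om (of_int d))"
      unfolding eval_mlift mlift_def zz_def fexp_def
      by (simp add: of_int_mult_single lookup_sum lookup_single om_inj del: of_int_diff)
    also have "\<dots> = 0" by (simp add: f(2))
    finally have "(\<Sum>m\<in>keys f. lookup f m when fst m - snd m = d) = 0" .
    thus "lookup (\<Sum>m\<in>keys f. single (fst m - snd m, 0) (lookup f m)) n = lookup 0 n"
      by (cases "e = 0") (simp_all add: n lookup_sum lookup_single when_def)
  qed
  hence fh: "f = (single (1, 1) 1 - 1) * h" using h by simp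
  have lf: "lookup f (a, b) = lookup h (a - 1, b - 1) - lookup h (a, b)" for a b
    by (simp add: fh left_diff_distrib lookup_minus lookup_shift)
  define D where "D a b = lookup h (a, b) - lookup h (b, a)" for a b
  have D: "D (a - 1) (b - 1) = D a b" for a b
    using lf[of a b] lf[of b a] f(1) unfolding D_def sym_laurent2_iff by simp
  have Dn: "D (a - int n) (b - int n) = D a b" for a b n
  proof (induction n)
    case (Suc n)
    show ?case using D[of "a - int n" "b - int n"] Suc by (simp add: algebra_simps)
  qed simp
  have "D a b = 0" for a b
  proof (rule ccontr)
    assume "D a b \<noteq> 0"
            have sub: "range (\<lambda>n. (a - int n, b - int n)) \<subseteq> keys h \<union> prod.swap ` keys h"
    proof (intro image_subsetI)
      fix n
      have "D (a - int n) (b - int n) \<noteq> 0" using \<open>D a b \<noteq> 0\<close> Dn by simp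
      hence "(a - int n, b - int n) \<in> keys h \<or> (b - int n, a - int n) \<in> keys h" by (auto simp: D_def in_keys_iff)
      moreover have "(a - int n, b - int n) = prod.swap (b - int n, a - int n)" by simp
      ultimately show "(a - int n, b - int n) \<in> keys h \<union> prod.swap ` keys h" by blast
    qed
        have "infinite (range (\<lambda>n. (a - int n, b - int n)))"
      by (rule range_inj_infinite) (auto intro: injI)
    thus False using finite_subset[OF sub] by simp
  qed
  hence "h \<in> sym_laurent2" by (auto simp: sym_laurent2_iff D_def)
  thus "f \<in> {(single (1, 1) 1 - 1) * g |g. g \<in> sym_laurent2}" using fh by blast
qed

section \<open>Restriction of supercharacters\<close>

definition rest :: "g3 group_ring \<Rightarrow> g3 group_ring" where
  "rest = mlift (\<lambda>\<mu>. fexp (restrict_weight gx_cartan \<mu>))"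

lemma restrict_weight_add: "restrict_weight H (\<mu> + \<nu>) = restrict_weight H \<mu> + restrict_weight H \<nu>"
  by (auto simp: restrict_weight_def)

lemma rest_hom: "rest (f + g) = rest f + rest g" "rest (f * g) = rest f * rest g" "rest (- f) = - rest f"
  "rest 0 = 0" "rest 1 = 1" "rest (of_int c) = of_int c" "rest (sum F A) = (\<Sum>a\<in>A. rest (F a))"
  "rest (fexp \<mu>) = fexp (restrict_weight gx_cartan \<mu>)"
proof -
  have m: "fexp (restrict_weight gx_cartan (\<mu> + \<nu>)) = fexp (restrict_weight gx_cartan \<mu>) * fexp (restrict_weight gx_cartan \<nu>)" for \<mu> \<nu>
    by (simp add: restrict_weight_add fexp_add)
  have "restrict_weight gx_cartan 0 = 0" by (auto simp: restrict_weight_def)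
  hence z: "fexp (restrict_weight gx_cartan 0) = 1" by (simp add: fexp_zero)
  show "rest (f + g) = rest f + rest g" "rest (- f) = - rest f" "rest 0 = 0" "rest (sum F A) = (\<Sum>a\<in>A. rest (F a))"
    "rest (fexp \<mu>) = fexp (restrict_weight gx_cartan \<mu>)"
    unfolding rest_def by (simp_all add: mlift_add mlift_uminus mlift_sum fexp_def)
  show "rest (f * g) = rest f * rest g" unfolding rest_def by (rule mlift_mult) (rule m)
  show "rest 1 = 1" "rest (of_int c) = of_int c" unfolding rest_def by (rule mlift_of_int; rule m z)+
qed

lemma rest_ipoly: "rest (ipoly w p) = ipoly (rest w) p"
  by (induction p) (simp_all add: ipoly_pCons ipoly_0 rest_hom)

text \<open>A weight basis for the whole torus is also one for the Cartan subalgebra of g_x, with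
  restricted weights.\<close>

lemma (in g3_repn) rest_sch: "rest (sch G3 g3_cartan id M) = sch G3 gx_cartan id M"
proof -
  obtain B wt where wb: "weight_basis G3 g3_cartan id M B wt" and B: "finite B" "basis B" "B \<subseteq> even_part M \<union> odd_part M"
    and "\<forall>b\<in>B. \<exists>k. wt b h12 = of_int k" using g3_weight_basis by blast
  then obtain k where k: "\<And>b. b \<in> B \<Longrightarrow> wt b h12 = of_int (k b)" by metis
  have h: "h12 \<in> g3_cartan" using h12_gx gx_cartan_sub by blast
  have wt: "wt b \<in> dual G3 g3_cartan" "act M h12 b = of_int (k b) \<odot> b" if "b \<in> B" for b
    using wb that h k[OF that] unfolding weight_basis_def by auto
  have r: "restrict_weight gx_cartan (wt b) = om (of_int (k b))" if b: "b \<in> B" for b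
  proof
    fix a
    show "restrict_weight gx_cartan (wt b) a = om (of_int (k b)) a"
    proof (cases "a \<in> gx_cartan")
      case True
            then obtain t where t: "a = cart t (- t) 0" by (rule gx_cartanE)
      hence t': "a = g3_scale t h12" by (simp add: cart_h cart_scale)
      have "wt b (t \<odot>\<^bsub>G3\<^esub> h12) = t * wt b h12" using wt(1)[OF b] h unfolding dual_def by blast
      hence "wt b a = t * of_int (k b)" using k[OF b] t' by simp
      thus ?thesis using True om_apply(1)[of "of_int (k b)" t] t by (simp add: restrict_weight_def)
    qed (simp add: restrict_weight_def om_apply)
  qed
  have "act M (id h) \<in> LinearCombinations.module_hom \<CC> M M" if "h \<in> g3_cartan" for h
    using that gx_cartan_sub(3) act_endo unfolding endo_def by (simp add: subset_iff del: G3_simps)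
  hence "sch G3 g3_cartan id M = (\<Sum>b\<in>B. of_int (par_sign (b \<in> odd_part M)) * fexp (wt b))"
    by (intro sch_weight_basis[OF ss wb])
  hence "rest (sch G3 g3_cartan id M) = (\<Sum>b\<in>B. of_int (par_sign (b \<in> odd_part M)) * zz (k b))"
    by (simp add: rest_hom r zz_def)
  thus ?thesis using sch_gx[OF B wt(2)] by simp
qed

lemma ds_sch_rest:
  assumes "fd_rep G3 M"
  shows "sch G3 gx_cartan gq (DS_mod M x0) = rest (sch G3 g3_cartan id M)"
    "rest (sch G3 g3_cartan id M) \<in> int_adjoin (zz 2 + zz (-2))"
proof -
  interpret g3_repn M by (rule g3_repnI[OF assms])
  obtain C k where "finite C" "\<forall>c\<in>C. even (k c)"
    "\<forall>j. (\<Sum>c\<in>C. of_int (par_sign (c \<in> odd_part M)) * (if k c = - j then 1 else 0))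
          = (\<Sum>c\<in>C. of_int (par_sign (c \<in> odd_part M)) * (if k c = j then 1 else 0 :: int))"
    "sch G3 gx_cartan gq (DS_mod M x0) = (\<Sum>c\<in>C. of_int (par_sign (c \<in> odd_part M)) * zz (k c))"
    "sch G3 gx_cartan id M = (\<Sum>c\<in>C. of_int (par_sign (c \<in> odd_part M)) * zz (k c))" using ds_sch by blast
  moreover from this have "(\<Sum>c\<in>C. of_int (par_sign (c \<in> odd_part M)) * zz (k c)) \<in> int_adjoin (zz 2 + zz (-2))"
    by (intro sym_adjoin) auto
  ultimately show "sch G3 gx_cartan gq (DS_mod M x0) = rest (sch G3 g3_cartan id M)"
    "rest (sch G3 g3_cartan id M) \<in> int_adjoin (zz 2 + zz (-2))" by (simp_all add: rest_sch)
qed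

section \<open>The supercharacter ring of \<open>\<gg>\<^sub>x\<close>\<close>

lemma wrep_power:
  assumes "wrep L H K \<iota> I \<pi> wt \<rho>"
  shows "\<exists>I' \<pi>' wt' \<rho>'. wrep L H K \<iota> I' \<pi>' wt' \<rho>' \<and> wch I' \<pi>' wt' = wch I \<pi> wt ^ n"
proof (induction n)
  case 0
  \<comment> \<open>The zeroth power is the trivial module, of dimension one, even and of weight
    0.\<close>
  have "wrep L H K \<iota> {0} (\<lambda>_. False) (\<lambda>_. 0) (\<lambda>_ _ _. 0)" by (simp add: wrep_def dual_def)
  moreover have "wch {0} (\<lambda>_. False) (\<lambda>_. 0) = wch I \<pi> wt ^ 0" by (simp add: wch_def par_sign_def fexp_zero)
  ultimately show ?case by blast
next
  case (Suc n)
  then obtain I' \<pi>' wt' \<rho>' where *: "wrep L H K \<iota> I' \<pi>' wt' \<rho>'" "wch I' \<pi>' wt' = wch I \<pi> wt ^ n" by blast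
  from wrep_tensor[OF assms *(1)] show ?case unfolding *(2) by simp
qed

text \<open>Powers of a supercharacter are supercharacters of tensor powers, so every integral
  polynomial in it lies in the ring.\<close>

lemma int_adjoin_wch:
  fixes K :: "('g, 'n) lie_super_scheme"
  assumes w: "wrep L H K \<iota> I \<pi> wt \<rho>" and K: "superspace K" "\<iota> ` H \<subseteq> carrier K"
  shows "int_adjoin (wch I \<pi> wt) \<subseteq> sch_ring L H K \<iota>"
  unfolding sch_ring_def
proof (intro int_adjoin_subset int_span_add int_span_scale)
  fix n
  obtain I' \<pi>' wt' \<rho>' where *: "wrep L H K \<iota> I' \<pi>' wt' \<rho>'" "wch I' \<pi>' wt' = wch I \<pi> wt ^ n"
    using wrep_power[OF w] by blast
  obtain M :: "('g, complex vec) rep" where "fd_rep K M" "sch L H \<iota> M = wch I' \<pi>' wt'"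
    using wrep_realize[OF *(1) K] by blast
  thus "wch I \<pi> wt ^ n \<in> int_span {sch L H \<iota> M |M :: ('g, complex vec) rep. fd_rep K M}"
    unfolding *(2) by (intro int_span_base) (metis (mono_tags, lifting) mem_Collect_eq)
qed

lemma gq_h12: "h \<in> gx_cartan \<Longrightarrow> gq h \<in> carrier (DS_alg G3 x0)"
  unfolding gx_cartan_def carrier_gx carrier_DS_alg by blast

lemma gq_gx: "gq (cart t (- t) 0) = t \<odot>\<^bsub>DS_alg G3 x0\<^esub> gq h12"
proof -
  have "cart t (- t) 0 = g3_scale t h12" by (simp add: cart_h cart_scale)
  thus ?thesis using gq_add_scale(2)[of h12 t] h12_gx gx_cartan_sub by (simp add: subset_iff del: G3_simps)
qed

text \<open>Here the weights are only integral and symmetric in each parity, so the exponents may be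
  odd and the larger ring appears.\<close>

lemma sch_gx_module:
  fixes M :: "(g3 set, 'v) rep" (structure)
  assumes "fd_rep (DS_alg G3 x0) M"
  shows "sch G3 gx_cartan gq M \<in> int_adjoin (zz 1 + zz (-1))"
proof -
  let ?K = "DS_alg G3 x0"
  interpret K: sspace ?K by (rule sspaceI[OF superspace_DS_alg])
  interpret sspace M using assms by (intro sspaceI) (simp add: fd_rep_def is_rep_def)
  interpret fd_repn ?K M by (intro fd_repn.intro fd_repn_axioms.intro) (fact K.sspace_axioms sspace_axioms lie_superalgebra_DS_alg assms)+
  let ?e = "gq (gsl mE)" and ?f = "gq (gsl mF)" and ?h = "gq h12"
  have p: "?e \<in> part ?K False" "?f \<in> part ?K False" "?h \<in> part ?K False"
    unfolding part_def gsl_h12[symmetric] by (simp_all add: carrier_DS_alg traceless_mat del: gsl.simps)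
  have c: "gsl mE \<in> ad.ker" "gsl mF \<in> ad.ker" "h12 \<in> ad.ker"
    unfolding gsl_h12[symmetric] by (intro gsl_ker traceless_mat)+
  have "brk ?K ?h ?e = 2 \<odot>\<^bsub>?K\<^esub> ?e" "brk ?K ?h ?f = (-2) \<odot>\<^bsub>?K\<^esub> ?f" "brk ?K ?e ?f = ?h"
    using brk_DS_alg c sl2_triple_12 gq_add_scale(2)[OF gsl_carrier(1)[OF traceless_mat(1)]] gq_add_scale(2)[OF gsl_carrier(1)[OF traceless_mat(2)]]
    by (simp_all del: gsl.simps)
  note sl2 = p this
  have dg: "diagonal (act M ?h)" by (rule sl2_diagonal[OF sl2])
  have "\<exists>B. finite B \<and> basis B \<and> B \<subseteq> joint [act M ?h]"
  proof (rule joint_basis)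
    show "T v \<in> even_part M" if "T \<in> set [act M ?h]" "v \<in> even_part M" for T v
      using act_part[OF p(3), of v False] that by (simp add: part_def)
    show "T v \<in> odd_part M" if "T \<in> set [act M ?h]" "v \<in> odd_part M" for T v
      using act_part[OF p(3), of v True] that by (simp add: part_def)
  qed (use fd dg in auto)
  then obtain B where B: "finite B" "basis B" "B \<subseteq> joint [act M ?h]" by blast
  hence "\<forall>b\<in>B. \<exists>j. act M ?h b = of_int j \<odot> b" unfolding joint_def by (auto elim!: Ints_cases)
  then obtain k where k: "\<And>b. b \<in> B \<Longrightarrow> act M ?h b = of_int (k b) \<odot> b" by metis
  have BM: "B \<subseteq> carrier M" and Bp: "B \<subseteq> even_part M \<union> odd_part M" using B(3) joint_carrier unfolding joint_def by blast+
  have hK: "?h \<in> carrier ?K" by (rule part_carrier(1)[OF p(3)])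
  have act: "act M (gq h) b = om (of_int (k b)) h \<odot> b" if h: "h \<in> gx_cartan" and b: "b \<in> B" for h b
  proof -
    obtain t where t: "h = cart t (- t) 0" by (rule gx_cartanE[OF h])
    have bM: "b \<in> carrier M" using b BM by blast
    thus ?thesis using k[OF b] act_smul[OF hK bM, of t] by (simp add: t gq_gx om_apply smul_assoc)
  qed
  have "weight_basis G3 gx_cartan gq M B (\<lambda>b. om (of_int (k b)))"
    unfolding weight_basis_def using B(1,2) Bp act om_dual by blast
  moreover have "act M (gq h) \<in> LinearCombinations.module_hom \<CC> M M" if "h \<in> gx_cartan" for h
    using act_endo[OF gq_h12[OF that]] by (simp add: endo_def)
  ultimately have sch: "sch G3 gx_cartan gq M = (\<Sum>b\<in>B. of_int (par_sign (b \<in> odd_part M)) * zz (k b))"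
    unfolding zz_def by (intro sch_weight_basis[OF ss])
  have nz: "b \<noteq> \<zero>" if "b \<in> B" for b using that B(2) zero_nin_lin_indpt[of B] BM UNIV_nontrivial unfolding basis_def by metis
  have par: "b \<in> even_part M \<longleftrightarrow> b \<notin> odd_part M" if "b \<in> B" for b using that nz parts_disjoint Bp by blast
  have sym: "(\<Sum>c\<in>B. of_int (par_sign (c \<in> odd_part M)) * (if k c = - j then 1 else 0))
          = (\<Sum>c\<in>B. of_int (par_sign (c \<in> odd_part M)) * (if k c = j then 1 else 0 :: int))" for j
  proof (rule symmetric_counts[where E = "even_part M"])
    fix P and i :: int assume "P = even_part M \<or> P = odd_part M"
    then obtain p where p: "P = part M p" unfolding part_def by metis
    have "card {b \<in> B. b \<in> part M p \<and> (of_int (k b) :: complex) = - of_int i} = card {b \<in> B. b \<in> part M p \<and> (of_int (k b) :: complex) = of_int i}"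
      by (rule sl2_weights_symmetric[OF sl2 B(1,2) Bp k]) simp_all
    moreover have "(of_int (k b) = - (of_int i :: complex)) = (k b = - i)" for b by (metis of_int_eq_iff of_int_minus)
    ultimately show "card {b \<in> B. b \<in> P \<and> k b = - i} = card {b \<in> B. b \<in> P \<and> k b = i}" unfolding p by simp
  qed (use B par in auto)
  show ?thesis unfolding sch by (rule sym_adjoin[OF B(1)]) (use sym in simp_all)
qed

section \<open>The standard module of sl(2) and the supercharacter ring of g_x\<close>

fun ent :: "mat2 \<Rightarrow> nat \<Rightarrow> nat \<Rightarrow> complex" where
  "ent ((a, b), (c, d)) i j = (if i = 0 then (if j = 0 then a else b) else (if j = 0 then c else d))"

lemma ent_linear: "ent (A + B) i j = ent A i j + ent B i j" "ent (A - B) i j = ent A i j - ent B i j" "ent (mscale c A) i j = c * ent A i j"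
  "ent 0 i j = 0"
  by (cases A rule: mat2_cases; cases B rule: mat2_cases; simp add: zero_prod_def)+

lemma ent_mmul: "i \<in> {0, 1} \<Longrightarrow> j \<in> {0, 1} \<Longrightarrow> ent (mmul A B) i j = (\<Sum>k\<in>{0, 1}. ent A i k * ent B k j)"
  by (cases A rule: mat2_cases; cases B rule: mat2_cases) auto

text \<open>The inverse of the isomorphism from sl(2) to g_x; its matrix entries define the standard
  module.\<close>

definition gmt :: "g3 set \<Rightarrow> mat2" where "gmt = inv_into traceless (\<lambda>A. gq (gsl A))"

lemma gmt_gq: "A \<in> traceless \<Longrightarrow> gmt (gq (gsl A)) = A"
  unfolding gmt_def by (rule inv_into_f_f) (auto intro!: inj_onI dest: gq_gsl_inj simp del: gsl.simps)

lemma DS_algE: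
  assumes "B \<in> carrier (DS_alg G3 x0)"
  obtains A where "A \<in> traceless" "B = gq (gsl A)"
  using assms unfolding carrier_DS_alg by blast

lemma gq_gsl_hom:
  assumes "A \<in> traceless" "B \<in> traceless"
  shows "gq (gsl A) \<oplus>\<^bsub>DS_alg G3 x0\<^esub> gq (gsl B) = gq (gsl (A + B))" "c \<odot>\<^bsub>DS_alg G3 x0\<^esub> gq (gsl A) = gq (gsl (mscale c A))"
    "brk (DS_alg G3 x0) (gq (gsl A)) (gq (gsl B)) = gq (gsl (mmul A B - mmul B A))"
  using assms gq_add_scale gsl_carrier(1) brk_DS_alg gsl_ker
  by (simp_all add: gsl_linear gsl_brk del: gsl.simps G3_simps)

lemma sl2_standard_wrep:
  "wrep G3 gx_cartan (DS_alg G3 x0) gq {0, 1} (\<lambda>_. False) (\<lambda>i. if i = 0 then om 1 else om (-1)) (\<lambda>B. ent (gmt B))"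
proof -
  let ?K = "DS_alg G3 x0"
  interpret K: sspace ?K by (rule sspaceI[OF superspace_DS_alg])
  have hom: "gmt (a \<oplus>\<^bsub>?K\<^esub> b) = gmt a + gmt b" "gmt (c \<odot>\<^bsub>?K\<^esub> a) = mscale c (gmt a)"
    "gmt (brk ?K a b) = mmul (gmt a) (gmt b) - mmul (gmt b) (gmt a)" if "a \<in> carrier ?K" "b \<in> carrier ?K" for a b c
  proof -
        from that(1) obtain A where A: "A \<in> traceless" "a = gq (gsl A)" by (rule DS_algE)
    from that(2) obtain B where B: "B \<in> traceless" "b = gq (gsl B)" by (rule DS_algE)
    show "gmt (a \<oplus>\<^bsub>?K\<^esub> b) = gmt a + gmt b" "gmt (c \<odot>\<^bsub>?K\<^esub> a) = mscale c (gmt a)"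
      "gmt (brk ?K a b) = mmul (gmt a) (gmt b) - mmul (gmt b) (gmt a)"
            using A(1) B(1) unfolding A(2) B(2)
      by (simp_all add: gq_gsl_hom gmt_gq traceless_simps mat_commutator_traceless del: gsl.simps)
  qed
  have "gmt \<zero>\<^bsub>?K\<^esub> = 0" using gmt_gq[of 0] gq_gsl_eq_zero[of 0] by (simp add: traceless_simps del: gsl.simps)
  hence odd: "gmt a = 0" if "a \<in> part ?K True" for a using that by (simp add: part_def carrier_DS_alg)
  have pc: "a \<in> carrier ?K" if "a \<in> part ?K p" for a p
    using that K.parts_carrier by (auto simp: part_def split: if_splits)
  have br: "ent (gmt (brk ?K a b)) i j = (\<Sum>k\<in>{0, 1}. ent (gmt a) i k * ent (gmt b) k j) - koszul p q * (\<Sum>k\<in>{0, 1}. ent (gmt b) i k * ent (gmt a) k j)"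
    if ab: "a \<in> part ?K p" "b \<in> part ?K q" and ij: "i \<in> {0, 1}" "j \<in> {0, 1}" for a b p q i j
  proof (cases "p \<and> q")
    case True
    thus ?thesis using ab odd hom(3)[OF pc pc, OF ab] by (simp add: ent_linear)
  next
    case False
    hence "koszul p q = 1" by (simp add: koszul_def)
    thus ?thesis unfolding hom(3)[OF pc pc, OF ab] ent_linear ent_mmul[OF ij] by simp
  qed
  have dg: "ent (gmt (gq h)) i j = (if i = j then (if i = 0 then om 1 else om (-1)) h else 0)"
    if h: "h \<in> gx_cartan" and ij: "i \<in> {0, 1}" "j \<in> {0, 1}" for h i j
  proof -
    obtain t where t: "h = cart t (- t) 0" by (rule gx_cartanE[OF h])
    have "gsl (mscale t mH) = h" unfolding gsl_linear(2) gsl_h12 t by (simp add: cart_h cart_scale)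
    hence "gmt (gq h) = mscale t mH" using gmt_gq[of "mscale t mH"] by (simp add: traceless_simps traceless_mat del: gsl.simps mscale.simps)
    thus ?thesis using ij by (auto simp: t om_apply)
  qed
  show ?thesis
    unfolding wrep_def
  proof (intro conjI allI ballI impI)
    show "(if i = 0 then om 1 else om (- 1)) \<in> dual G3 gx_cartan" for i :: nat by (simp add: om_dual)
    show "ent (gmt (a \<oplus>\<^bsub>?K\<^esub> b)) i j = ent (gmt a) i j + ent (gmt b) i j" if "a \<in> carrier ?K" "b \<in> carrier ?K" for a b i j
      unfolding hom(1)[OF that] by (rule ent_linear)
    show "ent (gmt (c \<odot>\<^bsub>?K\<^esub> a)) i j = c * ent (gmt a) i j" if "a \<in> carrier ?K" for c a i j
      unfolding hom(2)[OF that that] by (rule ent_linear)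
    show "False = (False \<noteq> p)" if "a \<in> part ?K p" "ent (gmt a) i j \<noteq> 0" for p a i j
      using odd[of a] that by (cases p) (simp_all add: ent_linear)
  qed (fact br dg | simp)+
qed

text \<open>Weight symmetry bounds the ring from above. The standard module, with weights 1 and - 1,
  generates all of it.\<close>

lemma J_gx_eq: "J_gx x0 = int_adjoin (zz 1 + zz (-1))"
proof
  have "wch {0, 1} (\<lambda>_. False) (\<lambda>i. if i = 0 then om 1 else om (-1)) = zz 1 + zz (-1)"
    by (simp add: wch_def par_sign_def zz_def)
  thus "int_adjoin (zz 1 + zz (-1)) \<subseteq> J_gx x0"
    using int_adjoin_wch[OF sl2_standard_wrep superspace_DS_alg] gq_h12 unfolding J_gx_def by (simp add: image_subset_iff)
  show "J_gx x0 \<subseteq> int_adjoin (zz 1 + zz (-1))"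
  proof
    fix f assume "f \<in> J_gx x0"
    thus "f \<in> int_adjoin (zz 1 + zz (-1))" unfolding J_gx_def sch_ring_def
      by (induction rule: int_span_induct) (auto simp del: split_paired_Ex intro: int_adjoin_closed(1,3,6) sch_gx_module)
  qed
qed

section \<open>The image of \<open>ds\<^sub>x\<close>\<close>

interpretation AD: g3_repn "adj_rep G3"
  by (rule g3_repnI[OF fd_rep_adj])

text \<open>The functor sends the adjoint module to g_x, where the classes of \<open>mE\<close>,
  \<open>mF\<close> and \<open>mH\<close> have weights 2, - 2 and 0. Computing there avoids the
  weights of all 31 dimensions of G(3).\<close>

lemma rest_sch_adj: "rest (sch G3 g3_cartan id (adj_rep G3)) = zz 2 + zz (-2) + 1"
proof -
  let ?Q = "DS_mod (adj_rep G3) x0"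
  interpret Q: sspace ?Q by (rule sspaceI[OF ad.quo.superspace_Q])
  let ?e = "gq (gsl mE)" and ?f = "gq (gsl mF)" and ?h = "gq (gsl mH)"
  note hom = gq_gsl_hom(1,2)[unfolded DS_alg_simps]
  have T: "mE \<in> traceless" "mF \<in> traceless" "mH \<in> traceless" by (rule traceless_mat)+
  have car: "carrier ?Q = gq ` gsl ` traceless" "even_part ?Q = gq ` gsl ` traceless" "odd_part ?Q = {\<zero>\<^bsub>?Q\<^esub>}"
    using carrier_DS_alg unfolding DS_alg_simps by simp_all
  have zero: "gq (gsl A) = \<zero>\<^bsub>?Q\<^esub> \<longleftrightarrow> A = 0" if "A \<in> traceless" for A
    using gq_gsl_eq_zero[OF that] unfolding DS_alg_simps .
  have ne: "?e \<noteq> ?f" "?e \<noteq> ?h" "?f \<noteq> ?h" using gq_gsl_inj[OF T(1,2)] gq_gsl_inj[OF T(1,3)] gq_gsl_inj[OF T(2,3)] by (auto simp del: gsl.simps)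
  have S: "{?e, ?f, ?h} \<subseteq> carrier ?Q" unfolding car using T by blast
  have lc: "Q.lincomb a {?e, ?f, ?h} = gq (gsl ((a ?h, a ?e), (a ?f, - a ?h)))" for a
  proof -
    have "Q.lincomb a {?e, ?f, ?h} = a ?e \<odot>\<^bsub>?Q\<^esub> ?e \<oplus>\<^bsub>?Q\<^esub> (a ?f \<odot>\<^bsub>?Q\<^esub> ?f \<oplus>\<^bsub>?Q\<^esub> (a ?h \<odot>\<^bsub>?Q\<^esub> ?h \<oplus>\<^bsub>?Q\<^esub> \<zero>\<^bsub>?Q\<^esub>))"
      using S ne by (simp add: Q.lc_insert Q.lc_zero)
    also have "\<dots> = a ?e \<odot>\<^bsub>?Q\<^esub> ?e \<oplus>\<^bsub>?Q\<^esub> (a ?f \<odot>\<^bsub>?Q\<^esub> ?f \<oplus>\<^bsub>?Q\<^esub> a ?h \<odot>\<^bsub>?Q\<^esub> ?h)" using S by simp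
    also have "\<dots> = gq (gsl (mscale (a ?e) mE + (mscale (a ?f) mF + mscale (a ?h) mH)))"
      using T by (simp only: hom traceless_simps)
    finally show ?thesis by simp
  qed
  have "Q.lin_indpt {?e, ?f, ?h}"
  proof (rule Q.indepI[OF _ S])
    fix a v assume "Q.lincomb a {?e, ?f, ?h} = \<zero>\<^bsub>?Q\<^esub>" and v: "v \<in> {?e, ?f, ?h}"
    hence "((a ?h, a ?e), (a ?f, - a ?h)) = (0 :: mat2)" unfolding lc by (subst (asm) zero) (simp_all add: traceless_neg)
    hence "a ?h = 0 \<and> a ?e = 0 \<and> a ?f = 0" by (simp add: zero_prod_def)
    thus "a v = 0" using v by blast
  qed simp
  moreover have "Q.span {?e, ?f, ?h} = carrier ?Q"
  proof
    show "Q.span {?e, ?f, ?h} \<subseteq> carrier ?Q" by (rule Q.span_is_subset2[OF S])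
    show "carrier ?Q \<subseteq> Q.span {?e, ?f, ?h}"
    proof
      fix v assume "v \<in> carrier ?Q"
      then obtain A where A: "A \<in> traceless" "v = gq (gsl A)" unfolding car by blast
      obtain m1 m2 m3 m4 where m: "A = ((m1, m2), (m3, m4))" by (rule mat2_cases)
      have "v = Q.lincomb (\<lambda>b. if b = ?e then m2 else if b = ?f then m3 else m1) {?e, ?f, ?h}"
        unfolding lc using A ne by (simp add: m traceless_neg)
      thus "v \<in> Q.span {?e, ?f, ?h}" using Q.span_iff[OF _ S] by blast
    qed
  qed
  ultimately have bas: "Q.basis {?e, ?f, ?h}" using S by (simp add: Q.basis_def)
  have act: "act ?Q (gq h) (gq (gsl A)) = om c h \<odot>\<^bsub>?Q\<^esub> gq (gsl A)"
    if h: "h \<in> gx_cartan" and A: "A \<in> traceless" "mmul mH A - mmul A mH = mscale c A" for h A c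
  proof -
    obtain t where t: "h = cart t (- t) 0" by (rule gx_cartanE[OF h])
    have h': "h = gsl (mscale t mH)" unfolding gsl_linear(2) gsl_h12 t by (simp add: cart_h cart_scale)
    have "act ?Q (gq h) (gq (gsl A)) = gq (gsl (mmul (mscale t mH) A - mmul A (mscale t mH)))"
      using gq_gsl_hom(3)[OF traceless_simps(2)[OF T(3)] A(1), of t] unfolding DS_alg_simps h' .
    also have "mmul (mscale t mH) A - mmul A (mscale t mH) = mscale (t * c) A"
      unfolding mmul_linear(3,4) mmul_linear(7)[symmetric] A(2) mscale_linear(3) ..
    finally show ?thesis using hom(2)[OF A(1) A(1), of "t * c"] by (simp add: t om_apply)
  qed
  define wt where "wt b = (if b = ?e then om 2 else if b = ?f then om (-2) else om 0)" for b
  have "weight_basis G3 gx_cartan gq ?Q {?e, ?f, ?h} wt"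
    unfolding weight_basis_def
  proof (intro conjI ballI bas)
    show "{?e, ?f, ?h} \<subseteq> even_part ?Q \<union> odd_part ?Q" using S unfolding car by blast
    fix b assume b: "b \<in> {?e, ?f, ?h}"
    show "wt b \<in> dual G3 gx_cartan" by (simp add: wt_def om_dual)
    fix h assume h: "h \<in> gx_cartan"
    have "act ?Q (gq h) ?e = om 2 h \<odot>\<^bsub>?Q\<^esub> ?e" "act ?Q (gq h) ?f = om (-2) h \<odot>\<^bsub>?Q\<^esub> ?f" "act ?Q (gq h) ?h = om 0 h \<odot>\<^bsub>?Q\<^esub> ?h"
      by (rule act[OF h]; use T in \<open>simp add: zero_prod_def\<close>)+
    moreover have "wt ?e = om 2" "wt ?f = om (-2)" "wt ?h = om 0" using ne by (simp_all add: wt_def del: gsl.simps)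
    ultimately show "act ?Q (gq h) b = wt b h \<odot>\<^bsub>?Q\<^esub> b" using b by (elim insertE emptyE) (simp_all only:)
  qed simp
  hence "sch G3 gx_cartan gq ?Q = (\<Sum>b\<in>{?e, ?f, ?h}. of_int (par_sign (b \<in> odd_part ?Q)) * fexp (wt b))"
    by (rule sch_weight_basis[OF ad.quo.superspace_Q]) (rule AD.DS_act_hom)
  also have "\<dots> = zz 2 + (zz (-2) + zz 0)"
  proof -
    have "?e \<notin> odd_part ?Q" "?f \<notin> odd_part ?Q" "?h \<notin> odd_part ?Q"
      unfolding car using zero T by (simp_all add: zero_prod_def del: gsl.simps)
    thus ?thesis using ne by (simp add: par_sign_def wt_def zz_def del: gsl.simps)
  qed
  finally show ?thesis using ds_sch_rest(1)[OF fd_rep_adj] by (simp add: zz_0 add.assoc)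
qed

lemma int_adjoin_trans: "w \<in> int_adjoin v \<Longrightarrow> int_adjoin w \<subseteq> int_adjoin v"
  by (auto simp: ipoly_pcompose[symmetric])

lemma rest_J: "f \<in> J_G3 \<Longrightarrow> rest f \<in> int_adjoin (zz 2 + zz (-2))"
  unfolding J_G3_def sch_ring_def
  by (induction rule: int_span_induct)
    (auto simp: rest_hom simp del: split_paired_Ex intro: int_adjoin_closed(1,3,6) ds_sch_rest(2))

lemma rest_image: "rest ` J_G3 = int_adjoin (zz 2 + zz (-2))"
proof
  show "rest ` J_G3 \<subseteq> int_adjoin (zz 2 + zz (-2))" using rest_J by blast
  let ?s = "sch G3 g3_cartan id (adj_rep G3)"
  obtain B wt where wb: "weight_basis G3 g3_cartan id (adj_rep G3) B wt" using AD.g3_weight_basis by blast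
  have id: "id ` g3_cartan \<subseteq> carrier G3" unfolding image_id id_apply by (rule gx_cartan_sub(3))
  obtain I \<pi> w \<rho> where w: "wrep G3 g3_cartan G3 id I \<pi> w \<rho>" "wch I \<pi> w = ?s"
    using wrep_of_rep[OF fd_rep_adj wb lie_superalgebra_G3 id] by (elim exE conjE) (rule that)
  have "int_adjoin ?s \<subseteq> J_G3"
    using int_adjoin_wch[OF w(1) superspace_G3 id] unfolding w(2) J_G3_def .
  hence "rest ` int_adjoin ?s \<subseteq> rest ` J_G3" by (rule image_mono)
  moreover have "rest ` int_adjoin ?s = int_adjoin (zz 2 + zz (-2) + 1)"
    by (simp add: image_image rest_ipoly rest_sch_adj)
  ultimately have "int_adjoin (zz 2 + zz (-2) + 1) \<subseteq> rest ` J_G3" by simp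
  \<comment> \<open>The adjoint module yields w_x + 1, and subtracting the integer 1 does not change
    the ring generated.\<close>
  moreover have "zz 2 + zz (-2) \<in> int_adjoin (zz 2 + zz (-2) + 1)"
    using int_adjoin_closed(1)[OF int_adjoin_closed(5) int_adjoin_closed(4), of "zz 2 + zz (-2) + 1" "-1"] by simp
  hence "int_adjoin (zz 2 + zz (-2)) \<subseteq> int_adjoin (zz 2 + zz (-2) + 1)" by (rule int_adjoin_trans)
  ultimately show "int_adjoin (zz 2 + zz (-2)) \<subseteq> rest ` J_G3" by (rule order_trans[rotated])
qed

lemma is_ds_rest: "is_ds x0 rest"
proof -
  have "zz 2 + zz (-2) \<in> int_adjoin (zz 1 + zz (-1))" using zz_chebyshev[of 1 2] by simp
  hence "rest ` J_G3 \<subseteq> J_gx x0" unfolding rest_image J_gx_eq by (rule int_adjoin_trans)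
  thus ?thesis unfolding is_ds_def by (simp add: rest_hom ds_sch_rest(1))
qed

text \<open>\<open>is_ds\<close> prescribes the values on supercharacters and requires additivity on
  \<open>J_G3\<close>, which they span.\<close>

lemma is_ds_eq_rest:
  assumes ds: "is_ds x0 ds" and f: "f \<in> J_G3"
  shows "ds f = rest f"
proof -
  have J: "J_G3 = int_span {sch G3 g3_cartan id M |M :: (g3, complex vec) rep. fd_rep G3 M}"
    by (simp add: J_G3_def sch_ring_def)
    have ds_add: "ds (a + b) = ds a + ds b" if "a \<in> J_G3" "b \<in> J_G3" for a b
    using ds that unfolding is_ds_def by blast
  have z: "ds 0 = 0" using ds_add[of 0 0] by (simp add: J int_span_zero)
  show ?thesis using f unfolding J
  proof (induction rule: int_span_induct)
    case (base s)
    then obtain M :: "(g3, complex vec) rep" where M: "fd_rep G3 M" "s = sch G3 g3_cartan id M" by blast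
    hence "ds s = sch G3 gx_cartan gq (DS_mod M x0)" using ds unfolding is_ds_def by blast
    thus ?case using ds_sch_rest(1)[OF M(1)] M(2) by simp
  next
    case (add a b)
        thus ?case using ds_add[of a b] unfolding J by (simp add: rest_hom)
  next
    case (uminus a)
    have "ds (a + - a) = ds a + ds (- a)" by (rule ds_add) (use uminus in \<open>simp_all add: J\<close>)
    hence "ds (- a) = - ds a" using z by (simp add: eq_neg_iff_add_eq_0 add.commute)
    thus ?case using uminus by (simp add: rest_hom)
  qed (simp add: z rest_hom)
qed

lemma ds_image: "is_ds x0 ds \<Longrightarrow> ds ` J_G3 = int_adjoin (zz 2 + zz (-2))"
  unfolding rest_image[symmetric] using is_ds_eq_rest by (intro image_cong) auto

section \<open>Independence of the scaling of \<open>x\<close>\<close>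

lemma scaled_image_kernel:
  assumes V: "cvs V" and T: "cvs.endo V T" and c: "c \<noteq> 0" and T': "\<And>v. v \<in> carrier V \<Longrightarrow> T' v = c \<odot>\<^bsub>V\<^esub> T v"
  shows "T' ` carrier V = T ` carrier V" "{v \<in> carrier V. T' v = \<zero>\<^bsub>V\<^esub>} = {v \<in> carrier V. T v = \<zero>\<^bsub>V\<^esub>}"
proof -
  interpret cvs V by fact
  note e = endo_simps[OF T]
  show "T' ` carrier V = T ` carrier V"
  proof (intro equalityI image_subsetI)
    fix v assume v: "v \<in> carrier V"
    have "T' v = T (c \<odot>\<^bsub>V\<^esub> v)" using v by (simp add: T' e)
    thus "T' v \<in> T ` carrier V" using v by auto
    have "T v = T' (inverse c \<odot>\<^bsub>V\<^esub> v)" using v c by (simp add: T' e smul_assoc[symmetric])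
    thus "T v \<in> T' ` carrier V" using v by auto
  qed
  have "T' v = \<zero>\<^bsub>V\<^esub> \<longleftrightarrow> T v = \<zero>\<^bsub>V\<^esub>" if "v \<in> carrier V" for v
    using that c smul_eq_0[of "T v" c] by (auto simp: T' e)
  thus "{v \<in> carrier V. T' v = \<zero>\<^bsub>V\<^esub>} = {v \<in> carrier V. T v = \<zero>\<^bsub>V\<^esub>}" by auto
qed

text \<open>The constructions depend on x only through its kernel and image in each module, and a
  nonzero scalar changes neither. The records are therefore equal, not merely isomorphic.\<close>

lemma DS_scale:
  assumes x: "x = g3_scale c x0" and c: "c \<noteq> 0"
  shows "DS_alg G3 x = DS_alg G3 x0" "gx_coset x = gq" "\<And>M. fd_rep G3 M \<Longrightarrow> DS_mod M x = DS_mod M x0"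
proof -
  have x0: "x0 \<in> carrier G3" by (rule ad.xK)
  have x': "x = c \<odot>\<^bsub>G3\<^esub> x0" by (simp add: x)
  have "brk G3 x v = c \<odot>\<^bsub>G3\<^esub> brk G3 x0 v" if "v \<in> carrier G3" for v
    using ad.act_smul[OF x0, of v c] that unfolding x' by simp
  note * = scaled_image_kernel[OF G3.cvs_axioms _ c this]
  have "G3.endo (brk G3 x0)" unfolding G3.endo_def by (rule ad.brk_hom)
    note ** = *[OF this]
  have i: "ds_ideal G3 x = ds_ideal G3 x0" unfolding ds_ideal_def by (rule **(1))
  have k: "{a \<in> carrier G3. brk G3 x a = \<zero>\<^bsub>G3\<^esub>} = {a \<in> carrier G3. brk G3 x0 a = \<zero>\<^bsub>G3\<^esub>}" by (rule **(2))
  show "DS_alg G3 x = DS_alg G3 x0" unfolding DS_alg_def i k ..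
  show "gx_coset x = gq" by (simp add: fun_eq_iff gx_coset_def i)
  show "DS_mod M x = DS_mod M x0" if M: "fd_rep G3 M" for M :: "(g3, 'v) rep"
  proof -
    interpret g3_repn M by (rule g3_repnI[OF M])
    have "act M x v = c \<odot>\<^bsub>M\<^esub> act M x0 v" if "v \<in> carrier M" for v unfolding x' by (rule act_smul[OF x0 that])
        note * = scaled_image_kernel[OF cvs_axioms act_endo[OF x0] c this]
    have i: "act M x ` carrier M = act M x0 ` carrier M" by (rule *(1))
    have k: "{v \<in> carrier M. act M x v = \<zero>\<^bsub>M\<^esub>} = {v \<in> carrier M. act M x0 v = \<zero>\<^bsub>M\<^esub>}" by (rule *(2))
    show ?thesis unfolding DS_mod_def i k ..
  qed
qed

theorem mainTheorem9:
  fixes x :: g3 and \<beta> :: "g3 weight" and x1 x2 x1i x2i wx :: "g3 group_ring"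
  defines "\<beta> \<equiv> eps 3 + delta"
    and "x1 \<equiv> xmon 1 0" and "x2 \<equiv> xmon 0 1" and "x1i \<equiv> xmon (-1) 0" and "x2i \<equiv> xmon 0 (-1)"
    and "wx \<equiv> x1 * x2i + x2 * x1i"
  assumes "x \<in> g3_root_space \<beta>" and "x \<noteq> \<zero>\<^bsub>G3\<^esub>"
  shows
    \<comment> \<open>\<open>\<gg>\<^sub>x\<close> is \<open>\<ss>\<ll>(2)\<close>, embedded in \<open>\<gg>\<close>, with the stated root system\<close>
    "lie_iso gx_embedded (DS_alg G3 x) (gx_coset x)
     \<and> (\<exists>f. lie_iso sl2 (DS_alg G3 x) f)
     \<and> gx_roots x = {restrict_weight gx_cartan (eps 1 - eps 2), restrict_weight gx_cartan (eps 2 - eps 1)}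
    \<comment> \<open>\<open>ds\<^sub>x\<close> exists, and its image is the polynomial ring in \<open>w\<^sub>x\<close>\<close>
     \<and> (\<exists>ds. is_ds x ds)
     \<and> (\<forall>ds. is_ds x ds \<longrightarrow> ds ` J_G3 = int_adjoin wx)
     \<and> wx \<in> J_gx x \<and> inj (ipoly wx)
    \<comment> \<open>the equivalent form, and the comparison with the whole ring\<close>
     \<and> x1 * x2 = 1 \<and> x1 * x1i = 1 \<and> x2 * x2i = 1
     \<and> (\<forall>ds. is_ds x ds \<longrightarrow> ds ` J_G3 = int_adjoin (x1 ^ 2 + x2 ^ 2))
     \<and> int_adjoin (x1 ^ 2 + x2 ^ 2) \<subset> J_gx x
     \<and> J_gx x = eval_laurent2 ` sym_laurent2
     \<and> {f \<in> sym_laurent2. eval_laurent2 f = 0}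
         = {(Poly_Mapping.single (1, 1) 1 - 1) * g |g. g \<in> sym_laurent2}
     \<and> J_gx x = int_adjoin (x1 + x1i)"
proof -
  obtain c where x: "x = g3_scale c x0" using assms(7) root_space_beta unfolding \<beta>_def by blast
  have c: "c \<noteq> 0"
  proof
    assume "c = 0"
    hence "x = \<zero>\<^bsub>G3\<^esub>" using G3.smul_0[OF ad.xK] x by simp
    thus False using assms(8) by simp
  qed
  note DS = DS_scale[OF x c]
  have J: "J_gx x = J_gx x0" by (simp add: J_gx_def DS(1,2))
  have ds: "is_ds x ds \<longleftrightarrow> is_ds x0 ds" for ds
    unfolding is_ds_def J DS(2) by (simp add: DS(3))
  \<comment> \<open>In terms of z = x_1, both x_1/x_2 + x_2/x_1 and x_1^2 + x_2^2 are z^2 + z^(-2),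
    so the two forms of the result coincide.\<close>
  have z: "x1 = zz 1" "x2 = zz (-1)" "x1i = zz (-1)" "x2i = zz 1"
    by (simp_all add: x1_def x2_def x1i_def x2i_def xmon_zz)
  have w: "wx = zz 2 + zz (-2)" "x1 ^ 2 + x2 ^ 2 = zz 2 + zz (-2)"
    by (simp_all add: wx_def z power2_eq_square zz_add[symmetric])
  have u: "x1 + x1i = zz 1 + zz (-1)" by (simp add: z)
  have w_in: "zz 2 + zz (-2) \<in> int_adjoin (zz 1 + zz (-1))" using zz_chebyshev[of 1 2] by simp
  have "gx_roots x = {restrict_weight gx_cartan (eps 1 - eps 2), restrict_weight gx_cartan (eps 2 - eps 1)}"
    using gx_roots_x0 by (simp add: gx_roots_def DS(1,2))
  moreover have "\<exists>f. lie_iso sl2 (DS_alg G3 x) f" unfolding DS(1) using lie_iso_trans[OF lie_iso_gsl lie_iso_gx] by blast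
  moreover have "int_adjoin (x1 ^ 2 + x2 ^ 2) \<subset> J_gx x"
        unfolding w J J_gx_eq
  proof (rule psubsetI)
    show "int_adjoin (zz 2 + zz (-2)) \<subseteq> int_adjoin (zz 1 + zz (-1))" by (rule int_adjoin_trans[OF w_in])
    show "int_adjoin (zz 2 + zz (-2)) \<noteq> int_adjoin (zz 1 + zz (-1))"
      using zz_notin_adjoin int_adjoin_closed(5)[of "zz 1 + zz (-1)"] by metis
  qed
  moreover have "x1 * x2 = 1" "x1 * x1i = 1" "x2 * x2i = 1" by (simp_all add: z zz_add[symmetric] zz_0)
  moreover have "inj (ipoly wx)" unfolding w using inj_ipoly[of 2] by simp
  ultimately show ?thesis
    unfolding DS(1,2) using lie_iso_gx is_ds_rest ds_image w_in eval_kernel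
    by (simp add: ds w u J J_gx_eq eval_sym) blast
qed

end
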